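(* Let $\tau>0$ and let $K$ be the Hilbert–Schmidt operator in $L^2((0,\tau);dx)$ given by $(Kf)(x)=\int_0^\tau dx'\,k(x-x')f(x')$, where $$k(t)=\begin{cases}\sum_{\ell\in\mathcal{L}}\alpha_\ell e^{-\lambda_\ell t},&t>0,\\ \sum_{m\in\mathcal{M}}\beta_m e^{\mu_m t},&t<0,\end{cases}$$ with $\mathcal{L}=\{1,\dots,L\}$, $\mathcal{M}=\{1,\dots,M\}$, $L,M\in\mathbb{N}$, $\alpha_\ell,\beta_m,\lambda_\ell,\mu_m\in\mathbb{C}$, $\operatorname{Re}(\lambda_\ell)>0$, $\operatorname{Re}(\mu_m)>0$. Let $N=L+M$ and let $\zeta_1,\dots,\zeta_N\in\mathbb{C}$ be the numbers defined in the context, assumed pairwise distinct. Then $$\begin{aligned}\det\nolimits_2(I-K)&=\exp\Big(\tau k(0_-)-\tau\sum_{m\in\mathcal{M}}\mu_m\Big)\sum_{\substack{\widetilde{\mathcal{L}}\subseteq\{1,\dots,N\}\\|\widetilde{\mathcal{L}}|=L}}V_{\widetilde{\mathcal{L}}}\exp\big(-i\tau v_{\widetilde{\mathcal{L}}}\big)\\&=\exp\Big(\tau k(0_+)-\tau\sum_{\ell\in\mathcal{L}}\lambda_\ell\Big)\sum_{\substack{\widetilde{\mathcal{M}}\subseteq\{1,\dots,N\}\\|\widetilde{\mathcal{M}}|=M}}W_{\widetilde{\mathcal{M}}}\exp\big(i\tau w_{\widetilde{\mathcal{M}}}\big),\end{aligned}$$ where $k(0_\pm)=\lim_{\varepsilon\downarrow0}k(\pm\varepsilon)$,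 $|\mathcal{S}|$ denotes the cardinality of $\mathcal{S}$, $\widetilde{\mathcal{L}}^\bot=\{1,\dots,N\}\setminus\widetilde{\mathcal{L}}$, $\widetilde{\mathcal{M}}^\bot=\{1,\dots,N\}\setminus\widetilde{\mathcal{M}}$, and $$V_{\widetilde{\mathcal{L}}}=\prod_{\ell\in\mathcal{L},\,m\in\widetilde{\mathcal{L}}^\bot}(\lambda_\ell-i\zeta_m)\prod_{\ell\in\widetilde{\mathcal{L}},\,m\in\mathcal{M}}(\mu_m+i\zeta_\ell)\prod_{\ell\in\mathcal{L},\,m\in\mathcal{M}}(\mu_m+\lambda_\ell)^{-1}\prod_{\ell\in\widetilde{\mathcal{L}},\,m\in\widetilde{\mathcal{L}}^\bot}(i\zeta_\ell-i\zeta_m)^{-1},$$ $$W_{\widetilde{\mathcal{M}}}=\prod_{\ell\in\mathcal{L},\,m\in\widetilde{\mathcal{M}}}(\lambda_\ell-i\zeta_m)\prod_{\ell\in\widetilde{\mathcal{M}}^\bot,\,m\in\mathcal{M}}(\mu_m+i\zeta_\ell)\prod_{\ell\in\mathcal{L},\,m\in\mathcal{M}}(\mu_m+\lambda_\ell)^{-1}\prod_{\ell\in\widetilde{\mathcal{M}}^\bot,\,m\in\widetilde{\mathcal{M}}}(i\zeta_\ell-i\zeta_m)^{-1},$$ $$v_{\widetilde{\mathcal{L}}}=\sum_{m\in\widetilde{\mathcal{L}}^\bot}\zeta_m,\qquad w_{\widetilde{\mathcal{M}}}=\sum_{\ell\in\widetilde{\mathcal{M}}^\bot}\zeta_\ell.$$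 Finally, if $\mathcal{L}=\emptyset$ or $\mathcal{M}=\emptyset$ (i.e., $k(t)=0$ for $t>0$, respectively for $t<0$), then $K$ is a Volterra operator and hence $\det_2(I-K)=1$.
   Context: $\det_2(I-A)=\det((I-A)\exp(A))$ is the $2$-modified Fredholm determinant of a Hilbert–Schmidt operator $A$. The Fourier transform of $k$ (the symbol) is the rational function $$\mathcal{F}(k)(x)=\int_{\mathbb{R}}dt\,e^{ixt}k(t)=\sum_{\ell\in\mathcal{L}}\alpha_\ell(\lambda_\ell-ix)^{-1}+\sum_{m\in\mathcal{M}}\beta_m(\mu_m+ix)^{-1},\quad x\in\mathbb{R}.$$ The numbers $\zeta_1,\dots,\zeta_N\in\mathbb{C}$, $N=L+M$, are defined (up to order) by $$1-\mathcal{F}(k)(x)=\prod_{n=1}^N(-ix+i\zeta_n)\prod_{\ell\in\mathcal{L}}(-ix+\lambda_\ell)^{-1}\prod_{m\in\mathcal{M}}(-ix-\mu_m)^{-1}.$$ *)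

theory Defs
  imports "HOL-Analysis.Analysis" "Jordan_Normal_Form.Determinant"
begin

text \<open>
  The Hilbert space \<open>L\<^sup>2(M)\<close> is handled through representatives: its elements are square integrable
  functions, equality is equality almost everywhere, and an operator is a map on functions all of
  whose properties are required on \<open>L2 M\<close> only and up to null sets. The notions formulated with
  orthonormal bases indexed by \<open>nat\<close> are meant for separable, infinite-dimensional \<open>L\<^sup>2(M)\<close>.
\<close>

definition L2 :: "'a measure \<Rightarrow> ('a \<Rightarrow> complex) set" where
  "L2 M = {f \<in> borel_measurable M. integrable M (\<lambda>x. (cmod (f x))\<^sup>2)}"

definition l2_inner :: "'a measure \<Rightarrow> ('a \<Rightarrow> complex) \<Rightarrow> ('a \<Rightarrow> complex) \<Rightarrow> complex" where
  "l2_inner M f g = (LINT x|M. cnj (f x) * g x)"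

definition l2_norm :: "'a measure \<Rightarrow> ('a \<Rightarrow> complex) \<Rightarrow> real" where
  "l2_norm M f = sqrt (LINT x|M. (cmod (f x))\<^sup>2)"

definition orthonormal_basis :: "'a measure \<Rightarrow> (nat \<Rightarrow> 'a \<Rightarrow> complex) \<Rightarrow> bool" where
  "orthonormal_basis M e \<longleftrightarrow>
     (\<forall>i. e i \<in> L2 M) \<and>
     (\<forall>i j. l2_inner M (e i) (e j) = (if i = j then 1 else 0)) \<and>
     (\<forall>f\<in>L2 M. (\<forall>i. l2_inner M (e i) f = 0) \<longrightarrow> (AE x in M. f x = 0))"

type_synonym 'a l2_op = "('a \<Rightarrow> complex) \<Rightarrow> ('a \<Rightarrow> complex)"

definition bounded_operator :: "'a measure \<Rightarrow> 'a l2_op \<Rightarrow> bool" where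
  "bounded_operator M A \<longleftrightarrow>
     (\<forall>f\<in>L2 M. A f \<in> L2 M) \<and>
     (\<forall>f\<in>L2 M. \<forall>g\<in>L2 M. \<forall>a b.
        AE x in M. A (\<lambda>y. a * f y + b * g y) x = a * A f x + b * A g x) \<and>
     (\<exists>C. \<forall>f\<in>L2 M. l2_norm M (A f) \<le> C * l2_norm M f)"

text \<open>The sum below does not depend on the choice of the orthonormal basis.\<close>

definition hilbert_schmidt :: "'a measure \<Rightarrow> 'a l2_op \<Rightarrow> bool" where
  "hilbert_schmidt M A \<longleftrightarrow> bounded_operator M A \<and>
     (\<exists>e. orthonormal_basis M e \<and> summable (\<lambda>n. (l2_norm M (A (e n)))\<^sup>2))"

text \<open>Trace class operators are the products of two Hilbert--Schmidt operators.\<close>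

definition trace_class :: "'a measure \<Rightarrow> 'a l2_op \<Rightarrow> bool" where
  "trace_class M T \<longleftrightarrow> bounded_operator M T \<and>
     (\<exists>A B. hilbert_schmidt M A \<and> hilbert_schmidt M B \<and>
        (\<forall>f\<in>L2 M. AE x in M. T f x = A (B f) x))"

text \<open>
  The determinant of an operator \<open>B = I + T\<close> with \<open>T\<close> trace class: the limit of the determinants of
  the compressions of \<open>B\<close> to the spans of the first \<open>n\<close> elements of an orthonormal basis. For trace
  class \<open>T\<close> the compressions of \<open>T\<close> converge to \<open>T\<close> in trace norm, so that the limit exists and is
  the same for all bases.
\<close>

definition fredholm_det :: "'a measure \<Rightarrow> 'a l2_op \<Rightarrow> complex" where
  "fredholm_det M B = (THE d.
     trace_class M (\<lambda>f x. B f x - f x) \<and>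
     (\<forall>e. orthonormal_basis M e \<longrightarrow>
        (\<lambda>n. Determinant.det (Matrix.mat n n (\<lambda>(i, j). l2_inner M (e i) (B (e j)))))
          \<longlonglongrightarrow> d))"

text \<open>The exponential series of \<open>A\<close>, converging in \<open>L\<^sup>2(M)\<close>; the limit is unique up to null sets.\<close>

definition operator_exp :: "'a measure \<Rightarrow> 'a l2_op \<Rightarrow> 'a l2_op" where
  "operator_exp M A f = (SOME g. g \<in> L2 M \<and>
     (\<lambda>m. l2_norm M (\<lambda>x. g x - (\<Sum>n<m. (A ^^ n) f x / fact n))) \<longlonglongrightarrow> 0)"

text \<open>\<open>det2_one_minus M A\<close> is \<open>det\<^sub>2(I - A)\<close>.\<close>

definition one_minus :: "'a l2_op \<Rightarrow> 'a l2_op" where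
  "one_minus A f = (\<lambda>x. f x - A f x)"

definition det2_one_minus :: "'a measure \<Rightarrow> 'a l2_op \<Rightarrow> complex" where
  "det2_one_minus M A = fredholm_det M (one_minus A \<circ> operator_exp M A)"

definition compact_operator :: "'a measure \<Rightarrow> 'a l2_op \<Rightarrow> bool" where
  "compact_operator M A \<longleftrightarrow> bounded_operator M A \<and>
     (\<forall>f. (\<forall>n. f n \<in> L2 M) \<and> (\<exists>C. \<forall>n::nat. l2_norm M (f n) \<le> C) \<longrightarrow>
        (\<exists>r g. strict_mono r \<and> g \<in> L2 M \<and>
           (\<lambda>n. l2_norm M (\<lambda>x. A (f (r n)) x - g x)) \<longlonglongrightarrow> 0))"

definition op_spectrum :: "'a measure \<Rightarrow> 'a l2_op \<Rightarrow> complex set" where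
  "op_spectrum M A = {z. \<not> (\<exists>R. bounded_operator M R \<and>
     (\<forall>f\<in>L2 M. (AE x in M. R (\<lambda>y. z * f y - A f y) x = f x) \<and>
                (AE x in M. z * R f x - A (R f) x = f x)))}"

definition volterra_operator :: "'a measure \<Rightarrow> 'a l2_op \<Rightarrow> bool" where
  "volterra_operator M A \<longleftrightarrow> compact_operator M A \<and> op_spectrum M A = {0}"

abbreviation lborel_Ioo :: "real \<Rightarrow> real measure" where
  "lborel_Ioo \<tau> \<equiv> restrict_space lborel {0<..<\<tau>}"

definition conv_operator :: "real \<Rightarrow> (real \<Rightarrow> complex) \<Rightarrow> real l2_op" where
  "conv_operator \<tau> k f = (\<lambda>x. LINT x'|lborel_Ioo \<tau>. k (x - x') * f x')"

definition fourier :: "(real \<Rightarrow> complex) \<Rightarrow> real \<Rightarrow> complex" where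
  "fourier k x = (LINT t|lborel. exp (\<i> * of_real x * of_real t) * k t)"

text \<open>
  The symbol condition that determines \<open>\<zeta>\<^sub>1, \<dots>, \<zeta>\<^sub>N\<close>, \<open>N = L + M\<close>, up to order.
\<close>

definition symbol_zeros ::
  "nat \<Rightarrow> nat \<Rightarrow> (nat \<Rightarrow> complex) \<Rightarrow> (nat \<Rightarrow> complex) \<Rightarrow> (real \<Rightarrow> complex) \<Rightarrow> (nat \<Rightarrow> complex) \<Rightarrow> bool"
where
  "symbol_zeros L M lam \<mu> k \<zeta> \<longleftrightarrow> (\<forall>x::real.
     1 - fourier k x =
       (\<Prod>n\<in>{1..L+M}. - \<i> * of_real x + \<i> * \<zeta> n) *
       (\<Prod>l\<in>{1..L}. inverse (- \<i> * of_real x + lam l)) *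
       (\<Prod>m\<in>{1..M}. inverse (- \<i> * of_real x - \<mu> m)))"

definition V_coeff ::
  "nat \<Rightarrow> nat \<Rightarrow> (nat \<Rightarrow> complex) \<Rightarrow> (nat \<Rightarrow> complex) \<Rightarrow> (nat \<Rightarrow> complex) \<Rightarrow> nat set \<Rightarrow> complex"
where
  "V_coeff L M lam \<mu> \<zeta> S =
     (\<Prod>l\<in>{1..L}. \<Prod>m\<in>{1..L+M} - S. lam l - \<i> * \<zeta> m) *
     (\<Prod>l\<in>S. \<Prod>m\<in>{1..M}. \<mu> m + \<i> * \<zeta> l) *
     (\<Prod>l\<in>{1..L}. \<Prod>m\<in>{1..M}. inverse (\<mu> m + lam l)) *
     (\<Prod>l\<in>S. \<Prod>m\<in>{1..L+M} - S. inverse (\<i> * \<zeta> l - \<i> * \<zeta> m))"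

definition W_coeff ::
  "nat \<Rightarrow> nat \<Rightarrow> (nat \<Rightarrow> complex) \<Rightarrow> (nat \<Rightarrow> complex) \<Rightarrow> (nat \<Rightarrow> complex) \<Rightarrow> nat set \<Rightarrow> complex"
where
  "W_coeff L M lam \<mu> \<zeta> S =
     (\<Prod>l\<in>{1..L}. \<Prod>m\<in>S. lam l - \<i> * \<zeta> m) *
     (\<Prod>l\<in>{1..L+M} - S. \<Prod>m\<in>{1..M}. \<mu> m + \<i> * \<zeta> l) *
     (\<Prod>l\<in>{1..L}. \<Prod>m\<in>{1..M}. inverse (\<mu> m + lam l)) *
     (\<Prod>l\<in>{1..L+M} - S. \<Prod>m\<in>S. inverse (\<i> * \<zeta> l - \<i> * \<zeta> m))"

end

theory Submission
  imports Defs "HOL-Complex_Analysis.Complex_Analysis" "HOL-Computational_Algebra.Fundamental_Theorem_Algebra"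
begin

text \<open>
  Let \<open>s = -ix\<close>, let \<open>p\<^sub>j\<close> be the numbers \<open>\<mu>\<^sub>m\<close> followed by the numbers \<open>-\<lambda>\<^sub>l\<close>, and \<open>z\<^sub>n = -i\<zeta>\<^sub>n\<close>.
  Continuing the exponential sum that represents \<open>k\<close> on \<open>t < 0\<close> to all \<open>t\<close> gives an operator \<open>R\<close> of rank
  at most \<open>M\<close>, and \<open>V = K - R\<close> is a Volterra operator. The functions
  \<open>(I - V)\<^sup>-\<^sup>1 exp (p\<^sub>m x)\<close> are explicit combinations of the \<open>exp (z\<^sub>n x)\<close>, so that
  \<open>I - K = (I - V) (I - F)\<close> with \<open>F\<close> explicit of rank \<open>M\<close>. As \<open>det\<^sub>2 (I - V) = 1\<close>, the determinant of \<open>I - K\<close>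
  is, up to an exponential factor, an \<open>M\<close> by \<open>M\<close> determinant of the form \<open>det (\<Sum>\<^sub>n w\<^sub>n X\<^sub>n X\<^sub>n\<^sup>T)\<close>, whose expansion is
  the sum over the subsets of cardinality \<open>M\<close>. Coinciding \<open>p\<^sub>j\<close> and vanishing coefficients are
  reached by continuity.

  The determinant in the definition is evaluated on compressions. The map
  \<open>X \<mapsto> det (I + X) exp (- tr X)\<close> on matrices is bounded by \<open>exp (\<parallel>X\<parallel>\<^sub>2\<^sup>2 / 2)\<close> by Hadamard's inequality,
  and Cauchy's estimates make it locally Lipschitz in the Hilbert--Schmidt norm. It therefore extends to
  Hilbert--Schmidt operators, and \<open>det\<^sub>2 (I + A) det\<^sub>2 (I + B) = det\<^sub>2 ((I + A) (I + B)) exp (tr (A B))\<close> holds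
  for the extension.
\<close>

section \<open>Regularised determinants of matrices\<close>

text \<open>The jump of \<open>k\<close> at 0 leaves K Hilbert-Schmidt but in general not trace
  class, while the determinant in the definition has to converge to one value along every
  orthonormal basis. Hence every identity is phrased so that only traces of products occur; these
  are double integrals independent of the basis. That det_2 (I - V) = 1 is obtained without
  eigenvalues: the determinant is 1 + O(r^2) for Hilbert-Schmidt norm r, cutting the interval into N
  pieces leaves N diagonal blocks of norm O(1/N), and the product of their determinants tends to 1.
  The same limit evaluates the determinant of an exponential, as the N-th power of the one at time
  1/N. The factor exp (tau k(0_-)) comes from the trace of V F: since (I - V) F = R, the diagonal of
  V F is that of F minus that of R, and R(x,x) = k(0_-). The second formula follows from the first
  by comparing subleading coefficients of the polynomial with the roots -i zeta_n.\<close>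

lemma hadamard_orthogonalise_row:
  fixes A :: "complex mat"
  assumes A: "A \<in> carrier_mat n n" and k: "k < n" and jk: "j \<le> k"
    and orth: "\<And>p q. p < k \<Longrightarrow> q < k \<Longrightarrow> p \<noteq> q \<Longrightarrow> (\<Sum>l<n. A $$ (p,l) * cnj (A $$ (q,l))) = 0"
  shows "\<exists>B\<in>carrier_mat n n. Determinant.det B = Determinant.det A \<and>
     (\<forall>i<n. i \<noteq> k \<longrightarrow> (\<forall>l<n. B $$ (i,l) = A $$ (i,l))) \<and>
     (\<Sum>l<n. (cmod (B $$ (k,l)))\<^sup>2) \<le> (\<Sum>l<n. (cmod (A $$ (k,l)))\<^sup>2) \<and>
     (\<forall>q<j. (\<Sum>l<n. B $$ (k,l) * cnj (B $$ (q,l))) = 0)"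
  using jk
proof (induction j)
  case 0
  then show ?case using A by (intro bexI[of _ A]) auto
next
  case (Suc j)
  then obtain B where B: "B \<in> carrier_mat n n" "Determinant.det B = Determinant.det A"
    "\<And>i l. i < n \<Longrightarrow> i \<noteq> k \<Longrightarrow> l < n \<Longrightarrow> B $$ (i,l) = A $$ (i,l)"
    "(\<Sum>l<n. (cmod (B $$ (k,l)))\<^sup>2) \<le> (\<Sum>l<n. (cmod (A $$ (k,l)))\<^sup>2)"
    "\<And>q. q < j \<Longrightarrow> (\<Sum>l<n. B $$ (k,l) * cnj (B $$ (q,l))) = 0" by auto
  have jk: "j < k" "j < n" "j \<noteq> k" using Suc.prems k by auto
  define s where "s = (\<Sum>l<n. B $$ (k,l) * cnj (B $$ (j,l)))"
  define t where "t = (\<Sum>l<n. (cmod (B $$ (j,l)))\<^sup>2)"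
  \<comment> \<open>The Gram-Schmidt coefficient. If \<open>t = 0\<close> then row \<open>j\<close>
    vanishes and \<open>s = 0\<close>, so the value 0 of the quotient is the right one.\<close>
  define c where "c = - (s / of_real t)"
  define C where "C = addrow c k j B"
  have tc: "of_real t = (\<Sum>l<n. B $$ (j,l) * cnj (B $$ (j,l)))"
    unfolding t_def by (simp only: of_real_sum complex_norm_square)
  have s0: "s = 0" if "t = 0"
  proof -
    have "\<forall>l<n. B $$ (j,l) = 0" using that unfolding t_def
      by (subst (asm) sum_nonneg_eq_0_iff) auto
    then show ?thesis unfolding s_def by simp
  qed
  have ct: "c * of_real t = - s" unfolding c_def using s0 by auto
  have Ck: "C $$ (k,l) = B $$ (k,l) + c * B $$ (j,l)" if "l < n" for l
    using that B(1) k jk unfolding C_def by (simp add: algebra_simps)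
  have Ci: "C $$ (i,l) = B $$ (i,l)" if "l < n" "i < n" "i \<noteq> k" for i l
    using that B(1) unfolding C_def by simp
  have Cc: "C \<in> carrier_mat n n" using B(1) unfolding C_def by simp
  have dC: "Determinant.det C = Determinant.det A"
    unfolding C_def using det_addrow[OF jk(2) jk(3)[symmetric] B(1)] B(2) by simp
  have orthB: "(\<Sum>l<n. B $$ (p,l) * cnj (B $$ (q,l))) = 0" if "p < k" "q < k" "p \<noteq> q" for p q
    using orth[OF that] that k by (subst sum.cong[OF refl, of _ _ "\<lambda>l. A $$ (p,l) * cnj (A $$ (q,l))"]) (auto simp: B(3))
  have inner: "(\<Sum>l<n. C $$ (k,l) * cnj (C $$ (q,l)))
      = (\<Sum>l<n. B $$ (k,l) * cnj (B $$ (q,l))) + c * (\<Sum>l<n. B $$ (j,l) * cnj (B $$ (q,l)))" if "q < k" for q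
    using that k by (simp add: Ck Ci sum.distrib sum_distrib_left algebra_simps)
  have orthC: "(\<Sum>l<n. C $$ (k,l) * cnj (C $$ (q,l))) = 0" if "q < Suc j" for q
  proof (cases "q = j")
    case True
    then show ?thesis using inner[of j] jk ct tc s_def by simp
  next
    case False
    then show ?thesis using inner[of q] that jk orthB[of j q] B(5)[of q] by simp
  qed
  \<comment> \<open>Pythagoras: the new row is orthogonal to row \<open>j\<close>, so its squared
    length is that of the old row minus \<open>(cmod s)\<^sup>2 / t\<close>.\<close>
  have "complex_of_real (\<Sum>l<n. (cmod (C $$ (k,l)))\<^sup>2) = (\<Sum>l<n. C $$ (k,l) * cnj (C $$ (k,l)))"
    by (simp only: of_real_sum complex_norm_square)
  also have "\<dots> = (\<Sum>l<n. C $$ (k,l) * cnj (B $$ (k,l))) + cnj c * (\<Sum>l<n. C $$ (k,l) * cnj (C $$ (j,l)))"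
    using jk by (simp add: Ck Ci sum.distrib sum_distrib_left algebra_simps)
  also have "\<dots> = (\<Sum>l<n. C $$ (k,l) * cnj (B $$ (k,l)))" using orthC[of j] by simp
  also have "\<dots> = (\<Sum>l<n. B $$ (k,l) * cnj (B $$ (k,l))) + c * (\<Sum>l<n. B $$ (j,l) * cnj (B $$ (k,l)))"
    by (simp add: Ck sum.distrib sum_distrib_left algebra_simps)
  also have "(\<Sum>l<n. B $$ (j,l) * cnj (B $$ (k,l))) = cnj s"
    unfolding s_def by (simp add: mult.commute)
  also have "c * cnj s = - of_real ((cmod s)\<^sup>2 / t)"
    unfolding c_def by (simp only: of_real_divide complex_norm_square) simp
  also have "(\<Sum>l<n. B $$ (k,l) * cnj (B $$ (k,l))) = complex_of_real (\<Sum>l<n. (cmod (B $$ (k,l)))\<^sup>2)"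
    by (simp only: of_real_sum complex_norm_square)
  finally have "(\<Sum>l<n. (cmod (C $$ (k,l)))\<^sup>2) = (\<Sum>l<n. (cmod (B $$ (k,l)))\<^sup>2) - (cmod s)\<^sup>2 / t"
    by (metis of_real_eq_iff of_real_diff diff_conv_add_uminus)
  moreover have "t \<ge> 0" unfolding t_def by (simp add: sum_nonneg)
  ultimately have le: "(\<Sum>l<n. (cmod (C $$ (k,l)))\<^sup>2) \<le> (\<Sum>l<n. (cmod (B $$ (k,l)))\<^sup>2)" by simp
  show ?case
    using Cc dC orthC le B(3,4) Ci by (intro bexI[OF _ Cc]) fastforce
qed

text \<open>Row additions preserve the determinant, and subtracting the projection onto earlier rows
  can only shorten a row. The rows before \<open>k\<close> are already orthogonal when row
  \<open>k\<close> is treated.\<close>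

lemma hadamard_orthogonalise:
  fixes A :: "complex mat"
  assumes A: "A \<in> carrier_mat n n" and k: "k \<le> n"
  shows "\<exists>B\<in>carrier_mat n n. Determinant.det B = Determinant.det A \<and>
     (\<forall>i<n. (\<Sum>l<n. (cmod (B $$ (i,l)))\<^sup>2) \<le> (\<Sum>l<n. (cmod (A $$ (i,l)))\<^sup>2)) \<and>
     (\<forall>p<k. \<forall>q<k. p \<noteq> q \<longrightarrow> (\<Sum>l<n. B $$ (p,l) * cnj (B $$ (q,l))) = 0)"
  using k
proof (induction k)
  case 0
  then show ?case using A by (intro bexI[of _ A]) auto
next
  case (Suc k)
  then obtain B where B: "B \<in> carrier_mat n n" "Determinant.det B = Determinant.det A"
     "\<And>i. i < n \<Longrightarrow> (\<Sum>l<n. (cmod (B $$ (i,l)))\<^sup>2) \<le> (\<Sum>l<n. (cmod (A $$ (i,l)))\<^sup>2)"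
     "\<And>p q. p < k \<Longrightarrow> q < k \<Longrightarrow> p \<noteq> q \<Longrightarrow> (\<Sum>l<n. B $$ (p,l) * cnj (B $$ (q,l))) = 0" by auto
  have kn: "k < n" using Suc.prems by simp
  obtain C where C: "C \<in> carrier_mat n n" "Determinant.det C = Determinant.det B"
     "\<And>i l. i < n \<Longrightarrow> i \<noteq> k \<Longrightarrow> l < n \<Longrightarrow> C $$ (i,l) = B $$ (i,l)"
     "(\<Sum>l<n. (cmod (C $$ (k,l)))\<^sup>2) \<le> (\<Sum>l<n. (cmod (B $$ (k,l)))\<^sup>2)"
     "\<And>q. q < k \<Longrightarrow> (\<Sum>l<n. C $$ (k,l) * cnj (C $$ (q,l))) = 0"
    using hadamard_orthogonalise_row[OF B(1) kn order.refl B(4)] by auto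
  have old: "(\<Sum>l<n. C $$ (p,l) * cnj (C $$ (q,l))) = 0" if "p < k" "q < k" "p \<noteq> q" for p q
    using B(4)[OF that] that kn by (subst sum.cong[OF refl, of _ _ "\<lambda>l. B $$ (p,l) * cnj (B $$ (q,l))"]) (auto simp: C(3))
  have flip: "(\<Sum>l<n. C $$ (q,l) * cnj (C $$ (k,l))) = 0" if "q < k" for q
  proof -
    have "(\<Sum>l<n. C $$ (q,l) * cnj (C $$ (k,l))) = cnj (\<Sum>l<n. C $$ (k,l) * cnj (C $$ (q,l)))"
      by (simp add: mult.commute)
    then show ?thesis using C(5)[OF that] by simp
  qed
  have rows: "(\<Sum>l<n. (cmod (C $$ (i,l)))\<^sup>2) \<le> (\<Sum>l<n. (cmod (A $$ (i,l)))\<^sup>2)" if "i < n" for i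
  proof (cases "i = k")
    case True
    then show ?thesis using C(4) B(3)[OF kn] by simp
  next
    case False
    then show ?thesis using C(3)[OF that False] B(3)[OF that] by simp
  qed
  have orth: "(\<Sum>l<n. C $$ (p,l) * cnj (C $$ (q,l))) = 0" if "p < Suc k" "q < Suc k" "p \<noteq> q" for p q
    using that old[of p q] flip[of p] C(5)[of q] by (cases "p = k"; cases "q = k") auto
  show ?case using C(1,2) B(2) rows orth by (intro bexI[OF _ C(1)]) auto
qed

text \<open>For orthogonal rows the product of \<open>B\<close> with its conjugate transpose is
  diagonal with the squared row lengths as entries, so the bound is an equality for
  \<open>B\<close>; orthogonalisation has only shortened the rows of \<open>A\<close>, at fixed
  determinant.\<close>

theorem hadamard_inequality:
  fixes A :: "complex mat"
  assumes A: "A \<in> carrier_mat n n"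
  shows "(cmod (Determinant.det A))\<^sup>2 \<le> (\<Prod>i<n. \<Sum>l<n. (cmod (A $$ (i,l)))\<^sup>2)"
proof -
  obtain B where B: "B \<in> carrier_mat n n" "Determinant.det B = Determinant.det A"
     "\<And>i. i < n \<Longrightarrow> (\<Sum>l<n. (cmod (B $$ (i,l)))\<^sup>2) \<le> (\<Sum>l<n. (cmod (A $$ (i,l)))\<^sup>2)"
     "\<And>p q. p < n \<Longrightarrow> q < n \<Longrightarrow> p \<noteq> q \<Longrightarrow> (\<Sum>l<n. B $$ (p,l) * cnj (B $$ (q,l))) = 0"
    using hadamard_orthogonalise[OF A order.refl] by auto
  define C where "C = map_mat cnj B"
  have C: "C \<in> carrier_mat n n" using B(1) unfolding C_def by simp
  have CT: "transpose_mat C \<in> carrier_mat n n" using C by simp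
  have cd: "Determinant.det C = cnj (Determinant.det B)"
    using B(1) C unfolding det_def
    by (auto simp: C_def sign_def intro!: sum.cong prod.cong)
  define D where "D = B * transpose_mat C"
  have Dij: "D $$ (i,j) = (\<Sum>l<n. B $$ (i,l) * cnj (B $$ (j,l)))" if "i < n" "j < n" for i j
    using that B(1) C unfolding D_def C_def
    by (simp add: scalar_prod_def lessThan_atLeast0)
  have Dc: "D \<in> carrier_mat n n" using B(1) CT unfolding D_def by simp
  have "Determinant.det D = prod_list (diag_mat D)"
    using B(4) by (intro det_upper_triangular[OF _ Dc]) (auto simp: upper_triangular_def Dij Dc[THEN carrier_matD(1)])
  also have "\<dots> = (\<Prod>i<n. D $$ (i,i))"
    using Dc by (simp add: prod_list_diag_prod lessThan_atLeast0)
  also have "\<dots> = (\<Prod>i<n. complex_of_real (\<Sum>l<n. (cmod (B $$ (i,l)))\<^sup>2))"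
    by (intro prod.cong refl) (simp only: lessThan_iff Dij of_real_sum complex_norm_square)
  finally have "Determinant.det D = complex_of_real (\<Prod>i<n. \<Sum>l<n. (cmod (B $$ (i,l)))\<^sup>2)" by simp
  moreover have "Determinant.det D = complex_of_real ((cmod (Determinant.det A))\<^sup>2)"
    unfolding D_def using det_mult[OF B(1) CT] det_transpose[OF C] cd B(2)
    by (simp only: complex_norm_square)
  ultimately have "(cmod (Determinant.det A))\<^sup>2 = (\<Prod>i<n. \<Sum>l<n. (cmod (B $$ (i,l)))\<^sup>2)"
    by (metis of_real_eq_iff)
  also have "\<dots> \<le> (\<Prod>i<n. \<Sum>l<n. (cmod (A $$ (i,l)))\<^sup>2)"
    by (intro prod_mono) (auto intro!: sum_nonneg B(3))
  finally show ?thesis .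
qed

section \<open>Frobenius norm and regularised determinant of the corners of an infinite
  matrix\<close>

definition frob :: "nat \<Rightarrow> (nat \<Rightarrow> nat \<Rightarrow> complex) \<Rightarrow> real" where
  "frob n a = L2_set (\<lambda>p. cmod (a (fst p) (snd p))) ({..<n} \<times> {..<n})"

definition trunc_det2 :: "nat \<Rightarrow> (nat \<Rightarrow> nat \<Rightarrow> complex) \<Rightarrow> complex" where
  "trunc_det2 n a = Determinant.det (Matrix.mat n n (\<lambda>(i,j). of_bool (i = j) + a i j)) * exp (- (\<Sum>i<n. a i i))"

lemma frob_nonneg [simp]: "0 \<le> frob n a"
  unfolding frob_def by simp

lemma frob_sq: "(frob n a)\<^sup>2 = (\<Sum>i<n. \<Sum>j<n. (cmod (a i j))\<^sup>2)"
  unfolding frob_def L2_set_def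
  by (subst real_sqrt_pow2) (auto simp: sum.cartesian_product case_prod_beta intro!: sum_nonneg)

lemma frob_mono: "(\<And>i j. i < n \<Longrightarrow> j < n \<Longrightarrow> cmod (a i j) \<le> cmod (b i j)) \<Longrightarrow> frob n a \<le> frob n b"
  unfolding frob_def by (rule L2_set_mono) auto

lemma frob_triangle: "frob n (\<lambda>i j. a i j + b i j) \<le> frob n a + frob n b"
proof -
  have "frob n (\<lambda>i j. a i j + b i j)
      \<le> L2_set (\<lambda>p. cmod (a (fst p) (snd p)) + cmod (b (fst p) (snd p))) ({..<n} \<times> {..<n})"
    unfolding frob_def by (rule L2_set_mono) (auto intro: norm_triangle_ineq)
  also have "\<dots> \<le> L2_set (\<lambda>p. cmod (a (fst p) (snd p))) ({..<n} \<times> {..<n})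
      + L2_set (\<lambda>p. cmod (b (fst p) (snd p))) ({..<n} \<times> {..<n})"
    by (rule L2_set_triangle_ineq)
  finally show ?thesis unfolding frob_def .
qed

lemma frob_scale: "frob n (\<lambda>i j. c * a i j) = cmod c * frob n a"
  unfolding frob_def by (simp add: norm_mult case_prod_beta L2_set_right_distrib)

text \<open>Row \<open>i\<close> of I + A has squared length 1 + 2 Re (a i i) plus the squared
  length of row \<open>i\<close> of A, which is at most the exponential of the terms after 1.
  Hadamard's inequality multiplies these bounds, and the factor exp (- tr A) cancels the real part
  of the trace.\<close>

lemma norm_trunc_det2_le: "cmod (trunc_det2 n a) \<le> exp ((frob n a)\<^sup>2 / 2)"
proof -
  let ?A = "Matrix.mat n n (\<lambda>(i,j). of_bool (i = j) + a i j)"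
  have row: "(\<Sum>l<n. (cmod (?A $$ (i,l)))\<^sup>2) \<le> exp (2 * Re (a i i) + (\<Sum>l<n. (cmod (a i l))\<^sup>2))" if i: "i < n" for i
  proof -
    have "(\<Sum>l<n. (cmod (?A $$ (i,l)))\<^sup>2) = (\<Sum>l<n. (if l = i then 1 + 2 * Re (a i i) else 0) + (cmod (a i l))\<^sup>2)"
      using i by (intro sum.cong refl) (auto simp: cmod_power2, simp add: power2_eq_square algebra_simps)
    also have "\<dots> = 1 + (2 * Re (a i i) + (\<Sum>l<n. (cmod (a i l))\<^sup>2))"
      using i by (simp add: sum.distrib)
    finally show ?thesis using exp_ge_add_one_self by simp
  qed
  have "(cmod (Determinant.det ?A))\<^sup>2 \<le> (\<Prod>i<n. \<Sum>l<n. (cmod (?A $$ (i,l)))\<^sup>2)"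
    by (rule hadamard_inequality) simp
  also have "\<dots> \<le> (\<Prod>i<n. exp (2 * Re (a i i) + (\<Sum>l<n. (cmod (a i l))\<^sup>2)))"
    by (intro prod_mono) (use row in \<open>auto intro!: sum_nonneg\<close>)
  also have "\<dots> = exp (2 * Re (\<Sum>i<n. a i i) + (frob n a)\<^sup>2)"
    by (simp add: exp_sum[symmetric] sum.distrib frob_sq sum_distrib_left)
  also have "\<dots> = (exp (Re (\<Sum>i<n. a i i) + (frob n a)\<^sup>2 / 2))\<^sup>2"
    by (simp add: exp_double[symmetric] algebra_simps)
  finally have "cmod (Determinant.det ?A) \<le> exp (Re (\<Sum>i<n. a i i) + (frob n a)\<^sup>2 / 2)"
    by (rule power2_le_imp_le) simp
  then have "cmod (Determinant.det ?A) * exp (Re (- (\<Sum>i<n. a i i)))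
      \<le> exp (Re (\<Sum>i<n. a i i) + (frob n a)\<^sup>2 / 2) * exp (Re (- (\<Sum>i<n. a i i)))"
    by (rule mult_right_mono) simp
  also have "\<dots> = exp ((frob n a)\<^sup>2 / 2)" by (simp add: exp_add[symmetric])
  finally show ?thesis unfolding trunc_det2_def norm_mult norm_exp_eq_Re .
qed

lemma trunc_det2_holomorphic: "(\<lambda>z. trunc_det2 n (\<lambda>i j. a i j + z * b i j)) holomorphic_on S"
proof -
  have "(\<lambda>z. trunc_det2 n (\<lambda>i j. a i j + z * b i j)) =
    (\<lambda>z. (\<Sum>p\<in>{p. p permutes {0..<n}}. signof p * (\<Prod>i=0..<n. of_bool (i = p i) + (a i (p i) + z * b i (p i))))
      * exp (- (\<Sum>i<n. a i i + z * b i i)))"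
    unfolding trunc_det2_def det_def
    by (intro ext arg_cong2[where f="(*)"] refl)
       (auto simp: permutes_def intro!: sum.cong prod.cong)
  then show ?thesis by (auto intro!: holomorphic_intros)
qed

text \<open>Along the complex line through \<open>a\<close> and \<open>b\<close> the determinant is
  entire. Cauchy's estimate uses circles of radius \<open>1 / B\<close> around points of the unit
  disc: they stay where \<open>cmod x * B \<le> B + 1\<close>, and the reciprocal radius supplies
  the factor \<open>B\<close>.\<close>

lemma trunc_det2_lipschitz:
  assumes a: "frob n a \<le> A" and b: "frob n (\<lambda>i j. b i j - a i j) \<le> B"
  shows "cmod (trunc_det2 n b - trunc_det2 n a) \<le> B * exp ((A + B + 1)\<^sup>2 / 2)"
proof (cases "B > 0")
  case True
  define d where "d = (\<lambda>i j. b i j - a i j)"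
  define f where "f = (\<lambda>z. trunc_det2 n (\<lambda>i j. a i j + z * d i j))"
  have hol: "f holomorphic_on S" for S unfolding f_def by (rule trunc_det2_holomorphic)
  have "A \<ge> 0" using a frob_nonneg[of n a] by linarith
  have bd: "cmod (f z) \<le> exp ((A + cmod z * B)\<^sup>2 / 2)" for z
  proof -
    have "frob n (\<lambda>i j. a i j + z * d i j) \<le> A + cmod z * B"
      using frob_triangle[of n a "\<lambda>i j. z * d i j"] frob_scale[of n z d] a b
      unfolding d_def by (smt (verit) mult_left_mono norm_ge_zero)
    then have "exp ((frob n (\<lambda>i j. a i j + z * d i j))\<^sup>2 / 2) \<le> exp ((A + cmod z * B)\<^sup>2 / 2)"
      by (simp add: power_mono)
    then show ?thesis unfolding f_def using norm_trunc_det2_le order_trans by blast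
  qed
  have der: "cmod (deriv f w) \<le> B * exp ((A + B + 1)\<^sup>2 / 2)" if w: "cmod w \<le> 1" for w
  proof -
    have "cmod ((deriv ^^ 1) f w) \<le> fact 1 * exp ((A + B + 1)\<^sup>2 / 2) / (1 / B) ^ 1"
    proof (rule Cauchy_inequality)
      show "f holomorphic_on ball w (1/B)" by (rule hol)
      show "continuous_on (cball w (1/B)) f" by (rule holomorphic_on_imp_continuous_on[OF hol])
      show "0 < 1/B" using True by simp
      fix x assume "norm (w - x) = 1/B"
      then have "cmod x \<le> 1 + 1/B"
        using w by (metis add_mono dual_order.trans norm_minus_commute norm_triangle_sub order_refl)
      then have "cmod x * B \<le> B + 1" using True by (simp add: field_simps)
      then have "exp ((A + cmod x * B)\<^sup>2 / 2) \<le> exp ((A + B + 1)\<^sup>2 / 2)"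
        using \<open>A \<ge> 0\<close> True by (simp add: power_mono)
      then show "cmod (f x) \<le> exp ((A + B + 1)\<^sup>2 / 2)" using bd[of x] by linarith
    qed
    then show ?thesis using True by (simp add: field_simps)
  qed
  have "cmod (f 1 - f 0) \<le> B * exp ((A + B + 1)\<^sup>2 / 2) * cmod (1 - 0)"
  proof (rule field_differentiable_bound[where S="cball 0 1" and f'="deriv f"])
    fix z :: complex assume "z \<in> cball 0 1"
    show "(f has_field_derivative deriv f z) (at z within cball 0 1)"
      using hol[of UNIV] by (simp add: holomorphic_derivI has_field_derivative_at_within)
    show "cmod (deriv f z) \<le> B * exp ((A + B + 1)\<^sup>2 / 2)" using der \<open>z \<in> cball 0 1\<close> by simp
  qed auto
  then show ?thesis unfolding f_def d_def by simp
next
  case False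
  then have z: "frob n (\<lambda>i j. b i j - a i j) = 0" "B = 0"
    using b frob_nonneg[of n "\<lambda>i j. b i j - a i j"] by linarith+
  have "b i j = a i j" if "i < n" "j < n" for i j
  proof -
    have "(\<Sum>i<n. \<Sum>j<n. (cmod (b i j - a i j))\<^sup>2) = 0" using frob_sq[of n "\<lambda>i j. b i j - a i j"] z by simp
    then show ?thesis using that by (simp add: sum_nonneg_eq_0_iff sum_nonneg)
  qed
  then have "trunc_det2 n b = trunc_det2 n a" unfolding trunc_det2_def
    by (auto intro!: arg_cong2[where f="(*)"] arg_cong[where f="Determinant.det"] cong_mat)
  then show ?thesis using z by simp
qed

text \<open>A nonzero derivative at \<open>0\<close> would make \<open>\<bar>f\<bar>\<close> grow linearly in some direction.\<close>

lemma deriv_eq_0_of_gaussian_bound: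
  fixes f :: "complex \<Rightarrow> complex"
  assumes f: "(f has_field_derivative f') (at 0)" and f0: "f 0 = 1"
    and bd: "\<And>z. cmod (f z) \<le> exp (c * (cmod z)\<^sup>2)"
  shows "f' = 0"
proof -
  have "Re (w * f') = 0" if w: "cmod w = 1" for w
  proof -
    define g where "g = (\<lambda>t::real. Re (f (of_real t * w)) - exp (c * t\<^sup>2))"
    have l: "((\<lambda>t::real. of_real t * w) has_vector_derivative w) (at 0)"
      unfolding has_vector_derivative_def by (auto simp: scaleR_conv_of_real intro!: derivative_eq_intros)
    have "((\<lambda>t. f (of_real t * w)) has_vector_derivative w * f') (at 0)"
      using field_vector_diff_chain_at[OF l, of f f'] f by (simp add: o_def)
    then have "((\<lambda>t. Re (f (of_real t * w))) has_vector_derivative Re (w * f')) (at 0)"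
      by (rule bounded_linear.has_vector_derivative[OF bounded_linear_Re])
    then have "((\<lambda>t. Re (f (of_real t * w))) has_real_derivative Re (w * f')) (at 0)"
      unfolding has_real_derivative_iff_has_vector_derivative .
    moreover have d2: "((\<lambda>t. exp (c * t\<^sup>2)) has_real_derivative 0) (at 0)"
      by (auto intro!: derivative_eq_intros)
    ultimately have dg: "(g has_real_derivative Re (w * f')) (at 0)"
      unfolding g_def
      using DERIV_diff[of _ "Re (w * f')" 0 _ "\<lambda>t. exp (c * t\<^sup>2)" 0] d2 by simp
    have le: "g t \<le> g 0" for t
    proof -
      have "Re (f (of_real t * w)) \<le> cmod (f (of_real t * w))" by (rule complex_Re_le_cmod)
      also have "\<dots> \<le> exp (c * t\<^sup>2)" using bd[of "of_real t * w"] w by (simp add: norm_mult)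
      finally show ?thesis unfolding g_def using f0 by simp
    qed
    show ?thesis by (rule DERIV_local_max[OF dg, of 1]) (use le in auto)
  qed
  from this[of 1] this[of \<i>] show ?thesis by (simp add: complex_eq_iff)
qed

lemma trunc_det2_zero: "trunc_det2 n (\<lambda>i j. 0) = 1"
proof -
  have "Matrix.mat n n (\<lambda>(i,j). of_bool (i = j) + 0) = (1\<^sub>m n :: complex mat)"
    by (intro eq_matI) auto
  then show ?thesis unfolding trunc_det2_def by simp
qed

text \<open>The factor exp (- tr a) removes the linear term, as the Gaussian bound shows without
  computing a derivative; Taylor's formula with Cauchy's estimate for the second derivative gives
  the rest. The quadratic order is what makes products of N factors, for matrices of size O(1/N),
  converge to 1.\<close>

lemma trunc_det2_quadratic:
  assumes a: "frob n a \<le> A"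
  shows "cmod (trunc_det2 n a - 1) \<le> 2 * A\<^sup>2 * exp ((A + 1)\<^sup>2 / 2)"
proof (cases "A > 0")
  case True
  define f where "f = (\<lambda>z. trunc_det2 n (\<lambda>i j. z * a i j))"
  have hol: "f holomorphic_on S" for S
    unfolding f_def using trunc_det2_holomorphic[of n "\<lambda>i j. 0" a S] by simp
  have f0: "f 0 = 1" unfolding f_def by (simp add: trunc_det2_zero)
  have bd: "cmod (f z) \<le> exp ((cmod z * A)\<^sup>2 / 2)" for z
  proof -
    have "frob n (\<lambda>i j. z * a i j) \<le> cmod z * A" using a by (simp add: frob_scale mult_left_mono)
    then have "exp ((frob n (\<lambda>i j. z * a i j))\<^sup>2 / 2) \<le> exp ((cmod z * A)\<^sup>2 / 2)"
      by (simp add: power_mono)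
    then show ?thesis unfolding f_def using norm_trunc_det2_le order_trans by blast
  qed
  have f1: "deriv f 0 = 0"
  proof (rule deriv_eq_0_of_gaussian_bound)
    show "(f has_field_derivative deriv f 0) (at 0)"
      using hol[of UNIV] by (rule holomorphic_derivI) auto
    show "cmod (f z) \<le> exp (A\<^sup>2 / 2 * (cmod z)\<^sup>2)" for z
      using bd[of z] by (simp add: power_mult_distrib mult_ac)
  qed (rule f0)
  define E where "E = exp ((A + 1)\<^sup>2 / 2)"
  have der2: "cmod (deriv (deriv f) w) \<le> 2 * E * A\<^sup>2" if w: "cmod w \<le> 1" for w
  proof -
    have "cmod ((deriv ^^ 2) f w) \<le> fact 2 * E / (1 / A) ^ 2"
    proof (rule Cauchy_inequality)
      show "f holomorphic_on ball w (1/A)" by (rule hol)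
      show "continuous_on (cball w (1/A)) f" by (rule holomorphic_on_imp_continuous_on[OF hol])
      show "0 < 1/A" using True by simp
      fix x assume "norm (w - x) = 1/A"
      then have "cmod x \<le> 1 + 1/A"
        using w by (metis add_mono dual_order.trans norm_minus_commute norm_triangle_sub order_refl)
      then have "cmod x * A \<le> A + 1" using True by (simp add: field_simps)
      then have "exp ((cmod x * A)\<^sup>2 / 2) \<le> E"
        using True unfolding E_def by (simp add: power_mono)
      then show "cmod (f x) \<le> E" using bd[of x] by linarith
    qed
    then show ?thesis by (simp add: numeral_2_eq_2 field_simps)
  qed
  have T: "cmod ((deriv ^^ 0) f 1 - (\<Sum>i\<le>1. (deriv ^^ i) f 0 * (1 - 0) ^ i / fact i)) \<le> 2 * E * A\<^sup>2 * cmod (1 - 0) ^ Suc 1 / fact 1"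
  proof (rule complex_Taylor[where S="cball 0 1"])
    fix i and x :: complex
    have "(deriv ^^ i) f holomorphic_on UNIV" by (rule holomorphic_higher_deriv[OF hol open_UNIV])
    then have "((deriv ^^ i) f has_field_derivative deriv ((deriv ^^ i) f) x) (at x)"
      by (rule holomorphic_derivI) auto
    then show "((deriv ^^ i) f has_field_derivative (deriv ^^ Suc i) f x) (at x within cball 0 1)"
      by (simp add: has_field_derivative_at_within)
  next
    fix x :: complex assume "x \<in> cball 0 1"
    then show "cmod ((deriv ^^ Suc 1) f x) \<le> 2 * E * A\<^sup>2" using der2[of x] by simp
  qed auto
  have "cmod (f 1 - 1) \<le> 2 * E * A\<^sup>2"
    using T f0 f1 by simp
  then show ?thesis
    unfolding f_def E_def by (simp add: mult_ac)
next
  case False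
  then have "frob n a \<le> 0" "A = 0" using a frob_nonneg[of n a] by linarith+
  then have "cmod (trunc_det2 n a - trunc_det2 n (\<lambda>i j. 0)) \<le> 0 * exp ((0 + 0 + 1)\<^sup>2 / 2)"
    by (intro trunc_det2_lipschitz) (auto simp: frob_sq frob_def L2_set_def)
  then show ?thesis using \<open>A = 0\<close> by (simp add: trunc_det2_zero)
qed

section \<open>Hilbert--Schmidt matrices\<close>

text \<open>Sylvester's determinant identity. The block matrix with rows (1, U) and (W, 1) has the
  two block triangular factorisations \<open>L * R\<close> and \<open>R' * L\<close>.\<close>

lemma det_one_minus_mult_commute:
  fixes U W :: "complex mat"
  assumes U: "U \<in> carrier_mat n m" and W: "W \<in> carrier_mat m n"
  shows "Determinant.det (1\<^sub>m n - U * W) = Determinant.det (1\<^sub>m m - W * U)"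
proof -
  have UW: "U * W \<in> carrier_mat n n" "W * U \<in> carrier_mat m m" using U W by auto
  define L where "L = four_block_mat (1\<^sub>m n) (0\<^sub>m n m) W (1\<^sub>m m)"
  define R where "R = four_block_mat (1\<^sub>m n) U (0\<^sub>m m n) (1\<^sub>m m - W * U)"
  define R' where "R' = four_block_mat (1\<^sub>m n - U * W) U (0\<^sub>m m n) (1\<^sub>m m)"
  have LR: "L * R = four_block_mat (1\<^sub>m n) U W (1\<^sub>m m)"
  proof -
    have "L * R = four_block_mat (1\<^sub>m n * 1\<^sub>m n + 0\<^sub>m n m * 0\<^sub>m m n) (1\<^sub>m n * U + 0\<^sub>m n m * (1\<^sub>m m - W * U))
       (W * 1\<^sub>m n + 1\<^sub>m m * 0\<^sub>m m n) (W * U + 1\<^sub>m m * (1\<^sub>m m - W * U))"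
      unfolding L_def R_def by (rule mult_four_block_mat) (use U W in auto)
    moreover have "1\<^sub>m n * U + 0\<^sub>m n m * (1\<^sub>m m - W * U) = U" using U UW W by auto
    moreover have "W * U + 1\<^sub>m m * (1\<^sub>m m - W * U) = 1\<^sub>m m"
    proof -
      have "1\<^sub>m m * (1\<^sub>m m - W * U) = 1\<^sub>m m - W * U" by (rule left_mult_one_mat[OF minus_carrier_mat[OF UW(2)]])
      moreover have "X + (1\<^sub>m m - X) = 1\<^sub>m m" if "X \<in> carrier_mat m m" for X :: "complex mat"
        using that by (intro eq_matI) auto
      ultimately show ?thesis using UW(2) by simp
    qed
    ultimately show ?thesis using W by simp
  qed
  have RL: "R' * L = four_block_mat (1\<^sub>m n) U W (1\<^sub>m m)"
  proof -
    have "R' * L = four_block_mat ((1\<^sub>m n - U * W) * 1\<^sub>m n + U * W) ((1\<^sub>m n - U * W) * 0\<^sub>m n m + U * 1\<^sub>m m)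
       (0\<^sub>m m n * 1\<^sub>m n + 1\<^sub>m m * W) (0\<^sub>m m n * 0\<^sub>m n m + 1\<^sub>m m * 1\<^sub>m m)"
      unfolding L_def R'_def by (rule mult_four_block_mat) (use U W in auto)
    moreover have "(1\<^sub>m n - U * W) * 1\<^sub>m n = 1\<^sub>m n - U * W" by (rule right_mult_one_mat[OF minus_carrier_mat[OF UW(1)]])
    moreover have "1\<^sub>m n - X + X = 1\<^sub>m n" if "X \<in> carrier_mat n n" for X :: "complex mat"
      using that by (intro eq_matI) auto
    from this[OF UW(1)] have "1\<^sub>m n - U * W + U * W = 1\<^sub>m n" .
    moreover have "(1\<^sub>m n - U * W) * 0\<^sub>m n m + U * 1\<^sub>m m = U"
      using U right_mult_zero_mat[OF minus_carrier_mat[OF UW(1)], of "1\<^sub>m n" m] by simp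
    ultimately show ?thesis using W by simp
  qed
  have c: "L \<in> carrier_mat (n+m) (n+m)" "R \<in> carrier_mat (n+m) (n+m)" "R' \<in> carrier_mat (n+m) (n+m)"
    unfolding L_def R_def R'_def using UW minus_carrier_mat[OF UW(2)] minus_carrier_mat[OF UW(1)] by (auto intro!: four_block_carrier_mat)
  have "Determinant.det R' * Determinant.det L = Determinant.det L * Determinant.det R"
    using det_mult[OF c(3,1)] det_mult[OF c(1,2)] LR RL by simp
  moreover have "Determinant.det L = 1" unfolding L_def
    using det_four_block_mat_upper_right_zero[of "1\<^sub>m n" n "0\<^sub>m n m" m W "1\<^sub>m m"] W by simp
  moreover have "Determinant.det R = Determinant.det (1\<^sub>m m - W * U)" unfolding R_def
    using det_four_block_mat_lower_left_zero[of "1\<^sub>m n" n U m "0\<^sub>m m n" "1\<^sub>m m - W * U"] U minus_carrier_mat[OF UW(2)] by simp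
  moreover have "Determinant.det R' = Determinant.det (1\<^sub>m n - U * W)" unfolding R'_def
    using det_four_block_mat_lower_left_zero[of "1\<^sub>m n - U * W" n U m "0\<^sub>m m n" "1\<^sub>m m"] U minus_carrier_mat[OF UW(1)] by simp
  ultimately show ?thesis by simp
qed

text \<open>The Lipschitz estimate compares matrices of one size; padding with zeros brings
  truncations of different sizes into its range.\<close>

lemma trunc_det2_pad:
  assumes "n \<le> m"
  shows "trunc_det2 m (\<lambda>i j. if i < n \<and> j < n then a i j else 0) = trunc_det2 n a"
proof -
  let ?A = "Matrix.mat n n (\<lambda>(i,j). of_bool (i = j) + a i j)"
  let ?B = "Matrix.mat m m (\<lambda>(i,j). of_bool (i = j) + (if i < n \<and> j < n then a i j else 0))"
  obtain k where k: "m = n + k" using assms by (metis le_add_diff_inverse)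
  have "?B = four_block_mat ?A (0\<^sub>m n k) (0\<^sub>m k n) (1\<^sub>m k)"
    unfolding k by (intro eq_matI) auto
  then have "Determinant.det ?B = Determinant.det ?A"
    using det_four_block_mat_upper_right_zero[of ?A n "0\<^sub>m n k" k "0\<^sub>m k n" "1\<^sub>m k"] by simp
  moreover have "(\<Sum>i<m. if i < n \<and> i < n then a i i else 0) = (\<Sum>i<n. a i i)"
    using assms by (intro sum.mono_neutral_cong_right) auto
  ultimately show ?thesis unfolding trunc_det2_def by simp
qed

section \<open>The limit of the regularised determinants for Hilbert-Schmidt matrices\<close>

definition hs_mat :: "(nat \<Rightarrow> nat \<Rightarrow> complex) \<Rightarrow> bool" where
  "hs_mat a \<longleftrightarrow> (\<exists>B. \<forall>n. frob n a \<le> B)"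

definition det2 :: "(nat \<Rightarrow> nat \<Rightarrow> complex) \<Rightarrow> complex" where
  "det2 a = lim (\<lambda>n. trunc_det2 n a)"

lemma frob_mono_dim: "n \<le> m \<Longrightarrow> frob n a \<le> frob m a"
  unfolding frob_def L2_set_def by (intro real_sqrt_le_mono sum_mono2) auto

lemma hs_mat_frob_convergent:
  assumes "hs_mat a"
  shows "convergent (\<lambda>n. (frob n a)\<^sup>2)"
proof (rule Bseq_mono_convergent)
  obtain B where B: "\<And>n. frob n a \<le> B" using assms unfolding hs_mat_def by auto
  then have "norm ((frob n a)\<^sup>2) \<le> B\<^sup>2" for n by (simp add: power_mono)
  then show "Bseq (\<lambda>n. (frob n a)\<^sup>2)" by (rule BseqI')
  show "\<forall>m n. m \<le> n \<longrightarrow> (frob m a)\<^sup>2 \<le> (frob n a)\<^sup>2" by (simp add: power_mono frob_mono_dim)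
qed

text \<open>Once the n-corner is padded to size m, its difference from the m-corner has squared norm
  \<open>(frob m a)\<^sup>2 - (frob n a)\<^sup>2\<close>, which is small because a bounded monotone
  sequence converges.\<close>

lemma trunc_det2_tendsto:
  assumes "hs_mat a"
  shows "(\<lambda>n. trunc_det2 n a) \<longlonglongrightarrow> det2 a"
proof -
  obtain A where A: "\<And>n. frob n a \<le> A" using assms unfolding hs_mat_def by auto
  have A0: "A \<ge> 0" using A[of 0] frob_nonneg[of 0 a] by linarith
  define E where "E = exp ((A + A + 1)\<^sup>2 / 2)"
  have E: "E > 0" unfolding E_def by simp
  have key: "cmod (trunc_det2 m a - trunc_det2 n a) \<le> sqrt ((frob m a)\<^sup>2 - (frob n a)\<^sup>2) * E" if nm: "n \<le> m" for n m
  proof -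
    define p where "p = (\<lambda>i j. if i < n \<and> j < n then a i j else 0)"
    have sub: "{..<n} \<times> {..<n} \<subseteq> {..<m} \<times> {..<m}" using nm by auto
    have "(frob m (\<lambda>i j. a i j - p i j))\<^sup>2 = (\<Sum>q\<in>{..<m} \<times> {..<m}. (cmod (a (fst q) (snd q) - p (fst q) (snd q)))\<^sup>2)"
      by (simp add: frob_sq sum.cartesian_product case_prod_beta)
    also have "\<dots> = (\<Sum>q\<in>{..<m} \<times> {..<m} - {..<n} \<times> {..<n}. (cmod (a (fst q) (snd q)))\<^sup>2)"
      by (rule sum.mono_neutral_cong_right) (auto simp: p_def)
    also have "\<dots> = (frob m a)\<^sup>2 - (frob n a)\<^sup>2"
      using sub by (simp add: frob_sq sum.cartesian_product case_prod_beta sum_diff)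
    finally have fr: "frob m (\<lambda>i j. a i j - p i j) = sqrt ((frob m a)\<^sup>2 - (frob n a)\<^sup>2)"
      by (metis frob_nonneg real_sqrt_unique)
    have "frob m p \<le> A" using frob_mono[of m p a] A[of m] unfolding p_def by force
    then have "cmod (trunc_det2 m a - trunc_det2 m p)
        \<le> frob m (\<lambda>i j. a i j - p i j) * exp ((A + frob m (\<lambda>i j. a i j - p i j) + 1)\<^sup>2 / 2)"
      by (intro trunc_det2_lipschitz) auto
    also have "\<dots> \<le> frob m (\<lambda>i j. a i j - p i j) * E"
    proof -
      have "frob m (\<lambda>i j. a i j - p i j) \<le> frob m a" by (rule frob_mono) (auto simp: p_def)
      then have "frob m (\<lambda>i j. a i j - p i j) \<le> A" using A[of m] by linarith
      then show ?thesis unfolding E_def using A0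
        by (intro mult_left_mono) (auto intro!: power_mono)
    qed
    finally show ?thesis using trunc_det2_pad[OF nm, of a] unfolding p_def[symmetric] fr by simp
  qed
  have "Cauchy (\<lambda>n. trunc_det2 n a)"
  proof (rule CauchyI')
    fix e :: real assume e: "e > 0"
    have "Cauchy (\<lambda>n. (frob n a)\<^sup>2)" using hs_mat_frob_convergent[OF assms] convergent_Cauchy by blast
    moreover have "(e / E)\<^sup>2 > 0" using e E by simp
    ultimately obtain N where N: "\<And>m n. m \<ge> N \<Longrightarrow> n \<ge> N \<Longrightarrow> norm ((frob m a)\<^sup>2 - (frob n a)\<^sup>2) < (e / E)\<^sup>2"
      unfolding Cauchy_iff by blast
    show "\<exists>M. \<forall>m\<ge>M. \<forall>n>m. dist (trunc_det2 m a) (trunc_det2 n a) < e"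
    proof (intro exI[of _ N] allI impI)
      fix m n assume mn: "N \<le> m" "m < n"
      have "sqrt ((frob n a)\<^sup>2 - (frob m a)\<^sup>2) < e / E"
        using N[of n m] mn e E by (intro real_less_lsqrt) (auto simp: abs_less_iff)
      then have "sqrt ((frob n a)\<^sup>2 - (frob m a)\<^sup>2) * E < e" using E by (simp add: field_simps)
      then show "dist (trunc_det2 m a) (trunc_det2 n a) < e"
        using key[of m n] mn by (simp add: dist_norm norm_minus_commute)
    qed
  qed
  then show ?thesis unfolding det2_def using Cauchy_convergent convergent_LIMSEQ_iff by blast
qed

lemma det2_lipschitz:
  assumes "hs_mat a" "hs_mat b" and a: "\<And>n. frob n a \<le> A" and b: "\<And>n. frob n (\<lambda>i j. b i j - a i j) \<le> B"
  shows "cmod (det2 b - det2 a) \<le> B * exp ((A + B + 1)\<^sup>2 / 2)"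
proof (rule LIMSEQ_le_const2)
  show "(\<lambda>n. cmod (trunc_det2 n b - trunc_det2 n a)) \<longlonglongrightarrow> cmod (det2 b - det2 a)"
    by (intro tendsto_intros trunc_det2_tendsto assms)
qed (use trunc_det2_lipschitz[OF a b] in auto)

lemma det2_quadratic:
  assumes "\<And>n. frob n a \<le> A"
  shows "cmod (det2 a - 1) \<le> 2 * A\<^sup>2 * exp ((A + 1)\<^sup>2 / 2)"
proof (rule LIMSEQ_le_const2)
  have "hs_mat a" unfolding hs_mat_def using assms by auto
  then show "(\<lambda>n. cmod (trunc_det2 n a - 1)) \<longlonglongrightarrow> cmod (det2 a - 1)"
    by (intro tendsto_intros trunc_det2_tendsto)
qed (use trunc_det2_quadratic[OF assms] in auto)

lemma norm_sum_mult_sq_le: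
  fixes f g :: "'a \<Rightarrow> complex"
  shows "(cmod (\<Sum>k\<in>K. f k * g k))\<^sup>2 \<le> (\<Sum>k\<in>K. (cmod (f k))\<^sup>2) * (\<Sum>k\<in>K. (cmod (g k))\<^sup>2)"
proof -
  have "cmod (\<Sum>k\<in>K. f k * g k) \<le> (\<Sum>k\<in>K. cmod (f k) * cmod (g k))"
    by (rule order_trans[OF norm_sum]) (simp add: norm_mult)
  then have "(cmod (\<Sum>k\<in>K. f k * g k))\<^sup>2 \<le> (\<Sum>k\<in>K. cmod (f k) * cmod (g k))\<^sup>2"
    by (rule power_mono) simp
  also have "\<dots> \<le> (\<Sum>k\<in>K. (cmod (f k))\<^sup>2) * (\<Sum>k\<in>K. (cmod (g k))\<^sup>2)"
    by (rule Cauchy_Schwarz_ineq_sum)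
  finally show ?thesis .
qed

text \<open>Provides a summable majorant for the columns, whose tails control the error of cutting
  off a matrix product.\<close>

lemma hs_mat_columns:
  assumes "hs_mat a"
  obtains c :: "nat \<Rightarrow> real" where "summable c" "\<And>k n. (\<Sum>i<n. (cmod (a i k))\<^sup>2) \<le> c k"
proof -
  obtain A where A: "\<And>n. frob n a \<le> A" using assms unfolding hs_mat_def by auto
  have A2: "(frob n a)\<^sup>2 \<le> A\<^sup>2" for n using A[of n] by (simp add: power_mono)
  define c where "c k = (\<Sum>i. (cmod (a i k))\<^sup>2)" for k
  have part: "(\<Sum>k<p. \<Sum>i<n. (cmod (a i k))\<^sup>2) \<le> A\<^sup>2" for n p
  proof -
    have "(\<Sum>k<p. \<Sum>i<n. (cmod (a i k))\<^sup>2) \<le> (\<Sum>k<max n p. \<Sum>i<max n p. (cmod (a i k))\<^sup>2)"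
      by (intro order_trans[OF sum_mono sum_mono2] sum_mono2) (auto intro: sum_nonneg)
    also have "\<dots> = (frob (max n p) a)\<^sup>2" by (subst sum.swap) (simp add: frob_sq)
    finally show ?thesis using A2[of "max n p"] by linarith
  qed
  have sm: "summable (\<lambda>i. (cmod (a i k))\<^sup>2)" for k
  proof (rule summableI_nonneg_bounded)
    fix n
    have "(\<Sum>i<n. (cmod (a i k))\<^sup>2) \<le> (\<Sum>k<Suc k. \<Sum>i<n. (cmod (a i k))\<^sup>2)"
      by (simp add: sum_nonneg)
    then show "(\<Sum>i<n. (cmod (a i k))\<^sup>2) \<le> A\<^sup>2" using part[of n "Suc k"] by linarith
  qed auto
  have "summable c"
  proof (rule summableI_nonneg_bounded)
    show "0 \<le> c k" for k unfolding c_def by (intro suminf_nonneg sm) auto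
    fix p
    have "(\<lambda>n. \<Sum>k<p. \<Sum>i<n. (cmod (a i k))\<^sup>2) \<longlonglongrightarrow> (\<Sum>k<p. c k)"
      unfolding c_def by (intro tendsto_sum summable_LIMSEQ sm)
    then show "(\<Sum>k<p. c k) \<le> A\<^sup>2" by (rule LIMSEQ_le_const2) (use part in auto)
  qed
  moreover have "(\<Sum>i<n. (cmod (a i k))\<^sup>2) \<le> c k" for n k
    unfolding c_def by (intro sum_le_suminf sm) auto
  ultimately show ?thesis by (rule that)
qed

lemma hs_mat_transpose: "hs_mat a \<Longrightarrow> hs_mat (\<lambda>i j. a j i)"
proof -
  have "frob n (\<lambda>i j. a j i) = frob n a" for n
    using frob_sq[of n "\<lambda>i j. a j i"] frob_sq[of n a]
    by (subst (asm) sum.swap) (metis frob_nonneg power2_eq_iff_nonneg)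
  then show "hs_mat a \<Longrightarrow> hs_mat (\<lambda>i j. a j i)" unfolding hs_mat_def by simp
qed

lemma summable_tail_sum_le:
  fixes c :: "nat \<Rightarrow> real"
  assumes "summable c" "\<And>k. 0 \<le> c k"
  shows "(\<Sum>k\<in>{n..<m}. c k) \<le> (\<Sum>k. c (k + n))"
proof (cases "n \<le> m")
  case True
  then have "(\<Sum>k\<in>{n..<m}. c k) = (\<Sum>k<m-n. c (k + n))"
    using sum.shift_bounds_nat_ivl[of c 0 n "m - n"] by (simp add: atLeast0LessThan)
  also have "\<dots> \<le> (\<Sum>k. c (k + n))"
    by (intro sum_le_suminf) (use assms in \<open>auto simp: summable_iff_shift\<close>)
  finally show ?thesis .
next
  case False
  then show ?thesis using assms by (auto intro!: suminf_nonneg simp: summable_iff_shift)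
qed

text \<open>Corners do not multiply: the product of the n-corners yields \<open>cn\<close>, the sum
  over \<open>k < n\<close>, in place of \<open>c\<close>. By Cauchy-Schwarz both the norm of
  \<open>c - cn\<close> on the corner and its trace are at most \<open>sqrt (U n * V n)\<close>,
  with \<open>U\<close> and \<open>V\<close> the tails of the column and row majorants. So
  multiplicativity for finite matrices passes to the limit.\<close>

lemma det2_mult:
  assumes a: "hs_mat a" and b: "hs_mat b" and c: "hs_mat c"
    and cab: "\<And>i j. (\<lambda>k. a i k * b k j) sums c i j"
    and t: "(\<lambda>n. \<Sum>i<n. c i i) \<longlonglongrightarrow> t"
  shows "det2 (\<lambda>i j. a i j + b i j + c i j) = det2 a * det2 b * exp (- t)"
proof -
  obtain u where u: "summable u" "\<And>k n. (\<Sum>i<n. (cmod (a i k))\<^sup>2) \<le> u k"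
    using hs_mat_columns[OF a] by blast
  obtain v where v: "summable v" "\<And>k n. (\<Sum>j<n. (cmod (b k j))\<^sup>2) \<le> v k"
    using hs_mat_columns[OF hs_mat_transpose[OF b]] by blast
  have u0: "u k \<ge> 0" and v0: "v k \<ge> 0" for k using u(2)[where n=0] v(2)[where n=0] by auto
  define U where "U n = (\<Sum>k. u (k + n))" for n
  define V where "V n = (\<Sum>k. v (k + n))" for n
  have "U \<longlonglongrightarrow> 0" "V \<longlonglongrightarrow> 0" unfolding U_def V_def
    using suminf_exist_split2[OF u(1)] suminf_exist_split2[OF v(1)] by auto
  then have UV: "(\<lambda>n. sqrt (U n * V n)) \<longlonglongrightarrow> 0" using tendsto_real_sqrt[OF tendsto_mult] by fastforce
  have U0: "U n \<ge> 0" "V n \<ge> 0" for n unfolding U_def V_def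
    using u v u0 v0 by (auto intro!: suminf_nonneg simp: summable_iff_shift)
  define cn where "cn n i j = (\<Sum>k<n. a i k * b k j)" for n i j
  have lim: "(\<lambda>m. \<Sum>k\<in>{n..<m}. a i k * b k j) \<longlonglongrightarrow> c i j - cn n i j" for n i j
  proof -
    have "(\<lambda>m. (\<Sum>k<m. a i k * b k j) - cn n i j) \<longlonglongrightarrow> c i j - cn n i j"
      using cab[of i j] unfolding sums_def by (intro tendsto_diff tendsto_const)
    moreover have "eventually (\<lambda>m. (\<Sum>k<m. a i k * b k j) - cn n i j = (\<Sum>k\<in>{n..<m}. a i k * b k j)) sequentially"
      using eventually_ge_at_top[of n]
      by eventually_elim (auto simp: cn_def lessThan_atLeast0 sum_diff_nat_ivl)
    ultimately show ?thesis by (rule Lim_transform_eventually)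
  qed
  have cols: "(\<Sum>i<n. \<Sum>k\<in>{n..<m}. (cmod (a i k))\<^sup>2) \<le> U n" for n m
  proof -
    have "(\<Sum>i<n. \<Sum>k\<in>{n..<m}. (cmod (a i k))\<^sup>2) \<le> (\<Sum>k\<in>{n..<m}. u k)"
      by (subst sum.swap) (intro sum_mono u)
    then show ?thesis using summable_tail_sum_le[OF u(1) u0, of n m] unfolding U_def by linarith
  qed
  have rows: "(\<Sum>j<n. \<Sum>k\<in>{n..<m}. (cmod (b k j))\<^sup>2) \<le> V n" for n m
  proof -
    have "(\<Sum>j<n. \<Sum>k\<in>{n..<m}. (cmod (b k j))\<^sup>2) \<le> (\<Sum>k\<in>{n..<m}. v k)"
      by (subst sum.swap) (intro sum_mono v)
    then show ?thesis using summable_tail_sum_le[OF v(1) v0, of n m] unfolding V_def by linarith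
  qed
  have fr: "frob n (\<lambda>i j. c i j - cn n i j) \<le> sqrt (U n * V n)" for n
  proof (rule real_le_rsqrt, unfold frob_sq, rule LIMSEQ_le_const2)
    show "(\<lambda>m. \<Sum>i<n. \<Sum>j<n. (cmod (\<Sum>k\<in>{n..<m}. a i k * b k j))\<^sup>2) \<longlonglongrightarrow> (\<Sum>i<n. \<Sum>j<n. (cmod (c i j - cn n i j))\<^sup>2)"
      by (intro tendsto_sum tendsto_power tendsto_norm lim)
    have "(\<Sum>i<n. \<Sum>j<n. (cmod (\<Sum>k\<in>{n..<m}. a i k * b k j))\<^sup>2) \<le> U n * V n" for m
    proof -
      have "(\<Sum>i<n. \<Sum>j<n. (cmod (\<Sum>k\<in>{n..<m}. a i k * b k j))\<^sup>2)
          \<le> (\<Sum>i<n. \<Sum>j<n. (\<Sum>k\<in>{n..<m}. (cmod (a i k))\<^sup>2) * (\<Sum>k\<in>{n..<m}. (cmod (b k j))\<^sup>2))"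
        by (intro sum_mono norm_sum_mult_sq_le)
      also have "\<dots> = (\<Sum>i<n. \<Sum>k\<in>{n..<m}. (cmod (a i k))\<^sup>2) * (\<Sum>j<n. \<Sum>k\<in>{n..<m}. (cmod (b k j))\<^sup>2)"
        by (rule sum_product[symmetric])
      also have "\<dots> \<le> U n * V n"
        by (intro mult_mono cols rows) (auto intro!: sum_nonneg U0)
      finally show ?thesis .
    qed
    then show "\<exists>N. \<forall>m\<ge>N. (\<Sum>i<n. \<Sum>j<n. (cmod (\<Sum>k\<in>{n..<m}. a i k * b k j))\<^sup>2) \<le> U n * V n" by blast
  qed
  have tr: "cmod ((\<Sum>i<n. c i i) - (\<Sum>i<n. cn n i i)) \<le> sqrt (U n * V n)" for n
  proof (rule real_le_rsqrt, rule LIMSEQ_le_const2)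
    show "(\<lambda>m. (cmod (\<Sum>i<n. \<Sum>k\<in>{n..<m}. a i k * b k i))\<^sup>2) \<longlonglongrightarrow> (cmod ((\<Sum>i<n. c i i) - (\<Sum>i<n. cn n i i)))\<^sup>2"
      unfolding sum_subtractf[symmetric] by (intro tendsto_sum tendsto_power tendsto_norm lim)
    have "(cmod (\<Sum>i<n. \<Sum>k\<in>{n..<m}. a i k * b k i))\<^sup>2 \<le> U n * V n" for m
    proof -
      have "(cmod (\<Sum>i<n. \<Sum>k\<in>{n..<m}. a i k * b k i))\<^sup>2
          \<le> (\<Sum>i<n. \<Sum>k\<in>{n..<m}. (cmod (a i k))\<^sup>2) * (\<Sum>j<n. \<Sum>k\<in>{n..<m}. (cmod (b k j))\<^sup>2)"
        unfolding sum.cartesian_product case_prod_beta by (rule norm_sum_mult_sq_le)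
      also have "\<dots> \<le> U n * V n"
        by (intro mult_mono cols rows) (auto intro!: sum_nonneg U0)
      finally show ?thesis .
    qed
    then show "\<exists>N. \<forall>m\<ge>N. (cmod (\<Sum>i<n. \<Sum>k\<in>{n..<m}. a i k * b k i))\<^sup>2 \<le> U n * V n" by blast
  qed
  \<comment> \<open>On the corners (I + a) (I + b) = I + (a + b + cn) holds exactly, and the
    exponential factors differ by the trace of \<open>cn\<close>.\<close>
  have fin: "trunc_det2 n (\<lambda>i j. a i j + b i j + cn n i j) = trunc_det2 n a * trunc_det2 n b * exp (- (\<Sum>i<n. cn n i i))" for n
  proof -
    let ?A = "Matrix.mat n n (\<lambda>(i,j). of_bool (i = j) + a i j)"
    let ?B = "Matrix.mat n n (\<lambda>(i,j). of_bool (i = j) + b i j)"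
    have "Matrix.mat n n (\<lambda>(i,j). of_bool (i = j) + (a i j + b i j + cn n i j)) = ?A * ?B"
    proof (rule eq_matI)
      fix i j assume "i < dim_row (?A * ?B)" "j < dim_col (?A * ?B)"
      then have ij: "i < n" "j < n" by auto
      have "(\<Sum>k<n. (of_bool (i = k) + a i k) * (of_bool (k = j) + b k j))
         = (\<Sum>k<n. (if k = i then of_bool (k = j) + b k j else 0) + (if k = j then a i k else 0) + a i k * b k j)"
        by (intro sum.cong refl) (auto simp: algebra_simps)
      also have "\<dots> = of_bool (i = j) + (a i j + b i j + cn n i j)"
        using ij by (simp add: sum.distrib cn_def)
      finally show "Matrix.mat n n (\<lambda>(i,j). of_bool (i = j) + (a i j + b i j + cn n i j)) $$ (i, j) = (?A * ?B) $$ (i, j)"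
        using ij by (simp add: scalar_prod_def lessThan_atLeast0)
    qed auto
    moreover have "Determinant.det (?A * ?B) = Determinant.det ?A * Determinant.det ?B" by (rule det_mult) auto
    moreover have "exp (- (\<Sum>i<n. a i i + b i i + cn n i i)) = exp (- (\<Sum>i<n. a i i)) * exp (- (\<Sum>i<n. b i i)) * exp (- (\<Sum>i<n. cn n i i))"
      by (simp only: sum.distrib minus_add_distrib exp_add)
    ultimately show ?thesis unfolding trunc_det2_def by (simp only: mult_ac)
  qed
  define s where "s = (\<lambda>i j. a i j + b i j + c i j)"
  obtain A where A: "\<And>n. frob n a \<le> A" using a unfolding hs_mat_def by blast
  obtain B where B: "\<And>n. frob n b \<le> B" using b unfolding hs_mat_def by blast
  obtain C where C: "\<And>n. frob n c \<le> C" using c unfolding hs_mat_def by blast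
  have sb: "frob n s \<le> A + B + C" for n
    using frob_triangle[of n "\<lambda>i j. a i j + b i j" c] frob_triangle[of n a b] A[of n] B[of n] C[of n] unfolding s_def by linarith
  then have hs: "hs_mat s" unfolding hs_mat_def by blast
  have "(\<lambda>n. cmod (trunc_det2 n (\<lambda>i j. a i j + b i j + cn n i j) - trunc_det2 n s)) \<longlonglongrightarrow> 0"
  proof (rule Lim_null_comparison)
    show "\<forall>\<^sub>F n in sequentially. norm (cmod (trunc_det2 n (\<lambda>i j. a i j + b i j + cn n i j) - trunc_det2 n s))
        \<le> sqrt (U n * V n) * exp ((A + B + C + sqrt (U n * V n) + 1)\<^sup>2 / 2)"
    proof (intro always_eventually allI)
      fix n
      have "frob n (\<lambda>i j. a i j + b i j + cn n i j - s i j) = frob n (\<lambda>i j. c i j - cn n i j)"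
        unfolding s_def using frob_scale[of n "-1" "\<lambda>i j. c i j - cn n i j"] by simp
      then show "norm (cmod (trunc_det2 n (\<lambda>i j. a i j + b i j + cn n i j) - trunc_det2 n s))
        \<le> sqrt (U n * V n) * exp ((A + B + C + sqrt (U n * V n) + 1)\<^sup>2 / 2)"
        using trunc_det2_lipschitz[OF sb, of n "\<lambda>i j. a i j + b i j + cn n i j" "sqrt (U n * V n)"] fr[of n] by simp
    qed
    have "(\<lambda>n. sqrt (U n * V n) * exp ((A + B + C + sqrt (U n * V n) + 1)\<^sup>2 / 2)) \<longlonglongrightarrow> 0 * exp ((A + B + C + 0 + 1)\<^sup>2 / 2)"
      by (intro tendsto_mult tendsto_exp tendsto_divide tendsto_power tendsto_add tendsto_const UV) auto
    then show "(\<lambda>n. sqrt (U n * V n) * exp ((A + B + C + sqrt (U n * V n) + 1)\<^sup>2 / 2)) \<longlonglongrightarrow> 0" by simp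
  qed
  then have d0: "(\<lambda>n. trunc_det2 n (\<lambda>i j. a i j + b i j + cn n i j) - trunc_det2 n s) \<longlonglongrightarrow> 0"
    by (rule tendsto_norm_zero_cancel)
  have L1: "(\<lambda>n. trunc_det2 n (\<lambda>i j. a i j + b i j + cn n i j)) \<longlonglongrightarrow> det2 s"
    using tendsto_add[OF d0 trunc_det2_tendsto[OF hs]] by simp
  have "(\<lambda>n. cmod ((\<Sum>i<n. c i i) - (\<Sum>i<n. cn n i i))) \<longlonglongrightarrow> 0"
    by (rule Lim_null_comparison[OF always_eventually UV]) (simp add: tr)
  then have "(\<lambda>n. (\<Sum>i<n. c i i) - (\<Sum>i<n. cn n i i)) \<longlonglongrightarrow> 0" by (rule tendsto_norm_zero_cancel)
  from tendsto_diff[OF t this] have "(\<lambda>n. \<Sum>i<n. cn n i i) \<longlonglongrightarrow> t" by simp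
  then have "(\<lambda>n. trunc_det2 n a * trunc_det2 n b * exp (- (\<Sum>i<n. cn n i i))) \<longlonglongrightarrow> det2 a * det2 b * exp (- t)"
    by (intro tendsto_mult tendsto_exp tendsto_minus trunc_det2_tendsto a b)
  then have L2: "(\<lambda>n. trunc_det2 n (\<lambda>i j. a i j + b i j + cn n i j)) \<longlonglongrightarrow> det2 a * det2 b * exp (- t)"
    unfolding fin .
  show ?thesis using LIMSEQ_unique[OF L1 L2] by (simp add: s_def)
qed

lemma tendsto_det:
  assumes "\<And>i j. i < n \<Longrightarrow> j < n \<Longrightarrow> ((\<lambda>x. a x i j) \<longlongrightarrow> b i j) F"
  shows "((\<lambda>x. Determinant.det (Matrix.mat n n (\<lambda>(i,j). a x i j))) \<longlongrightarrow> (Determinant.det (Matrix.mat n n (\<lambda>(i,j). b i j)) :: complex)) F"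
proof -
  have *: "Determinant.det (Matrix.mat n n (\<lambda>(i,j). c i j)) =
     (\<Sum>p\<in>{p. p permutes {0..<n}}. signof p * (\<Prod>i=0..<n. c i (p i)))" for c :: "nat \<Rightarrow> nat \<Rightarrow> complex"
    unfolding det_def by (auto simp: permutes_def intro!: sum.cong prod.cong)
  have p: "p i < n" if "p permutes {0..<n}" "i < n" for p i
    using that permutes_in_image[of p "{0..<n}" i] by simp
  show ?thesis unfolding *
    by (intro tendsto_sum tendsto_mult tendsto_prod tendsto_const assms) (auto intro: p)
qed

text \<open>Sylvester's identity replaces the n-corner by an \<open>M\<close> by \<open>M\<close>
  determinant whose entries are partial sums of the pairings, so the limit is taken at fixed
  size.\<close>

lemma det2_finite_rank:
  assumes hs: "hs_mat a" and a: "\<And>i j. a i j = - (\<Sum>m<M. u m i * w m j)"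
    and G: "\<And>m m'. m < M \<Longrightarrow> m' < M \<Longrightarrow> (\<lambda>n. \<Sum>i<n. w m i * u m' i) \<longlonglongrightarrow> G m m'"
  shows "det2 a = Determinant.det (Matrix.mat M M (\<lambda>(m,m'). of_bool (m = m') - G m m')) * exp (\<Sum>m<M. G m m)"
proof -
  define g where "g n m m' = (\<Sum>i<n. w m i * u m' i)" for n m m'
  have "trunc_det2 n a = Determinant.det (Matrix.mat M M (\<lambda>(m,m'). of_bool (m = m') - g n m m')) * exp (\<Sum>m<M. g n m m)" for n
  proof -
    define U where "U = Matrix.mat n M (\<lambda>(i,m). u m i)"
    define W where "W = Matrix.mat M n (\<lambda>(m,j). w m j)"
    have UW: "U \<in> carrier_mat n M" "W \<in> carrier_mat M n" unfolding U_def W_def by auto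
    have "Matrix.mat n n (\<lambda>(i,j). of_bool (i = j) + a i j) = 1\<^sub>m n - U * W"
      by (rule eq_matI) (auto simp: U_def W_def scalar_prod_def a lessThan_atLeast0)
    moreover have "Matrix.mat M M (\<lambda>(m,m'). of_bool (m = m') - g n m m') = 1\<^sub>m M - W * U"
      by (rule eq_matI) (auto simp: U_def W_def scalar_prod_def g_def lessThan_atLeast0)
    moreover have "- (\<Sum>i<n. a i i) = (\<Sum>m<M. g n m m)"
      unfolding a g_def by (subst sum.swap) (simp add: sum_negf mult.commute)
    ultimately show ?thesis unfolding trunc_det2_def
      using det_one_minus_mult_commute[OF UW] by simp
  qed
  moreover have "(\<lambda>n. Determinant.det (Matrix.mat M M (\<lambda>(m,m'). of_bool (m = m') - g n m m')) * exp (\<Sum>m<M. g n m m))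
      \<longlonglongrightarrow> Determinant.det (Matrix.mat M M (\<lambda>(m,m'). of_bool (m = m') - G m m')) * exp (\<Sum>m<M. G m m)"
    by (intro tendsto_mult tendsto_exp tendsto_sum tendsto_det tendsto_diff tendsto_const) (use G in \<open>auto simp: g_def\<close>)
  ultimately have "(\<lambda>n. trunc_det2 n a)
      \<longlonglongrightarrow> Determinant.det (Matrix.mat M M (\<lambda>(m,m'). of_bool (m = m') - G m m')) * exp (\<Sum>m<M. G m m)"
    by (simp only:)
  then show ?thesis by (rule LIMSEQ_unique[OF trunc_det2_tendsto[OF hs]])
qed

section \<open>Square integrable functions\<close>

lemma L2_measurable [measurable_dest]: "f \<in> L2 M \<Longrightarrow> f \<in> borel_measurable M"
  unfolding L2_def by simp

lemma L2_integrable_sq: "f \<in> L2 M \<Longrightarrow> integrable M (\<lambda>x. (cmod (f x))\<^sup>2)"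
  unfolding L2_def by simp

lemma L2_integrable_norm_mult:
  assumes f: "f \<in> L2 M" and g: "g \<in> L2 M"
  shows "integrable M (\<lambda>x. cmod (f x) * cmod (g x))"
proof (rule Bochner_Integration.integrable_bound)
  show "integrable M (\<lambda>x. (cmod (f x))\<^sup>2 + (cmod (g x))\<^sup>2)"
    using f g by (intro Bochner_Integration.integrable_add L2_integrable_sq)
  have "cmod (f x) * cmod (g x) \<le> (cmod (f x))\<^sup>2 + (cmod (g x))\<^sup>2" for x
  proof -
    have "2 * cmod (f x) * cmod (g x) \<le> (cmod (f x))\<^sup>2 + (cmod (g x))\<^sup>2" by (rule sum_squares_bound)
    moreover have "0 \<le> cmod (f x) * cmod (g x)" by simp
    ultimately show ?thesis by linarith
  qed
  then show "AE x in M. norm (cmod (f x) * cmod (g x)) \<le> norm ((cmod (f x))\<^sup>2 + (cmod (g x))\<^sup>2)"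
    by (auto simp: abs_mult)
qed (use L2_measurable[OF f] L2_measurable[OF g] in measurable)

lemma L2_integrable_mult:
  assumes f: "f \<in> L2 M" and g: "g \<in> L2 M"
  shows "integrable M (\<lambda>x. f x * g x)"
  by (rule Bochner_Integration.integrable_bound[OF L2_integrable_norm_mult[OF f g]])
     (use L2_measurable[OF f] L2_measurable[OF g] in \<open>auto simp: norm_mult\<close>)

lemma L2_cnj: "f \<in> L2 M \<Longrightarrow> (\<lambda>x. cnj (f x)) \<in> L2 M"
  unfolding L2_def
  using measurable_compose[OF _ borel_measurable_continuous_onI[OF continuous_on_cnj[OF continuous_on_id]], of f M] by simp

lemma L2_cmult: "f \<in> L2 M \<Longrightarrow> (\<lambda>x. c * f x) \<in> L2 M"
  unfolding L2_def by (auto simp: norm_mult power_mult_distrib)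

lemma L2_add:
  assumes f: "f \<in> L2 M" and g: "g \<in> L2 M"
  shows "(\<lambda>x. f x + g x) \<in> L2 M"
proof -
  have "integrable M (\<lambda>x. (cmod (f x + g x))\<^sup>2)"
  proof (rule Bochner_Integration.integrable_bound)
    show "integrable M (\<lambda>x. 2 * (cmod (f x))\<^sup>2 + 2 * (cmod (g x))\<^sup>2)"
      using f g by (intro Bochner_Integration.integrable_add integrable_mult_right L2_integrable_sq)
    have "(cmod (f x + g x))\<^sup>2 \<le> 2 * (cmod (f x))\<^sup>2 + 2 * (cmod (g x))\<^sup>2" for x
    proof -
      have "(cmod (f x + g x))\<^sup>2 \<le> (cmod (f x) + cmod (g x))\<^sup>2"
        by (intro power_mono norm_triangle_ineq) simp
      moreover have "2 * cmod (f x) * cmod (g x) \<le> (cmod (f x))\<^sup>2 + (cmod (g x))\<^sup>2" by (rule sum_squares_bound)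
      ultimately show ?thesis by (simp add: power2_sum)
    qed
    then show "AE x in M. norm ((cmod (f x + g x))\<^sup>2) \<le> norm (2 * (cmod (f x))\<^sup>2 + 2 * (cmod (g x))\<^sup>2)"
      by auto
  qed (use L2_measurable[OF f] L2_measurable[OF g] in measurable)
  then show ?thesis using L2_measurable[OF f] L2_measurable[OF g] unfolding L2_def by simp
qed

lemma L2_diff: "f \<in> L2 M \<Longrightarrow> g \<in> L2 M \<Longrightarrow> (\<lambda>x. f x - g x) \<in> L2 M"
  using L2_add[of f M "\<lambda>x. - 1 * g x"] L2_cmult[of g M "-1"] by simp

lemma L2_zero [simp]: "(\<lambda>x. 0) \<in> L2 M"
  unfolding L2_def by simp

lemma L2_sum: "(\<And>i. i \<in> A \<Longrightarrow> f i \<in> L2 M) \<Longrightarrow> (\<lambda>x. \<Sum>i\<in>A. f i x) \<in> L2 M"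
  by (induction A rule: infinite_finite_induct) (auto intro: L2_add)

lemma l2_norm_nonneg [simp]: "0 \<le> l2_norm M f"
  unfolding l2_norm_def by simp

lemma l2_norm_sq: "(l2_norm M f)\<^sup>2 = (LINT x|M. (cmod (f x))\<^sup>2)"
  unfolding l2_norm_def by simp

lemma l2_inner_self: "l2_inner M f f = of_real ((l2_norm M f)\<^sup>2)"
  unfolding l2_inner_def l2_norm_sq
  by (subst integral_complex_of_real[symmetric])
     (intro Bochner_Integration.integral_cong refl, simp only: complex_norm_square mult.commute)

lemma l2_inner_commute: "l2_inner M g f = cnj (l2_inner M f g)"
  unfolding l2_inner_def by (subst Bochner_Integration.integral_cnj[symmetric]) (simp add: mult.commute)

lemma l2_inner_integrable: "f \<in> L2 M \<Longrightarrow> g \<in> L2 M \<Longrightarrow> integrable M (\<lambda>x. cnj (f x) * g x)"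
  by (intro L2_integrable_mult L2_cnj)

lemma l2_inner_add_right:
  "f \<in> L2 M \<Longrightarrow> g \<in> L2 M \<Longrightarrow> h \<in> L2 M \<Longrightarrow> l2_inner M f (\<lambda>x. g x + h x) = l2_inner M f g + l2_inner M f h"
  unfolding l2_inner_def
  by (simp add: distrib_left l2_inner_integrable Bochner_Integration.integral_add)

lemma l2_inner_cmult_right: "l2_inner M f (\<lambda>x. c * g x) = c * l2_inner M f g"
  unfolding l2_inner_def by (simp add: mult.left_commute[of _ c])

lemma l2_inner_diff_right:
  "f \<in> L2 M \<Longrightarrow> g \<in> L2 M \<Longrightarrow> h \<in> L2 M \<Longrightarrow> l2_inner M f (\<lambda>x. g x - h x) = l2_inner M f g - l2_inner M f h"
  unfolding l2_inner_def
  by (simp add: right_diff_distrib l2_inner_integrable Bochner_Integration.integral_diff)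

lemma l2_inner_sum_right:
  assumes "f \<in> L2 M" "\<And>i. i \<in> A \<Longrightarrow> g i \<in> L2 M"
  shows "l2_inner M f (\<lambda>x. \<Sum>i\<in>A. c i * g i x) = (\<Sum>i\<in>A. c i * l2_inner M f (g i))"
  using assms(2)
proof (induction A rule: infinite_finite_induct)
  case (insert i A)
  then have "l2_inner M f (\<lambda>x. c i * g i x + (\<Sum>i\<in>A. c i * g i x))
     = l2_inner M f (\<lambda>x. c i * g i x) + l2_inner M f (\<lambda>x. \<Sum>i\<in>A. c i * g i x)"
    by (intro l2_inner_add_right assms(1) L2_cmult L2_sum) auto
  then show ?case using insert by (simp add: l2_inner_cmult_right)
qed (auto simp: l2_inner_def)

lemma l2_norm_zero_iff:
  assumes "f \<in> L2 M"
  shows "l2_norm M f = 0 \<longleftrightarrow> (AE x in M. f x = 0)"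
proof -
  have "l2_norm M f = 0 \<longleftrightarrow> (LINT x|M. (cmod (f x))\<^sup>2) = 0" unfolding l2_norm_def by simp
  also have "\<dots> \<longleftrightarrow> (AE x in M. (cmod (f x))\<^sup>2 = 0)"
    by (rule integral_nonneg_eq_0_iff_AE) (use L2_integrable_sq[OF assms] in auto)
  finally show ?thesis by simp
qed

lemma integral_norm_mult_le:
  assumes f: "f \<in> L2 M" and g: "g \<in> L2 M"
  shows "(LINT x|M. cmod (f x) * cmod (g x)) \<le> l2_norm M f * l2_norm M g"
proof (cases "l2_norm M f = 0 \<or> l2_norm M g = 0")
  case True
  then have "(AE x in M. f x = 0) \<or> (AE x in M. g x = 0)" using l2_norm_zero_iff f g by blast
  then have "AE x in M. cmod (f x) * cmod (g x) = 0" by auto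
  then have "(LINT x|M. cmod (f x) * cmod (g x)) = (LINT x|M. 0)"
    by (intro integral_cong_AE) (use L2_measurable[OF f] L2_measurable[OF g] in auto)
  then show ?thesis by simp
next
  case False
  define a where "a = l2_norm M f"
  define b where "b = l2_norm M g"
  have ab: "a > 0" "b > 0" using False l2_norm_nonneg[of M f] l2_norm_nonneg[of M g] unfolding a_def b_def by linarith+
  \<comment> \<open>Young's inequality with weights for which the two squares integrate to
    \<open>a * b / 2\<close> each.\<close>
  have "(LINT x|M. cmod (f x) * cmod (g x)) \<le> (LINT x|M. (b / (2 * a)) * (cmod (f x))\<^sup>2 + (a / (2 * b)) * (cmod (g x))\<^sup>2)"
  proof (intro integral_mono Bochner_Integration.integrable_add integrable_mult_right L2_integrable_sq L2_integrable_norm_mult f g)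
    fix x
    have "0 \<le> (b * cmod (f x) - a * cmod (g x))\<^sup>2 / (2 * a * b)" using ab by simp
    also have "\<dots> = (b / (2 * a)) * (cmod (f x))\<^sup>2 + (a / (2 * b)) * (cmod (g x))\<^sup>2 - cmod (f x) * cmod (g x)"
      using ab by (simp add: power2_eq_square field_simps)
    finally show "cmod (f x) * cmod (g x) \<le> (b / (2 * a)) * (cmod (f x))\<^sup>2 + (a / (2 * b)) * (cmod (g x))\<^sup>2" by simp
  qed
  also have "\<dots> = (b / (2 * a)) * a\<^sup>2 + (a / (2 * b)) * b\<^sup>2"
    unfolding a_def b_def l2_norm_sq using f g
    by (subst Bochner_Integration.integral_add) (auto intro!: integrable_mult_right L2_integrable_sq)
  also have "\<dots> = a * b" using ab by (simp add: power2_eq_square)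
  finally show ?thesis unfolding a_def b_def .
qed

lemma l2_inner_le: "f \<in> L2 M \<Longrightarrow> g \<in> L2 M \<Longrightarrow> cmod (l2_inner M f g) \<le> l2_norm M f * l2_norm M g"
  unfolding l2_inner_def
  by (rule order_trans[OF integral_norm_bound])
     (use integral_norm_mult_le[of f M g] in \<open>simp add: norm_mult\<close>)

lemma l2_norm_minus: "l2_norm M (\<lambda>x. f x - g x) = l2_norm M (\<lambda>x. g x - f x)"
  unfolding l2_norm_def by (simp add: norm_minus_commute)

lemma l2_norm_cmult: "l2_norm M (\<lambda>x. c * f x) = cmod c * l2_norm M f"
  unfolding l2_norm_def by (simp add: norm_mult power_mult_distrib real_sqrt_mult)

lemma l2_norm_triangle:
  assumes f: "f \<in> L2 M" and g: "g \<in> L2 M"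
  shows "l2_norm M (\<lambda>x. f x + g x) \<le> l2_norm M f + l2_norm M g"
proof (rule power2_le_imp_le)
  have "(l2_norm M (\<lambda>x. f x + g x))\<^sup>2 \<le> (LINT x|M. (cmod (f x))\<^sup>2 + (cmod (g x))\<^sup>2 + 2 * (cmod (f x) * cmod (g x)))"
    unfolding l2_norm_sq
  proof (intro integral_mono Bochner_Integration.integrable_add integrable_mult_right L2_integrable_sq L2_integrable_norm_mult L2_add f g)
    fix x
    have "(cmod (f x + g x))\<^sup>2 \<le> (cmod (f x) + cmod (g x))\<^sup>2"
      by (intro power_mono norm_triangle_ineq) simp
    then show "(cmod (f x + g x))\<^sup>2 \<le> (cmod (f x))\<^sup>2 + (cmod (g x))\<^sup>2 + 2 * (cmod (f x) * cmod (g x))"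
      by (simp add: power2_sum)
  qed
  also have "\<dots> = (l2_norm M f)\<^sup>2 + (l2_norm M g)\<^sup>2 + 2 * (LINT x|M. cmod (f x) * cmod (g x))"
  proof -
    have i: "integrable M (\<lambda>x. (cmod (f x))\<^sup>2)" "integrable M (\<lambda>x. (cmod (g x))\<^sup>2)"
      "integrable M (\<lambda>x. 2 * (cmod (f x) * cmod (g x)))"
      by (intro integrable_mult_right L2_integrable_sq L2_integrable_norm_mult f g)+
    show ?thesis
      unfolding l2_norm_sq Bochner_Integration.integral_add[OF Bochner_Integration.integrable_add[OF i(1,2)] i(3)]
        Bochner_Integration.integral_add[OF i(1,2)] by simp
  qed
  also have "\<dots> \<le> (l2_norm M f + l2_norm M g)\<^sup>2"
    using integral_norm_mult_le[OF f g] by (simp add: power2_sum)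
  finally show "(l2_norm M (\<lambda>x. f x + g x))\<^sup>2 \<le> (l2_norm M f + l2_norm M g)\<^sup>2" .
qed simp

text \<open>Fatou's lemma in the form that completeness requires: the bound on the integrals yields
  integrability of the limit as well.\<close>

lemma integrable_fatou_le:
  fixes u :: "nat \<Rightarrow> 'a \<Rightarrow> real"
  assumes u: "\<And>k. integrable M (u k)" "\<And>k x. 0 \<le> u k x"
    and C: "\<forall>\<^sub>F k in sequentially. (LINT x|M. u k x) \<le> C"
    and v: "v \<in> borel_measurable M" and lim: "AE x in M. (\<lambda>k. u k x) \<longlonglongrightarrow> v x"
  shows "integrable M v \<and> (LINT x|M. v x) \<le> C"
proof -
  obtain k where "(LINT x|M. u k x) \<le> C" using C eventually_happens by force
  moreover have "0 \<le> (LINT x|M. u k x)" using u(2) by (simp add: integral_nonneg_AE)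
  ultimately have C0: "C \<ge> 0" by linarith
  have vn: "AE x in M. 0 \<le> v x"
    using lim by eventually_elim (rule LIMSEQ_le_const, use u(2) in auto)
  have "(\<integral>\<^sup>+ x. ennreal (v x) \<partial>M) = (\<integral>\<^sup>+ x. liminf (\<lambda>k. ennreal (u k x)) \<partial>M)"
  proof (rule nn_integral_cong_AE, use lim in eventually_elim)
    fix x assume "(\<lambda>k. u k x) \<longlonglongrightarrow> v x"
    then have "(\<lambda>k. ennreal (u k x)) \<longlonglongrightarrow> ennreal (v x)" by (rule tendsto_ennrealI)
    then show "ennreal (v x) = liminf (\<lambda>k. ennreal (u k x))"
      by (simp add: lim_imp_Liminf)
  qed
  also have "\<dots> \<le> liminf (\<lambda>k. \<integral>\<^sup>+ x. ennreal (u k x) \<partial>M)"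
    using u(1) by (intro nn_integral_liminf) simp
  also have "\<dots> \<le> limsup (\<lambda>k. \<integral>\<^sup>+ x. ennreal (u k x) \<partial>M)" by (rule Liminf_le_Limsup) simp
  also have "\<dots> \<le> ennreal C"
  proof (rule Limsup_bounded)
    show "\<forall>\<^sub>F k in sequentially. (\<integral>\<^sup>+ x. ennreal (u k x) \<partial>M) \<le> ennreal C"
      using C by eventually_elim (use u in \<open>simp add: nn_integral_eq_integral ennreal_leI\<close>)
  qed
  finally have le: "(\<integral>\<^sup>+ x. ennreal (v x) \<partial>M) \<le> ennreal C" .
  have int: "integrable M v"
    by (rule integrableI_nonneg[OF v vn]) (use le in \<open>simp add: le_less_trans\<close>)
  then have "(LINT x|M. v x) \<le> C"
    using le C0 nn_integral_eq_integral[OF int vn] by (simp add: ennreal_le_iff)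
  then show ?thesis using int by simp
qed

section \<open>Finite measure spaces and completeness of L2\<close>

context finite_measure
begin

lemma L2_bounded:
  assumes f: "f \<in> borel_measurable M" and "\<And>x. x \<in> space M \<Longrightarrow> cmod (f x) \<le> C"
  shows "f \<in> L2 M"
proof -
  have "integrable M (\<lambda>x. (cmod (f x))\<^sup>2)"
    by (rule integrable_const_bound[where B="C\<^sup>2"]) (use assms in \<open>auto intro!: AE_I2 power_mono\<close>)
  then show ?thesis using f unfolding L2_def by simp
qed

lemma l2_norm_bounded:
  assumes f: "f \<in> borel_measurable M" and C: "\<And>x. x \<in> space M \<Longrightarrow> cmod (f x) \<le> C" "0 \<le> C"
  shows "l2_norm M f \<le> C * sqrt (measure M (space M))"
proof -
  have "(LINT x|M. (cmod (f x))\<^sup>2) \<le> (LINT x|M. C\<^sup>2)"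
    by (intro integral_mono L2_integrable_sq L2_bounded[OF f C(1)]) (auto intro!: power_mono C)
  then have "l2_norm M f \<le> sqrt (C\<^sup>2 * measure M (space M))"
    unfolding l2_norm_def by (simp add: mult.commute)
  then show ?thesis using C(2) by (simp add: real_sqrt_mult)
qed

lemma L2_one: "(\<lambda>x. 1) \<in> L2 M"
  by (rule L2_bounded[of _ 1]) auto

lemma L2_integrable:
  assumes "f \<in> L2 M"
  shows "integrable M f"
  using L2_integrable_mult[OF assms L2_one] by simp

lemma integral_norm_le_l2_norm:
  assumes "f \<in> L2 M"
  shows "(LINT x|M. cmod (f x)) \<le> sqrt (measure M (space M)) * l2_norm M f"
proof -
  have "l2_norm M (\<lambda>x. 1) = sqrt (measure M (space M))" unfolding l2_norm_def by simp
  then show ?thesis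
    using integral_norm_mult_le[OF L2_one assms] by simp
qed

text \<open>On a finite measure space L2-Cauchy implies L1-Cauchy, so a subsequence converges almost
  everywhere; Fatou's lemma along that subsequence shows that the pointwise limit is also the
  L2-limit.\<close>

lemma riesz_fischer:
  fixes s :: "nat \<Rightarrow> 'a \<Rightarrow> complex"
  assumes s: "\<And>n. s n \<in> L2 M"
    and cauchy: "\<And>\<epsilon>. \<epsilon> > 0 \<Longrightarrow> \<exists>N. \<forall>i\<ge>N. \<forall>j\<ge>N. l2_norm M (\<lambda>x. s i x - s j x) < \<epsilon>"
  obtains g where "g \<in> L2 M" "(\<lambda>n. l2_norm M (\<lambda>x. s n x - g x)) \<longlonglongrightarrow> 0"
proof -
  have d: "(\<lambda>x. s i x - s j x) \<in> L2 M" for i j by (intro L2_diff s)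
  have sm: "s n \<in> borel_measurable M" for n by (rule L2_measurable[OF s])
  have "\<exists>N. \<forall>i\<ge>N. \<forall>j\<ge>N. (LINT x|M. norm (s i x - s j x)) < \<epsilon>" if "\<epsilon> > 0" for \<epsilon>
  proof -
    define m where "m = sqrt (measure M (space M))"
    have m: "m \<ge> 0" unfolding m_def by simp
    have "\<epsilon> / (m + 1) > 0" using m that by simp
    from cauchy[OF this] obtain N
      where N: "\<And>i j. i \<ge> N \<Longrightarrow> j \<ge> N \<Longrightarrow> l2_norm M (\<lambda>x. s i x - s j x) < \<epsilon> / (m + 1)" by blast
    show ?thesis
    proof (intro exI[of _ N] allI impI)
      fix i j assume ij: "N \<le> i" "N \<le> j"
      have "(LINT x|M. norm (s i x - s j x)) \<le> m * l2_norm M (\<lambda>x. s i x - s j x)"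
        unfolding m_def by (rule integral_norm_le_l2_norm[OF d])
      also have "\<dots> \<le> m * (\<epsilon> / (m + 1))" using N[OF ij] m by (intro mult_left_mono) auto
      also have "\<dots> = m * \<epsilon> / (m + 1)" by simp
      also have "\<dots> < \<epsilon>" using m that by (subst pos_divide_less_eq) (auto simp: algebra_simps)
      finally show "(LINT x|M. norm (s i x - s j x)) < \<epsilon>" .
    qed
  qed
  with L2_integrable[OF s] obtain r where r: "strict_mono r" "AE x in M. Cauchy (\<lambda>i. s (r i) x)"
    by (rule cauchy_L1_AE_cauchy_subseq)
  define g where "g = (\<lambda>x. lim (\<lambda>i. s (r i) x))"
  have gm: "g \<in> borel_measurable M" unfolding g_def by (intro borel_measurable_lim_metric sm)
  have conv: "AE x in M. (\<lambda>i. s (r i) x) \<longlonglongrightarrow> g x"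
    using r(2) unfolding g_def
    by eventually_elim (rule Cauchy_convergent[THEN convergent_LIMSEQ_iff[THEN iffD1]])
  have key: "\<exists>N. \<forall>n\<ge>N. integrable M (\<lambda>x. (cmod (s n x - g x))\<^sup>2) \<and> (LINT x|M. (cmod (s n x - g x))\<^sup>2) \<le> \<epsilon>\<^sup>2"
    if e: "\<epsilon> > 0" for \<epsilon>
  proof -
    obtain N where N: "\<And>i j. i \<ge> N \<Longrightarrow> j \<ge> N \<Longrightarrow> l2_norm M (\<lambda>x. s i x - s j x) < \<epsilon>"
      using cauchy[OF e] by auto
    show ?thesis
    proof (intro exI[of _ N] allI impI)
      fix n assume n: "N \<le> n"
      show "integrable M (\<lambda>x. (cmod (s n x - g x))\<^sup>2) \<and> (LINT x|M. (cmod (s n x - g x))\<^sup>2) \<le> \<epsilon>\<^sup>2"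
      proof (rule integrable_fatou_le[where u="\<lambda>k x. (cmod (s n x - s (r k) x))\<^sup>2"])
        show "integrable M (\<lambda>x. (cmod (s n x - s (r k) x))\<^sup>2)" for k by (rule L2_integrable_sq[OF d])
        show "\<forall>\<^sub>F k in sequentially. (LINT x|M. (cmod (s n x - s (r k) x))\<^sup>2) \<le> \<epsilon>\<^sup>2"
          unfolding eventually_sequentially l2_norm_sq[symmetric]
        proof (intro exI[of _ N] allI impI)
          fix k assume "N \<le> k"
          then have "N \<le> r k" using seq_suble[OF r(1), of k] by linarith
          then show "(l2_norm M (\<lambda>x. s n x - s (r k) x))\<^sup>2 \<le> \<epsilon>\<^sup>2"
            using N[OF n] by (intro power_mono) (auto intro: less_imp_le)
        qed
        show "(\<lambda>x. (cmod (s n x - g x))\<^sup>2) \<in> borel_measurable M" using sm[of n] gm by measurable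
        show "AE x in M. (\<lambda>k. (cmod (s n x - s (r k) x))\<^sup>2) \<longlonglongrightarrow> (cmod (s n x - g x))\<^sup>2"
          using conv by eventually_elim (intro tendsto_power tendsto_norm tendsto_diff tendsto_const)
      qed simp
    qed
  qed
  obtain N where N: "\<And>n. n \<ge> N \<Longrightarrow> integrable M (\<lambda>x. (cmod (s n x - g x))\<^sup>2)" using key[of 1] by auto
  have "(\<lambda>x. s N x - g x) \<in> L2 M" using N[of N] sm[of N] gm unfolding L2_def by simp
  then have gL: "g \<in> L2 M" using L2_diff[OF s[of N], of "\<lambda>x. s N x - g x"] by simp
  have "(\<lambda>n. l2_norm M (\<lambda>x. s n x - g x)) \<longlonglongrightarrow> 0"
  proof (rule LIMSEQ_I)
    fix \<epsilon> :: real assume e: "\<epsilon> > 0"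
    then obtain N where N: "\<And>n. n \<ge> N \<Longrightarrow> (LINT x|M. (cmod (s n x - g x))\<^sup>2) \<le> (\<epsilon>/2)\<^sup>2"
      using key[of "\<epsilon>/2"] by auto
    show "\<exists>N. \<forall>n\<ge>N. norm (l2_norm M (\<lambda>x. s n x - g x) - 0) < \<epsilon>"
    proof (intro exI[of _ N] allI impI)
      fix n assume "N \<le> n"
      then have "l2_norm M (\<lambda>x. s n x - g x) \<le> \<epsilon> / 2"
        using N[of n] e unfolding l2_norm_def by (intro real_le_lsqrt) auto
      then show "norm (l2_norm M (\<lambda>x. s n x - g x) - 0) < \<epsilon>" using e by simp
    qed
  qed
  then show ?thesis by (rule that[OF gL])
qed

end

section \<open>Orthonormal bases: Bessel, expansion, Parseval\<close>

lemma orthonormal_basisD: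
  assumes "orthonormal_basis M e"
  shows "e i \<in> L2 M" "l2_inner M (e i) (e j) = (if i = j then 1 else 0)"
    "f \<in> L2 M \<Longrightarrow> (\<And>i. l2_inner M (e i) f = 0) \<Longrightarrow> AE x in M. f x = 0"
  using assms unfolding orthonormal_basis_def by auto

lemma l2_norm_sum_orthonormal:
  assumes e: "orthonormal_basis M e" and A: "finite A"
  shows "(l2_norm M (\<lambda>x. \<Sum>i\<in>A. c i * e i x))\<^sup>2 = (\<Sum>i\<in>A. (cmod (c i))\<^sup>2)"
proof -
  have basis_L2: "e i \<in> L2 M" for i by (rule orthonormal_basisD(1)[OF e])
  have S: "(\<lambda>x. \<Sum>i\<in>A. c i * e i x) \<in> L2 M" by (intro L2_sum L2_cmult basis_L2)
  have ie: "l2_inner M (e i) (\<lambda>x. \<Sum>i\<in>A. c i * e i x) = c i" if "i \<in> A" for i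
    using that A by (simp add: l2_inner_sum_right basis_L2 orthonormal_basisD(2)[OF e] if_distrib sum.delta cong: if_cong)
  have "complex_of_real ((l2_norm M (\<lambda>x. \<Sum>i\<in>A. c i * e i x))\<^sup>2)
     = (\<Sum>j\<in>A. c j * l2_inner M (\<lambda>x. \<Sum>i\<in>A. c i * e i x) (e j))"
    unfolding l2_inner_self[symmetric] by (rule l2_inner_sum_right[OF S basis_L2])
  also have "\<dots> = (\<Sum>j\<in>A. c j * cnj (c j))"
    by (intro sum.cong refl) (simp add: l2_inner_commute[of M _ "e _"] ie)
  also have "\<dots> = complex_of_real (\<Sum>i\<in>A. (cmod (c i))\<^sup>2)"
    by (simp only: of_real_sum complex_norm_square)
  finally show ?thesis by (simp only: of_real_eq_iff)
qed

lemma bessel_inequality: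
  assumes e: "orthonormal_basis M e" and f: "f \<in> L2 M"
  shows "(\<Sum>i<n. (cmod (l2_inner M (e i) f))\<^sup>2) \<le> (l2_norm M f)\<^sup>2"
proof -
  define S where "S = (\<lambda>x. \<Sum>i<n. l2_inner M (e i) f * e i x)"
  define b where "b = (\<Sum>i<n. (cmod (l2_inner M (e i) f))\<^sup>2)"
  have basis_L2: "e i \<in> L2 M" for i by (rule orthonormal_basisD(1)[OF e])
  have SL: "S \<in> L2 M" unfolding S_def by (intro L2_sum L2_cmult basis_L2)
  have SS: "(l2_norm M S)\<^sup>2 = b" unfolding S_def b_def by (rule l2_norm_sum_orthonormal[OF e]) simp
  have "l2_inner M f S = (\<Sum>i<n. l2_inner M (e i) f * l2_inner M f (e i))"
    unfolding S_def by (rule l2_inner_sum_right[OF f basis_L2])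
  also have "\<dots> = of_real b" unfolding b_def
    by (simp only: of_real_sum complex_norm_square l2_inner_commute[of M f "e _"])
  finally have fS: "l2_inner M f S = of_real b" .
  have "b \<ge> 0" unfolding b_def by (simp add: sum_nonneg)
  have "b \<le> l2_norm M f * sqrt b"
  proof -
    have "l2_norm M S = sqrt b" using SS real_sqrt_unique[OF SS] by simp
    then show ?thesis using l2_inner_le[OF f SL] fS \<open>b \<ge> 0\<close> by simp
  qed
  then have "sqrt b * sqrt b \<le> l2_norm M f * sqrt b" using \<open>b \<ge> 0\<close> by simp
  have "sqrt b \<le> l2_norm M f"
  proof (cases "b = 0")
    case False
    then have "sqrt b > 0" using \<open>b \<ge> 0\<close> by simp
    with \<open>sqrt b * sqrt b \<le> l2_norm M f * sqrt b\<close> show ?thesis by (rule mult_right_le_imp_le)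
  qed simp
  then show ?thesis using \<open>b \<ge> 0\<close> unfolding b_def[symmetric] by (simp add: sqrt_le_D)
qed

context finite_measure
begin

text \<open>By Bessel's inequality the partial sums are Cauchy. Their limit \<open>g\<close> has the
  same coefficients as \<open>f\<close>, and completeness of the basis forces \<open>f = g\<close>
  almost everywhere.\<close>

lemma orthonormal_expansion:
  assumes e: "orthonormal_basis M e" and f: "f \<in> L2 M"
  shows "(\<lambda>n. l2_norm M (\<lambda>x. (\<Sum>i<n. l2_inner M (e i) f * e i x) - f x)) \<longlonglongrightarrow> 0"
proof -
  define c where "c i = l2_inner M (e i) f" for i
  define S where "S n = (\<lambda>x. \<Sum>i<n. c i * e i x)" for n
  have basis_L2: "e i \<in> L2 M" for i by (rule orthonormal_basisD(1)[OF e])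
  have SL: "S n \<in> L2 M" for n unfolding S_def by (intro L2_sum L2_cmult basis_L2)
  have sm: "summable (\<lambda>i. (cmod (c i))\<^sup>2)"
    by (rule summableI_nonneg_bounded) (use bessel_inequality[OF e f] in \<open>auto simp: c_def\<close>)
  have diff: "(l2_norm M (\<lambda>x. S m x - S n x))\<^sup>2 = (\<Sum>i\<in>{n..<m}. (cmod (c i))\<^sup>2)" if "n \<le> m" for m n
  proof -
    have "S m x - S n x = (\<Sum>i\<in>{n..<m}. c i * e i x)" for x
      unfolding S_def lessThan_atLeast0 using that by (simp add: sum_diff_nat_ivl)
    then show ?thesis using l2_norm_sum_orthonormal[OF e, of "{n..<m}" c] by simp
  qed
  have cauchy: "\<exists>N. \<forall>i\<ge>N. \<forall>j\<ge>N. l2_norm M (\<lambda>x. S i x - S j x) < \<epsilon>" if "\<epsilon> > 0" for \<epsilon>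
  proof -
    have "\<epsilon>\<^sup>2 > 0" using that by simp
    from sm[unfolded summable_Cauchy, rule_format, OF this] obtain N
      where N: "\<And>m n. m \<ge> N \<Longrightarrow> norm (\<Sum>i\<in>{m..<n}. (cmod (c i))\<^sup>2) < \<epsilon>\<^sup>2" by blast
    have *: "l2_norm M (\<lambda>x. S i x - S j x) < \<epsilon>" if "j \<ge> N" "j \<le> i" for i j
    proof (rule power2_less_imp_less)
      show "(l2_norm M (\<lambda>x. S i x - S j x))\<^sup>2 < \<epsilon>\<^sup>2"
        using N[OF that(1), of i] diff[OF that(2)] by (simp add: abs_less_iff)
    qed (use \<open>\<epsilon> > 0\<close> in simp)
    show ?thesis
    proof (intro exI[of _ N] allI impI)
      fix i j assume "N \<le> i" "N \<le> j"
      then show "l2_norm M (\<lambda>x. S i x - S j x) < \<epsilon>"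
        using *[of i j] *[of j i] l2_norm_minus[of M "S i" "S j"] by (cases "i \<le> j") auto
    qed
  qed
  obtain g where g: "g \<in> L2 M" "(\<lambda>n. l2_norm M (\<lambda>x. S n x - g x)) \<longlonglongrightarrow> 0"
    using riesz_fischer[OF SL cauchy] by blast
  have "l2_inner M (e i) (\<lambda>x. f x - g x) = 0" for i
  proof -
    have "(\<lambda>n. l2_inner M (e i) (\<lambda>x. S n x - g x)) \<longlonglongrightarrow> 0"
    proof (rule Lim_null_comparison[OF always_eventually])
      show "\<forall>n. norm (l2_inner M (e i) (\<lambda>x. S n x - g x)) \<le> l2_norm M (e i) * l2_norm M (\<lambda>x. S n x - g x)"
        by (intro allI l2_inner_le basis_L2 L2_diff SL g)
      show "(\<lambda>n. l2_norm M (e i) * l2_norm M (\<lambda>x. S n x - g x)) \<longlonglongrightarrow> 0"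
        using tendsto_mult_right_zero[OF g(2)] .
    qed
    moreover have "\<forall>\<^sub>F n in sequentially. l2_inner M (e i) (\<lambda>x. S n x - g x) = c i - l2_inner M (e i) g"
      using eventually_gt_at_top[of i]
    proof eventually_elim
      case (elim n)
      have "l2_inner M (e i) (S n) = c i"
        unfolding S_def using elim
        by (simp add: l2_inner_sum_right basis_L2 orthonormal_basisD(2)[OF e] if_distrib sum.delta cong: if_cong)
      then show ?case by (simp add: l2_inner_diff_right basis_L2 SL g)
    qed
    ultimately have "(\<lambda>n::nat. c i - l2_inner M (e i) g) \<longlonglongrightarrow> 0"
      by (rule Lim_transform_eventually)
    then have "c i - l2_inner M (e i) g = 0" by (simp add: LIMSEQ_const_iff)
    then show ?thesis by (simp add: l2_inner_diff_right basis_L2 f g c_def)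
  qed
  then have "AE x in M. f x - g x = 0"
    by (intro orthonormal_basisD(3)[OF e] L2_diff f g)
  then have "l2_norm M (\<lambda>x. S n x - g x) = l2_norm M (\<lambda>x. S n x - f x)" for n
    unfolding l2_norm_def using L2_measurable[OF SL[of n]] L2_measurable[OF f] L2_measurable[OF g(1)]
    by (intro arg_cong[where f=sqrt] integral_cong_AE) (auto elim: eventually_mono)
  then show ?thesis using g(2) unfolding S_def c_def by simp
qed

theorem parseval:
  assumes e: "orthonormal_basis M e" and f: "f \<in> L2 M" and g: "g \<in> L2 M"
  shows "(\<lambda>i. l2_inner M f (e i) * l2_inner M (e i) g) sums l2_inner M f g"
proof -
  define S where "S n = (\<lambda>x. \<Sum>i<n. l2_inner M (e i) g * e i x)" for n
  have basis_L2: "e i \<in> L2 M" for i by (rule orthonormal_basisD(1)[OF e])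
  have SL: "S n \<in> L2 M" for n unfolding S_def by (intro L2_sum L2_cmult basis_L2)
  have "(\<lambda>n. l2_inner M f (\<lambda>x. S n x - g x)) \<longlonglongrightarrow> 0"
  proof (rule Lim_null_comparison[OF always_eventually])
    show "\<forall>n. norm (l2_inner M f (\<lambda>x. S n x - g x)) \<le> l2_norm M f * l2_norm M (\<lambda>x. S n x - g x)"
      by (intro allI l2_inner_le f L2_diff SL g)
    show "(\<lambda>n. l2_norm M f * l2_norm M (\<lambda>x. S n x - g x)) \<longlonglongrightarrow> 0"
      unfolding S_def using tendsto_mult_right_zero[OF orthonormal_expansion[OF e g]] .
  qed
  then have "(\<lambda>n. l2_inner M f (S n) - l2_inner M f g) \<longlonglongrightarrow> 0"
    by (simp add: l2_inner_diff_right f SL g)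
  then have "(\<lambda>n. l2_inner M f (S n)) \<longlonglongrightarrow> l2_inner M f g" by (rule LIM_zero_cancel)
  moreover have "l2_inner M f (S n) = (\<Sum>i<n. l2_inner M f (e i) * l2_inner M (e i) g)" for n
    unfolding S_def by (subst l2_inner_sum_right[OF f basis_L2]) (simp add: mult.commute)
  ultimately show ?thesis unfolding sums_def by simp
qed

end

section \<open>Integral operators with bounded kernels\<close>

definition kop :: "'a measure \<Rightarrow> ('a \<Rightarrow> 'a \<Rightarrow> complex) \<Rightarrow> 'a l2_op" where
  "kop M a f = (\<lambda>x. LINT y|M. a x y * f y)"

definition kcomp :: "'a measure \<Rightarrow> ('a \<Rightarrow> 'a \<Rightarrow> complex) \<Rightarrow> ('a \<Rightarrow> 'a \<Rightarrow> complex) \<Rightarrow> 'a \<Rightarrow> 'a \<Rightarrow> complex" where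
  "kcomp M a b = (\<lambda>x y. LINT z|M. a x z * b z y)"

text \<open>Boundedness at every point of the space, rather than almost everywhere, puts every row
  and column in L2 and lets identities between composed kernels hold pointwise.\<close>

definition bker :: "'a measure \<Rightarrow> ('a \<Rightarrow> 'a \<Rightarrow> complex) \<Rightarrow> bool" where
  "bker M a \<longleftrightarrow> (\<lambda>(x,y). a x y) \<in> borel_measurable (M \<Otimes>\<^sub>M M) \<and>
     (\<exists>C. \<forall>x\<in>space M. \<forall>y\<in>space M. cmod (a x y) \<le> C)"

definition kmat :: "'a measure \<Rightarrow> (nat \<Rightarrow> 'a \<Rightarrow> complex) \<Rightarrow> ('a \<Rightarrow> 'a \<Rightarrow> complex) \<Rightarrow> nat \<Rightarrow> nat \<Rightarrow> complex" where
  "kmat M e a i j = l2_inner M (e i) (kop M a (e j))"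

text \<open>The trace of the product of the operators with kernels \<open>a\<close> and
  \<open>b\<close>. As a double integral it is insensitive to null sets of the product space, unlike
  an integral over the diagonal of a single kernel.\<close>

definition ktr :: "'a measure \<Rightarrow> ('a \<Rightarrow> 'a \<Rightarrow> complex) \<Rightarrow> ('a \<Rightarrow> 'a \<Rightarrow> complex) \<Rightarrow> complex" where
  "ktr M a b = (LINT y|M. LINT x|M. a x y * b y x)"

lemma bkerI:
  assumes "(\<lambda>(x,y). a x y) \<in> borel_measurable (M \<Otimes>\<^sub>M M)"
    "\<And>x y. x \<in> space M \<Longrightarrow> y \<in> space M \<Longrightarrow> cmod (a x y) \<le> C"
  shows "bker M a"
  using assms unfolding bker_def by blast

lemma bkerE:
  assumes "bker M a"
  obtains C where "C \<ge> 0" "\<And>x y. x \<in> space M \<Longrightarrow> y \<in> space M \<Longrightarrow> cmod (a x y) \<le> C"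
proof -
  obtain C where C: "\<forall>x\<in>space M. \<forall>y\<in>space M. cmod (a x y) \<le> C" using assms unfolding bker_def by blast
  show ?thesis by (rule that[of "max C 0"]) (use C in \<open>auto simp: le_max_iff_disj\<close>)
qed

lemma bker_measurable: "bker M a \<Longrightarrow> (\<lambda>(x,y). a x y) \<in> borel_measurable (M \<Otimes>\<^sub>M M)"
  unfolding bker_def by blast

lemma bker_row_measurable:
  assumes "bker M a" "x \<in> space M"
  shows "(\<lambda>y. a x y) \<in> borel_measurable M" "(\<lambda>y. a y x) \<in> borel_measurable M"
proof -
  show "(\<lambda>y. a x y) \<in> borel_measurable M"
    using measurable_Pair2[OF bker_measurable[OF assms(1)] assms(2)] by simp
  show "(\<lambda>y. a y x) \<in> borel_measurable M"
    using measurable_Pair1[OF bker_measurable[OF assms(1)] assms(2)] by simp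
qed

lemma bker_transpose:
  assumes "bker M a" shows "bker M (\<lambda>x y. a y x)"
proof -
  obtain C where "\<And>x y. x \<in> space M \<Longrightarrow> y \<in> space M \<Longrightarrow> cmod (a x y) \<le> C" using assms by (rule bkerE) blast
  then show ?thesis
    using measurable_pair_swap[OF bker_measurable[OF assms]] by (intro bkerI) auto
qed

lemma bker_add:
  assumes a: "bker M a" and b: "bker M b" shows "bker M (\<lambda>x y. a x y + b x y)"
proof -
  obtain C where C: "\<And>x y. x \<in> space M \<Longrightarrow> y \<in> space M \<Longrightarrow> cmod (a x y) \<le> C" using a by (rule bkerE) blast
  obtain D where D: "\<And>x y. x \<in> space M \<Longrightarrow> y \<in> space M \<Longrightarrow> cmod (b x y) \<le> D" using b by (rule bkerE) blast
  show ?thesis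
  proof (rule bkerI)
    show "(\<lambda>(x,y). a x y + b x y) \<in> borel_measurable (M \<Otimes>\<^sub>M M)"
      using borel_measurable_add[OF bker_measurable[OF a] bker_measurable[OF b]] by (simp add: case_prod_beta')
    show "cmod (a x y + b x y) \<le> C + D" if "x \<in> space M" "y \<in> space M" for x y
      by (rule norm_triangle_le) (use C[OF that] D[OF that] in linarith)
  qed
qed

lemma bker_mult:
  assumes a: "bker M a" and b: "bker M b" shows "bker M (\<lambda>x y. a x y * b x y)"
proof -
  obtain C where C: "C \<ge> 0" "\<And>x y. x \<in> space M \<Longrightarrow> y \<in> space M \<Longrightarrow> cmod (a x y) \<le> C" using a by (rule bkerE) blast
  obtain D where D: "\<And>x y. x \<in> space M \<Longrightarrow> y \<in> space M \<Longrightarrow> cmod (b x y) \<le> D" using b by (rule bkerE) blast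
  show ?thesis
  proof (rule bkerI)
    show "(\<lambda>(x,y). a x y * b x y) \<in> borel_measurable (M \<Otimes>\<^sub>M M)"
      using borel_measurable_times[OF bker_measurable[OF a] bker_measurable[OF b]] by (simp add: case_prod_beta')
    show "cmod (a x y * b x y) \<le> C * D" if "x \<in> space M" "y \<in> space M" for x y
      unfolding norm_mult by (intro mult_mono C D that) (use C in auto)
  qed
qed

lemma bker_const: "bker M (\<lambda>x y. c)"
  by (rule bkerI[where C="cmod c"]) auto

lemma bker_cmult: "bker M a \<Longrightarrow> bker M (\<lambda>x y. c * a x y)"
  by (intro bker_mult bker_const)

lemma bker_minus: "bker M a \<Longrightarrow> bker M (\<lambda>x y. - a x y)"
  using bker_cmult[of M a "-1"] by simp

lemma bker_diff: "bker M a \<Longrightarrow> bker M b \<Longrightarrow> bker M (\<lambda>x y. a x y - b x y)"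
  using bker_add[OF _ bker_minus, of M a b] by simp

lemma bker_sum: "(\<And>i. i \<in> I \<Longrightarrow> bker M (a i)) \<Longrightarrow> bker M (\<lambda>x y. \<Sum>i\<in>I. a i x y)"
  by (induction I rule: infinite_finite_induct) (auto intro: bker_const bker_add)

lemma bker_rank1:
  assumes u: "u \<in> borel_measurable M" "\<And>x. x \<in> space M \<Longrightarrow> cmod (u x) \<le> C"
    and w: "w \<in> borel_measurable M" "\<And>x. x \<in> space M \<Longrightarrow> cmod (w x) \<le> D"
  shows "bker M (\<lambda>x y. u x * w y)"
proof (rule bker_mult)
  show "bker M (\<lambda>x y. u x)"
    by (rule bkerI[where C=C]) (use measurable_compose[OF measurable_fst u(1)] u(2) in \<open>auto simp: case_prod_beta'\<close>)
  show "bker M (\<lambda>x y. w y)"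
    by (rule bkerI[where C=D]) (use measurable_compose[OF measurable_snd w(1)] w(2) in \<open>auto simp: case_prod_beta'\<close>)
qed

lemma kmat_cong:
  assumes "\<And>x y. x \<in> space M \<Longrightarrow> y \<in> space M \<Longrightarrow> a x y = b x y"
  shows "kmat M e a = kmat M e b"
  unfolding kmat_def kop_def l2_inner_def
  by (intro ext Bochner_Integration.integral_cong refl) (auto intro!: Bochner_Integration.integral_cong assms)

context finite_measure
begin

lemma bker_row_L2:
  assumes "bker M a" "x \<in> space M"
  shows "(\<lambda>y. a x y) \<in> L2 M" "(\<lambda>y. a y x) \<in> L2 M"
proof -
  obtain C where C: "\<And>x y. x \<in> space M \<Longrightarrow> y \<in> space M \<Longrightarrow> cmod (a x y) \<le> C" using assms(1) by (rule bkerE) blast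
  show "(\<lambda>y. a x y) \<in> L2 M" "(\<lambda>y. a y x) \<in> L2 M"
    using C bker_row_measurable[OF assms] assms(2) by (auto intro!: L2_bounded)
qed

lemma kop_integrable: "bker M a \<Longrightarrow> f \<in> L2 M \<Longrightarrow> x \<in> space M \<Longrightarrow> integrable M (\<lambda>y. a x y * f y)"
  by (rule L2_integrable_mult[OF bker_row_L2(1)])

lemma kop_measurable:
  assumes a: "bker M a" and f: "f \<in> borel_measurable M"
  shows "kop M a f \<in> borel_measurable M"
proof -
  have "(\<lambda>(x,y). a x y * f y) \<in> borel_measurable (M \<Otimes>\<^sub>M M)"
    using borel_measurable_times[OF bker_measurable[OF a] measurable_compose[OF measurable_snd f]]
    by (simp add: case_prod_beta')
  then show ?thesis unfolding kop_def by (rule borel_measurable_lebesgue_integral)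
qed

lemma kop_bound:
  assumes a: "bker M a" and f: "f \<in> L2 M"
    and C: "\<And>x y. x \<in> space M \<Longrightarrow> y \<in> space M \<Longrightarrow> cmod (a x y) \<le> C" "0 \<le> C" and x: "x \<in> space M"
  shows "cmod (kop M a f x) \<le> C * (LINT y|M. cmod (f y))"
proof -
  have "cmod (kop M a f x) \<le> (LINT y|M. cmod (a x y * f y))"
    unfolding kop_def by (rule integral_norm_bound)
  also have "\<dots> \<le> (LINT y|M. C * cmod (f y))"
  proof (rule integral_mono)
    show "integrable M (\<lambda>y. cmod (a x y * f y))" by (intro integrable_norm kop_integrable a f x)
    show "integrable M (\<lambda>y. C * cmod (f y))" by (intro integrable_mult_right integrable_norm L2_integrable f)
    show "cmod (a x y * f y) \<le> C * cmod (f y)" if "y \<in> space M" for y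
      unfolding norm_mult by (intro mult_right_mono C x that) simp
  qed
  finally show ?thesis by simp
qed

lemma kop_L2:
  assumes a: "bker M a" and f: "f \<in> L2 M"
  shows "kop M a f \<in> L2 M"
proof -
  obtain C where C: "C \<ge> 0" "\<And>x y. x \<in> space M \<Longrightarrow> y \<in> space M \<Longrightarrow> cmod (a x y) \<le> C" using a by (rule bkerE) blast
  show ?thesis
    by (rule L2_bounded[OF kop_measurable[OF a L2_measurable[OF f]] kop_bound[OF a f C(2,1)]])
qed

lemma kop_l2_norm_le:
  assumes a: "bker M a"
  obtains C where "C \<ge> 0" "\<And>f. f \<in> L2 M \<Longrightarrow> l2_norm M (kop M a f) \<le> C * l2_norm M f"
proof -
  obtain C where C: "C \<ge> 0" "\<And>x y. x \<in> space M \<Longrightarrow> y \<in> space M \<Longrightarrow> cmod (a x y) \<le> C" using a by (rule bkerE) blast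
  define m where "m = sqrt (measure M (space M))"
  have m: "m \<ge> 0" unfolding m_def by simp
  show ?thesis
  proof (rule that[of "C * m * m"])
    fix f assume f: "f \<in> L2 M"
    have "l2_norm M (kop M a f) \<le> C * (LINT y|M. cmod (f y)) * m"
      unfolding m_def
      by (intro l2_norm_bounded kop_measurable a L2_measurable[OF f] kop_bound[OF a f C(2,1)]) (use C in auto)
    also have "\<dots> \<le> C * (m * l2_norm M f) * m"
      using C m integral_norm_le_l2_norm[OF f] unfolding m_def[symmetric]
      by (intro mult_right_mono mult_left_mono) auto
    finally show "l2_norm M (kop M a f) \<le> C * m * m * l2_norm M f" by (simp add: mult_ac)
  qed (use C m in auto)
qed

text \<open>Moves a kernel from one factor of a pairing to the other; composition of operators and
  the entries of product matrices both reduce to it.\<close>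

lemma kernel_fubini:
  assumes a: "bker M a" and f: "f \<in> L2 M" and g: "g \<in> L2 M"
  shows "(LINT x|M. f x * kop M a g x) = (LINT y|M. (LINT x|M. f x * a x y) * g y)"
proof -
  interpret P: pair_sigma_finite M M by unfold_locales
  obtain C where C: "C \<ge> 0" "\<And>x y. x \<in> space M \<Longrightarrow> y \<in> space M \<Longrightarrow> cmod (a x y) \<le> C" using a by (rule bkerE) blast
  have fm: "f \<in> borel_measurable M" and gm: "g \<in> borel_measurable M" using f g by (auto intro: L2_measurable)
  have m: "(\<lambda>p. f (fst p) * a (fst p) (snd p) * g (snd p)) \<in> borel_measurable (M \<Otimes>\<^sub>M M)"
    using bker_measurable[OF a] measurable_compose[OF measurable_fst fm] measurable_compose[OF measurable_snd gm]
    by (intro borel_measurable_times) (auto simp: case_prod_beta')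
  have m2: "(\<lambda>p. C * (cmod (f (fst p)) * cmod (g (snd p)))) \<in> borel_measurable (M \<Otimes>\<^sub>M M)"
    using fm gm by measurable
  have "integrable (M \<Otimes>\<^sub>M M) (\<lambda>p. C * (cmod (f (fst p)) * cmod (g (snd p))))"
  proof (rule P.Fubini_integrable[OF m2])
    show "integrable M (\<lambda>x. LINT y|M. norm (C * (cmod (f (fst (x, y))) * cmod (g (snd (x, y))))))"
      using C(1) L2_integrable[OF f] by (simp add: abs_mult)
    show "AE x in M. integrable M (\<lambda>y. C * (cmod (f (fst (x, y))) * cmod (g (snd (x, y)))))"
      using L2_integrable[OF g] by simp
  qed
  then have "integrable (M \<Otimes>\<^sub>M M) (\<lambda>p. f (fst p) * a (fst p) (snd p) * g (snd p))"
  proof (rule Bochner_Integration.integrable_bound[OF _ m])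
    show "AE p in M \<Otimes>\<^sub>M M. norm (f (fst p) * a (fst p) (snd p) * g (snd p)) \<le> norm (C * (cmod (f (fst p)) * cmod (g (snd p))))"
    proof (rule AE_I2)
      fix p assume "p \<in> space (M \<Otimes>\<^sub>M M)"
      then have p: "fst p \<in> space M" "snd p \<in> space M" by (auto simp: space_pair_measure)
      have "cmod (f (fst p)) * cmod (a (fst p) (snd p)) * cmod (g (snd p)) \<le> cmod (f (fst p)) * C * cmod (g (snd p))"
        by (intro mult_right_mono mult_left_mono C p) auto
      then show "norm (f (fst p) * a (fst p) (snd p) * g (snd p)) \<le> norm (C * (cmod (f (fst p)) * cmod (g (snd p))))"
        using C(1) by (simp add: norm_mult abs_mult mult_ac)
    qed
  qed
  then have int: "integrable (M \<Otimes>\<^sub>M M) (\<lambda>(x,y). f x * a x y * g y)" by (simp add: case_prod_beta')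
  have "(LINT x|M. f x * kop M a g x) = (LINT x|M. LINT y|M. f x * a x y * g y)"
    unfolding kop_def by (simp add: mult.assoc)
  also have "\<dots> = (LINT y|M. LINT x|M. f x * a x y * g y)" using P.Fubini_integral[OF int] by simp
  finally show ?thesis by simp
qed

lemma bker_kcomp:
  assumes a: "bker M a" and b: "bker M b"
  shows "bker M (kcomp M a b)"
proof -
  obtain C where C: "C \<ge> 0" "\<And>x y. x \<in> space M \<Longrightarrow> y \<in> space M \<Longrightarrow> cmod (a x y) \<le> C" using a by (rule bkerE) blast
  obtain D where D: "D \<ge> 0" "\<And>x y. x \<in> space M \<Longrightarrow> y \<in> space M \<Longrightarrow> cmod (b x y) \<le> D" using b by (rule bkerE) blast
  show ?thesis
  proof (rule bkerI)
    have "(\<lambda>q. a (fst (fst q)) (snd q)) \<in> borel_measurable ((M \<Otimes>\<^sub>M M) \<Otimes>\<^sub>M M)"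
      using measurable_compose[OF _ bker_measurable[OF a], of "\<lambda>q. (fst (fst q), snd q)" "(M \<Otimes>\<^sub>M M) \<Otimes>\<^sub>M M"] by simp
    moreover have "(\<lambda>q. b (snd q) (snd (fst q))) \<in> borel_measurable ((M \<Otimes>\<^sub>M M) \<Otimes>\<^sub>M M)"
      using measurable_compose[OF _ bker_measurable[OF b], of "\<lambda>q. (snd q, snd (fst q))" "(M \<Otimes>\<^sub>M M) \<Otimes>\<^sub>M M"] by simp
    ultimately have "(\<lambda>q. a (fst (fst q)) (snd q) * b (snd q) (snd (fst q))) \<in> borel_measurable ((M \<Otimes>\<^sub>M M) \<Otimes>\<^sub>M M)"
      by (rule borel_measurable_times)
    then have "(\<lambda>(p,z). a (fst p) z * b z (snd p)) \<in> borel_measurable ((M \<Otimes>\<^sub>M M) \<Otimes>\<^sub>M M)"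
      by (simp add: case_prod_beta')
    then have "(\<lambda>p. LINT z|M. a (fst p) z * b z (snd p)) \<in> borel_measurable (M \<Otimes>\<^sub>M M)"
      by (rule borel_measurable_lebesgue_integral)
    then show "(\<lambda>(x,y). kcomp M a b x y) \<in> borel_measurable (M \<Otimes>\<^sub>M M)"
      unfolding kcomp_def by (simp add: case_prod_beta')
    fix x y assume xy: "x \<in> space M" "y \<in> space M"
    have "cmod (kop M a (\<lambda>z. b z y) x) \<le> C * (LINT z|M. cmod (b z y))"
      by (rule kop_bound[OF a bker_row_L2(2)[OF b xy(2)] C(2,1) xy(1)])
    also have "\<dots> \<le> C * (LINT z|M. D)"
      by (intro mult_left_mono integral_mono integrable_norm L2_integrable bker_row_L2(2)[OF b xy(2)]) (use D C xy in auto)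
    finally show "cmod (kcomp M a b x y) \<le> C * (D * measure M (space M))"
      unfolding kcomp_def kop_def by (simp add: mult.commute)
  qed
qed

lemma kop_kcomp:
  assumes a: "bker M a" and b: "bker M b" and f: "f \<in> L2 M" and x: "x \<in> space M"
  shows "kop M (kcomp M a b) f x = kop M a (kop M b f) x"
  using kernel_fubini[OF b bker_row_L2(1)[OF a x] f] unfolding kop_def kcomp_def by simp

lemma kop_add:
  assumes a: "bker M a" and b: "bker M b" and f: "f \<in> L2 M" and x: "x \<in> space M"
  shows "kop M (\<lambda>x y. a x y + b x y) f x = kop M a f x + kop M b f x"
  unfolding kop_def distrib_right
  by (rule Bochner_Integration.integral_add[OF kop_integrable[OF a f x] kop_integrable[OF b f x]])

lemma kop_cmult: "kop M (\<lambda>x y. c * a x y) f x = c * kop M a f x"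
  unfolding kop_def by (simp add: mult.assoc)

lemma kop_linear:
  assumes a: "bker M a" and f: "f \<in> L2 M" and g: "g \<in> L2 M" and x: "x \<in> space M"
  shows "kop M a (\<lambda>y. c * f y + d * g y) x = c * kop M a f x + d * kop M a g x"
proof -
  have "kop M a (\<lambda>y. c * f y + d * g y) x = (LINT y|M. c * (a x y * f y) + d * (a x y * g y))"
    unfolding kop_def by (simp add: algebra_simps)
  also have "\<dots> = (LINT y|M. c * (a x y * f y)) + (LINT y|M. d * (a x y * g y))"
    by (intro Bochner_Integration.integral_add integrable_mult_right kop_integrable a f g x)
  finally show ?thesis unfolding kop_def by simp
qed

lemma kop_cong_AE:
  assumes f: "f \<in> L2 M" and g: "g \<in> L2 M" and fg: "AE y in M. f y = g y" and a: "bker M a" and x: "x \<in> space M"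
  shows "kop M a f x = kop M a g x"
  unfolding kop_def using bker_row_measurable(1)[OF a x] L2_measurable[OF f] L2_measurable[OF g] fg
  by (intro integral_cong_AE) (auto elim: eventually_mono)

lemma bounded_operator_kop:
  assumes "bker M a"
  shows "bounded_operator M (kop M a)"
  unfolding bounded_operator_def
proof (intro conjI ballI allI)
  obtain C where C: "\<And>f. f \<in> L2 M \<Longrightarrow> l2_norm M (kop M a f) \<le> C * l2_norm M f"
    using assms by (rule kop_l2_norm_le) blast
  then show "\<exists>C. \<forall>f\<in>L2 M. l2_norm M (kop M a f) \<le> C * l2_norm M f" by blast
qed (use assms in \<open>auto intro!: kop_L2 AE_I2 kop_linear\<close>)

end

text \<open>The basis is arbitrary because \<open>fredholm_det\<close> requires the limit along
  every orthonormal basis.\<close>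

locale l2_basis = finite_measure M for M :: "'a measure" +
  fixes e :: "nat \<Rightarrow> 'a \<Rightarrow> complex"
  assumes onb: "orthonormal_basis M e"
begin

lemma basis_L2: "e i \<in> L2 M"
  by (rule orthonormal_basisD(1)[OF onb])

lemma kop_eq_inner:
  "kop M a f x = l2_inner M (\<lambda>y. cnj (a x y)) f"
  unfolding kop_def l2_inner_def by simp

lemma bessel_rows:
  assumes a: "bker M a" and x: "x \<in> space M"
  shows "(\<Sum>j<n. (cmod (kop M a (e j) x))\<^sup>2) \<le> (LINT y|M. (cmod (a x y))\<^sup>2)"
proof -
  have "(\<Sum>j<n. (cmod (l2_inner M (e j) (\<lambda>y. cnj (a x y))))\<^sup>2) \<le> (l2_norm M (\<lambda>y. cnj (a x y)))\<^sup>2"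
    by (intro bessel_inequality onb L2_cnj bker_row_L2(1)[OF a x])
  moreover have "cmod (l2_inner M (e j) (\<lambda>y. cnj (a x y))) = cmod (kop M a (e j) x)" for j
    unfolding kop_eq_inner l2_inner_commute[of M "e j"] by simp
  ultimately show ?thesis by (simp add: l2_norm_sq)
qed

text \<open>Bessel's inequality for each row, integrated over \<open>x\<close>. The set
  \<open>Q\<close> is there for diagonal blocks: their Hilbert-Schmidt norm then scales with the
  measure of the block.\<close>

lemma sum_l2_norm_kop_le:
  assumes a: "bker M a" and Q: "Q \<in> sets M" and C: "0 \<le> C"
    and bd: "\<And>x y. x \<in> space M \<Longrightarrow> y \<in> space M \<Longrightarrow> cmod (a x y) \<le> (if x \<in> Q \<and> y \<in> Q then C else 0)"
  shows "(\<Sum>j<n. (l2_norm M (kop M a (e j)))\<^sup>2) \<le> (C * measure M Q)\<^sup>2"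
proof -
  have "(\<Sum>j<n. (l2_norm M (kop M a (e j)))\<^sup>2) = (LINT x|M. (\<Sum>j<n. (cmod (kop M a (e j) x))\<^sup>2))"
    unfolding l2_norm_sq
    by (rule Bochner_Integration.integral_sum[symmetric]) (intro L2_integrable_sq kop_L2 a basis_L2)
  also have "\<dots> \<le> (LINT x|M. indicator Q x * (C\<^sup>2 * measure M Q))"
  proof (rule integral_mono)
    show "integrable M (\<lambda>x. \<Sum>j<n. (cmod (kop M a (e j) x))\<^sup>2)"
      by (intro Bochner_Integration.integrable_sum L2_integrable_sq kop_L2 a basis_L2)
    show "integrable M (\<lambda>x. indicator Q x * (C\<^sup>2 * measure M Q))"
      using Q by (intro integrable_mult_left) (auto simp: integrable_indicator_iff emeasure_finite less_top[symmetric])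
    fix x assume x: "x \<in> space M"
    have "(LINT y|M. (cmod (a x y))\<^sup>2) \<le> (LINT y|M. indicator Q x * (C\<^sup>2 * indicator Q y))"
    proof (rule integral_mono)
      show "integrable M (\<lambda>y. (cmod (a x y))\<^sup>2)" by (intro L2_integrable_sq bker_row_L2(1)[OF a x])
      show "integrable M (\<lambda>y. indicator Q x * (C\<^sup>2 * indicator Q y))"
        using Q by (intro integrable_mult_right) (auto simp: integrable_indicator_iff emeasure_finite less_top[symmetric])
      show "(cmod (a x y))\<^sup>2 \<le> indicator Q x * (C\<^sup>2 * indicator Q y)" if "y \<in> space M" for y
        using power_mono[OF bd[OF x that] norm_ge_zero, of 2] by (auto simp: indicator_def split: if_splits)
    qed
    also have "\<dots> = indicator Q x * (C\<^sup>2 * measure M Q)"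
      using Q by (simp add: sets.Int_space_eq2 Int_absorb1 sets.sets_into_space)
    finally show "(\<Sum>j<n. (cmod (kop M a (e j) x))\<^sup>2) \<le> indicator Q x * (C\<^sup>2 * measure M Q)"
      using bessel_rows[OF a x, of n] by linarith
  qed
  also have "\<dots> = (C * measure M Q)\<^sup>2"
    using Q by (simp add: sets.sets_into_space Int_absorb1 Int_absorb2 power2_eq_square mult_ac)
  finally show ?thesis .
qed

lemma frob_kmat_le:
  assumes a: "bker M a" and Q: "Q \<in> sets M" and C: "0 \<le> C"
    and bd: "\<And>x y. x \<in> space M \<Longrightarrow> y \<in> space M \<Longrightarrow> cmod (a x y) \<le> (if x \<in> Q \<and> y \<in> Q then C else 0)"
  shows "frob n (kmat M e a) \<le> C * measure M Q"
proof (rule power2_le_imp_le)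
  have "(frob n (kmat M e a))\<^sup>2 = (\<Sum>j<n. \<Sum>i<n. (cmod (kmat M e a i j))\<^sup>2)"
    unfolding frob_sq by (rule sum.swap)
  also have "\<dots> \<le> (\<Sum>j<n. (l2_norm M (kop M a (e j)))\<^sup>2)"
    unfolding kmat_def by (intro sum_mono bessel_inequality onb kop_L2 a basis_L2)
  also have "\<dots> \<le> (C * measure M Q)\<^sup>2" by (rule sum_l2_norm_kop_le[OF assms])
  finally show "(frob n (kmat M e a))\<^sup>2 \<le> (C * measure M Q)\<^sup>2" .
qed (use C in simp)

lemma frob_kmat_le_sup:
  assumes a: "bker M a" and C: "0 \<le> C" "\<And>x y. x \<in> space M \<Longrightarrow> y \<in> space M \<Longrightarrow> cmod (a x y) \<le> C"
  shows "frob n (kmat M e a) \<le> C * measure M (space M)"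
  by (rule frob_kmat_le[OF a sets.top C(1)]) (use C in auto)

lemma hs_mat_kmat:
  assumes a: "bker M a"
  shows "hs_mat (kmat M e a)"
proof -
  obtain C where C: "C \<ge> 0" "\<And>x y. x \<in> space M \<Longrightarrow> y \<in> space M \<Longrightarrow> cmod (a x y) \<le> C" using a by (rule bkerE) blast
  show ?thesis unfolding hs_mat_def using frob_kmat_le_sup[OF a C] by blast
qed

lemma hilbert_schmidt_kop:
  assumes a: "bker M a"
  shows "hilbert_schmidt M (kop M a)"
  unfolding hilbert_schmidt_def
proof (intro conjI exI[of _ e] bounded_operator_kop a onb)
  obtain C where C: "C \<ge> 0" "\<And>x y. x \<in> space M \<Longrightarrow> y \<in> space M \<Longrightarrow> cmod (a x y) \<le> C" using a by (rule bkerE) blast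
  show "summable (\<lambda>n. (l2_norm M (kop M a (e n)))\<^sup>2)"
  proof (rule summableI_nonneg_bounded)
    show "(\<Sum>j<n. (l2_norm M (kop M a (e j)))\<^sup>2) \<le> (C * measure M (space M))\<^sup>2" for n
      by (rule sum_l2_norm_kop_le[OF a sets.top C(1)]) (use C in auto)
  qed simp
qed

lemma kmat_add:
  assumes "bker M a" "bker M b"
  shows "kmat M e (\<lambda>x y. a x y + b x y) = (\<lambda>i j. kmat M e a i j + kmat M e b i j)"
proof (intro ext)
  fix i j
  have "kmat M e (\<lambda>x y. a x y + b x y) i j = l2_inner M (e i) (\<lambda>x. kop M a (e j) x + kop M b (e j) x)"
    unfolding kmat_def l2_inner_def
    by (intro Bochner_Integration.integral_cong refl) (simp add: kop_add assms basis_L2)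
  then show "kmat M e (\<lambda>x y. a x y + b x y) i j = kmat M e a i j + kmat M e b i j"
    unfolding kmat_def using assms by (simp add: l2_inner_add_right basis_L2 kop_L2)
qed

lemma kmat_cmult: "kmat M e (\<lambda>x y. c * a x y) = (\<lambda>i j. c * kmat M e a i j)"
proof (intro ext)
  fix i j
  have "kop M (\<lambda>x y. c * a x y) (e j) = (\<lambda>x. c * kop M a (e j) x)" by (intro ext kop_cmult)
  then show "kmat M e (\<lambda>x y. c * a x y) i j = c * kmat M e a i j"
    unfolding kmat_def by (simp add: l2_inner_cmult_right)
qed

text \<open>The complex conjugate of the adjoint operator applied to \<open>e i\<close>.\<close>

definition kadj :: "('a \<Rightarrow> 'a \<Rightarrow> complex) \<Rightarrow> nat \<Rightarrow> 'a \<Rightarrow> complex" where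
  "kadj a i y = (LINT x|M. cnj (e i x) * a x y)"

lemma kadj_L2:
  assumes "bker M a"
  shows "kadj a i \<in> L2 M"
proof -
  have "kadj a i = kop M (\<lambda>x y. a y x) (\<lambda>x. cnj (e i x))"
    unfolding kadj_def kop_def by (simp add: mult.commute)
  then show ?thesis using kop_L2[OF bker_transpose[OF assms] L2_cnj[OF basis_L2]] by simp
qed

lemma l2_inner_kop:
  assumes "bker M a" "f \<in> L2 M"
  shows "l2_inner M (e i) (kop M a f) = (LINT y|M. kadj a i y * f y)"
  unfolding l2_inner_def kadj_def by (rule kernel_fubini[OF assms(1) L2_cnj[OF basis_L2] assms(2)])

lemma kmat_kcomp_eq:
  assumes a: "bker M a" and b: "bker M b"
  shows "kmat M e (kcomp M a b) i j = (LINT y|M. kadj a i y * kop M b (e j) y)"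
proof -
  have "kmat M e (kcomp M a b) i j = l2_inner M (e i) (kop M a (kop M b (e j)))"
    unfolding kmat_def l2_inner_def
    by (intro Bochner_Integration.integral_cong refl) (simp add: kop_kcomp a b basis_L2)
  then show ?thesis using l2_inner_kop[OF a kop_L2[OF b basis_L2]] by simp
qed

lemma kmat_kcomp_sums:
  assumes a: "bker M a" and b: "bker M b"
  shows "(\<lambda>k. kmat M e a i k * kmat M e b k j) sums kmat M e (kcomp M a b) i j"
proof -
  have "(\<lambda>k. l2_inner M (\<lambda>y. cnj (kadj a i y)) (e k) * l2_inner M (e k) (kop M b (e j)))
     sums l2_inner M (\<lambda>y. cnj (kadj a i y)) (kop M b (e j))"
    by (intro parseval onb L2_cnj kadj_L2 kop_L2 a b basis_L2)
  moreover have "l2_inner M (\<lambda>y. cnj (kadj a i y)) (e k) = kmat M e a i k" for k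
    unfolding kmat_def l2_inner_kop[OF a basis_L2] by (simp add: l2_inner_def)
  moreover have "l2_inner M (\<lambda>y. cnj (kadj a i y)) (kop M b (e j)) = kmat M e (kcomp M a b) i j"
    unfolding kmat_kcomp_eq[OF a b] by (simp add: l2_inner_def)
  ultimately show ?thesis unfolding kmat_def by simp
qed

text \<open>For fixed \<open>y\<close> Parseval's identity sums the products
  \<open>kadj a i y * kop M b (e i) y\<close> to the inner integral; Bessel's inequality bounds the
  partial sums by a constant, so dominated convergence applies. In particular the trace is the same
  in all bases.\<close>

lemma kmat_trace:
  assumes a: "bker M a" and b: "bker M b"
  shows "(\<lambda>n. \<Sum>i<n. kmat M e (kcomp M a b) i i) \<longlonglongrightarrow> ktr M a b"
proof -
  obtain C where C: "C \<ge> 0" "\<And>x y. x \<in> space M \<Longrightarrow> y \<in> space M \<Longrightarrow> cmod (a x y) \<le> C" using a by (rule bkerE) blast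
  obtain D where D: "D \<ge> 0" "\<And>x y. x \<in> space M \<Longrightarrow> y \<in> space M \<Longrightarrow> cmod (b x y) \<le> D" using b by (rule bkerE) blast
  define m where "m = sqrt (measure M (space M))"
  have int: "integrable M (\<lambda>y. kadj a i y * kop M b (e i) y)" for i
    by (intro L2_integrable_mult kadj_L2 kop_L2 a b basis_L2)
  have sums: "(\<lambda>i. kadj a i y * kop M b (e i) y) sums (LINT x|M. a x y * b y x)" if y: "y \<in> space M" for y
  proof -
    have "(\<lambda>i. l2_inner M (\<lambda>x. cnj (b y x)) (e i) * l2_inner M (e i) (\<lambda>x. a x y)) sums l2_inner M (\<lambda>x. cnj (b y x)) (\<lambda>x. a x y)"
      by (intro parseval onb L2_cnj bker_row_L2[OF a y] bker_row_L2[OF b y])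
    then show ?thesis unfolding kop_eq_inner kadj_def l2_inner_def by (simp add: mult.commute)
  qed
  have bound: "cmod (\<Sum>i<n. kadj a i y * kop M b (e i) y) \<le> (C * m) * (D * m)" if y: "y \<in> space M" for n y
  proof (rule power2_le_imp_le)
    have "(cmod (\<Sum>i<n. kadj a i y * kop M b (e i) y))\<^sup>2 \<le> (\<Sum>i<n. (cmod (kadj a i y))\<^sup>2) * (\<Sum>i<n. (cmod (kop M b (e i) y))\<^sup>2)"
      by (rule norm_sum_mult_sq_le)
    also have "\<dots> \<le> (C * m)\<^sup>2 * (D * m)\<^sup>2"
    proof (rule mult_mono)
      have "(\<Sum>i<n. (cmod (kadj a i y))\<^sup>2) \<le> (l2_norm M (\<lambda>x. a x y))\<^sup>2"
        unfolding kadj_def l2_inner_def[symmetric] by (intro bessel_inequality onb bker_row_L2[OF a y])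
      also have "\<dots> \<le> (C * m)\<^sup>2"
        unfolding m_def by (intro power_mono l2_norm_bounded bker_row_measurable[OF a y] C y l2_norm_nonneg)
      finally show "(\<Sum>i<n. (cmod (kadj a i y))\<^sup>2) \<le> (C * m)\<^sup>2" .
      have "(\<Sum>i<n. (cmod (kop M b (e i) y))\<^sup>2) \<le> (l2_norm M (\<lambda>x. b y x))\<^sup>2"
        unfolding l2_norm_sq by (rule bessel_rows[OF b y])
      also have "\<dots> \<le> (D * m)\<^sup>2"
        unfolding m_def by (intro power_mono l2_norm_bounded bker_row_measurable[OF b y] D y l2_norm_nonneg)
      finally show "(\<Sum>i<n. (cmod (kop M b (e i) y))\<^sup>2) \<le> (D * m)\<^sup>2" .
    qed (auto intro: sum_nonneg)
    finally show "(cmod (\<Sum>i<n. kadj a i y * kop M b (e i) y))\<^sup>2 \<le> ((C * m) * (D * m))\<^sup>2"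
      by (simp only: power_mult_distrib)
    show "0 \<le> (C * m) * (D * m)" using C D unfolding m_def by simp
  qed
  have "(\<lambda>n. LINT y|M. (\<Sum>i<n. kadj a i y * kop M b (e i) y)) \<longlonglongrightarrow> (LINT y|M. LINT x|M. a x y * b y x)"
  proof (rule integral_dominated_convergence[where w="\<lambda>y. (C * m) * (D * m)"])
    show "(\<lambda>y. LINT x|M. a x y * b y x) \<in> borel_measurable M"
    proof (rule borel_measurable_lebesgue_integral)
      show "(\<lambda>(y,x). a x y * b y x) \<in> borel_measurable (M \<Otimes>\<^sub>M M)"
        by (rule bker_measurable[OF bker_mult[OF bker_transpose[OF a] b]])
    qed
    show "(\<lambda>y. \<Sum>i<n. kadj a i y * kop M b (e i) y) \<in> borel_measurable M" for n
      by (intro borel_measurable_sum borel_measurable_integrable int)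
    show "AE y in M. (\<lambda>n. \<Sum>i<n. kadj a i y * kop M b (e i) y) \<longlonglongrightarrow> (LINT x|M. a x y * b y x)"
      by (rule AE_I2) (rule sums[unfolded sums_def])
    show "AE y in M. norm (\<Sum>i<n. kadj a i y * kop M b (e i) y) \<le> (C * m) * (D * m)" for n
      by (rule AE_I2) (rule bound)
  qed simp
  then show ?thesis unfolding ktr_def kmat_kcomp_eq[OF a b]
    by (simp add: Bochner_Integration.integral_sum[OF int])
qed

text \<open>This is det_2 (I + A), so that det_2 (I - K) is \<open>kdet\<close> of the negated
  kernel of K.\<close>

definition kdet :: "('a \<Rightarrow> 'a \<Rightarrow> complex) \<Rightarrow> complex" where
  "kdet a = det2 (kmat M e a)"

lemma kdet_cong: "(\<And>x y. x \<in> space M \<Longrightarrow> y \<in> space M \<Longrightarrow> a x y = b x y) \<Longrightarrow> kdet a = kdet b"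
  unfolding kdet_def by (metis kmat_cong)

lemma kdet_mult:
  assumes a: "bker M a" and b: "bker M b"
  shows "kdet (\<lambda>x y. a x y + b x y + kcomp M a b x y) = kdet a * kdet b * exp (- ktr M a b)"
proof -
  have "kmat M e (\<lambda>x y. a x y + b x y + kcomp M a b x y)
     = (\<lambda>i j. kmat M e a i j + kmat M e b i j + kmat M e (kcomp M a b) i j)"
    by (simp add: kmat_add bker_add bker_kcomp a b)
  then show ?thesis unfolding kdet_def
    using det2_mult[OF hs_mat_kmat[OF a] hs_mat_kmat[OF b] hs_mat_kmat[OF bker_kcomp[OF a b]]
      kmat_kcomp_sums[OF a b] kmat_trace[OF a b]] by simp
qed

lemma kdet_quadratic:
  assumes a: "bker M a" and Q: "Q \<in> sets M" and C: "0 \<le> C"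
    and bd: "\<And>x y. x \<in> space M \<Longrightarrow> y \<in> space M \<Longrightarrow> cmod (a x y) \<le> (if x \<in> Q \<and> y \<in> Q then C else 0)"
  shows "cmod (kdet a - 1) \<le> 2 * (C * measure M Q)\<^sup>2 * exp ((C * measure M Q + 1)\<^sup>2 / 2)"
  unfolding kdet_def by (intro det2_quadratic frob_kmat_le[OF assms])

lemma kdet_quadratic_sup:
  assumes a: "bker M a" and C: "0 \<le> C" "\<And>x y. x \<in> space M \<Longrightarrow> y \<in> space M \<Longrightarrow> cmod (a x y) \<le> C"
  shows "cmod (kdet a - 1) \<le> 2 * (C * measure M (space M))\<^sup>2 * exp ((C * measure M (space M) + 1)\<^sup>2 / 2)"
  by (rule kdet_quadratic[OF a sets.top C(1)]) (use C in auto)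

lemma kdet_lipschitz:
  assumes a: "bker M a" and b: "bker M b"
    and A: "0 \<le> A" "\<And>x y. x \<in> space M \<Longrightarrow> y \<in> space M \<Longrightarrow> cmod (a x y) \<le> A"
    and B: "0 \<le> B" "\<And>x y. x \<in> space M \<Longrightarrow> y \<in> space M \<Longrightarrow> cmod (b x y - a x y) \<le> B"
  shows "cmod (kdet b - kdet a) \<le> B * measure M (space M) *
    exp ((A * measure M (space M) + B * measure M (space M) + 1)\<^sup>2 / 2)"
  unfolding kdet_def
proof (rule det2_lipschitz)
  have "kmat M e (\<lambda>x y. b x y - a x y) = (\<lambda>i j. kmat M e b i j - kmat M e a i j)"
    using kmat_add[OF b bker_cmult[OF a, of "-1"]] unfolding kmat_cmult by simp
  then show "frob n (\<lambda>i j. kmat M e b i j - kmat M e a i j) \<le> B * measure M (space M)" for n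
    using frob_kmat_le_sup[OF bker_diff[OF b a] B] by simp
qed (use frob_kmat_le_sup[OF a A] hs_mat_kmat a b in auto)

text \<open>Parseval's identity turns the pairings of coefficient sequences in
  \<open>det2_finite_rank\<close> into integrals.\<close>

lemma kdet_finite_rank:
  assumes u: "\<And>m. m < N \<Longrightarrow> u m \<in> L2 M" and w: "\<And>m. m < N \<Longrightarrow> w m \<in> L2 M"
    and a: "bker M a" "\<And>x y. x \<in> space M \<Longrightarrow> y \<in> space M \<Longrightarrow> a x y = - (\<Sum>m<N. u m x * w m y)"
  shows "kdet a = Determinant.det (Matrix.mat N N (\<lambda>(m,m'). of_bool (m = m') - (LINT x|M. w m x * u m' x)))
     * exp (\<Sum>m<N. LINT x|M. w m x * u m x)"
  unfolding kdet_def
proof (rule det2_finite_rank[where u="\<lambda>m i. l2_inner M (e i) (u m)" and w="\<lambda>m j. l2_inner M (\<lambda>x. cnj (w m x)) (e j)"])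
  show "hs_mat (kmat M e a)" by (rule hs_mat_kmat[OF a(1)])
  fix i j
  have k: "kop M a (e j) x = (\<Sum>m<N. - l2_inner M (\<lambda>x. cnj (w m x)) (e j) * u m x)" if x: "x \<in> space M" for x
  proof -
    have "kop M a (e j) x = (LINT y|M. (\<Sum>m<N. (- u m x) * (w m y * e j y)))"
      unfolding kop_def
      by (intro Bochner_Integration.integral_cong refl)
         (simp add: a(2)[OF x] sum_distrib_right sum_negf mult.assoc)
    also have "\<dots> = (\<Sum>m<N. LINT y|M. (- u m x) * (w m y * e j y))"
      by (intro Bochner_Integration.integral_sum integrable_mult_right L2_integrable_mult w basis_L2) simp
    finally show ?thesis by (simp add: l2_inner_def mult.commute)
  qed
  have "kmat M e a i j = l2_inner M (e i) (\<lambda>x. \<Sum>m<N. - l2_inner M (\<lambda>x. cnj (w m x)) (e j) * u m x)"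
    unfolding kmat_def l2_inner_def[of M "e i"]
    by (intro Bochner_Integration.integral_cong refl) (simp add: k)
  also have "\<dots> = (\<Sum>m<N. - l2_inner M (\<lambda>x. cnj (w m x)) (e j) * l2_inner M (e i) (u m))"
    by (intro l2_inner_sum_right basis_L2 u) simp
  finally show "kmat M e a i j = - (\<Sum>m<N. l2_inner M (e i) (u m) * l2_inner M (\<lambda>x. cnj (w m x)) (e j))"
    by (simp add: sum_negf mult.commute)
next
  fix m m' assume m: "m < N" "m' < N"
  have "(\<lambda>i. l2_inner M (\<lambda>x. cnj (w m x)) (e i) * l2_inner M (e i) (u m')) sums l2_inner M (\<lambda>x. cnj (w m x)) (u m')"
    by (intro parseval onb L2_cnj w u m)
  then show "(\<lambda>n. \<Sum>i<n. l2_inner M (\<lambda>x. cnj (w m x)) (e i) * l2_inner M (e i) (u m')) \<longlonglongrightarrow> (LINT x|M. w m x * u m' x)"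
    unfolding sums_def l2_inner_def[of M "\<lambda>x. cnj (w m x)" "u m'"] by simp
qed

end

section \<open>Exponentials of integral operators\<close>

text \<open>A product of \<open>N\<close> factors 1 + O(1/N^2) is 1 + O(1/N); if its value does not
  depend on \<open>N\<close>, it is 1. This one limit serves exponentials, kernels of square zero
  and triangular kernels.\<close>

lemma prod_near_one_eq_one:
  fixes x :: complex
  assumes x: "\<And>N. N \<ge> 1 \<Longrightarrow> x = (\<Prod>j<N. d N j)"
    and d: "\<And>N j. N \<ge> 1 \<Longrightarrow> j < N \<Longrightarrow> cmod (d N j - 1) \<le> K / (real N)\<^sup>2"
  shows "x = 1"
proof -
  have "cmod (x - 1) \<le> exp (K * inverse (real N)) - 1" if N: "N \<ge> 1" for N
  proof -
    have K: "0 \<le> K / (real N)\<^sup>2"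
      using d[OF N, of 0] N norm_ge_zero[of "d N 0 - 1"] by linarith
    have "cmod (x - 1) = cmod ((\<Prod>j<N. 1 + (d N j - 1)) - 1)" using x[OF N] by simp
    also have "\<dots> \<le> (\<Prod>j<N. 1 + cmod (d N j - 1)) - 1"
      by (rule norm_prod_minus1_le_prod_minus1)
    also have "\<dots> \<le> (\<Prod>j<N. exp (K / (real N)\<^sup>2)) - 1"
    proof (intro diff_right_mono prod_mono conjI)
      fix j assume "j \<in> {..<N}"
      then have "1 + cmod (d N j - 1) \<le> 1 + K / (real N)\<^sup>2" using d[OF N] by simp
      also have "\<dots> \<le> exp (K / (real N)\<^sup>2)" by (rule exp_ge_add_one_self)
      finally show "1 + cmod (d N j - 1) \<le> exp (K / (real N)\<^sup>2)" .
    qed simp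
    also have "(\<Prod>j<N. exp (K / (real N)\<^sup>2)) = exp (K * inverse (real N))"
    proof -
      have "real N * (K / (real N)\<^sup>2) = K * inverse (real N)"
        using N by (simp add: power2_eq_square divide_simps)
      then show ?thesis using exp_of_nat_mult[of N "K / (real N)\<^sup>2"] by simp
    qed
    finally show ?thesis .
  qed
  note le = this
  have lim: "(\<lambda>N. exp (K * inverse (real N)) - 1) \<longlonglongrightarrow> exp (K * 0) - 1"
    by (intro tendsto_diff tendsto_exp tendsto_mult tendsto_const lim_inverse_n)
  have "cmod (x - 1) \<le> exp (K * 0) - 1"
    by (rule LIMSEQ_le_const[OF lim], rule exI[of _ 1]) (simp add: le)
  then show ?thesis by simp
qed

primrec kpow :: "'a measure \<Rightarrow> ('a \<Rightarrow> 'a \<Rightarrow> complex) \<Rightarrow> nat \<Rightarrow> 'a \<Rightarrow> 'a \<Rightarrow> complex" where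
  "kpow M a 0 = a"
| "kpow M a (Suc n) = kcomp M a (kpow M a n)"

text \<open>The kernel of the \<open>n\<close>-th power is \<open>kpow M a (n - 1)\<close>, so that \<open>kseries\<close> is a power series
  without constant term.\<close>

definition kseries :: "'a measure \<Rightarrow> ('a \<Rightarrow> 'a \<Rightarrow> complex) \<Rightarrow> (nat \<Rightarrow> complex) \<Rightarrow> 'a \<Rightarrow> 'a \<Rightarrow> complex" where
  "kseries M a c = (\<lambda>x y. \<Sum>n. c n * kpow M a n x y)"

definition kexp :: "'a measure \<Rightarrow> ('a \<Rightarrow> 'a \<Rightarrow> complex) \<Rightarrow> complex \<Rightarrow> 'a \<Rightarrow> 'a \<Rightarrow> complex" where
  "kexp M a t = kseries M a (\<lambda>n. t ^ Suc n / fact (Suc n))"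

definition kexp_rest :: "'a measure \<Rightarrow> ('a \<Rightarrow> 'a \<Rightarrow> complex) \<Rightarrow> complex \<Rightarrow> 'a \<Rightarrow> 'a \<Rightarrow> complex" where
  "kexp_rest M a t = kseries M a (\<lambda>n. t ^ Suc (Suc n) / fact (Suc (Suc n)))"

lemma kcomp_eq_kop: "kcomp M a b x y = kop M a (\<lambda>z. b z y) x"
  unfolding kcomp_def kop_def by simp

lemma kcomp_cong:
  assumes "\<And>z. z \<in> space M \<Longrightarrow> a x z = a' x z" "\<And>z. z \<in> space M \<Longrightarrow> b z y = b' z y"
  shows "kcomp M a b x y = kcomp M a' b' x y"
  unfolding kcomp_def by (intro Bochner_Integration.integral_cong refl) (simp add: assms)

context finite_measure
begin

lemma bker_kpow: "bker M a \<Longrightarrow> bker M (kpow M a n)"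
  by (induction n) (auto intro: bker_kcomp)

lemma kcomp_assoc:
  assumes "bker M a" "bker M b" "bker M c" "x \<in> space M" "y \<in> space M"
  shows "kcomp M (kcomp M a b) c x y = kcomp M a (kcomp M b c) x y"
  unfolding kcomp_eq_kop[of M _ c] kcomp_eq_kop[of M a "\<lambda>x y. kop M b (\<lambda>z. c z y) x"]
  by (rule kop_kcomp[OF assms(1,2) bker_row_L2(2)[OF assms(3,5)] assms(4)])

lemma kcomp_kpow:
  assumes a: "bker M a" and xy: "x \<in> space M" "y \<in> space M"
  shows "kcomp M (kpow M a m) (kpow M a n) x y = kpow M a (Suc (m + n)) x y"
  using xy
proof (induction m arbitrary: x y)
  case (Suc m)
  have "kcomp M (kpow M a (Suc m)) (kpow M a n) x y = kcomp M a (kcomp M (kpow M a m) (kpow M a n)) x y"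
    unfolding kpow.simps(2) by (intro kcomp_assoc a bker_kpow Suc.prems)
  also have "\<dots> = kcomp M a (kpow M a (Suc (m + n))) x y"
    by (intro kcomp_cong Suc refl)
  finally show ?case by simp
qed simp

text \<open>Integrating the estimate for one power against a row of \<open>a\<close> gains a factor
  \<open>q\<close>. The constant weight serves the exponential series; an exponential weight makes
  \<open>q\<close> small for triangular kernels.\<close>

lemma kpow_bound_weighted:
  fixes w :: "'a \<Rightarrow> real"
  assumes a: "bker M a" and A: "\<And>x y. x \<in> space M \<Longrightarrow> y \<in> space M \<Longrightarrow> cmod (a x y) * w y \<le> A * w x"
    and w: "\<And>x. x \<in> space M \<Longrightarrow> 0 < w x" "w \<in> borel_measurable M" "\<And>x. x \<in> space M \<Longrightarrow> w x \<le> W"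
    and q: "\<And>x. x \<in> space M \<Longrightarrow> (LINT z|M. cmod (a x z) * w z) \<le> q * w x"
    and xy: "x \<in> space M" "y \<in> space M"
  shows "cmod (kpow M a n x y) * w y \<le> A * q ^ n * w x"
  using xy(1)
proof (induction n arbitrary: x)
  case 0
  then show ?case using A xy by simp
next
  case (Suc n)
  have kL: "(\<lambda>z. kpow M a n z y) \<in> L2 M" by (intro bker_row_L2(2) bker_kpow a xy)
  have wL: "(\<lambda>z. complex_of_real (w z)) \<in> L2 M"
    by (rule L2_bounded[where C=W]) (use w(2) w(3) w(1)[THEN less_imp_le] in simp_all)
  have q0: "0 \<le> q"
  proof -
    have "0 \<le> (LINT z|M. cmod (a y z) * w z)"
      by (rule Bochner_Integration.integral_nonneg) (simp add: w(1) less_imp_le)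
    then have "0 \<le> q * w y" using q[OF xy(2)] by linarith
    then show ?thesis using w(1)[OF xy(2)] by (simp add: zero_le_mult_iff)
  qed
  have A0: "0 \<le> A"
  proof -
    have "0 \<le> cmod (a y y) * w y" using w(1)[OF xy(2)] by simp
    then have "0 \<le> A * w y" using A[OF xy(2,2)] by linarith
    then show ?thesis using w(1)[OF xy(2)] by (simp add: zero_le_mult_iff)
  qed
  have int: "integrable M (\<lambda>z. cmod (a x z) * cmod (kpow M a n z y))"
    by (rule L2_integrable_norm_mult[OF bker_row_L2(1)[OF a Suc.prems] kL])
  have int2: "integrable M (\<lambda>z. cmod (a x z) * w z)"
  proof (rule Bochner_Integration.integrable_cong[OF refl, THEN iffD1])
    show "integrable M (\<lambda>z. cmod (a x z) * cmod (complex_of_real (w z)))"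
      by (rule L2_integrable_norm_mult[OF bker_row_L2(1)[OF a Suc.prems] wL])
    show "cmod (a x z) * cmod (complex_of_real (w z)) = cmod (a x z) * w z" if "z \<in> space M" for z
      using w(1)[OF that] by simp
  qed
  have "cmod (kpow M a (Suc n) x y) \<le> (LINT z|M. cmod (a x z) * cmod (kpow M a n z y))"
    unfolding kpow.simps(2) kcomp_def norm_mult[symmetric] by (rule integral_norm_bound)
  then have "cmod (kpow M a (Suc n) x y) * w y \<le> (LINT z|M. cmod (a x z) * cmod (kpow M a n z y)) * w y"
    using w(1)[OF xy(2)] by (intro mult_right_mono) auto
  also have "\<dots> = (LINT z|M. cmod (a x z) * (cmod (kpow M a n z y) * w y))"
    by (simp add: mult.assoc[symmetric])
  also have "\<dots> \<le> (LINT z|M. A * q ^ n * (cmod (a x z) * w z))"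
  proof (rule integral_mono)
    show "integrable M (\<lambda>z. cmod (a x z) * (cmod (kpow M a n z y) * w y))"
      using integrable_mult_left[OF int, of "w y"] by (simp add: mult.assoc)
    show "integrable M (\<lambda>z. A * q ^ n * (cmod (a x z) * w z))" by (intro integrable_mult_right int2)
    show "cmod (a x z) * (cmod (kpow M a n z y) * w y) \<le> A * q ^ n * (cmod (a x z) * w z)" if "z \<in> space M" for z
      using mult_left_mono[OF Suc.IH[OF that] norm_ge_zero[of "a x z"]] by (simp add: mult_ac)
  qed
  also have "\<dots> = A * q ^ n * (LINT z|M. cmod (a x z) * w z)" by simp
  also have "\<dots> \<le> A * q ^ n * (q * w x)"
    using A0 q0 by (intro mult_left_mono q Suc.prems) auto
  finally show ?case by (simp add: mult_ac)
qed

lemma kpow_bound: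
  assumes a: "bker M a" and C: "C \<ge> 0" "\<And>x y. x \<in> space M \<Longrightarrow> y \<in> space M \<Longrightarrow> cmod (a x y) \<le> C"
    and xy: "x \<in> space M" "y \<in> space M"
  shows "cmod (kpow M a n x y) \<le> C * (C * measure M (space M)) ^ n"
proof -
  have "cmod (kpow M a n x y) * 1 \<le> C * (C * measure M (space M)) ^ n * 1"
  proof (rule kpow_bound_weighted[OF a, where w="\<lambda>_. 1" and W=1])
    fix x assume x: "x \<in> space M"
    have "(LINT z|M. cmod (a x z) * 1) \<le> (LINT z|M. C)"
      by (rule integral_mono) (use x C bker_row_L2(1)[OF a x] in \<open>auto intro: L2_integrable\<close>)
    then show "(LINT z|M. cmod (a x z) * 1) \<le> C * measure M (space M) * 1" by (simp add: mult.commute)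
  qed (use C xy in auto)
  then show ?thesis by simp
qed

lemma integral_mult_sums:
  fixes F :: "nat \<Rightarrow> 'a \<Rightarrow> complex"
  assumes g: "g \<in> L2 M" and F: "\<And>n. F n \<in> borel_measurable M"
    "\<And>n z. z \<in> space M \<Longrightarrow> cmod (F n z) \<le> D n" and D: "summable D"
  shows "(\<lambda>n. LINT z|M. g z * F n z) sums (LINT z|M. g z * (\<Sum>n. F n z))"
proof -
  have FL: "F n \<in> L2 M" for n by (rule L2_bounded[OF F(1,2)])
  have int: "integrable M (\<lambda>z. g z * F n z)" for n by (rule L2_integrable_mult[OF g FL])
  have sF: "summable (\<lambda>n. cmod (F n z))" if "z \<in> space M" for z
    by (rule summable_comparison_test[OF _ D]) (use F(2)[OF that] in auto)
  have "(\<lambda>n. LINT z|M. g z * F n z) sums (LINT z|M. (\<Sum>n. g z * F n z))"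
  proof (rule sums_integral[OF int])
    show "AE z in M. summable (\<lambda>n. norm (g z * F n z))"
      by (rule AE_I2) (auto simp: norm_mult intro!: summable_mult sF)
    show "summable (\<lambda>n. LINT z|M. norm (g z * F n z))"
    proof (rule summable_comparison_test)
      show "summable (\<lambda>n. (LINT z|M. cmod (g z)) * D n)" by (intro summable_mult D)
      show "\<exists>N. \<forall>n\<ge>N. norm (LINT z|M. norm (g z * F n z)) \<le> (LINT z|M. cmod (g z)) * D n"
      proof (intro exI allI impI)
        fix n
        have "(LINT z|M. norm (g z * F n z)) \<le> (LINT z|M. cmod (g z) * D n)"
        proof (rule integral_mono)
          show "integrable M (\<lambda>z. norm (g z * F n z))" by (rule integrable_norm[OF int])
          show "integrable M (\<lambda>z. cmod (g z) * D n)" by (intro integrable_mult_left integrable_norm L2_integrable g)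
        qed (auto simp: norm_mult intro!: mult_left_mono F)
        moreover have "0 \<le> (LINT z|M. norm (g z * F n z))" by (rule integral_nonneg_AE) simp
        ultimately show "norm (LINT z|M. norm (g z * F n z)) \<le> (LINT z|M. cmod (g z)) * D n" by simp
      qed
    qed
  qed
  moreover have "(LINT z|M. (\<Sum>n. g z * F n z)) = (LINT z|M. g z * (\<Sum>n. F n z))"
    by (rule Bochner_Integration.integral_cong[OF refl], rule suminf_mult, rule summable_norm_cancel, erule sF)
  ultimately show ?thesis by simp
qed

end

text \<open>The majorant \<open>B\<close> is left open because it is instantiated twice: by the
  crude geometric bound for the exponential, and by the bound from an exponential weight for the
  resolvent.\<close>

locale kernel_powers = finite_measure M for M :: "'a measure" +
  fixes a :: "'a \<Rightarrow> 'a \<Rightarrow> complex" and B :: "nat \<Rightarrow> real"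
  assumes a: "bker M a"
    and B: "\<And>n x y. x \<in> space M \<Longrightarrow> y \<in> space M \<Longrightarrow> cmod (kpow M a n x y) \<le> B n"
    and B0: "\<And>n. 0 \<le> B n"
begin

abbreviation summable_coeff :: "(nat \<Rightarrow> complex) \<Rightarrow> bool" where
  "summable_coeff c \<equiv> summable (\<lambda>n. cmod (c n) * B n)"

lemma kseries_term_le:
  "x \<in> space M \<Longrightarrow> y \<in> space M \<Longrightarrow> cmod (c n * kpow M a n x y) \<le> cmod (c n) * B n"
  unfolding norm_mult by (intro mult_left_mono B) auto

lemma kseries_summable_norm:
  assumes c: "summable_coeff c" and xy: "x \<in> space M" "y \<in> space M"
  shows "summable (\<lambda>n. cmod (c n * kpow M a n x y))"
  by (rule summable_comparison_test[OF _ c]) (use kseries_term_le[OF xy] in auto)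

lemma kseries_sums:
  assumes "summable_coeff c" "x \<in> space M" "y \<in> space M"
  shows "(\<lambda>n. c n * kpow M a n x y) sums kseries M a c x y"
  unfolding kseries_def by (rule summable_sums[OF summable_norm_cancel[OF kseries_summable_norm[OF assms]]])

lemma kseries_bound:
  assumes c: "summable_coeff c" and xy: "x \<in> space M" "y \<in> space M"
  shows "cmod (kseries M a c x y) \<le> (\<Sum>n. cmod (c n) * B n)"
proof -
  have "cmod (kseries M a c x y) \<le> (\<Sum>n. cmod (c n * kpow M a n x y))"
    unfolding kseries_def by (rule summable_norm[OF kseries_summable_norm[OF assms]])
  also have "\<dots> \<le> (\<Sum>n. cmod (c n) * B n)"
    by (intro suminf_le kseries_term_le xy kseries_summable_norm c)
  finally show ?thesis .
qed

lemma bker_kseries: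
  assumes c: "summable_coeff c"
  shows "bker M (kseries M a c)"
proof (rule bkerI)
  have "(\<lambda>p. \<Sum>n. c n * kpow M a n (fst p) (snd p)) \<in> borel_measurable (M \<Otimes>\<^sub>M M)"
  proof (rule borel_measurable_suminf)
    show "(\<lambda>p. c n * kpow M a n (fst p) (snd p)) \<in> borel_measurable (M \<Otimes>\<^sub>M M)" for n
      using bker_measurable[OF bker_cmult[OF bker_kpow[OF a]]] by (simp add: case_prod_beta')
  qed
  then show "(\<lambda>(x,y). kseries M a c x y) \<in> borel_measurable (M \<Otimes>\<^sub>M M)"
    unfolding kseries_def by (simp add: case_prod_beta')
qed (rule kseries_bound[OF c])

lemma kop_kseries_sums:
  assumes c: "summable_coeff c" and f: "f \<in> L2 M" and x: "x \<in> space M"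
  shows "(\<lambda>n. c n * kop M (kpow M a n) f x) sums kop M (kseries M a c) f x"
proof -
  have "(\<lambda>n. LINT z|M. f z * (c n * kpow M a n x z)) sums (LINT z|M. f z * (\<Sum>n. c n * kpow M a n x z))"
  proof (rule integral_mult_sums[OF f _ _ c])
    show "(\<lambda>z. c n * kpow M a n x z) \<in> borel_measurable M" for n
      by (intro borel_measurable_times borel_measurable_const bker_row_measurable(1) bker_kpow a x)
    show "cmod (c n * kpow M a n x z) \<le> cmod (c n) * B n" if "z \<in> space M" for n z
      by (rule kseries_term_le[OF x that])
  qed
  then show ?thesis unfolding kop_def kseries_def by (simp add: mult_ac)
qed

lemma kcomp_kseries_left:
  assumes c: "summable_coeff c" and xy: "x \<in> space M" "y \<in> space M"
  shows "(\<lambda>n. c n * kpow M a (Suc n) x y) sums kcomp M a (kseries M a c) x y"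
proof -
  have "(\<lambda>n. LINT z|M. a x z * (c n * kpow M a n z y)) sums (LINT z|M. a x z * (\<Sum>n. c n * kpow M a n z y))"
  proof (rule integral_mult_sums[OF bker_row_L2(1)[OF a xy(1)] _ _ c])
    show "(\<lambda>z. c n * kpow M a n z y) \<in> borel_measurable M" for n
      by (intro borel_measurable_times borel_measurable_const bker_row_measurable(2) bker_kpow a xy)
    show "cmod (c n * kpow M a n z y) \<le> cmod (c n) * B n" if "z \<in> space M" for n z
      by (rule kseries_term_le[OF that xy(2)])
  qed
  then show ?thesis unfolding kpow.simps(2) kcomp_def kseries_def by (simp add: mult.left_commute[of _ "c _"])
qed

text \<open>Cauchy product under the integral. As \<open>kpow M a n\<close> is the power n + 1, the
  factors with indices \<open>i\<close> and \<open>k - i\<close> combine to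
  \<open>kpow M a (Suc k)\<close>.\<close>

lemma kcomp_kseries:
  assumes c: "summable_coeff c" and d: "summable_coeff d" and xy: "x \<in> space M" "y \<in> space M"
  shows "(\<lambda>k. (\<Sum>i\<le>k. c i * d (k - i)) * kpow M a (Suc k) x y) sums kcomp M (kseries M a c) (kseries M a d) x y"
proof -
  define F where "F k z = (\<Sum>i\<le>k. (c i * kpow M a i x z) * (d (k - i) * kpow M a (k - i) z y))" for k z
  define D where "D k = (\<Sum>i\<le>k. (cmod (c i) * B i) * (cmod (d (k - i)) * B (k - i)))" for k
  have D: "summable D" unfolding D_def
    by (rule summable_Cauchy_product) (use c d B0 in \<open>auto simp: abs_mult abs_of_nonneg\<close>)
  have Fm: "F k \<in> borel_measurable M" for k unfolding F_def
    by (intro borel_measurable_sum borel_measurable_times borel_measurable_const bker_row_measurable bker_kpow a xy)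
  have Fb: "cmod (F k z) \<le> D k" if z: "z \<in> space M" for k z
    unfolding F_def D_def
  proof (rule sum_norm_le)
    fix i
    show "cmod (c i * kpow M a i x z * (d (k - i) * kpow M a (k - i) z y)) \<le> cmod (c i) * B i * (cmod (d (k - i)) * B (k - i))"
      unfolding norm_mult[of "c i * kpow M a i x z"]
      by (intro mult_mono kseries_term_le xy z) (auto simp: B0)
  qed
  have sF: "(\<Sum>k. F k z) = kseries M a c x z * kseries M a d z y" if z: "z \<in> space M" for z
    unfolding F_def kseries_def
    by (rule Cauchy_product[symmetric]) (intro kseries_summable_norm c d xy z)+
  have "(\<lambda>k. LINT z|M. 1 * F k z) sums (LINT z|M. 1 * (\<Sum>k. F k z))"
    by (rule integral_mult_sums[OF L2_one Fm Fb D])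
  moreover have "(LINT z|M. 1 * (\<Sum>k. F k z)) = kcomp M (kseries M a c) (kseries M a d) x y"
    unfolding kcomp_def by (intro Bochner_Integration.integral_cong refl) (simp add: sF)
  moreover have "(LINT z|M. 1 * F k z) = (\<Sum>i\<le>k. c i * d (k - i)) * kpow M a (Suc k) x y" for k
  proof -
    have "(LINT z|M. 1 * F k z) = (LINT z|M. (\<Sum>i\<le>k. (c i * d (k - i)) * (kpow M a i x z * kpow M a (k - i) z y)))"
      unfolding F_def by (simp add: mult_ac)
    also have "\<dots> = (\<Sum>i\<le>k. LINT z|M. (c i * d (k - i)) * (kpow M a i x z * kpow M a (k - i) z y))"
      by (intro Bochner_Integration.integral_sum integrable_mult_right L2_integrable_mult bker_row_L2 bker_kpow a xy)
    also have "\<dots> = (\<Sum>i\<le>k. (c i * d (k - i)) * kcomp M (kpow M a i) (kpow M a (k - i)) x y)"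
      unfolding kcomp_def by simp
    also have "\<dots> = (\<Sum>i\<le>k. (c i * d (k - i)) * kpow M a (Suc k) x y)"
      by (intro sum.cong refl) (simp only: kcomp_kpow[OF a xy] atMost_iff le_add_diff_inverse)
    finally show ?thesis by (simp only: sum_distrib_right)
  qed
  ultimately show ?thesis by simp
qed

end

lemma norm_power_div_fact: "cmod (t ^ n / fact n) = cmod t ^ n * inverse (fact n)"
  by (simp add: norm_divide norm_power field_simps)

lemma norm_exp_minus_one_le: "cmod (exp z - 1) \<le> cmod z * exp (cmod z)"
proof -
  have "cmod (exp z - exp 0) \<le> exp (cmod z) * cmod (z - 0)"
  proof (rule field_differentiable_bound[where S="cball 0 (cmod z)" and f'=exp])
    fix w :: complex assume "w \<in> cball 0 (cmod z)"
    then show "cmod (exp w) \<le> exp (cmod z)"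
      using complex_Re_le_cmod[of w] by (simp add: norm_exp_eq_Re)
  qed (auto intro: has_field_derivative_at_within DERIV_exp)
  then show ?thesis by (simp add: mult.commute)
qed

context finite_measure
begin

lemma norm_integral_le:
  fixes f :: "'a \<Rightarrow> complex"
  assumes f: "f \<in> borel_measurable M" "\<And>x. x \<in> space M \<Longrightarrow> cmod (f x) \<le> C"
  shows "cmod (LINT x|M. f x) \<le> C * measure M (space M)"
proof -
  have "cmod (LINT x|M. f x) \<le> (LINT x|M. cmod (f x))" by (rule integral_norm_bound)
  also have "\<dots> \<le> (LINT x|M. C)"
    by (intro integral_mono integrable_norm L2_integrable L2_bounded[OF f]) (auto intro: f)
  finally show ?thesis by (simp add: mult.commute)
qed

lemma ktr_bound:
  assumes a: "bker M a" "\<And>x y. x \<in> space M \<Longrightarrow> y \<in> space M \<Longrightarrow> cmod (a x y) \<le> A"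
    and b: "bker M b" "\<And>x y. x \<in> space M \<Longrightarrow> y \<in> space M \<Longrightarrow> cmod (b x y) \<le> B" and A: "0 \<le> A"
  shows "cmod (ktr M a b) \<le> A * B * (measure M (space M))\<^sup>2"
proof -
  have m: "(\<lambda>(y,x). a x y * b y x) \<in> borel_measurable (M \<Otimes>\<^sub>M M)"
    by (rule bker_measurable[OF bker_mult[OF bker_transpose[OF a(1)] b(1)]])
  have "cmod (ktr M a b) \<le> (A * B * measure M (space M)) * measure M (space M)"
    unfolding ktr_def
  proof (rule norm_integral_le)
    show "(\<lambda>y. LINT x|M. a x y * b y x) \<in> borel_measurable M"
      by (rule borel_measurable_lebesgue_integral[OF m])
    fix y assume y: "y \<in> space M"
    show "cmod (LINT x|M. a x y * b y x) \<le> A * B * measure M (space M)"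
    proof (rule norm_integral_le)
      show "(\<lambda>x. a x y * b y x) \<in> borel_measurable M"
        by (intro borel_measurable_times bker_row_measurable[OF a(1) y] bker_row_measurable[OF b(1) y])
      show "cmod (a x y * b y x) \<le> A * B" if "x \<in> space M" for x
        unfolding norm_mult by (intro mult_mono a b y that A) simp
    qed
  qed
  then show ?thesis by (simp add: power2_eq_square mult_ac)
qed

end

section \<open>The determinant of the exponential of a kernel\<close>

locale l2_basis_kernel = l2_basis M e for M :: "'a measure" and e +
  fixes a :: "'a \<Rightarrow> 'a \<Rightarrow> complex"
  assumes bker_a: "bker M a"
begin

definition C :: real where
  "C = (SOME C. C \<ge> 0 \<and> (\<forall>x\<in>space M. \<forall>y\<in>space M. cmod (a x y) \<le> C))"

lemma C: "C \<ge> 0" "\<And>x y. x \<in> space M \<Longrightarrow> y \<in> space M \<Longrightarrow> cmod (a x y) \<le> C"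
proof -
  obtain D where "D \<ge> 0" "\<And>x y. x \<in> space M \<Longrightarrow> y \<in> space M \<Longrightarrow> cmod (a x y) \<le> D"
    using bker_a by (rule bkerE) blast
  then have "\<exists>D. D \<ge> 0 \<and> (\<forall>x\<in>space M. \<forall>y\<in>space M. cmod (a x y) \<le> D)" by blast
  from someI_ex[OF this] show "C \<ge> 0" "\<And>x y. x \<in> space M \<Longrightarrow> y \<in> space M \<Longrightarrow> cmod (a x y) \<le> C"
    unfolding C_def by blast+
qed

definition \<mu> :: real where "\<mu> = measure M (space M)"

lemma mu_nonneg: "0 \<le> \<mu>"
  unfolding \<mu>_def by simp

definition B :: "nat \<Rightarrow> real" where "B n = C * (C * \<mu>) ^ n"

sublocale kernel_powers M a B
proof
  show "bker M a" by (rule bker_a)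
  show "cmod (kpow M a n x y) \<le> B n" if "x \<in> space M" "y \<in> space M" for n x y
    unfolding B_def \<mu>_def by (rule kpow_bound[OF bker_a C that])
  show "0 \<le> B n" for n unfolding B_def using C(1) mu_nonneg by simp
qed

lemma summable_shifted_exp_coeff:
  "summable (\<lambda>n. cmod (t ^ (n + d) / fact (n + d)) * B n)"
proof (rule summable_comparison_test)
  show "summable (\<lambda>n. cmod t ^ d * C * (inverse (fact n) * (cmod t * (C * \<mu>)) ^ n))"
    by (intro summable_mult summable_exp)
  show "\<exists>N. \<forall>n\<ge>N. norm (cmod (t ^ (n + d) / fact (n + d)) * B n)
      \<le> cmod t ^ d * C * (inverse (fact n) * (cmod t * (C * \<mu>)) ^ n)"
  proof (intro exI allI impI)
    fix n
    have "norm (cmod (t ^ (n + d) / fact (n + d)) * B n) = cmod t ^ d * C * (inverse (fact (n + d)) * (cmod t * (C * \<mu>)) ^ n)"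
    proof -
      have "norm (cmod (t ^ (n + d) / fact (n + d)) * B n) = cmod (t ^ (n + d) / fact (n + d)) * B n"
        using B0[of n] by simp
      then show ?thesis unfolding norm_power_div_fact B_def
        by (simp only: power_add power_mult_distrib mult_ac)
    qed
    also have "\<dots> \<le> cmod t ^ d * C * (inverse (fact n) * (cmod t * (C * \<mu>)) ^ n)"
      using C(1) mu_nonneg
      by (intro mult_left_mono mult_right_mono le_imp_inverse_le fact_mono) auto
    finally show "norm (cmod (t ^ (n + d) / fact (n + d)) * B n)
      \<le> cmod t ^ d * C * (inverse (fact n) * (cmod t * (C * \<mu>)) ^ n)" .
  qed
qed

lemma kexp_coeff: "summable_coeff (\<lambda>n. t ^ Suc n / fact (Suc n))"
  using summable_shifted_exp_coeff[of t 1] by simp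

lemma kexp_rest_coeff: "summable_coeff (\<lambda>n. t ^ Suc (Suc n) / fact (Suc (Suc n)))"
  using summable_shifted_exp_coeff[of t 2] by simp

lemma bker_kexp: "bker M (kexp M a t)"
  unfolding kexp_def by (rule bker_kseries[OF kexp_coeff])

lemma bker_kexp_rest: "bker M (kexp_rest M a t)"
  unfolding kexp_rest_def by (rule bker_kseries[OF kexp_rest_coeff])

lemma kexp_eq:
  assumes xy: "x \<in> space M" "y \<in> space M"
  shows "kexp M a t x y = t * a x y + kcomp M a (kexp_rest M a t) x y"
proof -
  have "(\<lambda>n. t ^ Suc (Suc n) / fact (Suc (Suc n)) * kpow M a (Suc n) x y) sums kcomp M a (kexp_rest M a t) x y"
    unfolding kexp_rest_def by (rule kcomp_kseries_left[OF kexp_rest_coeff xy])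
  from sums_Suc[of "\<lambda>n. t ^ Suc n / fact (Suc n) * kpow M a n x y", OF this]
  have "(\<lambda>n. t ^ Suc n / fact (Suc n) * kpow M a n x y) sums (kcomp M a (kexp_rest M a t) x y + t * a x y)"
    by simp
  then show ?thesis
    using sums_unique2[OF kseries_sums[OF kexp_coeff xy, of t]] unfolding kexp_def by (simp add: add.commute)
qed

text \<open>The law exp ((s + t) A) = exp (s A) exp (t A) for exponentials stripped of the identity
  operator.\<close>

lemma kexp_add:
  assumes xy: "x \<in> space M" "y \<in> space M"
  shows "kexp M a (s + t) x y = kexp M a s x y + kexp M a t x y + kcomp M (kexp M a s) (kexp M a t) x y"
proof -
  define c where "c = (\<lambda>t n. t ^ Suc n / fact (Suc n) :: complex)"
  \<comment> \<open>The coefficients of the composition start at the second power of the kernel,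
    hence the 0 at index 0.\<close>
  define d where "d = (\<lambda>n. case n of 0 \<Rightarrow> 0 | Suc k \<Rightarrow> (\<Sum>i\<le>k. c s i * c t (k - i)))"
  have "(\<lambda>k. (\<Sum>i\<le>k. c s i * c t (k - i)) * kpow M a (Suc k) x y) sums kcomp M (kexp M a s) (kexp M a t) x y"
    unfolding kexp_def c_def by (rule kcomp_kseries[OF kexp_coeff kexp_coeff xy])
  then have "(\<lambda>n. d (Suc n) * kpow M a (Suc n) x y) sums kcomp M (kexp M a s) (kexp M a t) x y"
    by (simp add: d_def)
  then have 1: "(\<lambda>n. d n * kpow M a n x y) sums kcomp M (kexp M a s) (kexp M a t) x y"
    by (rule sums_Suc_imp[rotated]) (simp add: d_def)
  have E: "(\<lambda>n. c t n * kpow M a n x y) sums kexp M a t x y" for t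
    unfolding kexp_def c_def by (rule kseries_sums[OF kexp_coeff xy])
  have cd: "c (s + t) n = c s n + c t n + d n" for n
  proof (cases n)
    case 0
    then show ?thesis by (simp add: c_def d_def)
  next
    case (Suc k)
    have fs: "u ^ m /\<^sub>R fact m = u ^ m / fact m" for u :: complex and m
      by (simp add: scaleR_conv_of_real divide_inverse mult.commute)
    \<comment> \<open>The summands at the two ends of the binomial sum are \<open>c s n\<close> and
      \<open>c t n\<close>; the inner ones make up \<open>d n\<close>.\<close>
    have "c (s + t) n = (\<Sum>i\<le>Suc (Suc k). s ^ i / fact i * (t ^ (Suc (Suc k) - i) / fact (Suc (Suc k) - i)))"
      using exp_series_add_commuting[of s t "Suc (Suc k)"] Suc by (simp only: c_def fs mult.commute)
    also have "\<dots> = (\<Sum>i\<le>Suc k. s ^ i / fact i * (t ^ (Suc (Suc k) - i) / fact (Suc (Suc k) - i))) + c s n"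
      using Suc by (simp add: c_def)
    also have "(\<Sum>i\<le>Suc k. s ^ i / fact i * (t ^ (Suc (Suc k) - i) / fact (Suc (Suc k) - i)))
        = c t n + (\<Sum>i\<le>k. c s i * c t (k - i))"
      unfolding sum.atMost_Suc_shift using Suc by (simp add: c_def Suc_diff_le del: fact_Suc power_Suc)
    finally show ?thesis using Suc by (simp add: d_def)
  qed
  have "(\<lambda>n. c (s + t) n * kpow M a n x y) sums (kexp M a s x y + kexp M a t x y + kcomp M (kexp M a s) (kexp M a t) x y)"
    unfolding cd distrib_right by (intro sums_add E 1)
  then show ?thesis using sums_unique2[OF E] by blast
qed

text \<open>Composing \<open>a\<close> with \<open>kexp_rest\<close> gives the kernel of exp (t A) -
  I - t A. The terms linear in \<open>s\<close> and \<open>t\<close> cancel in the addition law, and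
  the remaining kernels are compared through the traces of their matrices.\<close>

lemma ktr_kexp_rest_add:
  "ktr M a (kexp_rest M a (s + t)) = ktr M a (kexp_rest M a s) + ktr M a (kexp_rest M a t) + ktr M (kexp M a s) (kexp M a t)"
proof -
  have "kmat M e (kcomp M a (kexp_rest M a (s + t)))
     = kmat M e (\<lambda>x y. kcomp M a (kexp_rest M a s) x y + kcomp M a (kexp_rest M a t) x y + kcomp M (kexp M a s) (kexp M a t) x y)"
  proof (rule kmat_cong)
    fix x y assume xy: "x \<in> space M" "y \<in> space M"
    show "kcomp M a (kexp_rest M a (s + t)) x y
      = kcomp M a (kexp_rest M a s) x y + kcomp M a (kexp_rest M a t) x y + kcomp M (kexp M a s) (kexp M a t) x y"
      using kexp_eq[OF xy, of "s + t"] kexp_eq[OF xy, of s] kexp_eq[OF xy, of t] kexp_add[OF xy, of s t]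
      by (simp add: algebra_simps)
  qed
  also have "\<dots> = (\<lambda>i j. kmat M e (kcomp M a (kexp_rest M a s)) i j + kmat M e (kcomp M a (kexp_rest M a t)) i j
      + kmat M e (kcomp M (kexp M a s) (kexp M a t)) i j)"
    by (simp add: kmat_add bker_add bker_kcomp bker_a bker_kexp bker_kexp_rest)
  finally have "(\<lambda>n. \<Sum>i<n. kmat M e (kcomp M a (kexp_rest M a (s + t))) i i)
     = (\<lambda>n. (\<Sum>i<n. kmat M e (kcomp M a (kexp_rest M a s)) i i) + (\<Sum>i<n. kmat M e (kcomp M a (kexp_rest M a t)) i i)
      + (\<Sum>i<n. kmat M e (kcomp M (kexp M a s) (kexp M a t)) i i))"
    by (simp add: sum.distrib)
  moreover have "(\<lambda>n. (\<Sum>i<n. kmat M e (kcomp M a (kexp_rest M a s)) i i) + (\<Sum>i<n. kmat M e (kcomp M a (kexp_rest M a t)) i i)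
      + (\<Sum>i<n. kmat M e (kcomp M (kexp M a s) (kexp M a t)) i i))
     \<longlonglongrightarrow> ktr M a (kexp_rest M a s) + ktr M a (kexp_rest M a t) + ktr M (kexp M a s) (kexp M a t)"
    by (intro tendsto_add kmat_trace bker_a bker_kexp bker_kexp_rest)
  ultimately have "(\<lambda>n. \<Sum>i<n. kmat M e (kcomp M a (kexp_rest M a (s + t))) i i)
     \<longlonglongrightarrow> ktr M a (kexp_rest M a s) + ktr M a (kexp_rest M a t) + ktr M (kexp M a s) (kexp M a t)" by (simp only:)
  then show ?thesis by (rule LIMSEQ_unique[OF kmat_trace[OF bker_a bker_kexp_rest]])
qed

text \<open>\<open>gexp\<close> is \<open>det (exp (t A)) exp (- t tr A)\<close> without reference to the trace of \<open>A\<close>, which need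
  not exist: it is multiplicative in \<open>t\<close> and \<open>1 + O(t\<^sup>2)\<close>, hence constant.\<close>

definition gexp :: "complex \<Rightarrow> complex" where
  "gexp t = kdet (kexp M a t) * exp (ktr M a (kexp_rest M a t))"

lemma gexp_add: "gexp (s + t) = gexp s * gexp t"
proof -
  have "kdet (kexp M a (s + t)) = kdet (\<lambda>x y. kexp M a s x y + kexp M a t x y + kcomp M (kexp M a s) (kexp M a t) x y)"
    by (rule kdet_cong) (rule kexp_add)
  also have "\<dots> = kdet (kexp M a s) * kdet (kexp M a t) * exp (- ktr M (kexp M a s) (kexp M a t))"
    by (rule kdet_mult[OF bker_kexp bker_kexp])
  finally show ?thesis
    unfolding gexp_def ktr_kexp_rest_add by (simp add: exp_add exp_minus field_simps)
qed

text \<open>The factor \<open>cmod t ^ d\<close> is common to all terms of the series; what is left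
  is bounded by the majorant at \<open>t = 1\<close>.\<close>

lemma kseries_exp_bound:
  assumes t: "cmod t \<le> 1"
  shows "\<exists>S\<ge>0. \<forall>t x y. cmod t \<le> 1 \<longrightarrow> x \<in> space M \<longrightarrow> y \<in> space M \<longrightarrow>
     cmod (kseries M a (\<lambda>n. t ^ (n + d) / fact (n + d)) x y) \<le> cmod t ^ d * S"
proof -
  define S where "S = (\<Sum>n. cmod (1 ^ (n + d) / fact (n + d)) * B n)"
  have s: "summable (\<lambda>n. cmod (1 ^ (n + d) / fact (n + d)) * B n)" by (rule summable_shifted_exp_coeff)
  have "S \<ge> 0" unfolding S_def by (intro suminf_nonneg s mult_nonneg_nonneg B0) simp
  moreover have "cmod (kseries M a (\<lambda>n. t ^ (n + d) / fact (n + d)) x y) \<le> cmod t ^ d * S"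
    if t: "cmod t \<le> 1" and xy: "x \<in> space M" "y \<in> space M" for t x y
  proof -
    have "cmod (kseries M a (\<lambda>n. t ^ (n + d) / fact (n + d)) x y) \<le> (\<Sum>n. cmod (t ^ (n + d) / fact (n + d)) * B n)"
      by (rule kseries_bound[OF summable_shifted_exp_coeff xy])
    also have "\<dots> \<le> (\<Sum>n. cmod t ^ d * (cmod (1 ^ (n + d) / fact (n + d)) * B n))"
    proof (rule suminf_le[OF _ summable_shifted_exp_coeff summable_mult[OF s]])
      fix n
      have "cmod t ^ (n + d) \<le> cmod t ^ d" by (rule power_decreasing) (use t in auto)
      then have "cmod t ^ (n + d) * (inverse (fact (n + d)) * B n) \<le> cmod t ^ d * (inverse (fact (n + d)) * B n)"
        using B0[of n] by (intro mult_right_mono) auto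
      then show "cmod (t ^ (n + d) / fact (n + d)) * B n \<le> cmod t ^ d * (cmod (1 ^ (n + d) / fact (n + d)) * B n)"
        unfolding norm_power_div_fact by (simp add: mult_ac)
    qed
    also have "\<dots> = cmod t ^ d * S" unfolding S_def by (rule suminf_mult[OF s])
    finally show ?thesis .
  qed
  ultimately show ?thesis by blast
qed

text \<open>\<open>kexp\<close> is O(t), so its determinant is 1 + O(t^2) by
  \<open>kdet_quadratic_sup\<close>; \<open>kexp_rest\<close> is itself O(t^2), hence so is the
  exponent.\<close>

lemma gexp_bound: "\<exists>K. \<forall>t. cmod t \<le> 1 \<longrightarrow> cmod (gexp t - 1) \<le> K * (cmod t)\<^sup>2"
proof -
  obtain S where S: "S \<ge> 0" "\<And>t x y. cmod t \<le> 1 \<Longrightarrow> x \<in> space M \<Longrightarrow> y \<in> space M \<Longrightarrow> cmod (kexp M a t x y) \<le> cmod t * S"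
    using kseries_exp_bound[of 1 1] unfolding kexp_def by auto
  obtain R where R: "R \<ge> 0" "\<And>t x y. cmod t \<le> 1 \<Longrightarrow> x \<in> space M \<Longrightarrow> y \<in> space M \<Longrightarrow> cmod (kexp_rest M a t x y) \<le> (cmod t)\<^sup>2 * R"
    using kseries_exp_bound[of 1 2] unfolding kexp_rest_def by auto
  define K1 where "K1 = 2 * (S * \<mu>)\<^sup>2 * exp ((S * \<mu> + 1)\<^sup>2 / 2)"
  define K2 where "K2 = C * R * \<mu>\<^sup>2"
  have K0: "K1 \<ge> 0" "K2 \<ge> 0" unfolding K1_def K2_def using C(1) R(1) by auto
  have "cmod (gexp t - 1) \<le> (K1 * exp K2 + K2 * exp K2) * (cmod t)\<^sup>2" if t: "cmod t \<le> 1" for t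
  proof -
    define D where "D = kdet (kexp M a t)"
    define T where "T = ktr M a (kexp_rest M a t)"
    have "cmod (D - 1) \<le> 2 * (cmod t * S * \<mu>)\<^sup>2 * exp ((cmod t * S * \<mu> + 1)\<^sup>2 / 2)"
      unfolding D_def \<mu>_def using S(1) by (intro kdet_quadratic_sup bker_kexp S(2) t) auto
    also have "\<dots> \<le> 2 * (cmod t * S * \<mu>)\<^sup>2 * exp ((S * \<mu> + 1)\<^sup>2 / 2)"
    proof -
      have "cmod t * (S * \<mu>) \<le> 1 * (S * \<mu>)" using t S(1) mu_nonneg by (intro mult_right_mono) auto
      then have "(cmod t * S * \<mu> + 1)\<^sup>2 \<le> (S * \<mu> + 1)\<^sup>2"
        using S(1) mu_nonneg by (intro power_mono) (auto simp: mult_ac)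
      then show ?thesis by (intro mult_left_mono) auto
    qed
    also have "\<dots> = K1 * (cmod t)\<^sup>2" unfolding K1_def by (simp add: power_mult_distrib mult_ac)
    finally have D1: "cmod (D - 1) \<le> K1 * (cmod t)\<^sup>2" .
    have "cmod T \<le> C * ((cmod t)\<^sup>2 * R) * \<mu>\<^sup>2"
      unfolding T_def \<mu>_def by (intro ktr_bound bker_a bker_kexp_rest C R(2) t)
    then have T1: "cmod T \<le> K2 * (cmod t)\<^sup>2" unfolding K2_def by (simp add: mult_ac)
    have "(cmod t)\<^sup>2 \<le> 1" using t by (simp add: power_le_one)
    then have "K2 * (cmod t)\<^sup>2 \<le> K2 * 1" using K0(2) by (intro mult_left_mono)
    then have eT: "exp (cmod T) \<le> exp K2" using T1 by simp
    have "gexp t - 1 = (D - 1) * exp T + (exp T - 1)"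
      unfolding gexp_def D_def T_def by (simp add: algebra_simps)
    then have "cmod (gexp t - 1) \<le> cmod (D - 1) * cmod (exp T) + cmod (exp T - 1)"
      by (metis norm_mult norm_triangle_ineq)
    also have "\<dots> \<le> K1 * (cmod t)\<^sup>2 * exp K2 + K2 * (cmod t)\<^sup>2 * exp K2"
    proof (rule add_mono)
      have "cmod (exp T) \<le> exp K2" using norm_exp[of T] eT by linarith
      then show "cmod (D - 1) * cmod (exp T) \<le> K1 * (cmod t)\<^sup>2 * exp K2"
        using D1 K0 by (intro mult_mono) auto
      have "cmod (exp T - 1) \<le> cmod T * exp (cmod T)" by (rule norm_exp_minus_one_le)
      also have "\<dots> \<le> K2 * (cmod t)\<^sup>2 * exp K2" using T1 eT K0 by (intro mult_mono) auto
      finally show "cmod (exp T - 1) \<le> K2 * (cmod t)\<^sup>2 * exp K2" .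
    qed
    finally show ?thesis by (simp add: algebra_simps)
  qed
  then show ?thesis by blast
qed

lemma gexp_one: "gexp 1 = 1"
proof -
  obtain K where K: "\<And>t. cmod t \<le> 1 \<Longrightarrow> cmod (gexp t - 1) \<le> K * (cmod t)\<^sup>2" using gexp_bound by blast
  have pow: "gexp (of_nat (Suc n) * t) = gexp t ^ Suc n" for n t
  proof (induction n)
    case (Suc n)
    have "of_nat (Suc (Suc n)) * t = of_nat (Suc n) * t + t" by (simp add: algebra_simps)
    then have "gexp (of_nat (Suc (Suc n)) * t) = gexp (of_nat (Suc n) * t) * gexp t" by (simp only: gexp_add)
    then show ?case by (simp only: Suc.IH power_Suc2[of _ "Suc n"])
  qed simp
  show ?thesis
  proof (rule prod_near_one_eq_one[where d="\<lambda>N j. gexp (1 / of_nat N)" and K=K])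
    fix N :: nat assume N: "N \<ge> 1"
    then obtain n where n: "N = Suc n" by (cases N) auto
    have "gexp (of_nat (Suc n) * (1 / of_nat (Suc n))) = gexp (1 / of_nat (Suc n)) ^ Suc n" by (rule pow)
    moreover have "of_nat (Suc n) * (1 / of_nat (Suc n)) = (1 :: complex)" using of_nat_neq_0[of n] by (simp del: of_nat_Suc)
    ultimately show "gexp 1 = (\<Prod>j<N. gexp (1 / of_nat N))" unfolding n prod_constant card_lessThan by (simp only:)
    fix j
    have "cmod (1 / of_nat N) = 1 / real N" by (simp add: norm_divide)
    then show "cmod (gexp (1 / of_nat N) - 1) \<le> K / (real N)\<^sup>2"
      using K[of "1 / of_nat N"] N by (simp add: power_divide)
  qed
qed

lemma kdet_kexp: "kdet (kexp M a 1) = exp (- ktr M a (kexp_rest M a 1))"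
  using gexp_one unfolding gexp_def by (simp add: exp_minus field_simps)

text \<open>The kernel of \<open>(I - A) exp A - I\<close>.\<close>

definition det2_kernel :: "'a \<Rightarrow> 'a \<Rightarrow> complex" where
  "det2_kernel = kcomp M a (\<lambda>x y. kexp_rest M a 1 x y - kexp M a 1 x y)"

lemma bker_det2_kernel: "bker M det2_kernel"
  unfolding det2_kernel_def by (intro bker_kcomp bker_diff bker_a bker_kexp bker_kexp_rest)

lemma kcomp_minus:
  assumes "bker M b" "bker M c" "x \<in> space M" "y \<in> space M"
  shows "kcomp M a (\<lambda>x y. b x y - c x y) x y = kcomp M a b x y - kcomp M a c x y"
  unfolding kcomp_def right_diff_distrib
  by (intro Bochner_Integration.integral_diff L2_integrable_mult bker_row_L2 bker_a assms)

lemma det2_kernel_eq: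
  assumes xy: "x \<in> space M" "y \<in> space M"
  shows "det2_kernel x y = kexp M a 1 x y - a x y - kcomp M a (kexp M a 1) x y"
  unfolding det2_kernel_def kcomp_minus[OF bker_kexp_rest bker_kexp xy] using kexp_eq[OF xy, of 1] by simp

text \<open>A compression of (I - A) exp A has determinant \<open>trunc_det2\<close> times the
  exponential of a trace. Multiplicativity expresses the limit through det_2 (I - A) and the
  determinant of the exponential; all trace factors then cancel.\<close>

lemma det_compressions_tendsto:
  "(\<lambda>n. trunc_det2 n (kmat M e det2_kernel) * exp (\<Sum>i<n. kmat M e det2_kernel i i)) \<longlonglongrightarrow> kdet (\<lambda>x y. - a x y)"
proof -
  have bm: "bker M (\<lambda>x y. - a x y)" by (rule bker_minus[OF bker_a])
  have km: "kcomp M (\<lambda>x y. - a x y) b = (\<lambda>x y. - kcomp M a b x y)" for b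
    unfolding kcomp_def by simp
  have "kdet det2_kernel = kdet (\<lambda>x y. - a x y + kexp M a 1 x y + kcomp M (\<lambda>x y. - a x y) (kexp M a 1) x y)"
    by (rule kdet_cong) (simp add: det2_kernel_eq km)
  also have "\<dots> = kdet (\<lambda>x y. - a x y) * kdet (kexp M a 1) * exp (- ktr M (\<lambda>x y. - a x y) (kexp M a 1))"
    by (rule kdet_mult[OF bm bker_kexp])
  also have "ktr M (\<lambda>x y. - a x y) (kexp M a 1) = - ktr M a (kexp M a 1)"
    unfolding ktr_def by simp
  finally have kd: "kdet det2_kernel = kdet (\<lambda>x y. - a x y) * exp (- ktr M a (kexp_rest M a 1)) * exp (ktr M a (kexp M a 1))"
    unfolding kdet_kexp by simp
  have "kmat M e det2_kernel = kmat M e (\<lambda>x y. kcomp M a (kexp_rest M a 1) x y + (- 1) * kcomp M a (kexp M a 1) x y)"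
    unfolding det2_kernel_def by (rule kmat_cong) (simp add: kcomp_minus bker_kexp_rest bker_kexp)
  also have "\<dots> = (\<lambda>i j. kmat M e (kcomp M a (kexp_rest M a 1)) i j + (-1) * kmat M e (kcomp M a (kexp M a 1)) i j)"
    by (simp only: kmat_add bker_cmult bker_kcomp bker_a bker_kexp bker_kexp_rest kmat_cmult)
  finally have "(\<lambda>n. \<Sum>i<n. kmat M e det2_kernel i i)
     = (\<lambda>n. (\<Sum>i<n. kmat M e (kcomp M a (kexp_rest M a 1)) i i) - (\<Sum>i<n. kmat M e (kcomp M a (kexp M a 1)) i i))"
    by (simp add: sum_subtractf)
  moreover have "(\<lambda>n. (\<Sum>i<n. kmat M e (kcomp M a (kexp_rest M a 1)) i i) - (\<Sum>i<n. kmat M e (kcomp M a (kexp M a 1)) i i))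
     \<longlonglongrightarrow> ktr M a (kexp_rest M a 1) - ktr M a (kexp M a 1)"
    by (intro tendsto_diff kmat_trace bker_a bker_kexp bker_kexp_rest)
  ultimately have "(\<lambda>n. \<Sum>i<n. kmat M e det2_kernel i i) \<longlonglongrightarrow> ktr M a (kexp_rest M a 1) - ktr M a (kexp M a 1)"
    by (simp only:)
  then have "(\<lambda>n. trunc_det2 n (kmat M e det2_kernel) * exp (\<Sum>i<n. kmat M e det2_kernel i i))
      \<longlonglongrightarrow> kdet det2_kernel * exp (ktr M a (kexp_rest M a 1) - ktr M a (kexp M a 1))"
    unfolding kdet_def by (intro tendsto_mult tendsto_exp trunc_det2_tendsto hs_mat_kmat bker_det2_kernel)
  then show ?thesis unfolding kd by (simp add: exp_diff exp_minus)
qed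

section \<open>The operator exponential and the trace class property\<close>

lemma kop_funpow:
  assumes f: "f \<in> L2 M"
  shows "(kop M a ^^ n) f \<in> L2 M"
    and "x \<in> space M \<Longrightarrow> (kop M a ^^ Suc n) f x = kop M (kpow M a n) f x"
proof -
  show L: "(kop M a ^^ n) f \<in> L2 M" for n by (induction n) (auto simp: f intro: kop_L2 bker_a)
  show "x \<in> space M \<Longrightarrow> (kop M a ^^ Suc n) f x = kop M (kpow M a n) f x"
  proof (induction n arbitrary: x)
    case (Suc n)
    have "(kop M a ^^ Suc (Suc n)) f x = kop M a ((kop M a ^^ Suc n) f) x" by simp
    also have "\<dots> = kop M a (kop M (kpow M a n) f) x"
      unfolding kop_def[of M a "(kop M a ^^ Suc n) f"] kop_def[of M a "kop M (kpow M a n) f"]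
      by (intro Bochner_Integration.integral_cong refl) (simp only: Suc.IH)
    also have "\<dots> = kop M (kpow M a (Suc n)) f x"
      using kop_kcomp[OF bker_a bker_kpow[OF bker_a] f Suc.prems] by simp
    finally show ?case .
  qed simp
qed

lemma kop_exp_series_tendsto:
  assumes f: "f \<in> L2 M"
  shows "(\<lambda>m. l2_norm M (\<lambda>x. (f x + kop M (kexp M a 1) f x) - (\<Sum>n<m. (kop M a ^^ n) f x / fact n))) \<longlonglongrightarrow> 0"
\<comment> \<open>After the shift each partial sum contains the term \<open>f x\<close> of index 0,
  the only one that is not given by a power of the kernel.\<close>
proof (subst filterlim_sequentially_Suc[symmetric])
  define c :: "nat \<Rightarrow> complex" where "c n = 1 ^ Suc n / fact (Suc n)" for n
  define r where "r p = (\<Sum>n. cmod (c (n + p)) * B (n + p))" for p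
  define F where "F = (LINT y|M. cmod (f y))"
  have F: "F \<ge> 0" unfolding F_def by (rule Bochner_Integration.integral_nonneg) simp
  have sc: "summable (\<lambda>n. cmod (c n) * B n)" unfolding c_def by (rule kexp_coeff)
  have sr: "summable (\<lambda>n. cmod (c (n + p)) * B (n + p))" for p using sc by (subst summable_iff_shift)
  have r0: "r \<longlonglongrightarrow> 0" unfolding r_def by (rule suminf_exist_split2[OF sc])
  have rn: "r p \<ge> 0" for p unfolding r_def by (intro suminf_nonneg sr mult_nonneg_nonneg B0) simp
  have ptw: "cmod ((f x + kop M (kexp M a 1) f x) - (\<Sum>n<Suc p. (kop M a ^^ n) f x / fact n)) \<le> r p * F"
    if x: "x \<in> space M" for p x
  proof -
    have s: "(\<lambda>n. c n * kop M (kpow M a n) f x) sums kop M (kexp M a 1) f x"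
      unfolding kexp_def c_def by (rule kop_kseries_sums[OF kexp_coeff f x])
    have tb: "cmod (c n * kop M (kpow M a n) f x) \<le> cmod (c n) * B n * F" for n
      unfolding norm_mult F_def mult.assoc
      by (intro mult_left_mono kop_bound bker_kpow bker_a f B B0 x) auto
    have "(\<Sum>n<Suc p. (kop M a ^^ n) f x / fact n) = f x + (\<Sum>n<p. c n * kop M (kpow M a n) f x)"
      unfolding sum.lessThan_Suc_shift c_def
      by (simp add: kop_funpow(2)[OF f x, simplified] del: fact_Suc)
    then have "(f x + kop M (kexp M a 1) f x) - (\<Sum>n<Suc p. (kop M a ^^ n) f x / fact n)
       = (\<Sum>n. c (n + p) * kop M (kpow M a (n + p)) f x)"
      using suminf_minus_initial_segment[OF sums_summable[OF s], of p] sums_unique[OF s] by simp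
    also have "cmod \<dots> \<le> (\<Sum>n. cmod (c (n + p) * kop M (kpow M a (n + p)) f x))"
      by (rule summable_norm, rule summable_comparison_test[OF _ summable_mult2[OF sr, of p F]]) (use tb in auto)
    also have "\<dots> \<le> (\<Sum>n. cmod (c (n + p)) * B (n + p) * F)"
      by (intro suminf_le tb summable_mult2 sr, rule summable_comparison_test[OF _ summable_mult2[OF sr, of p F]]) (use tb in auto)
    also have "\<dots> = r p * F" unfolding r_def by (rule suminf_mult2[OF sr, symmetric])
    finally show ?thesis .
  qed
  have meas: "(\<lambda>x. (f x + kop M (kexp M a 1) f x) - (\<Sum>n<Suc p. (kop M a ^^ n) f x / fact n)) \<in> borel_measurable M" for p
  proof -
    have "(\<lambda>x. \<Sum>n<Suc p. inverse (fact n) * (kop M a ^^ n) f x) \<in> L2 M" by (intro L2_sum L2_cmult kop_funpow f)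
    then show ?thesis
      by (intro borel_measurable_diff borel_measurable_add L2_measurable f kop_L2 bker_kexp)
         (simp add: divide_inverse mult.commute)
  qed
  show "(\<lambda>p. l2_norm M (\<lambda>x. (f x + kop M (kexp M a 1) f x) - (\<Sum>n<Suc p. (kop M a ^^ n) f x / fact n))) \<longlonglongrightarrow> 0"
  proof (rule Lim_null_comparison[OF always_eventually])
    show "\<forall>p. norm (l2_norm M (\<lambda>x. (f x + kop M (kexp M a 1) f x) - (\<Sum>n<Suc p. (kop M a ^^ n) f x / fact n)))
        \<le> r p * F * sqrt \<mu>"
    proof
      fix p
      have "l2_norm M (\<lambda>x. (f x + kop M (kexp M a 1) f x) - (\<Sum>n<Suc p. (kop M a ^^ n) f x / fact n)) \<le> r p * F * sqrt \<mu>"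
        unfolding \<mu>_def by (rule l2_norm_bounded[OF meas ptw mult_nonneg_nonneg[OF rn F]])
      then show "norm (l2_norm M (\<lambda>x. (f x + kop M (kexp M a 1) f x) - (\<Sum>n<Suc p. (kop M a ^^ n) f x / fact n)))
        \<le> r p * F * sqrt \<mu>" by (simp only: real_norm_def abs_of_nonneg[OF l2_norm_nonneg])
    qed
    show "(\<lambda>p. r p * F * sqrt \<mu>) \<longlonglongrightarrow> 0"
      by (intro tendsto_mult_left_zero r0)
  qed
qed

text \<open>\<open>operator_exp\<close> is a choice among the L2-limits of the series, and two such
  limits differ on a null set only; hence the equality almost everywhere.\<close>

lemma operator_exp_kop:
  assumes f: "f \<in> L2 M"
  shows "operator_exp M (kop M a) f \<in> L2 M"
    and "AE x in M. operator_exp M (kop M a) f x = f x + kop M (kexp M a 1) f x"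
proof -
  define S where "S = (\<lambda>m x. \<Sum>n<m. (kop M a ^^ n) f x / fact n)"
  define g0 where "g0 = (\<lambda>x. f x + kop M (kexp M a 1) f x)"
  define g where "g = operator_exp M (kop M a) f"
  have g0L: "g0 \<in> L2 M" unfolding g0_def by (intro L2_add f kop_L2 bker_kexp)
  have SL: "S m \<in> L2 M" for m
  proof -
    have "(\<lambda>x. \<Sum>n<m. inverse (fact n) * (kop M a ^^ n) f x) \<in> L2 M" by (intro L2_sum L2_cmult kop_funpow(1) f)
    then show ?thesis unfolding S_def by (simp add: divide_inverse mult.commute)
  qed
  have g0: "(\<lambda>m. l2_norm M (\<lambda>x. g0 x - S m x)) \<longlonglongrightarrow> 0"
    unfolding g0_def S_def by (rule kop_exp_series_tendsto[OF f])
  have "\<exists>g. g \<in> L2 M \<and> (\<lambda>m. l2_norm M (\<lambda>x. g x - S m x)) \<longlonglongrightarrow> 0" using g0L g0 by blast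
  from someI_ex[OF this] have g: "g \<in> L2 M" "(\<lambda>m. l2_norm M (\<lambda>x. g x - S m x)) \<longlonglongrightarrow> 0"
    unfolding g_def operator_exp_def S_def by blast+
  have "l2_norm M (\<lambda>x. g x - g0 x) \<le> 0"
  proof (rule LIMSEQ_le_const[OF tendsto_add_zero[OF g(2) g0]], intro exI allI impI)
    fix m
    have "l2_norm M (\<lambda>x. (g x - S m x) + (S m x - g0 x)) \<le> l2_norm M (\<lambda>x. g x - S m x) + l2_norm M (\<lambda>x. S m x - g0 x)"
      by (intro l2_norm_triangle L2_diff g SL g0L)
    then show "l2_norm M (\<lambda>x. g x - g0 x) \<le> l2_norm M (\<lambda>x. g x - S m x) + l2_norm M (\<lambda>x. g0 x - S m x)"
      by (simp add: l2_norm_minus[of M "S m" g0])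
  qed
  then have "l2_norm M (\<lambda>x. g x - g0 x) = 0" using l2_norm_nonneg[of M "\<lambda>x. g x - g0 x"] by linarith
  then have "AE x in M. g x - g0 x = 0" using l2_norm_zero_iff[OF L2_diff[OF g(1) g0L]] by blast
  then show "AE x in M. operator_exp M (kop M a) f x = f x + kop M (kexp M a 1) f x"
    unfolding g_def[symmetric] by eventually_elim (simp add: g0_def)
  show "operator_exp M (kop M a) f \<in> L2 M" using g(1) unfolding g_def .
qed

definition det2_op :: "'a l2_op" where
  "det2_op = one_minus (kop M a) \<circ> operator_exp M (kop M a)"

lemma det2_op_L2: "f \<in> L2 M \<Longrightarrow> (\<lambda>x. det2_op f x - f x) \<in> L2 M"
  unfolding det2_op_def one_minus_def o_def
  by (intro L2_diff operator_exp_kop kop_L2 bker_a)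

lemma det2_op_AE:
  assumes f: "f \<in> L2 M"
  shows "AE x in M. det2_op f x - f x = kop M det2_kernel f x"
proof -
  define g where "g = operator_exp M (kop M a) f"
  define g0 where "g0 = (\<lambda>x. f x + kop M (kexp M a 1) f x)"
  have g: "g \<in> L2 M" "AE x in M. g x = g0 x"
    unfolding g_def g0_def by (rule operator_exp_kop[OF f])+
  have kL: "kop M (kexp M a 1) f \<in> L2 M" by (intro kop_L2 bker_kexp f)
  have g0L: "g0 \<in> L2 M" unfolding g0_def by (intro L2_add f kL)
  have "det2_op f x - f x = kop M det2_kernel f x" if x: "x \<in> space M" and gx: "g x = g0 x" for x
  proof -
    have "kop M a g x = kop M a g0 x" by (rule kop_cong_AE[OF g(1) g0L g(2) bker_a x])
    also have "\<dots> = kop M a f x + kop M a (kop M (kexp M a 1) f) x"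
      using kop_linear[OF bker_a f kL x, of 1 1] unfolding g0_def by simp
    also have "kop M a (kop M (kexp M a 1) f) x = kop M (kcomp M a (kexp M a 1)) f x"
      by (rule kop_kcomp[OF bker_a bker_kexp f x, symmetric])
    finally have "det2_op f x - f x = kop M (kexp M a 1) f x + (-1) * kop M a f x + (-1) * kop M (kcomp M a (kexp M a 1)) f x"
      unfolding det2_op_def one_minus_def o_def g_def[symmetric] using gx by (simp add: g0_def)
    also have "\<dots> = kop M (\<lambda>x y. kexp M a 1 x y + (-1) * a x y + (-1) * kcomp M a (kexp M a 1) x y) f x"
      by (simp only: kop_add bker_add bker_cmult bker_kcomp bker_a bker_kexp f x kop_cmult)
    also have "\<dots> = kop M det2_kernel f x"
      unfolding kop_def by (intro Bochner_Integration.integral_cong refl) (simp add: det2_kernel_eq[OF x])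
    finally show ?thesis .
  qed
  then show ?thesis using g(2) AE_space by (auto elim: eventually_elim2)
qed

text \<open>Up to null sets the operator is a product of two integral operators with bounded
  kernels, both Hilbert-Schmidt; the definition of \<open>det2_kernel\<close> as a composition is
  made for this.\<close>

lemma trace_class_det2_op: "trace_class M (\<lambda>f x. det2_op f x - f x)"
  unfolding trace_class_def
proof (intro conjI)
  let ?T = "\<lambda>f x. det2_op f x - f x"
  show "bounded_operator M ?T"
    unfolding bounded_operator_def
  proof (intro conjI ballI allI)
    show "?T f \<in> L2 M" if "f \<in> L2 M" for f by (rule det2_op_L2[OF that])
    fix f g c d assume f: "f \<in> L2 M" and g: "g \<in> L2 M"
    show "AE x in M. ?T (\<lambda>y. c * f y + d * g y) x = c * ?T f x + d * ?T g x"
      using det2_op_AE[OF L2_add[OF L2_cmult[OF f, of c] L2_cmult[OF g, of d]]] det2_op_AE[OF f] det2_op_AE[OF g] AE_space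
      by eventually_elim (simp only: kop_linear[OF bker_det2_kernel f g])
  next
    obtain K where K: "\<And>f. f \<in> L2 M \<Longrightarrow> l2_norm M (kop M det2_kernel f) \<le> K * l2_norm M f"
      using bker_det2_kernel by (rule kop_l2_norm_le) blast
    have "l2_norm M (?T f) = l2_norm M (kop M det2_kernel f)" if f: "f \<in> L2 M" for f
    proof -
      have "(LINT x|M. (cmod (?T f x))\<^sup>2) = (LINT x|M. (cmod (kop M det2_kernel f x))\<^sup>2)"
      proof (rule integral_cong_AE)
        show "(\<lambda>x. (cmod (?T f x))\<^sup>2) \<in> borel_measurable M"
          using L2_measurable[OF det2_op_L2[OF f]] by simp
        show "(\<lambda>x. (cmod (kop M det2_kernel f x))\<^sup>2) \<in> borel_measurable M"
          using L2_measurable[OF kop_L2[OF bker_det2_kernel f]] by simp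
        show "AE x in M. (cmod (?T f x))\<^sup>2 = (cmod (kop M det2_kernel f x))\<^sup>2"
          using det2_op_AE[OF f] by eventually_elim simp
      qed
      then show ?thesis unfolding l2_norm_def by simp
    qed
    then show "\<exists>C. \<forall>f\<in>L2 M. l2_norm M (?T f) \<le> C * l2_norm M f" using K by auto
  qed
  have b: "bker M (\<lambda>x y. kexp_rest M a 1 x y - kexp M a 1 x y)" by (intro bker_diff bker_kexp_rest bker_kexp)
  show "\<exists>A B. hilbert_schmidt M A \<and> hilbert_schmidt M B \<and> (\<forall>f\<in>L2 M. AE x in M. ?T f x = A (B f) x)"
  proof (intro exI conjI ballI)
    show "hilbert_schmidt M (kop M a)" by (rule hilbert_schmidt_kop[OF bker_a])
    show "hilbert_schmidt M (kop M (\<lambda>x y. kexp_rest M a 1 x y - kexp M a 1 x y))" by (rule hilbert_schmidt_kop[OF b])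
    fix f assume f: "f \<in> L2 M"
    show "AE x in M. ?T f x = kop M a (kop M (\<lambda>x y. kexp_rest M a 1 x y - kexp M a 1 x y) f) x"
      using det2_op_AE[OF f] AE_space
      by eventually_elim (simp only: det2_kernel_def kop_kcomp[OF bker_a b f])
  qed
qed

lemma det2_op_compressions:
  "Determinant.det (Matrix.mat n n (\<lambda>(i,j). l2_inner M (e i) (det2_op (e j))))
    = trunc_det2 n (kmat M e det2_kernel) * exp (\<Sum>i<n. kmat M e det2_kernel i i)"
proof -
  have "l2_inner M (e i) (det2_op (e j)) = of_bool (i = j) + kmat M e det2_kernel i j" for i j
  proof -
    have m: "(\<lambda>x. det2_op (e j) x) \<in> L2 M" using L2_add[OF det2_op_L2[OF basis_L2] basis_L2, of j j] by simp
    have "l2_inner M (e i) (det2_op (e j)) = l2_inner M (e i) (\<lambda>x. e j x + kop M det2_kernel (e j) x)"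
      unfolding l2_inner_def
      by (intro integral_cong_AE borel_measurable_times L2_measurable[OF m] L2_measurable[OF L2_cnj[OF basis_L2]]
          borel_measurable_add L2_measurable[OF basis_L2] L2_measurable[OF kop_L2[OF bker_det2_kernel basis_L2]])
         (use det2_op_AE[OF basis_L2, of j] in eventually_elim, simp add: algebra_simps)
    also have "\<dots> = l2_inner M (e i) (e j) + kmat M e det2_kernel i j"
      unfolding kmat_def by (rule l2_inner_add_right[OF basis_L2 basis_L2 kop_L2[OF bker_det2_kernel basis_L2]])
    finally show ?thesis by (simp add: orthonormal_basisD(2)[OF onb])
  qed
  then show ?thesis unfolding trunc_det2_def by (simp add: exp_minus)
qed

end

text \<open>The basis \<open>e0\<close> makes the limit unique: if there were no basis, the
  condition on all bases would hold for every number.\<close>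

theorem det2_one_minus_kop:
  assumes M: "finite_measure M" and a: "bker M a" and e0: "orthonormal_basis M e0"
    and d: "\<And>e. orthonormal_basis M e \<Longrightarrow> det2 (kmat M e (\<lambda>x y. - a x y)) = d"
  shows "det2_one_minus M (kop M a) = d"
proof -
  let ?B = "one_minus (kop M a) \<circ> operator_exp M (kop M a)"
  have loc: "l2_basis_kernel M e a" if "orthonormal_basis M e" for e
    using M a that by (simp add: l2_basis_kernel_def l2_basis_kernel_axioms_def l2_basis_def l2_basis_axioms_def)
  have lim: "(\<lambda>n. Determinant.det (Matrix.mat n n (\<lambda>(i, j). l2_inner M (e i) (?B (e j))))) \<longlonglongrightarrow> d"
    if e: "orthonormal_basis M e" for e
  proof -
    interpret l2_basis_kernel M e a by (rule loc[OF e])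
    show ?thesis
      using det_compressions_tendsto d[OF e] unfolding kdet_def det2_op_compressions[symmetric] det2_op_def by simp
  qed
  show ?thesis unfolding det2_one_minus_def fredholm_det_def
  proof (rule the_equality)
    interpret l2_basis_kernel M e0 a by (rule loc[OF e0])
    show "trace_class M (\<lambda>f x. ?B f x - f x) \<and> (\<forall>e. orthonormal_basis M e \<longrightarrow>
        (\<lambda>n. Determinant.det (Matrix.mat n n (\<lambda>(i, j). l2_inner M (e i) (?B (e j))))) \<longlonglongrightarrow> d)"
      using trace_class_det2_op lim unfolding det2_op_def by blast
  next
    fix d' assume "trace_class M (\<lambda>f x. ?B f x - f x) \<and> (\<forall>e. orthonormal_basis M e \<longrightarrow>
        (\<lambda>n. Determinant.det (Matrix.mat n n (\<lambda>(i, j). l2_inner M (e i) (?B (e j))))) \<longlonglongrightarrow> d')"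
    then have "(\<lambda>n. Determinant.det (Matrix.mat n n (\<lambda>(i, j). l2_inner M (e0 i) (?B (e0 j))))) \<longlonglongrightarrow> d'"
      using e0 by blast
    then show "d' = d" by (rule LIMSEQ_unique[OF _ lim[OF e0]])
  qed
qed

section \<open>Volterra kernels\<close>

context l2_basis
begin

lemma kdet_zero: "kdet (\<lambda>x y. 0) = 1"
proof -
  have "cmod (kdet (\<lambda>x y. 0) - 1) \<le> 2 * (0 * measure M (space M))\<^sup>2 * exp ((0 * measure M (space M) + 1)\<^sup>2 / 2)"
    by (rule kdet_quadratic_sup[OF bker_const]) auto
  then show ?thesis by simp
qed

text \<open>If A has square zero, the operators I + t A form a one-parameter group; hence
  \<open>D 1\<close> is the N-th power of D (1/N) = 1 + O(1/N^2).\<close>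

lemma kdet_square_zero:
  assumes n: "bker M n" and nn: "\<And>x y. x \<in> space M \<Longrightarrow> y \<in> space M \<Longrightarrow> kcomp M n n x y = 0" and tr: "ktr M n n = 0"
  shows "kdet n = 1"
proof -
  obtain C where C: "C \<ge> 0" "\<And>x y. x \<in> space M \<Longrightarrow> y \<in> space M \<Longrightarrow> cmod (n x y) \<le> C" using n by (rule bkerE) blast
  define m where "m = measure M (space M)"
  have m: "m \<ge> 0" unfolding m_def by simp
  define D where "D t = kdet (\<lambda>x y. t * n x y)" for t
  have add: "D (s + t) = D s * D t" for s t
  proof -
    have kc: "kcomp M (\<lambda>x y. s * n x y) (\<lambda>x y. t * n x y) = (\<lambda>x y. s * t * kcomp M n n x y)"
      unfolding kcomp_def by (simp add: mult_ac)
    have kt: "ktr M (\<lambda>x y. s * n x y) (\<lambda>x y. t * n x y) = s * t * ktr M n n"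
      unfolding ktr_def by (simp add: mult_ac)
    have "D (s + t) = kdet (\<lambda>x y. s * n x y + t * n x y + kcomp M (\<lambda>x y. s * n x y) (\<lambda>x y. t * n x y) x y)"
      unfolding D_def by (rule kdet_cong) (simp add: kc nn distrib_right)
    also have "\<dots> = D s * D t * exp (- (s * t * ktr M n n))"
      unfolding D_def kt[symmetric] by (rule kdet_mult) (intro bker_cmult n)+
    finally show ?thesis using tr by simp
  qed
  have pow: "D (of_nat (Suc k) * t) = D t ^ Suc k" for k t
  proof (induction k)
    case (Suc k)
    have "of_nat (Suc (Suc k)) * t = of_nat (Suc k) * t + t" by (simp add: algebra_simps)
    then have "D (of_nat (Suc (Suc k)) * t) = D (of_nat (Suc k) * t) * D t" by (simp only: add)
    then show ?case by (simp only: Suc.IH power_Suc2[of _ "Suc k"])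
  qed simp
  have "D 1 = 1"
  proof (rule prod_near_one_eq_one[where d="\<lambda>N j. D (1 / of_nat N)" and K="2 * (C * m)\<^sup>2 * exp ((C * m + 1)\<^sup>2 / 2)"])
    fix N :: nat assume N: "N \<ge> 1"
    then obtain k where k: "N = Suc k" by (cases N) auto
    have "D (of_nat (Suc k) * (1 / of_nat (Suc k))) = D (1 / of_nat (Suc k)) ^ Suc k" by (rule pow)
    moreover have "of_nat (Suc k) * (1 / of_nat (Suc k)) = (1 :: complex)" using of_nat_neq_0[of k] by (simp del: of_nat_Suc)
    ultimately show "D 1 = (\<Prod>j<N. D (1 / of_nat N))" unfolding k prod_constant card_lessThan by (simp only:)
    fix j
    have "cmod (D (1 / of_nat N) - 1) \<le> 2 * (C / real N * m)\<^sup>2 * exp ((C / real N * m + 1)\<^sup>2 / 2)"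
      unfolding D_def m_def
    proof (rule kdet_quadratic_sup)
      show "bker M (\<lambda>x y. 1 / of_nat N * n x y)" by (intro bker_cmult n)
      show "0 \<le> C / real N" using C(1) by simp
      show "cmod (1 / of_nat N * n x y) \<le> C / real N" if "x \<in> space M" "y \<in> space M" for x y
        using C(2)[OF that] by (simp add: norm_mult norm_divide divide_right_mono)
    qed
    also have "\<dots> \<le> 2 * (C / real N * m)\<^sup>2 * exp ((C * m + 1)\<^sup>2 / 2)"
    proof -
      have "C / real N \<le> C / 1" using N C(1) by (intro divide_left_mono) auto
      then have "C / real N * m \<le> C * m" using m by (intro mult_right_mono) auto
      then have "(C / real N * m + 1)\<^sup>2 \<le> (C * m + 1)\<^sup>2"
        using C(1) m by (intro power_mono add_mono) auto
      then show ?thesis by (intro mult_left_mono) auto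
    qed
    also have "\<dots> = 2 * (C * m)\<^sup>2 * exp ((C * m + 1)\<^sup>2 / 2) / (real N)\<^sup>2"
      by (simp add: power_mult_distrib power_divide)
    finally show "cmod (D (1 / of_nat N) - 1) \<le> 2 * (C * m)\<^sup>2 * exp ((C * m + 1)\<^sup>2 / 2) / (real N)\<^sup>2" .
  qed
  then show ?thesis unfolding D_def by simp
qed

definition blk :: "'a set \<Rightarrow> 'a set \<Rightarrow> ('a \<Rightarrow> 'a \<Rightarrow> complex) \<Rightarrow> 'a \<Rightarrow> 'a \<Rightarrow> complex" where
  "blk Q R a = (\<lambda>x y. if x \<in> Q \<and> y \<in> R then a x y else 0)"

lemma bker_blk:
  assumes a: "bker M a" and Q: "Q \<in> sets M" "R \<in> sets M"
  shows "bker M (blk Q R a)"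
proof -
  obtain C where C: "C \<ge> 0" "\<And>x y. x \<in> space M \<Longrightarrow> y \<in> space M \<Longrightarrow> cmod (a x y) \<le> C" using a by (rule bkerE) blast
  show ?thesis
  proof (rule bkerI)
    have "(\<lambda>p. indicator (Q \<times> R) p * (\<lambda>(x,y). a x y) p) \<in> borel_measurable (M \<Otimes>\<^sub>M M)"
      using Q by (intro borel_measurable_times bker_measurable a borel_measurable_indicator) auto
    moreover have "(\<lambda>p. indicator (Q \<times> R) p * (\<lambda>(x,y). a x y) p) = (\<lambda>(x,y). blk Q R a x y)"
      unfolding blk_def by (auto simp: fun_eq_iff indicator_def)
    ultimately show "(\<lambda>(x,y). blk Q R a x y) \<in> borel_measurable (M \<Otimes>\<^sub>M M)" by simp
    show "cmod (blk Q R a x y) \<le> C" if "x \<in> space M" "y \<in> space M" for x y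
      unfolding blk_def using C(1) C(2)[OF that] by simp
  qed
qed

lemma kcomp_eq_0:
  assumes "\<And>z. a x z * b z y = 0"
  shows "kcomp M a b x y = 0"
  unfolding kcomp_def assms by simp

lemma ktr_eq_0:
  assumes "\<And>x y. a x y * b y x = 0"
  shows "ktr M a b = 0"
  unfolding ktr_def assms by simp

lemma l2_norm_basis: "l2_norm M (e i) = 1"
proof -
  have "complex_of_real ((l2_norm M (e i))\<^sup>2) = complex_of_real 1"
    using l2_inner_self[of M "e i"] orthonormal_basisD(2)[OF onb, of i i] by simp
  then have "(l2_norm M (e i))\<^sup>2 = 1" by (simp only: of_real_eq_iff)
  then show ?thesis using real_sqrt_unique[of "l2_norm M (e i)" 1] by simp
qed

text \<open>A block triangular \<open>I + A\<close> factors as \<open>(I + A\<^sub>1\<^sub>1) (I + A\<^sub>2\<^sub>1) (I + A\<^sub>2\<^sub>2)\<close>, and the off-diagonal block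
  squares to zero.\<close>

lemma kdet_block_triangular:
  assumes a: "bker M a" and Q: "Q \<in> sets M" "R \<in> sets M" and disj: "Q \<inter> R = {}"
    and z: "\<And>x y. x \<in> Q \<Longrightarrow> y \<in> R \<Longrightarrow> a x y = 0"
  shows "kdet (blk (Q \<union> R) (Q \<union> R) a) = kdet (blk Q Q a) * kdet (blk R R a)"
proof -
  define p where "p = blk Q Q a"
  define n where "n = blk R Q a"
  define q where "q = blk R R a"
  have b: "bker M p" "bker M n" "bker M q" unfolding p_def n_def q_def by (intro bker_blk a Q)+
  have d: "x \<in> Q \<Longrightarrow> x \<notin> R" for x using disj by auto
  have kn: "kdet n = 1"
    by (rule kdet_square_zero[OF b(2)]) (auto intro!: kcomp_eq_0 ktr_eq_0 simp: n_def blk_def d)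
  have "kdet (\<lambda>x y. p x y + n x y + kcomp M p n x y) = kdet p * kdet n * exp (- ktr M p n)"
    by (rule kdet_mult[OF b(1,2)])
  moreover have kpn: "kcomp M p n x y = 0" for x y
    by (rule kcomp_eq_0) (auto simp: p_def n_def blk_def d)
  moreover have "ktr M p n = 0"
    by (rule ktr_eq_0) (auto simp: p_def n_def blk_def d)
  ultimately have pn: "kdet (\<lambda>x y. p x y + n x y) = kdet p" using kn by simp
  have "kdet (\<lambda>x y. (p x y + n x y) + q x y + kcomp M (\<lambda>x y. p x y + n x y) q x y)
      = kdet (\<lambda>x y. p x y + n x y) * kdet q * exp (- ktr M (\<lambda>x y. p x y + n x y) q)"
    by (rule kdet_mult[OF bker_add[OF b(1,2)] b(3)])
  moreover have "kcomp M (\<lambda>x y. p x y + n x y) q x y = 0" for x y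
    by (rule kcomp_eq_0) (auto simp: p_def n_def q_def blk_def d)
  moreover have "ktr M (\<lambda>x y. p x y + n x y) q = 0"
    by (rule ktr_eq_0) (auto simp: p_def n_def q_def blk_def d)
  moreover have "(\<lambda>x y. (p x y + n x y) + q x y + 0) = blk (Q \<union> R) (Q \<union> R) a"
    by (auto simp: fun_eq_iff p_def n_def q_def blk_def d z)
  ultimately show ?thesis using pn unfolding p_def q_def by simp
qed

lemma kdet_blocks:
  fixes Q :: "nat \<Rightarrow> 'a set"
  assumes a: "bker M a" and Q: "\<And>j. Q j \<in> sets M" and disj: "\<And>i j. i < j \<Longrightarrow> j < N \<Longrightarrow> Q i \<inter> Q j = {}"
    and z: "\<And>i j x y. i < j \<Longrightarrow> j < N \<Longrightarrow> x \<in> Q i \<Longrightarrow> y \<in> Q j \<Longrightarrow> a x y = 0" and n: "n \<le> N"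
  shows "kdet (blk (\<Union>j<n. Q j) (\<Union>j<n. Q j) a) = (\<Prod>j<n. kdet (blk (Q j) (Q j) a))"
  using n
proof (induction n)
  case 0
  have "blk {} {} a = (\<lambda>x y. 0)" unfolding blk_def by auto
  then show ?case using kdet_zero by simp
next
  case (Suc n)
  have U: "(\<Union>j<Suc n. Q j) = (\<Union>j<n. Q j) \<union> Q n" by (auto simp: less_Suc_eq)
  have "kdet (blk ((\<Union>j<n. Q j) \<union> Q n) ((\<Union>j<n. Q j) \<union> Q n) a)
      = kdet (blk (\<Union>j<n. Q j) (\<Union>j<n. Q j) a) * kdet (blk (Q n) (Q n) a)"
    by (rule kdet_block_triangular[OF a _ Q]) (use Q disj z Suc.prems in \<open>auto simp: Suc_le_eq, blast?\<close>)
  then show ?case using Suc unfolding U by simp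
qed

text \<open>For each \<open>N\<close> the determinant is the product over the diagonal blocks. A
  block of measure at most \<open>m / N\<close> has Hilbert-Schmidt norm O(1/N), hence determinant 1
  + O(1/N^2).\<close>

lemma kdet_triangular:
  assumes a: "bker M a" and Q: "\<And>N j. Q N j \<in> sets M"
    and cover: "\<And>N. N \<ge> 1 \<Longrightarrow> (\<Union>j<N. Q N j) = space M"
    and disj: "\<And>N i j. i < j \<Longrightarrow> j < N \<Longrightarrow> Q N i \<inter> Q N j = {}"
    and z: "\<And>N i j x y. i < j \<Longrightarrow> j < N \<Longrightarrow> x \<in> Q N i \<Longrightarrow> y \<in> Q N j \<Longrightarrow> a x y = 0"
    and small: "\<And>N j. N \<ge> 1 \<Longrightarrow> j < N \<Longrightarrow> measure M (Q N j) \<le> m / real N"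
  shows "kdet a = 1"
proof -
  obtain C where C: "C \<ge> 0" "\<And>x y. x \<in> space M \<Longrightarrow> y \<in> space M \<Longrightarrow> cmod (a x y) \<le> C" using a by (rule bkerE) blast
  show ?thesis
  proof (rule prod_near_one_eq_one[where d="\<lambda>N j. kdet (blk (Q N j) (Q N j) a)" and K="2 * (C * m)\<^sup>2 * exp ((C * m + 1)\<^sup>2 / 2)"])
    fix N :: nat assume N: "N \<ge> 1"
    have "kdet (blk (\<Union>j<N. Q N j) (\<Union>j<N. Q N j) a) = (\<Prod>j<N. kdet (blk (Q N j) (Q N j) a))"
      by (rule kdet_blocks[OF a Q disj z order.refl])
    moreover have "kdet (blk (space M) (space M) a) = kdet a"
      by (rule kdet_cong) (simp add: blk_def)
    ultimately show "kdet a = (\<Prod>j<N. kdet (blk (Q N j) (Q N j) a))" using cover[OF N] by simp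
    fix j assume j: "j < N"
    define q where "q = measure M (Q N j)"
    have q: "0 \<le> q" "q \<le> m / real N" unfolding q_def using small[OF N j] by auto
    have m: "m / real N \<le> m / 1" "m \<ge> 0"
    proof -
      have "0 \<le> m / real N" using q by linarith
      then show "m \<ge> 0" using N by (auto simp: zero_le_divide_iff)
      then show "m / real N \<le> m / 1" using N by (intro divide_left_mono) auto
    qed
    have "cmod (kdet (blk (Q N j) (Q N j) a) - 1) \<le> 2 * (C * q)\<^sup>2 * exp ((C * q + 1)\<^sup>2 / 2)"
      unfolding q_def by (rule kdet_quadratic[OF bker_blk[OF a Q Q] Q C(1)]) (use C in \<open>auto simp: blk_def\<close>)
    also have "\<dots> \<le> 2 * (C * (m / real N))\<^sup>2 * exp ((C * m + 1)\<^sup>2 / 2)"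
      using q C(1) m
      by (intro mult_mono power_mono exp_le_cancel_iff[THEN iffD2] divide_right_mono add_mono) auto
    also have "\<dots> = 2 * (C * m)\<^sup>2 * exp ((C * m + 1)\<^sup>2 / 2) / (real N)\<^sup>2"
      by (simp add: power_mult_distrib power_divide)
    finally show "cmod (kdet (blk (Q N j) (Q N j) a) - 1) \<le> 2 * (C * m)\<^sup>2 * exp ((C * m + 1)\<^sup>2 / 2) / (real N)\<^sup>2" .
  qed
qed

text \<open>A diagonal argument makes all coefficients in the basis converge. Finite expansions
  approximate \<open>g\<close>, and the bound \<open>D\<close> makes the error uniform along the
  sequence.\<close>

lemma weakly_convergent_subsequence:
  assumes f: "\<And>n. f n \<in> L2 M" and bd: "\<And>n. l2_norm M (f n) \<le> D"
  obtains r :: "nat \<Rightarrow> nat" where "strict_mono r" "\<And>g. g \<in> L2 M \<Longrightarrow> convergent (\<lambda>n. l2_inner M g (f (r n)))"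
proof -
  have D0: "D \<ge> 0" using bd[of 0] l2_norm_nonneg[of M "f 0"] by linarith
  have b: "norm (l2_inner M (e i) (f n)) \<le> D" for n i
    using l2_inner_le[OF basis_L2[of i] f[of n]] bd[of n] unfolding l2_norm_basis by simp
  obtain r where r: "strict_mono r" and rc: "\<And>i. i \<in> UNIV \<Longrightarrow> \<exists>l. (\<lambda>n. l2_inner M (e i) (f (r n))) \<longlonglongrightarrow> l"
    by (rule function_convergent_subsequence[of "UNIV :: nat set" "\<lambda>n i. l2_inner M (e i) (f n)" D])
       (auto intro: b)
  have "convergent (\<lambda>n. l2_inner M g (f (r n)))" if g: "g \<in> L2 M" for g
  proof -
    define G where "G p = (\<lambda>x. \<Sum>i<p. l2_inner M (e i) g * e i x)" for p
    have GL: "G p \<in> L2 M" for p unfolding G_def by (intro L2_sum L2_cmult basis_L2)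
    have G: "(\<lambda>p. l2_norm M (\<lambda>x. G p x - g x)) \<longlonglongrightarrow> 0"
      unfolding G_def by (rule orthonormal_expansion[OF onb g])
    have Gi: "l2_inner M (G p) h = (\<Sum>i<p. cnj (l2_inner M (e i) g) * l2_inner M (e i) h)" if h: "h \<in> L2 M" for p h
    proof -
      have "l2_inner M h (G p) = (\<Sum>i<p. l2_inner M (e i) g * l2_inner M h (e i))"
        unfolding G_def by (rule l2_inner_sum_right[OF h basis_L2])
      then have "cnj (l2_inner M h (G p)) = (\<Sum>i<p. cnj (l2_inner M (e i) g) * cnj (l2_inner M h (e i)))" by simp
      then show ?thesis by (simp only: l2_inner_commute[of M _ h])
    qed
    have cG: "Cauchy (\<lambda>n. l2_inner M (G p) (f (r n)))" for p
    proof -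
      have "convergent (\<lambda>n. \<Sum>i<p. cnj (l2_inner M (e i) g) * l2_inner M (e i) (f (r n)))"
        by (intro convergent_sum convergent_mult convergent_const) (use rc in \<open>auto simp: convergent_def\<close>)
      then show ?thesis unfolding Gi[OF f] by (rule convergent_Cauchy)
    qed
    have "Cauchy (\<lambda>n. l2_inner M g (f (r n)))"
    proof (rule metric_CauchyI)
      fix \<epsilon> :: real assume e: "\<epsilon> > 0"
      \<comment> \<open>The summand 1 keeps the divisor positive for \<open>D = 0\<close>.\<close>
      then have "\<epsilon> / (3 * (D + 1)) > 0" using D0 by simp
      from LIMSEQ_D[OF G this] obtain p where "\<forall>q\<ge>p. norm (l2_norm M (\<lambda>x. G q x - g x) - 0) < \<epsilon> / (3 * (D + 1))"
        by blast
      from this[rule_format, OF order.refl] have p: "l2_norm M (\<lambda>x. G p x - g x) < \<epsilon> / (3 * (D + 1))" by simp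
      have e3: "\<epsilon> / 3 > 0" using e by simp
      obtain N where N: "\<And>m n. m \<ge> N \<Longrightarrow> n \<ge> N \<Longrightarrow> dist (l2_inner M (G p) (f (r m))) (l2_inner M (G p) (f (r n))) < \<epsilon> / 3"
        using metric_CauchyD[OF cG[of p] e3] by blast
      have near: "cmod (l2_inner M (G p) (f (r n)) - l2_inner M g (f (r n))) < \<epsilon> / 3" for n
      proof -
        have "l2_inner M (G p) (f (r n)) - l2_inner M g (f (r n)) = cnj (l2_inner M (f (r n)) (\<lambda>x. G p x - g x))"
          by (simp add: l2_inner_diff_right f GL g l2_inner_commute[of M _ "f (r n)", symmetric])
        then have "cmod (l2_inner M (G p) (f (r n)) - l2_inner M g (f (r n))) \<le> l2_norm M (f (r n)) * l2_norm M (\<lambda>x. G p x - g x)"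
          using l2_inner_le[OF f L2_diff[OF GL g]] by simp
        also have "\<dots> \<le> D * (\<epsilon> / (3 * (D + 1)))"
          using bd p D0 by (intro mult_mono) auto
        also have "\<dots> = \<epsilon> / 3 * (D / (D + 1))" by simp
        also have "\<dots> < \<epsilon> / 3 * 1" using e D0 by (intro mult_strict_left_mono) auto
        finally show ?thesis by simp
      qed
      show "\<exists>N. \<forall>m\<ge>N. \<forall>n\<ge>N. dist (l2_inner M g (f (r m))) (l2_inner M g (f (r n))) < \<epsilon>"
      proof (intro exI[of _ N] allI impI)
        fix m n assume mn: "N \<le> m" "N \<le> n"
        define u where "u = (\<lambda>n. l2_inner M (G p) (f (r n)) - l2_inner M g (f (r n)))"
        define X where "X = l2_inner M (G p) (f (r m)) - l2_inner M (G p) (f (r n))"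
        have "l2_inner M g (f (r m)) - l2_inner M g (f (r n)) = X - u m + u n"
          unfolding u_def X_def by simp
        then have "dist (l2_inner M g (f (r m))) (l2_inner M g (f (r n)))
          \<le> dist (l2_inner M (G p) (f (r m))) (l2_inner M (G p) (f (r n))) + cmod (u m) + cmod (u n)"
          unfolding dist_norm X_def[symmetric]
          using norm_triangle_ineq[of "X - u m" "u n"] norm_triangle_ineq4[of X "u m"] by simp
        then show "dist (l2_inner M g (f (r m))) (l2_inner M g (f (r n))) < \<epsilon>"
          using near[of m] near[of n] N[OF mn] unfolding u_def by linarith
      qed
    qed
    then show ?thesis by (rule Cauchy_convergent)
  qed
  then show ?thesis by (rule that[OF r])
qed

text \<open>Weak convergence of \<open>f (r n)\<close> gives pointwise convergence of the images,
  since the value at \<open>x\<close> is a pairing with row \<open>x\<close>; the images are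
  uniformly bounded, so dominated convergence yields convergence in L2.\<close>

lemma compact_operator_kop:
  assumes a: "bker M a"
  shows "compact_operator M (kop M a)"
  unfolding compact_operator_def
proof (intro conjI allI impI bounded_operator_kop a)
  fix f :: "nat \<Rightarrow> 'a \<Rightarrow> complex" assume "(\<forall>n. f n \<in> L2 M) \<and> (\<exists>C. \<forall>n. l2_norm M (f n) \<le> C)"
  then obtain D where f: "\<And>n. f n \<in> L2 M" and D: "\<And>n. l2_norm M (f n) \<le> D" by blast
  obtain r :: "nat \<Rightarrow> nat" where r: "strict_mono r" and
    weak: "\<And>g. g \<in> L2 M \<Longrightarrow> convergent (\<lambda>n. l2_inner M g (f (r n)))"
    using weakly_convergent_subsequence[of f D] f D by blast
  obtain C where C: "C \<ge> 0" "\<And>x y. x \<in> space M \<Longrightarrow> y \<in> space M \<Longrightarrow> cmod (a x y) \<le> C" using a by (rule bkerE) blast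
  define m where "m = sqrt (measure M (space M))"
  define E where "E = C * (m * D)"
  define h where "h n = kop M a (f (r n))" for n
  define g where "g = (\<lambda>x. lim (\<lambda>n. h n x))"
  have hm: "h n \<in> borel_measurable M" for n unfolding h_def by (intro kop_measurable a L2_measurable f)
  have gm: "g \<in> borel_measurable M" unfolding g_def by (intro borel_measurable_lim_metric hm)
  have hb: "cmod (h n x) \<le> E" if x: "x \<in> space M" for n x
  proof -
    have "cmod (h n x) \<le> C * (LINT y|M. cmod (f (r n) y))"
      unfolding h_def by (rule kop_bound[OF a f C(2,1) x])
    also have "\<dots> \<le> C * (m * l2_norm M (f (r n)))"
      unfolding m_def by (intro mult_left_mono integral_norm_le_l2_norm f C)
    also have "\<dots> \<le> E" unfolding E_def using C(1) D[of "r n"] by (intro mult_left_mono) (auto simp: m_def)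
    finally show ?thesis .
  qed
  have lim: "(\<lambda>n. h n x) \<longlonglongrightarrow> g x" if x: "x \<in> space M" for x
    using weak[OF L2_cnj[OF bker_row_L2(1)[OF a x]]]
    unfolding g_def h_def kop_eq_inner convergent_LIMSEQ_iff .
  have gb: "cmod (g x) \<le> E" if x: "x \<in> space M" for x
    by (rule LIMSEQ_le_const2[OF tendsto_norm[OF lim[OF x]]]) (use hb[OF x] in blast)
  have "(\<lambda>n. LINT x|M. (cmod (h n x - g x))\<^sup>2) \<longlonglongrightarrow> (LINT x|M. 0)"
  proof (rule integral_dominated_convergence[where w="\<lambda>x. (E + E)\<^sup>2"])
    show "AE x in M. (\<lambda>n. (cmod (h n x - g x))\<^sup>2) \<longlonglongrightarrow> 0"
    proof (rule AE_I2)
      fix x assume x: "x \<in> space M"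
      have "(\<lambda>n. (cmod (h n x - g x))\<^sup>2) \<longlonglongrightarrow> (cmod (g x - g x))\<^sup>2"
        by (intro tendsto_power tendsto_norm tendsto_diff tendsto_const lim x)
      then show "(\<lambda>n. (cmod (h n x - g x))\<^sup>2) \<longlonglongrightarrow> 0" by simp
    qed
    show "AE x in M. norm ((cmod (h n x - g x))\<^sup>2) \<le> (E + E)\<^sup>2" for n
    proof (rule AE_I2)
      fix x assume x: "x \<in> space M"
      have "cmod (h n x - g x) \<le> E + E"
        using norm_triangle_ineq4[of "h n x" "g x"] hb[OF x, of n] gb[OF x] by linarith
      from power_mono[OF this norm_ge_zero, of 2]
      show "norm ((cmod (h n x - g x))\<^sup>2) \<le> (E + E)\<^sup>2" by (simp only: real_norm_def abs_power2)
    qed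
    show "(\<lambda>x. (cmod (h n x - g x))\<^sup>2) \<in> borel_measurable M" for n using hm[of n] gm by measurable
  qed auto
  then have "(\<lambda>n. LINT x|M. (cmod (h n x - g x))\<^sup>2) \<longlonglongrightarrow> 0" by simp
  from tendsto_real_sqrt[OF this] have "(\<lambda>n. l2_norm M (\<lambda>x. h n x - g x)) \<longlonglongrightarrow> 0"
    unfolding l2_norm_def by simp
  then show "\<exists>r g. strict_mono r \<and> g \<in> L2 M \<and> (\<lambda>n. l2_norm M (\<lambda>x. kop M a (f (r n)) x - g x)) \<longlonglongrightarrow> 0"
    using r L2_bounded[OF gm gb] unfolding h_def by blast
qed

text \<open>A bounded inverse would bound the norm 1 of \<open>e n\<close> by a constant times the
  norm of the image of \<open>e n\<close>, and the latter tends to 0 because the operator is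
  Hilbert-Schmidt.\<close>

lemma zero_in_spectrum:
  assumes a: "bker M a"
  shows "0 \<in> op_spectrum M (kop M a)"
  unfolding op_spectrum_def
proof (rule CollectI, rule notI)
  assume "\<exists>R. bounded_operator M R \<and> (\<forall>f\<in>L2 M. (AE x in M. R (\<lambda>y. 0 * f y - kop M a f y) x = f x) \<and>
                (AE x in M. 0 * R f x - kop M a (R f) x = f x))"
  then obtain R where R: "bounded_operator M R"
    "\<And>f. f \<in> L2 M \<Longrightarrow> AE x in M. R (\<lambda>y. 0 * f y - kop M a f y) x = f x" by blast
  obtain C where C: "\<And>f. f \<in> L2 M \<Longrightarrow> l2_norm M (R f) \<le> C * l2_norm M f"
    using R(1) unfolding bounded_operator_def by blast
  define g where "g n = (\<lambda>y. 0 * e n y - kop M a (e n) y)" for n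
  have gL: "g n \<in> L2 M" for n unfolding g_def by (intro L2_diff L2_cmult basis_L2 kop_L2 a)
  have RL: "R (g n) \<in> L2 M" for n using R(1) gL unfolding bounded_operator_def by blast
  have ge: "l2_norm M (g n) = l2_norm M (kop M a (e n))" for n
    unfolding g_def l2_norm_def by simp
  have e1: "(l2_norm M (e n))\<^sup>2 = 1" for n by (simp add: l2_norm_basis)
  have "1 \<le> (C * l2_norm M (kop M a (e n)))\<^sup>2" for n
  proof -
    have "(LINT x|M. (cmod (R (g n) x))\<^sup>2) = (LINT x|M. (cmod (e n x))\<^sup>2)"
    proof (rule integral_cong_AE)
      show "AE x in M. (cmod (R (g n) x))\<^sup>2 = (cmod (e n x))\<^sup>2"
        using R(2)[OF basis_L2, of n] unfolding g_def by eventually_elim simp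
    qed (use L2_measurable[OF RL] L2_measurable[OF basis_L2] in auto)
    then have "1 = (l2_norm M (R (g n)))\<^sup>2" using e1[of n] unfolding l2_norm_sq by simp
    also have "\<dots> \<le> (C * l2_norm M (kop M a (e n)))\<^sup>2"
      using C[OF gL, of n] unfolding ge by (intro power_mono) auto
    finally show ?thesis .
  qed
  note ge1 = this
  have lim: "(\<lambda>n. (C * l2_norm M (kop M a (e n)))\<^sup>2) \<longlonglongrightarrow> 0"
  proof -
    obtain D where D: "D \<ge> 0" "\<And>x y. x \<in> space M \<Longrightarrow> y \<in> space M \<Longrightarrow> cmod (a x y) \<le> D" using a by (rule bkerE) blast
    have "summable (\<lambda>n. (l2_norm M (kop M a (e n)))\<^sup>2)"
      by (rule summableI_nonneg_bounded[OF _ sum_l2_norm_kop_le[OF a sets.top D(1)]]) (use D in auto)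
    from tendsto_mult_right_zero[OF summable_LIMSEQ_zero[OF this], of "C\<^sup>2"]
    show ?thesis by (simp add: power_mult_distrib)
  qed
  have "1 \<le> (0::real)" by (rule LIMSEQ_le_const[OF lim]) (intro exI allI impI ge1)
  then show False by simp
qed

end

section \<open>Neumann series of the resolvent\<close>

context kernel_powers
begin

text \<open>Writes \<open>a\<close> itself as a series in its powers, so that composition with
  \<open>a\<close> on the right becomes a special case of \<open>kcomp_kseries\<close>.\<close>

lemma kseries_delta: "kseries M a (\<lambda>n. if n = 0 then 1 else 0) = a"
proof (intro ext)
  fix x y
  have "(\<lambda>n. (if n = 0 then 1 else 0) * kpow M a n x y) = (\<lambda>n. if n = 0 then a x y else 0)" by auto
  moreover have "(\<lambda>n. if n = 0 then a x y else 0) sums a x y" by (rule sums_single)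
  ultimately show "kseries M a (\<lambda>n. if n = 0 then 1 else 0) x y = a x y"
    unfolding kseries_def by (simp add: sums_iff)
qed

lemma kcomp_kseries_right:
  assumes c: "summable_coeff c" and xy: "x \<in> space M" "y \<in> space M"
  shows "(\<lambda>n. c n * kpow M a (Suc n) x y) sums kcomp M (kseries M a c) a x y"
proof -
  have d: "summable_coeff (\<lambda>n. if n = 0 then 1 else 0)"
    by (rule summable_comparison_test[of _ "\<lambda>n. if n = 0 then B 0 else 0"]) (auto simp: B0)
  have "(\<Sum>i\<le>k. c i * (if k - i = 0 then 1 else 0)) = c k" for k
  proof -
    have "(\<Sum>i\<le>k. c i * (if k - i = 0 then 1 else 0)) = (\<Sum>i\<le>k. if i = k then c i else 0)"
      by (intro sum.cong refl) auto
    then show ?thesis by simp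
  qed
  then show ?thesis using kcomp_kseries[OF c d xy] unfolding kseries_delta by simp
qed

text \<open>The resolvent is R = (I + S) / z with S the sum of A^(n+1) / z^(n+1). The equations z S
  = A + A S = A + S A make it a two-sided inverse.\<close>

lemma resolvent_not_spectrum:
  assumes z: "z \<noteq> 0" and c: "summable_coeff (\<lambda>n. 1 / z ^ Suc n)"
  shows "z \<notin> op_spectrum M (kop M a)"
proof -
  define S where "S = kseries M a (\<lambda>n. 1 / z ^ Suc n)"
  define R where "R = (\<lambda>f x. 1 / z * f x + 1 / z * kop M S f x)"
  have bS: "bker M S" unfolding S_def by (rule bker_kseries[OF c])
  have eqL: "z * S x y = a x y + kcomp M a S x y" and eqR: "z * S x y = a x y + kcomp M S a x y"
    if xy: "x \<in> space M" "y \<in> space M" for x y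
  proof -
    have "(\<lambda>n. 1 / z ^ Suc n * kpow M a n x y) sums S x y"
      unfolding S_def by (rule kseries_sums[OF c xy])
    from sums_mult[OF this, of z] have 1: "(\<lambda>n. 1 / z ^ n * kpow M a n x y) sums (z * S x y)"
      using z by (simp add: field_simps)
    have L: "(\<lambda>n. 1 / z ^ Suc n * kpow M a (Suc n) x y) sums kcomp M a S x y"
      unfolding S_def by (rule kcomp_kseries_left[OF c xy])
    have R: "(\<lambda>n. 1 / z ^ Suc n * kpow M a (Suc n) x y) sums kcomp M S a x y"
      unfolding S_def by (rule kcomp_kseries_right[OF c xy])
    show "z * S x y = a x y + kcomp M a S x y"
      using sums_unique2[OF 1 sums_Suc[of "\<lambda>n. 1 / z ^ n * kpow M a n x y", OF L]] by simp
    then show "z * S x y = a x y + kcomp M S a x y" using sums_unique2[OF L R] by simp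
  qed
  have kL: "z * kop M S f x = kop M a f x + kop M a (kop M S f) x"
    and kR: "z * kop M S f x = kop M a f x + kop M S (kop M a f) x" if f: "f \<in> L2 M" and x: "x \<in> space M" for f x
  proof -
    have "z * kop M S f x = kop M (\<lambda>x y. z * S x y) f x" by (simp add: kop_cmult)
    also have "\<dots> = kop M (\<lambda>x y. a x y + kcomp M a S x y) f x"
      unfolding kop_def by (intro Bochner_Integration.integral_cong refl) (simp add: eqL x)
    finally show "z * kop M S f x = kop M a f x + kop M a (kop M S f) x"
      by (simp add: kop_add[OF a bker_kcomp[OF a bS] f x] kop_kcomp[OF a bS f x])
    have "z * kop M S f x = kop M (\<lambda>x y. z * S x y) f x" by (simp add: kop_cmult)
    also have "\<dots> = kop M (\<lambda>x y. a x y + kcomp M S a x y) f x"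
      unfolding kop_def by (intro Bochner_Integration.integral_cong refl) (simp add: eqR x)
    finally show "z * kop M S f x = kop M a f x + kop M S (kop M a f) x"
      by (simp add: kop_add[OF a bker_kcomp[OF bS a] f x] kop_kcomp[OF bS a f x])
  qed
  have RL: "R f \<in> L2 M" if "f \<in> L2 M" for f
    unfolding R_def by (intro L2_add L2_cmult kop_L2 bS that)
  have "bounded_operator M R" unfolding bounded_operator_def
  proof (intro conjI ballI allI)
    show "R f \<in> L2 M" if "f \<in> L2 M" for f by (rule RL[OF that])
    fix f g u v assume fg: "f \<in> L2 M" "g \<in> L2 M"
    show "AE x in M. R (\<lambda>y. u * f y + v * g y) x = u * R f x + v * R g x"
      by (rule AE_I2) (simp add: R_def kop_linear[OF bS fg] add_divide_distrib distrib_left add_ac)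
  next
    obtain K where K: "\<And>f. f \<in> L2 M \<Longrightarrow> l2_norm M (kop M S f) \<le> K * l2_norm M f"
      using bS by (rule kop_l2_norm_le) blast
    have "l2_norm M (R f) \<le> (cmod (1 / z) + cmod (1 / z) * K) * l2_norm M f" if f: "f \<in> L2 M" for f
    proof -
      have "l2_norm M (R f) \<le> l2_norm M (\<lambda>x. 1 / z * f x) + l2_norm M (\<lambda>x. 1 / z * kop M S f x)"
        unfolding R_def by (intro l2_norm_triangle L2_cmult kop_L2 bS f)
      also have "\<dots> \<le> cmod (1 / z) * l2_norm M f + cmod (1 / z) * (K * l2_norm M f)"
        unfolding l2_norm_cmult by (intro add_mono mult_left_mono K f) auto
      finally show ?thesis by (simp add: algebra_simps)
    qed
    then show "\<exists>C. \<forall>f\<in>L2 M. l2_norm M (R f) \<le> C * l2_norm M f" by blast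
  qed
  moreover have "AE x in M. R (\<lambda>y. z * f y - kop M a f y) x = f x" if f: "f \<in> L2 M" for f
  proof (rule AE_I2)
    fix x assume x: "x \<in> space M"
    have "kop M S (\<lambda>y. z * f y - kop M a f y) x = z * kop M S f x - kop M S (kop M a f) x"
      using kop_linear[OF bS f kop_L2[OF a f] x, of z "-1"] by simp
    then show "R (\<lambda>y. z * f y - kop M a f y) x = f x"
      using kR[OF f x] z unfolding R_def by (simp add: field_simps)
  qed
  moreover have "AE x in M. z * R f x - kop M a (R f) x = f x" if f: "f \<in> L2 M" for f
  proof (rule AE_I2)
    fix x assume x: "x \<in> space M"
    have "kop M a (R f) x = 1 / z * kop M a f x + 1 / z * kop M a (kop M S f) x"
      unfolding R_def by (rule kop_linear[OF a f kop_L2[OF bS f] x])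
    then have "z * kop M a (R f) x = z * kop M S f x" using kL[OF f x] z by (simp add: field_simps)
    then have "kop M a (R f) x = kop M S f x" using z by simp
    then show "z * R f x - kop M a (R f) x = f x" using z unfolding R_def by (simp add: field_simps)
  qed
  ultimately show ?thesis unfolding op_spectrum_def by blast
qed

end

section \<open>The cosine basis of an interval\<close>

lemma borel_integrable_Icc:
  fixes f :: "real \<Rightarrow> 'a::euclidean_space"
  assumes "continuous_on {a..b} f"
  shows "integrable lborel (\<lambda>x. indicator {a<..<b} x *\<^sub>R f x)"
proof -
  have "set_integrable lborel {a..b} f" by (rule borel_integrable_atLeastAtMost') (rule assms)
  then have "set_integrable lborel {a<..<b} f" by (rule set_integrable_subset) auto
  then show ?thesis unfolding set_integrable_def .
qed

lemma integral_Ioo_FTC: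
  fixes f :: "real \<Rightarrow> 'a::euclidean_space"
  assumes ab: "a \<le> b" and F: "\<And>x. (F has_vector_derivative f x) (at x)" and f: "continuous_on {a..b} f"
  shows "(LINT x|lborel. indicator {a<..<b} x *\<^sub>R f x) = F b - F a"
proof -
  have "(LINT x|lborel. indicator {a<..<b} x *\<^sub>R f x) = (LINT x|lborel. indicator {a..b} x *\<^sub>R f x)"
  proof (rule integral_cong_AE)
    show "(\<lambda>x. indicator {a<..<b} x *\<^sub>R f x) \<in> borel_measurable lborel"
      by (rule borel_measurable_integrable[OF borel_integrable_Icc[OF f]])
    show "(\<lambda>x. indicator {a..b} x *\<^sub>R f x) \<in> borel_measurable lborel"
      using borel_integrable_atLeastAtMost'[OF f] unfolding set_integrable_def by (rule borel_measurable_integrable)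
    have "AE x in lborel. x \<noteq> a \<and> x \<noteq> b"
      using AE_lborel_singleton[of a] AE_lborel_singleton[of b] by eventually_elim simp
    then show "AE x in lborel. indicator {a<..<b} x *\<^sub>R f x = indicator {a..b} x *\<^sub>R f x"
      by eventually_elim (auto simp: indicator_def)
  qed
  also have "\<dots> = F b - F a"
    by (rule integral_FTC_Icc[OF ab has_vector_derivative_at_within[OF F] f])
  finally show ?thesis .
qed

lemma space_lborel_Ioo [simp]: "space (lborel_Ioo \<tau>) = {0<..<\<tau>}"
  by (simp add: space_restrict_space)

lemma finite_measure_lborel_Ioo: "finite_measure (lborel_Ioo \<tau>)"
  by (rule finite_measureI) (use emeasure_bounded_finite[of "{0<..<\<tau>}"] in \<open>simp add: emeasure_restrict_space\<close>)

lemma lborel_Ioo_integral: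
  fixes f :: "real \<Rightarrow> 'a::{banach, second_countable_topology}"
  shows "(LINT x|lborel_Ioo \<tau>. f x) = (LINT x|lborel. indicator {0<..<\<tau>} x *\<^sub>R f x)"
  by (rule integral_restrict_space) simp

lemma lborel_Ioo_FTC:
  fixes f :: "real \<Rightarrow> 'a::euclidean_space"
  assumes "0 \<le> \<tau>" "\<And>x. (F has_vector_derivative f x) (at x)" "continuous_on {0..\<tau>} f"
  shows "(LINT x|lborel_Ioo \<tau>. f x) = F \<tau> - F 0"
  unfolding lborel_Ioo_integral by (rule integral_Ioo_FTC[OF assms])

lemma measurable_lborel_Ioo:
  "f \<in> borel_measurable borel \<Longrightarrow> f \<in> borel_measurable (lborel_Ioo \<tau>)"
  by (rule measurable_restrict_space1) simp

lemma measure_lborel_Ioo: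
  assumes "A \<in> sets borel" "A \<subseteq> {0<..<\<tau>}"
  shows "measure (lborel_Ioo \<tau>) A = measure lborel A"
  using assms by (intro measure_restrict_space) auto

text \<open>Some orthonormal basis must be exhibited for the value of the determinant to be unique.
  Cosines are convenient: the cosine maps the rescaled interval injectively into [-1, 1], so
  completeness reduces to polynomial approximation.\<close>

definition cos_basis :: "real \<Rightarrow> nat \<Rightarrow> real \<Rightarrow> complex" where
  "cos_basis \<tau> n x = of_real (sqrt ((if n = 0 then 1 else 2) / \<tau>) * cos (real n * (pi * x / \<tau>)))"

lemma integral_cos:
  assumes t: "\<tau> > 0"
  shows "(LINT x|lborel_Ioo \<tau>. cos (of_int k * (pi * x / \<tau>))) = (if k = 0 then \<tau> else 0)"
proof (cases "k = 0")
  case True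
  then have "(LINT x|lborel_Ioo \<tau>. cos (of_int k * (pi * x / \<tau>))) = \<tau> - 0"
    using t by (intro lborel_Ioo_FTC[where F="\<lambda>x. x"]) (auto intro!: derivative_eq_intros simp: has_real_derivative_iff_has_vector_derivative[symmetric])
  then show ?thesis using True by simp
next
  case False
  define c where "c = of_int k * pi / \<tau>"
  have c: "c \<noteq> 0" using False t unfolding c_def by simp
  have e: "of_int k * (pi * x / \<tau>) = c * x" for x unfolding c_def by simp
  have "(LINT x|lborel_Ioo \<tau>. cos (c * x)) = sin (c * \<tau>) / c - sin (c * 0) / c"
    using t c
    by (intro lborel_Ioo_FTC[where F="\<lambda>x. sin (c * x) / c"])
       (auto intro!: derivative_eq_intros continuous_intros simp: has_real_derivative_iff_has_vector_derivative[symmetric])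
  moreover have "sin (c * \<tau>) = 0" using t unfolding c_def by (auto simp: sin_zero_iff_int2)
  ultimately show ?thesis unfolding e using False by simp
qed

lemma cos_basis_orthonormal:
  assumes t: "\<tau> > 0"
  shows "l2_inner (lborel_Ioo \<tau>) (cos_basis \<tau> m) (cos_basis \<tau> n) = (if m = n then 1 else 0)"
proof -
  define d where "d n = sqrt ((if n = 0 then 1 else 2) / \<tau>)" for n :: nat
  have int: "integrable (lborel_Ioo \<tau>) (\<lambda>x. cos (of_int k * (pi * x / \<tau>)))" for k :: int
  proof -
    interpret finite_measure "lborel_Ioo \<tau>" by (rule finite_measure_lborel_Ioo)
    show ?thesis
      by (rule integrable_const_bound[where B=1])
         (use t in \<open>auto intro!: measurable_lborel_Ioo borel_measurable_continuous_onI continuous_intros\<close>)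
  qed
  have "l2_inner (lborel_Ioo \<tau>) (cos_basis \<tau> m) (cos_basis \<tau> n)
     = (LINT x|lborel_Ioo \<tau>. complex_of_real (d m * d n / 2 * (cos (of_int (int m - int n) * (pi * x / \<tau>)) + cos (of_int (int m + int n) * (pi * x / \<tau>)))))"
    unfolding l2_inner_def cos_basis_def d_def[symmetric]
  proof (rule Bochner_Integration.integral_cong[OF refl])
    fix x
    define p where "p = pi * x / \<tau>"
    have "d m * cos (real m * p) * (d n * cos (real n * p)) = d m * d n * (cos (real m * p) * cos (real n * p))"
      by (simp add: mult_ac)
    also have "\<dots> = d m * d n / 2 * (cos (of_int (int m - int n) * p) + cos (of_int (int m + int n) * p))"
      by (simp add: cos_times_cos left_diff_distrib distrib_right)
    finally have e: "d m * cos (real m * p) * (d n * cos (real n * p))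
       = d m * d n / 2 * (cos (of_int (int m - int n) * p) + cos (of_int (int m + int n) * p))" .
    show "cnj (complex_of_real (d m * cos (real m * (pi * x / \<tau>)))) * complex_of_real (d n * cos (real n * (pi * x / \<tau>)))
       = complex_of_real (d m * d n / 2 * (cos (of_int (int m - int n) * (pi * x / \<tau>)) + cos (of_int (int m + int n) * (pi * x / \<tau>))))"
      unfolding p_def[symmetric] complex_cnj_complex_of_real of_real_mult[symmetric] e ..
  qed
  also have "\<dots> = complex_of_real (d m * d n / 2 * ((if int m - int n = 0 then \<tau> else 0) + (if int m + int n = 0 then \<tau> else 0)))"
    unfolding integral_complex_of_real integral_mult_right_zero
      Bochner_Integration.integral_add[OF int int] integral_cos[OF t] ..
  also have "\<dots> = (if m = n then 1 else 0)"
  proof (cases "m = n")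
    case True
    have "d m * d m = (if m = 0 then 1 else 2) / \<tau>" unfolding d_def using t by simp
    then show ?thesis using True t by auto
  qed auto
  finally show ?thesis .
qed

text \<open>The positive and negative parts of \<open>F\<close> are densities of measures that agree
  on half-lines, hence everywhere. So the two parts are equal almost everywhere, which forces both
  to vanish there.\<close>

lemma AE_zero_of_integrals_greaterThan:
  fixes F :: "real \<Rightarrow> real"
  assumes F: "integrable lborel F" and z: "\<And>c. (LINT x|lborel. indicator {c<..} x * F x) = 0"
  shows "AE x in lborel. F x = 0"
proof -
  have Fm: "F \<in> borel_measurable borel" using borel_measurable_integrable[OF F] by simp
  define P where "P = (\<lambda>x. max 0 (F x))"
  define N where "N = (\<lambda>x. max 0 (- F x))"
  have int: "integrable lborel P" "integrable lborel N" unfolding P_def N_def using F by auto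
  have inti: "integrable lborel (\<lambda>x. indicator {c<..} x * P x)" "integrable lborel (\<lambda>x. indicator {c<..} x * N x)" for c
    using integrable_mult_indicator[OF _ int(1), of "{c<..}"] integrable_mult_indicator[OF _ int(2), of "{c<..}"] by auto
  have em: "emeasure (density lborel (\<lambda>x. ennreal (G x))) {c<..} = ennreal (LINT x|lborel. indicator {c<..} x * G x)"
    if G: "integrable lborel (\<lambda>x. indicator {c<..} x * G x)" "\<And>x. 0 \<le> G x" "G \<in> borel_measurable borel" for G :: "real \<Rightarrow> real" and c
  proof -
    have "emeasure (density lborel (\<lambda>x. ennreal (G x))) {c<..} = (\<integral>\<^sup>+ x. ennreal (G x) * indicator {c<..} x \<partial>lborel)"
      using G(3) by (intro emeasure_density) simp_all
    also have "\<dots> = (\<integral>\<^sup>+ x. ennreal (indicator {c<..} x * G x) \<partial>lborel)"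
      by (intro nn_integral_cong) (auto simp: indicator_def)
    also have "\<dots> = ennreal (LINT x|lborel. indicator {c<..} x * G x)"
      by (intro nn_integral_eq_integral G) (auto intro!: AE_I2 mult_nonneg_nonneg G)
    finally show ?thesis .
  qed
  have meas: "P \<in> borel_measurable borel" "N \<in> borel_measurable borel" unfolding P_def N_def using Fm by auto
  have nn: "0 \<le> P x" "0 \<le> N x" for x unfolding P_def N_def by auto
  have "(LINT x|lborel. indicator {c<..} x * P x) = (LINT x|lborel. indicator {c<..} x * N x)" for c
  proof -
    have "(LINT x|lborel. indicator {c<..} x * P x) - (LINT x|lborel. indicator {c<..} x * N x)
       = (LINT x|lborel. indicator {c<..} x * P x - indicator {c<..} x * N x)"
      by (rule Bochner_Integration.integral_diff[OF inti, symmetric])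
    also have "\<dots> = (LINT x|lborel. indicator {c<..} x * F x)"
      by (intro Bochner_Integration.integral_cong refl) (auto simp: P_def N_def indicator_def)
    finally show ?thesis using z by simp
  qed
  then have "density lborel (\<lambda>x. ennreal (P x)) = density lborel (\<lambda>x. ennreal (N x))"
    by (intro measure_eqI_lessThan) (simp_all add: em[OF inti(1) nn(1) meas(1)] em[OF inti(2) nn(2) meas(2)])
  then have "AE x in lborel. ennreal (P x) = ennreal (N x)"
    using meas by (intro sigma_finite_measure.density_unique[OF lborel.sigma_finite_measure_axioms]) auto
  then show ?thesis
    by eventually_elim (auto simp: P_def N_def max_def split: if_splits)
qed

lemma cos_basis_L2: "cos_basis \<tau> n \<in> L2 (lborel_Ioo \<tau>)"
proof -
  interpret finite_measure "lborel_Ioo \<tau>" by (rule finite_measure_lborel_Ioo)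
  have "continuous_on UNIV (cos_basis \<tau> n)" unfolding cos_basis_def divide_inverse by (intro continuous_intros)
  then have "cos_basis \<tau> n \<in> borel_measurable borel" by (rule borel_measurable_continuous_onI)
  moreover have "cmod (cos_basis \<tau> n x) \<le> \<bar>sqrt ((if n = 0 then 1 else 2) / \<tau>)\<bar>" for x
    unfolding cos_basis_def norm_of_real abs_mult by (rule mult_left_le) auto
  ultimately show ?thesis by (intro L2_bounded measurable_lborel_Ioo)
qed

text \<open>A function orthogonal to all cosines is orthogonal to all powers of
  \<open>cos (\<theta> x)\<close>, hence by Weierstrass to every continuous function, and then to
  the indicators of half-lines, which are limits of continuous functions.\<close>

lemma cos_basis_complete:
  assumes t: "\<tau> > 0" and f: "f \<in> L2 (lborel_Ioo \<tau>)"
    and orth: "\<And>n. l2_inner (lborel_Ioo \<tau>) (cos_basis \<tau> n) f = 0"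
  shows "AE x in lborel_Ioo \<tau>. f x = 0"
proof -
  interpret finite_measure "lborel_Ioo \<tau>" by (rule finite_measure_lborel_Ioo)
  define \<theta> where "\<theta> = (\<lambda>x. pi * x / \<tau>)"
  have fi: "integrable (lborel_Ioo \<tau>) f" by (rule L2_integrable[OF f])
  have fm: "f \<in> borel_measurable (lborel_Ioo \<tau>)" by (rule L2_measurable[OF f])
  have int: "integrable (lborel_Ioo \<tau>) (\<lambda>x. complex_of_real (g x) * f x)"
    if g: "g \<in> borel_measurable borel" and b: "\<And>x. x \<in> {0<..<\<tau>} \<Longrightarrow> \<bar>g x\<bar> \<le> B" for g :: "real \<Rightarrow> real" and B
  proof (rule L2_integrable_mult[OF _ f])
    show "(\<lambda>x. complex_of_real (g x)) \<in> L2 (lborel_Ioo \<tau>)"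
      by (rule L2_bounded[where C=B]) (use g b in \<open>auto intro!: measurable_lborel_Ioo\<close>)
  qed
  have cm: "(\<lambda>x. cos (\<theta> x) ^ p * cos (real k * \<theta> x)) \<in> borel_measurable borel" for p k
    unfolding \<theta>_def by (intro borel_measurable_continuous_onI continuous_intros) (use t in auto)
  have cb: "\<bar>cos (\<theta> x) ^ p * cos (real k * \<theta> x)\<bar> \<le> 1" for p k x
    unfolding abs_mult power_abs by (intro mult_le_one power_le_one) auto
  have ci: "integrable (lborel_Ioo \<tau>) (\<lambda>x. complex_of_real (cos (\<theta> x) ^ p * cos (real k * \<theta> x)) * f x)" for p k
    by (rule int[OF cm cb])
  have J: "(LINT x|lborel_Ioo \<tau>. complex_of_real (cos (\<theta> x) ^ p * cos (real k * \<theta> x)) * f x) = 0" for p k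
  proof (induction p arbitrary: k)
    case 0
    define d where "d = sqrt ((if k = 0 then 1 else 2) / \<tau>)"
    have d: "d \<noteq> 0" using t unfolding d_def by auto
    have "0 = (LINT x|lborel_Ioo \<tau>. complex_of_real d * (complex_of_real (cos (real k * \<theta> x)) * f x))"
      using orth[of k] unfolding l2_inner_def cos_basis_def d_def \<theta>_def by (simp add: mult.assoc)
    then show ?case using d by simp
  next
    case (Suc p)
    have "complex_of_real (cos (\<theta> x) ^ Suc p * cos (real k * \<theta> x)) * f x
       = complex_of_real (1/2) * (complex_of_real (cos (\<theta> x) ^ p * cos (real (Suc k) * \<theta> x)) * f x
         + complex_of_real (cos (\<theta> x) ^ p * cos (real (if k = 0 then 1 else k - 1) * \<theta> x)) * f x)" for x
    proof -
      \<comment> \<open>For \<open>k = 0\<close> the index -1 is replaced by 1, the cosine being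
        even.\<close>
      have "cos (real (if k = 0 then 1 else k - 1) * \<theta> x) = cos (real k * \<theta> x - \<theta> x)"
        by (auto simp: of_nat_diff left_diff_distrib)
      then have "cos (\<theta> x) * cos (real k * \<theta> x) = 1/2 * (cos (real (Suc k) * \<theta> x) + cos (real (if k = 0 then 1 else k - 1) * \<theta> x))"
        by (simp only: cos_add cos_diff of_nat_Suc distrib_right mult_1_left)
           (simp add: algebra_simps)
      then have "cos (\<theta> x) ^ Suc p * cos (real k * \<theta> x)
         = 1/2 * (cos (\<theta> x) ^ p * cos (real (Suc k) * \<theta> x) + cos (\<theta> x) ^ p * cos (real (if k = 0 then 1 else k - 1) * \<theta> x))"
        by (simp only: power_Suc2 mult.assoc) (simp only: distrib_left mult_ac)
      then show ?thesis by (simp only: of_real_mult of_real_add distrib_left distrib_right mult.assoc)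
    qed
    then show ?case
      by (simp only: integral_mult_right_zero Bochner_Integration.integral_add[OF ci ci] Suc.IH) simp
  qed
  have cont: "(LINT x|lborel_Ioo \<tau>. complex_of_real (g x) * f x) = 0"
    if g: "continuous_on UNIV g" for g :: "real \<Rightarrow> real"
  proof -
    \<comment> \<open>The arc cosine transports \<open>g\<close> to [-1, 1], so that polynomials in
      \<open>cos (\<theta> x)\<close> approximate \<open>g\<close> uniformly on the
      interval.\<close>
    define h where "h u = g (\<tau> / pi * arccos u)" for u
    define nf where "nf = (LINT x|lborel_Ioo \<tau>. cmod (f x))"
    have nf: "nf \<ge> 0" unfolding nf_def by (rule Bochner_Integration.integral_nonneg) simp
    have hc: "continuous_on {-1..1} h" unfolding h_def
      by (rule continuous_on_compose2[OF g]) (auto intro!: continuous_intros)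
    have hcos: "h (cos (\<theta> x)) = g x" if "x \<in> {0<..<\<tau>}" for x
    proof -
      have "0 \<le> \<theta> x" "\<theta> x \<le> pi" using that t unfolding \<theta>_def by (auto simp: divide_simps)
      then show ?thesis unfolding h_def using t by (simp add: arccos_cos) (simp add: \<theta>_def)
    qed
    have gm: "g \<in> borel_measurable borel" using g by (rule borel_measurable_continuous_onI)
    have "compact (g ` {0..\<tau>})" using g by (intro compact_continuous_image) (auto intro: continuous_on_subset)
    then obtain Bg where Bg: "\<And>x. x \<in> {0..\<tau>} \<Longrightarrow> norm (g x) \<le> Bg"
      using compact_imp_bounded bounded_iff by (metis imageI)
    have gi: "integrable (lborel_Ioo \<tau>) (\<lambda>x. complex_of_real (g x) * f x)"
      by (rule int[OF gm, of Bg]) (use Bg in auto)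
    have "cmod (LINT x|lborel_Ioo \<tau>. complex_of_real (g x) * f x) \<le> \<epsilon> * nf" if e: "\<epsilon> > 0" for \<epsilon>
    proof -
      obtain p where p: "real_polynomial_function p" "\<And>x. x \<in> {-1..1} \<Longrightarrow> \<bar>h x - p x\<bar> < \<epsilon>"
        using Stone_Weierstrass_real_polynomial_function[OF compact_Icc hc e] by blast
      obtain b n where pb: "p = (\<lambda>x. \<Sum>i\<le>n. b i * x ^ i)"
        using p(1) unfolding real_polynomial_function_iff_sum by blast
      have c0: "integrable (lborel_Ioo \<tau>) (\<lambda>x. complex_of_real (cos (\<theta> x) ^ i) * f x)" for i
        using ci[of i 0] by simp
      have pe: "complex_of_real (p (cos (\<theta> x))) * f x = (\<Sum>i\<le>n. complex_of_real (b i) * (complex_of_real (cos (\<theta> x) ^ i) * f x))" for x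
        unfolding pb by (simp only: of_real_sum of_real_mult sum_distrib_right mult.assoc)
      have pi: "integrable (lborel_Ioo \<tau>) (\<lambda>x. complex_of_real (p (cos (\<theta> x))) * f x)"
        unfolding pe by (intro Bochner_Integration.integrable_sum integrable_mult_right c0)
      have "(LINT x|lborel_Ioo \<tau>. complex_of_real (p (cos (\<theta> x))) * f x)
          = (\<Sum>i\<le>n. LINT x|lborel_Ioo \<tau>. complex_of_real (b i) * (complex_of_real (cos (\<theta> x) ^ i) * f x))"
        unfolding pe by (intro Bochner_Integration.integral_sum integrable_mult_right c0)
      also have "\<dots> = 0" using J[of _ 0] by simp
      finally have p0: "(LINT x|lborel_Ioo \<tau>. complex_of_real (p (cos (\<theta> x))) * f x) = 0" .
      have "(LINT x|lborel_Ioo \<tau>. complex_of_real (g x) * f x)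
         = (LINT x|lborel_Ioo \<tau>. complex_of_real (g x) * f x - complex_of_real (p (cos (\<theta> x))) * f x)"
        unfolding Bochner_Integration.integral_diff[OF gi pi] p0 by simp
      also have "cmod \<dots> \<le> (LINT x|lborel_Ioo \<tau>. cmod (complex_of_real (g x) * f x - complex_of_real (p (cos (\<theta> x))) * f x))"
        by (rule integral_norm_bound)
      also have "\<dots> \<le> (LINT x|lborel_Ioo \<tau>. \<epsilon> * cmod (f x))"
      proof (rule integral_mono)
        show "integrable (lborel_Ioo \<tau>) (\<lambda>x. cmod (complex_of_real (g x) * f x - complex_of_real (p (cos (\<theta> x))) * f x))"
          by (intro integrable_norm Bochner_Integration.integrable_diff gi pi)
        show "integrable (lborel_Ioo \<tau>) (\<lambda>x. \<epsilon> * cmod (f x))" by (intro integrable_mult_right integrable_norm fi)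
        fix x assume "x \<in> space (lborel_Ioo \<tau>)"
        then have x: "x \<in> {0<..<\<tau>}" by simp
        have "cmod (complex_of_real (g x) * f x - complex_of_real (p (cos (\<theta> x))) * f x) = \<bar>h (cos (\<theta> x)) - p (cos (\<theta> x))\<bar> * cmod (f x)"
          unfolding hcos[OF x] left_diff_distrib[symmetric] of_real_diff[symmetric] norm_mult norm_of_real ..
        also have "\<dots> \<le> \<epsilon> * cmod (f x)"
          using p(2)[of "cos (\<theta> x)"] by (intro mult_right_mono) auto
        finally show "cmod (complex_of_real (g x) * f x - complex_of_real (p (cos (\<theta> x))) * f x) \<le> \<epsilon> * cmod (f x)" .
      qed
      also have "\<dots> = \<epsilon> * nf" unfolding nf_def by simp
      finally show ?thesis .
    qed
    then have le: "cmod (LINT x|lborel_Ioo \<tau>. complex_of_real (g x) * f x) \<le> \<epsilon> * nf" if "\<epsilon> > 0" for \<epsilon> using that by blast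
    have "cmod (LINT x|lborel_Ioo \<tau>. complex_of_real (g x) * f x) \<le> 0 + \<epsilon>" if "\<epsilon> > 0" for \<epsilon>
    proof -
      have "\<epsilon> / (nf + 1) > 0" using that nf by simp
      from le[OF this] have "cmod (LINT x|lborel_Ioo \<tau>. complex_of_real (g x) * f x) \<le> \<epsilon> * (nf / (nf + 1))" by simp
      also have "\<dots> \<le> \<epsilon> * 1" using that nf by (intro mult_left_mono) auto
      finally show ?thesis by simp
    qed
    then have "cmod (LINT x|lborel_Ioo \<tau>. complex_of_real (g x) * f x) \<le> 0" by (rule field_le_epsilon)
    then show ?thesis by simp
  qed
  have ind: "(LINT x|lborel_Ioo \<tau>. complex_of_real (indicator {c<..} x) * f x) = 0" for c
  proof -
    \<comment> \<open>Continuous ramps of slope \<open>n\<close> that converge pointwise to the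
      indicator.\<close>
    define g where "g n x = min 1 (max 0 (real n * (x - c)))" for n x
    have "(\<lambda>n. LINT x|lborel_Ioo \<tau>. complex_of_real (g n x) * f x)
       \<longlonglongrightarrow> (LINT x|lborel_Ioo \<tau>. complex_of_real (indicator {c<..} x) * f x)"
    proof (rule integral_dominated_convergence[where w="\<lambda>x. cmod (f x)"])
      have gc: "continuous_on UNIV (g n)" for n unfolding g_def by (intro continuous_intros)
      show "(\<lambda>x. complex_of_real (g n x) * f x) \<in> borel_measurable (lborel_Ioo \<tau>)" for n
        using measurable_lborel_Ioo[OF borel_measurable_continuous_onI[OF gc[of n]]] fm by measurable
      show "(\<lambda>x. complex_of_real (indicator {c<..} x) * f x) \<in> borel_measurable (lborel_Ioo \<tau>)"
        by (intro borel_measurable_times fm measurable_lborel_Ioo) measurable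
      show "integrable (lborel_Ioo \<tau>) (\<lambda>x. cmod (f x))" by (intro integrable_norm fi)
      have "(\<lambda>n. g n x) \<longlonglongrightarrow> indicator {c<..} x" for x
      proof (cases "x > c")
        case True
        obtain n0 where n0: "1 / (x - c) < real n0" using reals_Archimedean2 by blast
        have "g n x = 1" if "n \<ge> n0" for n
        proof -
          have "1 / (x - c) \<le> real n" using n0 that by linarith
          then have "1 \<le> real n * (x - c)" using True by (simp add: divide_le_eq)
          then show ?thesis unfolding g_def by simp
        qed
        then have "eventually (\<lambda>n. g n x = 1) sequentially" unfolding eventually_sequentially by blast
        then show ?thesis using True by (simp add: tendsto_eventually)
      next
        case False
        then have "real n * (x - c) \<le> 0" for n by (intro mult_nonneg_nonpos) auto
        then have "g n x = 0" for n unfolding g_def by (simp only: max_absorb1)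
        then show ?thesis using False by simp
      qed
      then show "AE x in lborel_Ioo \<tau>. (\<lambda>n. complex_of_real (g n x) * f x) \<longlonglongrightarrow> complex_of_real (indicator {c<..} x) * f x"
        by (intro AE_I2 tendsto_mult tendsto_of_real tendsto_const)
      show "AE x in lborel_Ioo \<tau>. norm (complex_of_real (g n x) * f x) \<le> cmod (f x)" for n
        by (rule AE_I2) (auto simp: norm_mult g_def intro!: mult_left_le_one_le)
    qed
    moreover have "(LINT x|lborel_Ioo \<tau>. complex_of_real (g n x) * f x) = 0" for n
      by (rule cont) (unfold g_def, intro continuous_intros)
    ultimately show ?thesis by (simp add: LIMSEQ_const_iff)
  qed
  define F where "F = (\<lambda>x. indicator {0<..<\<tau>} x *\<^sub>R f x)"
  have Fi: "integrable lborel F"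
    unfolding F_def using fi integrable_restrict_space[of "{0<..<\<tau>}" lborel f] by (simp add: set_integrable_def)
  have Fz: "(LINT x|lborel. indicator {c<..} x *\<^sub>R F x) = 0" for c
    using ind[of c] unfolding lborel_Ioo_integral F_def
    by (simp add: scaleR_conv_of_real mult_ac)
  have Fci: "integrable lborel (\<lambda>x. indicator {c<..} x *\<^sub>R F x)" for c
    by (rule integrable_mult_indicator[OF _ Fi]) simp
  have "AE x in lborel. Re (F x) = 0"
  proof (rule AE_zero_of_integrals_greaterThan)
    show "integrable lborel (\<lambda>x. Re (F x))" using Fi by simp
    show "(LINT x|lborel. indicator {c<..} x * Re (F x)) = 0" for c
      using integral_Re[OF Fci[of c]] unfolding Fz by simp
  qed
  moreover have "AE x in lborel. Im (F x) = 0"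
  proof (rule AE_zero_of_integrals_greaterThan)
    show "integrable lborel (\<lambda>x. Im (F x))" using Fi by simp
    show "(LINT x|lborel. indicator {c<..} x * Im (F x)) = 0" for c
      using integral_Im[OF Fci[of c]] unfolding Fz by simp
  qed
  ultimately have "AE x in lborel. x \<in> {0<..<\<tau>} \<longrightarrow> f x = 0"
    by eventually_elim (auto simp: F_def complex_eq_iff)
  then show ?thesis by (subst AE_restrict_space_iff) auto
qed

theorem orthonormal_basis_cos_basis:
  "\<tau> > 0 \<Longrightarrow> orthonormal_basis (lborel_Ioo \<tau>) (cos_basis \<tau>)"
  unfolding orthonormal_basis_def
  using cos_basis_L2 cos_basis_orthonormal cos_basis_complete by auto

section \<open>Partial fractions and subset expansions\<close>

text \<open>Lagrange interpolation of \<open>h\<close> at the nodes \<open>z n\<close>, divided by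
  the node polynomial. It is applied to numerators that vanish at all poles but one.\<close>

lemma lagrange_partial_fractions:
  fixes z :: "'a \<Rightarrow> complex" and h :: "complex poly"
  assumes T: "finite T" and inj: "inj_on z T" and deg: "degree h < card T" and x: "x \<notin> z ` T"
  shows "(\<Sum>n\<in>T. poly h (z n) / (\<Prod>l\<in>T-{n}. z n - z l) / (x - z n)) = poly h x / (\<Prod>n\<in>T. x - z n)"
proof -
  define D where "D n = (\<Prod>l\<in>T-{n}. z n - z l)" for n
  define L where "L n = (\<Prod>l\<in>T-{n}. [:- z l, 1:])" for n
  define q where "q = (\<Sum>n\<in>T. Polynomial.smult (poly h (z n) / D n) (L n))"
  have pL: "poly (L n) y = (\<Prod>l\<in>T-{n}. y - z l)" for n y
    unfolding L_def by (simp add: poly_prod algebra_simps)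
  have D0: "D n \<noteq> 0" if "n \<in> T" for n
    unfolding D_def using T inj that by (auto dest: inj_onD)
  have "h = q"
  proof (rule poly_eqI_degree[where A="z ` T"])
    fix y assume "y \<in> z ` T"
    then obtain n where n: "n \<in> T" "y = z n" by blast
    have "poly q y = (\<Sum>m\<in>T. poly h (z m) / D m * (\<Prod>l\<in>T-{m}. z n - z l))"
      unfolding q_def by (simp add: poly_sum pL n)
    also have "\<dots> = (\<Sum>m\<in>{n}. poly h (z m) / D m * (\<Prod>l\<in>T-{m}. z n - z l))"
    proof (rule sum.mono_neutral_right[OF T])
      show "\<forall>m\<in>T - {n}. poly h (z m) / D m * (\<Prod>l\<in>T-{m}. z n - z l) = 0"
      proof
        fix m assume "m \<in> T - {n}"
        then have "(\<Prod>l\<in>T-{m}. z n - z l) = 0" using n T by (intro prod_zero) auto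
        then show "poly h (z m) / D m * (\<Prod>l\<in>T-{m}. z n - z l) = 0" by simp
      qed
    qed (use n in auto)
    also have "\<dots> = poly h y" using D0[OF n(1)] n(2) unfolding D_def by simp
    finally show "poly h y = poly q y" ..
  next
    show "degree h < card (z ` T)" using deg inj by (simp add: card_image)
    have "degree (L n) \<le> card T - 1" if "n \<in> T" for n
    proof -
      have "degree (L n) \<le> sum (degree \<circ> (\<lambda>l. [:- z l, 1:])) (T-{n})"
        unfolding L_def by (rule degree_prod_sum_le) (use T in auto)
      then show ?thesis using that T by simp
    qed
    then have "degree q \<le> card T - 1"
      unfolding q_def by (intro degree_sum_le T) (auto intro: order_trans[OF degree_smult_le])
    then show "degree q < card (z ` T)" using deg inj by (simp add: card_image)
  qed
  then have "poly h x = poly q x" by (rule arg_cong)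
  also have "\<dots> = (\<Sum>n\<in>T. poly h (z n) / D n * (\<Prod>l\<in>T-{n}. x - z l))"
    unfolding q_def by (simp add: poly_sum pL)
  also have "\<dots> = (\<Sum>n\<in>T. poly h (z n) / D n / (x - z n) * (\<Prod>l\<in>T. x - z l))"
  proof (rule sum.cong[OF refl])
    fix n assume n: "n \<in> T"
    have "x - z n \<noteq> 0" using x n by auto
    moreover have "(\<Prod>l\<in>T. x - z l) = (x - z n) * (\<Prod>l\<in>T-{n}. x - z l)" by (rule prod.remove[OF T n])
    ultimately show "poly h (z n) / D n * (\<Prod>l\<in>T-{n}. x - z l) = poly h (z n) / D n / (x - z n) * (\<Prod>l\<in>T. x - z l)"
      by simp
  qed
  finally have "poly h x = (\<Sum>n\<in>T. poly h (z n) / D n / (x - z n)) * (\<Prod>l\<in>T. x - z l)"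
    by (simp only: sum_distrib_right)
  moreover have "(\<Prod>l\<in>T. x - z l) \<noteq> 0" using x T by auto
  ultimately show ?thesis unfolding D_def by simp
qed

section \<open>Weighted Gram determinants\<close>

lemma det_mat_sum:
  fixes a :: "nat \<Rightarrow> nat \<Rightarrow> complex"
  shows "Determinant.det (Matrix.mat n n (\<lambda>(i,j). a i j)) =
     (\<Sum>p\<in>{p. p permutes {0..<n}}. signof p * (\<Prod>i=0..<n. a i (p i)))"
  unfolding det_def by (auto simp: permutes_def intro!: sum.cong prod.cong)

lemma det_scale_rows:
  fixes a :: "nat \<Rightarrow> nat \<Rightarrow> complex"
  shows "Determinant.det (Matrix.mat n n (\<lambda>(i,j). c i * a i j)) =
    (\<Prod>i<n. c i) * Determinant.det (Matrix.mat n n (\<lambda>(i,j). a i j))"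
  unfolding det_mat_sum by (simp add: prod.distrib sum_distrib_left lessThan_atLeast0 mult_ac)

text \<open>The coefficient of \<open>\<Prod>\<^sub>n\<^sub>\<in>\<^sub>T w n\<close> in \<open>det (\<Sum>\<^sub>n w n X\<^sub>n X\<^sub>n\<^sup>T)\<close>; by Cauchy--Binet it is the square of a
  minor, but it is evaluated below by choosing weights that make the matrix diagonal.\<close>

definition gram_coeff :: "nat \<Rightarrow> ('a \<Rightarrow> nat \<Rightarrow> complex) \<Rightarrow> 'a set \<Rightarrow> complex" where
  "gram_coeff M X T = (\<Sum>g\<in>{g \<in> {0..<M} \<rightarrow>\<^sub>E T. inj_on g {0..<M} \<and> g ` {0..<M} = T}.
     (\<Prod>i=0..<M. X (g i) i) * Determinant.det (Matrix.mat M M (\<lambda>(i,j). X (g i) j)))"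

text \<open>Expanding the determinant row by row assigns an index \<open>g i\<close> to each row.
  Assignments that repeat an index give two equal rows; the injective ones are grouped by their
  image.\<close>

lemma det_weighted_gram:
  fixes X :: "'a \<Rightarrow> nat \<Rightarrow> complex"
  assumes I: "finite I"
  shows "Determinant.det (Matrix.mat M M (\<lambda>(i,j). \<Sum>n\<in>I. w n * X n i * X n j))
    = (\<Sum>T | T \<subseteq> I \<and> card T = M. (\<Prod>n\<in>T. w n) * gram_coeff M X T)"
proof -
  define W where "W g = (\<Prod>i=0..<M. w (g i) * X (g i) i)" for g
  define d where "d g = Determinant.det (Matrix.mat M M (\<lambda>(i,j). X (g i) j))" for g
  let ?G = "{0..<M} \<rightarrow>\<^sub>E I"
  have finG: "finite ?G" using I by (intro finite_PiE) auto
  have "Determinant.det (Matrix.mat M M (\<lambda>(i,j). \<Sum>n\<in>I. w n * X n i * X n j))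
     = (\<Sum>p\<in>{p. p permutes {0..<M}}. signof p * (\<Sum>g\<in>?G. \<Prod>i=0..<M. w (g i) * X (g i) i * X (g i) (p i)))"
    unfolding det_mat_sum by (subst prod_sum_PiE) (use I in auto)
  also have "\<dots> = (\<Sum>g\<in>?G. \<Sum>p\<in>{p. p permutes {0..<M}}. W g * (signof p * (\<Prod>i=0..<M. X (g i) (p i))))"
    unfolding W_def sum_distrib_left
    by (subst sum.swap) (simp add: prod.distrib mult_ac)
  also have "\<dots> = (\<Sum>g\<in>?G. W g * d g)"
    unfolding d_def det_mat_sum by (simp only: sum_distrib_left)
  also have "\<dots> = (\<Sum>g\<in>{g\<in>?G. inj_on g {0..<M}}. W g * d g)"
  proof (rule sum.mono_neutral_right[OF finG])
    show "\<forall>g\<in>?G - {g \<in> ?G. inj_on g {0..<M}}. W g * d g = 0"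
    proof
      fix g assume "g \<in> ?G - {g \<in> ?G. inj_on g {0..<M}}"
      then obtain i j where ij: "i < M" "j < M" "i \<noteq> j" "g i = g j" unfolding inj_on_def by auto
      have "d g = 0" unfolding d_def
        by (rule det_identical_rows[of _ M i j]) (use ij in \<open>auto intro!: eq_vecI\<close>)
      then show "W g * d g = 0" by simp
    qed
  qed auto
  also have "\<dots> = (\<Sum>T\<in>{T. T \<subseteq> I \<and> card T = M}. \<Sum>g\<in>{g\<in>{g\<in>?G. inj_on g {0..<M}}. g ` {0..<M} = T}. W g * d g)"
    by (rule sum.group[symmetric]) (use finG I in \<open>auto simp: card_image\<close>)
  also have "\<dots> = (\<Sum>T | T \<subseteq> I \<and> card T = M. (\<Prod>n\<in>T. w n) * gram_coeff M X T)"
  proof (rule sum.cong[OF refl])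
    fix T assume T: "T \<in> {T. T \<subseteq> I \<and> card T = M}"
    have S: "{g\<in>{g\<in>?G. inj_on g {0..<M}}. g ` {0..<M} = T} = {g \<in> {0..<M} \<rightarrow>\<^sub>E T. inj_on g {0..<M} \<and> g ` {0..<M} = T}"
      using T by (auto simp: PiE_iff)
    have "W g = (\<Prod>n\<in>T. w n) * (\<Prod>i=0..<M. X (g i) i)" if "inj_on g {0..<M}" "g ` {0..<M} = T" for g
    proof -
      have "(\<Prod>n\<in>T. w n) = (\<Prod>i=0..<M. w (g i))" using prod.reindex[OF that(1), of w] that(2) by simp
      then show ?thesis unfolding W_def by (simp add: prod.distrib)
    qed
    then show "(\<Sum>g\<in>{g\<in>{g\<in>?G. inj_on g {0..<M}}. g ` {0..<M} = T}. W g * d g) = (\<Prod>n\<in>T. w n) * gram_coeff M X T"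
      unfolding S gram_coeff_def sum_distrib_left d_def by (intro sum.cong refl) (auto simp: mult_ac)
  qed
  finally show ?thesis .
qed

text \<open>With these weights each matrix entry is a Lagrange sum: entry (i, j) is minus the value
  at \<open>p j\<close> of a polynomial with zeros at all \<open>p k\<close>, k distinct from i,
  over the node polynomial. The matrix is thus diagonal, and since \<open>T\<close> is its own only
  subset of cardinality \<open>M\<close>, the expansion consists of the single term wanted.\<close>

lemma gram_coeff_cauchy:
  fixes z :: "'a \<Rightarrow> complex" and p :: "nat \<Rightarrow> complex"
  assumes T: "finite T" "card T = M" and z: "inj_on z T" and p: "inj_on p {..<M}"
    and zp: "\<And>n m. n \<in> T \<Longrightarrow> m < M \<Longrightarrow> z n \<noteq> p m"
  shows "(\<Prod>n\<in>T. (\<Prod>m<M. z n - p m) / (\<Prod>l\<in>T-{n}. z n - z l)) * gram_coeff M (\<lambda>n m. 1 / (z n - p m)) T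
    = (\<Prod>m<M. - (\<Prod>k\<in>{..<M}-{m}. p m - p k) / (\<Prod>n\<in>T. p m - z n))"
proof -
  define d where "d n = (\<Prod>m<M. z n - p m) / (\<Prod>l\<in>T-{n}. z n - z l)" for n
  define c where "c m = - (\<Prod>k\<in>{..<M}-{m}. p m - p k) / (\<Prod>n\<in>T. p m - z n)" for m
  have entry: "(\<Sum>n\<in>T. d n * (1 / (z n - p i)) * (1 / (z n - p j))) = (if i = j then c i else 0)" if ij: "i < M" "j < M" for i j
  proof -
    define h where "h = (\<Prod>k\<in>{..<M}-{i}. [:- p k, 1:])"
    have ph: "poly h y = (\<Prod>k\<in>{..<M}-{i}. y - p k)" for y unfolding h_def by (simp add: poly_prod algebra_simps)
    have dh: "degree h < card T"
    proof -
      have "degree h \<le> sum (degree \<circ> (\<lambda>k. [:- p k, 1:])) ({..<M}-{i})"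
        unfolding h_def by (rule degree_prod_sum_le) auto
      then show ?thesis using T ij by simp
    qed
    have pj: "p j \<notin> z ` T" using zp ij by fastforce
    have "(\<Sum>n\<in>T. d n * (1 / (z n - p i)) * (1 / (z n - p j))) = - (\<Sum>n\<in>T. poly h (z n) / (\<Prod>l\<in>T-{n}. z n - z l) / (p j - z n))"
      unfolding sum_negf[symmetric]
    proof (rule sum.cong[OF refl])
      fix n assume n: "n \<in> T"
      have "(\<Prod>m<M. z n - p m) = (z n - p i) * poly h (z n)" unfolding ph using ij by (intro prod.remove) auto
      moreover have "z n - p i \<noteq> 0" using zp[OF n ij(1)] by simp
      ultimately have "d n * (1 / (z n - p i)) = poly h (z n) / (\<Prod>l\<in>T-{n}. z n - z l)" unfolding d_def by simp
      moreover have "1 / (z n - p j) = - (1 / (p j - z n))" by (metis minus_diff_eq minus_divide_right)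
      ultimately show "d n * (1 / (z n - p i)) * (1 / (z n - p j)) = - (poly h (z n) / (\<Prod>l\<in>T-{n}. z n - z l) / (p j - z n))"
        by simp
    qed
    also have "\<dots> = - (poly h (p j) / (\<Prod>n\<in>T. p j - z n))"
      by (simp only: lagrange_partial_fractions[OF T(1) z dh pj])
    also have "\<dots> = (if i = j then c i else 0)"
    proof (cases "i = j")
      case False
      then have "poly h (p j) = 0" unfolding ph using ij by (intro prod_zero) auto
      then show ?thesis using False by simp
    qed (simp add: c_def ph)
    finally show ?thesis .
  qed
  have "Determinant.det (Matrix.mat M M (\<lambda>(i,j). \<Sum>n\<in>T. d n * (1 / (z n - p i)) * (1 / (z n - p j)))) = (\<Prod>m<M. c m)"
  proof -
    define E where "E i j = (\<Sum>n\<in>T. d n * (1 / (z n - p i)) * (1 / (z n - p j)))" for i j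
    have E: "E i j = (if i = j then c i else 0)" if "i < M" "j < M" for i j
      unfolding E_def by (rule entry[OF that])
    have "Determinant.det (Matrix.mat M M (\<lambda>(i,j). E i j)) = prod_list (diag_mat (Matrix.mat M M (\<lambda>(i,j). E i j)))"
      by (rule det_upper_triangular) (auto simp: upper_triangular_def E)
    also have "\<dots> = (\<Prod>m<M. c m)" by (simp add: prod_list_diag_prod lessThan_atLeast0 E)
    finally have "Determinant.det (Matrix.mat M M (\<lambda>(i,j). E i j)) = (\<Prod>m<M. c m)" .
    then show ?thesis unfolding E_def .
  qed
  moreover have S: "{T'. T' \<subseteq> T \<and> card T' = M} = {T}"
    using card_subset_eq[OF T(1)] T(2) by (intro equalityI subsetI) simp_all
  have "Determinant.det (Matrix.mat M M (\<lambda>(i,j). \<Sum>n\<in>T. d n * (1 / (z n - p i)) * (1 / (z n - p j))))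
      = (\<Prod>n\<in>T. d n) * gram_coeff M (\<lambda>n m. 1 / (z n - p m)) T"
    using det_weighted_gram[OF T(1), of M d "\<lambda>n m. 1 / (z n - p m)"] unfolding S by simp
  ultimately show ?thesis unfolding d_def c_def by (simp only:)
qed

text \<open>The first \<open>M\<close> of the \<open>p j\<close> form one block, the others a
  second. With the poles as \<open>p\<close> and \<open>z n = - \<i> * \<zeta> n\<close> this
  becomes \<open>W_coeff\<close>.\<close>

definition subset_coeff :: "nat \<Rightarrow> nat \<Rightarrow> (nat \<Rightarrow> complex) \<Rightarrow> ('a \<Rightarrow> complex) \<Rightarrow> 'a set \<Rightarrow> 'a set \<Rightarrow> complex" where
  "subset_coeff M N p z I T =
     (\<Prod>m<M. \<Prod>l\<in>I-T. p m - z l) * (\<Prod>n\<in>T. \<Prod>j\<in>{M..<N}. z n - p j) *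
     (\<Prod>m<M. \<Prod>j\<in>{M..<N}. inverse (p m - p j)) * (\<Prod>n\<in>T. \<Prod>l\<in>I-T. inverse (z n - z l))"

text \<open>For each \<open>T\<close> the weight \<open>w n\<close> is the weight of
  \<open>gram_coeff_cauchy\<close> times a factor from the remaining poles and zeros. The hypothesis
  on \<open>\<gamma>\<close>, which is the characteristic polynomial evaluated at
  \<open>p m\<close>, lets the products within the first block and between it and \<open>T\<close>
  cancel.\<close>

lemma det_subset_expansion:
  fixes z :: "'a \<Rightarrow> complex" and p :: "nat \<Rightarrow> complex"
  assumes I: "finite I" and MN: "M \<le> N" and z: "inj_on z I" and p: "inj_on p {..<N}"
    and zp: "\<And>n j. n \<in> I \<Longrightarrow> j < N \<Longrightarrow> z n \<noteq> p j"
    and \<gamma>: "\<And>m. m < M \<Longrightarrow> (\<Prod>n\<in>I. p m - z n) = - \<gamma> m * (\<Prod>k\<in>{..<N}-{m}. p m - p k)"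
  shows "Determinant.det (Matrix.mat M M (\<lambda>(m,m'). \<gamma> m * exp (- of_real \<tau> * p m) *
      (\<Sum>n\<in>I. exp (of_real \<tau> * z n) * (\<Prod>j<N. z n - p j) / (\<Prod>l\<in>I-{n}. z n - z l) * (1 / (z n - p m)) * (1 / (z n - p m')))))
    = exp (- of_real \<tau> * (\<Sum>m<M. p m)) *
      (\<Sum>T | T \<subseteq> I \<and> card T = M. subset_coeff M N p z I T * exp (of_real \<tau> * (\<Sum>n\<in>T. z n)))"
proof -
  define w where "w n = exp (of_real \<tau> * z n) * (\<Prod>j<N. z n - p j) / (\<Prod>l\<in>I-{n}. z n - z l)" for n
  define X where "X n m = 1 / (z n - p m)" for n m
  have "Determinant.det (Matrix.mat M M (\<lambda>(m,m'). \<gamma> m * exp (- of_real \<tau> * p m) * (\<Sum>n\<in>I. w n * X n m * X n m')))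
    = (\<Prod>m<M. \<gamma> m * exp (- of_real \<tau> * p m)) * (\<Sum>T | T \<subseteq> I \<and> card T = M. (\<Prod>n\<in>T. w n) * gram_coeff M X T)"
    unfolding det_scale_rows[of M "\<lambda>m. \<gamma> m * exp (- of_real \<tau> * p m)"] det_weighted_gram[OF I] ..
  also have "\<dots> = exp (- of_real \<tau> * (\<Sum>m<M. p m)) * (\<Sum>T | T \<subseteq> I \<and> card T = M. (\<Prod>m<M. \<gamma> m) * ((\<Prod>n\<in>T. w n) * gram_coeff M X T))"
  proof -
    have "(\<Prod>m<M. exp (- of_real \<tau> * p m)) = exp (- of_real \<tau> * (\<Sum>m<M. p m))"
      by (simp add: exp_sum[symmetric] sum_distrib_left sum_negf)
    then show ?thesis by (simp only: prod.distrib sum_distrib_left mult_ac)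
  qed
  also have "(\<Sum>T | T \<subseteq> I \<and> card T = M. (\<Prod>m<M. \<gamma> m) * ((\<Prod>n\<in>T. w n) * gram_coeff M X T))
     = (\<Sum>T | T \<subseteq> I \<and> card T = M. subset_coeff M N p z I T * exp (of_real \<tau> * (\<Sum>n\<in>T. z n)))"
  proof (rule sum.cong[OF refl])
    fix T assume "T \<in> {T. T \<subseteq> I \<and> card T = M}"
    then have T: "T \<subseteq> I" "card T = M" by auto
    have fT: "finite T" using T I finite_subset by blast
    define A where "A s = (\<Prod>j\<in>{M..<N}. s - p j)" for s
    define PS where "PS s = (\<Prod>l\<in>I-T. s - z l)" for s
    define d where "d n = (\<Prod>m<M. z n - p m) / (\<Prod>l\<in>T-{n}. z n - z l)" for n
    have zT: "inj_on z T" using inj_on_subset[OF z T(1)] .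
    have pM: "inj_on p {..<M}" using inj_on_subset[OF p, of "{..<M}"] MN by auto
    have k: "(\<Prod>n\<in>T. d n) * gram_coeff M X T = (\<Prod>m<M. - (\<Prod>k\<in>{..<M}-{m}. p m - p k) / (\<Prod>n\<in>T. p m - z n))"
      unfolding d_def X_def by (rule gram_coeff_cauchy[OF fT T(2) zT pM]) (use zp T MN in auto)
    have wd: "w n = exp (of_real \<tau> * z n) * (A (z n) / PS (z n)) * d n" if n: "n \<in> T" for n
    proof -
      have "{..<N} = {..<M} \<union> {M..<N}" using MN by auto
      then have 1: "(\<Prod>j<N. z n - p j) = (\<Prod>m<M. z n - p m) * A (z n)"
        unfolding A_def by (simp add: prod.union_disjoint ivl_disj_int)
      have "I - {n} = (T - {n}) \<union> (I - T)" using T n by auto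
      then have 2: "(\<Prod>l\<in>I-{n}. z n - z l) = (\<Prod>l\<in>T-{n}. z n - z l) * PS (z n)"
        unfolding PS_def using I fT by (subst \<open>I - {n} = _\<close>, intro prod.union_disjoint) auto
      show ?thesis unfolding w_def d_def 1 2 by (simp add: mult_ac)
    qed
    have g: "\<gamma> m * (- (\<Prod>k\<in>{..<M}-{m}. p m - p k) / (\<Prod>n\<in>T. p m - z n)) = PS (p m) / A (p m)" if m: "m < M" for m
    proof -
      define b where "b = (\<Prod>k\<in>{..<M}-{m}. p m - p k)"
      define t where "t = (\<Prod>n\<in>T. p m - z n)"
      have u: "{..<N} - {m} = ({..<M} - {m}) \<union> {M..<N}" using MN m by auto
      have "(\<Prod>k\<in>({..<M}-{m}) \<union> {M..<N}. p m - p k) = (\<Prod>k\<in>{..<M}-{m}. p m - p k) * (\<Prod>k\<in>{M..<N}. p m - p k)"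
        by (rule prod.union_disjoint) (simp_all add: disjoint_iff)
      then have 1: "(\<Prod>k\<in>{..<N}-{m}. p m - p k) = b * A (p m)"
        unfolding A_def b_def u .
      have 2: "(\<Prod>n\<in>I. p m - z n) = t * PS (p m)"
        unfolding PS_def t_def by (subst mult.commute) (rule prod.subset_diff[OF T(1) I])
      have nz: "b \<noteq> 0" "A (p m) \<noteq> 0" "t \<noteq> 0"
      proof -
        have "p m \<noteq> p k" if "k < N" "k \<noteq> m" for k using that p m MN by (auto dest: inj_onD)
        moreover have "p m \<noteq> z n" if "n \<in> T" for n using zp[of n m] that T m MN by auto
        ultimately show "b \<noteq> 0" "A (p m) \<noteq> 0" "t \<noteq> 0"
          unfolding b_def A_def t_def using fT m MN by auto
      qed
      have "t * PS (p m) = - \<gamma> m * (b * A (p m))" using \<gamma>[OF m] 1 2 by simp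
      then have "\<gamma> m * (- b / t) = PS (p m) / A (p m)" using nz by (simp add: field_simps) 
      then show ?thesis unfolding b_def t_def .
    qed
    have "(\<Prod>m<M. \<gamma> m) * ((\<Prod>n\<in>T. w n) * gram_coeff M X T)
       = (\<Prod>m<M. \<gamma> m) * ((\<Prod>n\<in>T. exp (of_real \<tau> * z n)) * (\<Prod>n\<in>T. A (z n) / PS (z n)) * ((\<Prod>n\<in>T. d n) * gram_coeff M X T))"
    proof -
      have "(\<Prod>n\<in>T. w n) = (\<Prod>n\<in>T. exp (of_real \<tau> * z n)) * (\<Prod>n\<in>T. A (z n) / PS (z n)) * (\<Prod>n\<in>T. d n)"
        unfolding prod.distrib[symmetric] by (intro prod.cong refl wd)
      then show ?thesis by (simp only: mult.assoc)
    qed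
    also have "\<dots> = (\<Prod>n\<in>T. exp (of_real \<tau> * z n)) * (\<Prod>n\<in>T. A (z n) / PS (z n)) * (\<Prod>m<M. PS (p m) / A (p m))"
    proof -
      have "(\<Prod>m<M. \<gamma> m) * (\<Prod>m<M. - (\<Prod>k\<in>{..<M}-{m}. p m - p k) / (\<Prod>n\<in>T. p m - z n)) = (\<Prod>m<M. PS (p m) / A (p m))"
        unfolding prod.distrib[symmetric] by (intro prod.cong refl g) simp
      then show ?thesis unfolding k by (subst mult.left_commute) (simp only:)
    qed
    also have "(\<Prod>n\<in>T. exp (of_real \<tau> * z n)) = exp (of_real \<tau> * (\<Sum>n\<in>T. z n))"
      using fT by (simp add: exp_sum[symmetric] sum_distrib_left)
    finally have fin: "(\<Prod>m<M. \<gamma> m) * ((\<Prod>n\<in>T. w n) * gram_coeff M X T)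
        = exp (of_real \<tau> * (\<Sum>n\<in>T. z n)) * (\<Prod>n\<in>T. A (z n) / PS (z n)) * (\<Prod>m<M. PS (p m) / A (p m))" .
    show "(\<Prod>m<M. \<gamma> m) * ((\<Prod>n\<in>T. w n) * gram_coeff M X T) = subset_coeff M N p z I T * exp (of_real \<tau> * (\<Sum>n\<in>T. z n))"
    proof -
      have "subset_coeff M N p z I T = (\<Prod>m<M. PS (p m)) * (\<Prod>n\<in>T. A (z n)) * (\<Prod>m<M. inverse (A (p m))) * (\<Prod>n\<in>T. inverse (PS (z n)))"
        unfolding subset_coeff_def A_def PS_def by (simp add: prod_inversef[symmetric] o_def)
      with fin show ?thesis by (simp only: divide_inverse prod.distrib mult_ac)
    qed
  qed
  finally show ?thesis unfolding w_def X_def .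
qed

section \<open>Exponential kernels on an interval\<close>

lemma exp_has_vector_derivative:
  fixes c :: complex
  assumes "c \<noteq> 0"
  shows "((\<lambda>x. exp (c * of_real x) / c) has_vector_derivative exp (c * of_real x)) (at x)"
proof -
  have "((\<lambda>w. exp (c * w) / c) has_field_derivative exp (c * of_real x)) (at (of_real x))"
    using assms by (auto intro!: derivative_eq_intros)
  from has_vector_derivative_real_field[OF this] show ?thesis .
qed

lemma integral_exp:
  fixes c :: complex
  assumes "c \<noteq> 0" "0 \<le> \<tau>"
  shows "(LINT x|lborel_Ioo \<tau>. exp (c * of_real x)) = (exp (c * of_real \<tau>) - 1) / c"
proof -
  have "(LINT x|lborel_Ioo \<tau>. exp (c * of_real x)) = exp (c * of_real \<tau>) / c - exp (c * of_real 0) / c"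
    by (rule lborel_Ioo_FTC[OF assms(2) exp_has_vector_derivative[OF assms(1)]]) (intro continuous_intros)
  then show ?thesis by (simp add: diff_divide_distrib)
qed

lemma integral_exp_convolution:
  fixes p z :: complex
  assumes "z \<noteq> p" "0 < x" "x < \<tau>"
  shows "integrable (lborel_Ioo \<tau>) (\<lambda>y. if y < x then exp (p * of_real (x - y)) * exp (z * of_real y) else 0)" (is ?int)
    and "(LINT y|lborel_Ioo \<tau>. (if y < x then exp (p * of_real (x - y)) * exp (z * of_real y) else 0))
      = (exp (z * of_real x) - exp (p * of_real x)) / (z - p)" (is ?eq)
proof -
  define c where "c = z - p"
  have c: "c \<noteq> 0" using assms(1) unfolding c_def by simp
  have e: "exp (p * of_real (x - y)) * exp (z * of_real y) = exp (p * of_real x) * exp (c * of_real y)" for y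
    unfolding c_def by (simp add: exp_add[symmetric] algebra_simps)
  have i: "indicator {0<..<\<tau>} y *\<^sub>R (if y < x then exp (p * of_real (x - y)) * exp (z * of_real y) else 0)
      = exp (p * of_real x) * (indicator {0<..<x} y *\<^sub>R exp (c * of_real y))" for y
    using assms unfolding e by (auto simp: indicator_def)
  have cont: "continuous_on {0..x} (\<lambda>y. exp (c * of_real y))" by (intro continuous_intros)
  have "integrable lborel (\<lambda>y. exp (p * of_real x) * (indicator {0<..<x} y *\<^sub>R exp (c * of_real y)))"
    by (intro integrable_mult_right borel_integrable_Icc[OF cont])
  then show ?int
    by (subst integrable_restrict_space) (simp_all add: set_integrable_def i)
  have "(LINT y|lborel. indicator {0<..<x} y *\<^sub>R exp (c * of_real y)) = exp (c * of_real x) / c - exp (c * of_real 0) / c"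
    by (rule integral_Ioo_FTC[OF _ exp_has_vector_derivative[OF c] cont]) (use assms in simp)
  then have "(LINT y|lborel_Ioo \<tau>. (if y < x then exp (p * of_real (x - y)) * exp (z * of_real y) else 0))
     = exp (p * of_real x) * ((exp (c * of_real x) - 1) / c)"
    unfolding lborel_Ioo_integral i integral_mult_right_zero by (simp add: diff_divide_distrib)
  also have "\<dots> = (exp (z * of_real x) - exp (p * of_real x)) / c"
    unfolding c_def by (simp add: right_diff_distrib exp_add[symmetric] algebra_simps)
  finally show ?eq unfolding c_def .
qed

context finite_measure
begin

text \<open>Fubini's theorem. The diagonal of a composition is meaningful, so a trace can be read
  off from a formula for the composed kernel.\<close>

lemma ktr_eq_integral_diagonal:
  assumes a: "bker M a" and b: "bker M b"
  shows "ktr M a b = (LINT x|M. kcomp M a b x x)"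
proof -
  interpret P: pair_sigma_finite M M by unfold_locales
  interpret F: finite_measure "M \<Otimes>\<^sub>M M" by (rule finite_measure_pair_measure) unfold_locales
  have ab: "bker M (\<lambda>x y. a x y * b y x)" by (intro bker_mult a bker_transpose[OF b])
  obtain C where C: "\<And>x y. x \<in> space M \<Longrightarrow> y \<in> space M \<Longrightarrow> cmod (a x y * b y x) \<le> C" using ab by (rule bkerE) blast
  have "integrable (M \<Otimes>\<^sub>M M) (\<lambda>(x,y). a x y * b y x)"
    by (rule F.integrable_const_bound[where B=C]) (use C bker_measurable[OF ab] in \<open>auto intro!: AE_I2 simp: space_pair_measure\<close>)
  from P.Fubini_integral[OF this] show ?thesis unfolding ktr_def kcomp_def by simp
qed

end

definition Ioo_block :: "real \<Rightarrow> nat \<Rightarrow> nat \<Rightarrow> real set" where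
  "Ioo_block \<tau> N j = {x \<in> {0<..<\<tau>}. real j * (\<tau> / real N) \<le> x \<and> x < real (Suc j) * (\<tau> / real N)}"

lemma Ioo_block_sets: "Ioo_block \<tau> N j \<in> sets (lborel_Ioo \<tau>)"
proof -
  have "Ioo_block \<tau> N j = {0<..<\<tau>} \<inter> {real j * (\<tau> / real N)..<real (Suc j) * (\<tau> / real N)}"
    unfolding Ioo_block_def by auto
  then show ?thesis by (simp add: sets_restrict_space_iff)
qed

lemma Ioo_block_less:
  assumes "\<tau> > 0" "i < j" "x \<in> Ioo_block \<tau> N i" "y \<in> Ioo_block \<tau> N j"
  shows "x < y"
proof -
  have "real (Suc i) * (\<tau> / real N) \<le> real j * (\<tau> / real N)"
    using assms(1,2) by (intro mult_right_mono) auto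
  then show ?thesis using assms(3,4) unfolding Ioo_block_def by auto
qed

lemma Ioo_block_cover:
  assumes "\<tau> > 0" "N \<ge> 1"
  shows "(\<Union>j<N. Ioo_block \<tau> N j) = {0<..<\<tau>}"
proof (intro equalityI subsetI)
  fix x assume x: "x \<in> {0<..<\<tau>}"
  define h where "h = \<tau> / real N"
  have h: "h > 0" "real N * h = \<tau>" using assms unfolding h_def by auto
  define j where "j = nat \<lfloor>x / h\<rfloor>"
  have xh: "0 \<le> x / h" using x h by auto
  have j: "real j \<le> x / h" "x / h < real (Suc j)"
    unfolding j_def using xh by (auto simp: of_nat_nat floor_le_iff) linarith+
  have 1: "real j * h \<le> x" "x < real (Suc j) * h" using j h by (simp_all add: field_simps)
  then have "real j * h < real N * h" using x h by auto
  then have "real j < real N" by (rule mult_right_less_imp_less) (use h in simp)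
  then have "j < N" by simp
  then show "x \<in> (\<Union>j<N. Ioo_block \<tau> N j)" using 1 x unfolding Ioo_block_def h_def by auto
qed (auto simp: Ioo_block_def)

lemma measure_Ioo_block:
  assumes "\<tau> > 0"
  shows "measure (lborel_Ioo \<tau>) (Ioo_block \<tau> N j) \<le> \<tau> / real N"
proof -
  define s where "s = real j * (\<tau> / real N)"
  define t where "t = real (Suc j) * (\<tau> / real N)"
  have "t = s + \<tau> / real N" unfolding s_def t_def by (simp add: distrib_right add_divide_distrib)
  then have st: "t - s = \<tau> / real N" "s \<le> t" using assms by auto
  have eq: "Ioo_block \<tau> N j = {0<..<\<tau>} \<inter> {s..<t}" unfolding Ioo_block_def s_def t_def by auto
  have "measure (lborel_Ioo \<tau>) (Ioo_block \<tau> N j) = measure lborel ({0<..<\<tau>} \<inter> {s..<t})"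
    unfolding eq by (rule measure_lborel_Ioo) auto
  also have "\<dots> \<le> measure lborel {s..<t}"
    by (rule measure_mono_fmeasurable) (use st in \<open>auto simp: fmeasurable_def\<close>)
  also have "\<dots> = \<tau> / real N" using st by simp
  finally show ?thesis .
qed

lemma norm_exp_mult_le:
  assumes "\<bar>t\<bar> \<le> \<tau>"
  shows "cmod (exp (p * of_real t)) \<le> exp (cmod p * \<tau>)"
proof -
  have "cmod p * \<bar>t\<bar> \<le> cmod p * \<tau>" using assms by (intro mult_left_mono) auto
  then have "exp (cmod (p * of_real t)) \<le> exp (cmod p * \<tau>)" by (simp add: norm_mult)
  then show ?thesis using norm_exp[of "p * of_real t"] by linarith
qed

locale l2_basis_Ioo = l2_basis "lborel_Ioo \<tau>" e for \<tau> :: real and e +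
  assumes tau_pos: "\<tau> > 0"
begin

lemma kdet_lower_triangular:
  assumes a: "bker (lborel_Ioo \<tau>) a" and z: "\<And>x y. 0 < x \<Longrightarrow> x < y \<Longrightarrow> y < \<tau> \<Longrightarrow> a x y = 0"
  shows "kdet a = 1"
proof (rule kdet_triangular[OF a, of "Ioo_block \<tau>" \<tau>])
  show "Ioo_block \<tau> N i \<inter> Ioo_block \<tau> N j = {}" if "i < j" for N i j
    using Ioo_block_less[OF tau_pos that] by blast
  show "a x y = 0" if "i < j" "x \<in> Ioo_block \<tau> N i" "y \<in> Ioo_block \<tau> N j" for N i j x y
    using that(2,3) by (intro z Ioo_block_less[OF tau_pos that]) (auto simp: Ioo_block_def)
qed (use tau_pos in \<open>auto simp: Ioo_block_sets Ioo_block_cover measure_Ioo_block\<close>)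

lemma kdet_upper_triangular:
  assumes a: "bker (lborel_Ioo \<tau>) a" and z: "\<And>x y. 0 < y \<Longrightarrow> y < x \<Longrightarrow> x < \<tau> \<Longrightarrow> a x y = 0"
  shows "kdet a = 1"
\<comment> \<open>Numbering the blocks from the right turns the upper triangular case into the order
  that \<open>kdet_triangular\<close> expects.\<close>
proof (rule kdet_triangular[OF a, of "\<lambda>N j. Ioo_block \<tau> N (N - 1 - j)" \<tau>])
  have lt: "N - 1 - j < N - 1 - i" if "i < j" "j < N" for i j N :: nat using that by auto
  show "Ioo_block \<tau> N (N - 1 - i) \<inter> Ioo_block \<tau> N (N - 1 - j) = {}" if "i < j" "j < N" for N i j
    using Ioo_block_less[OF tau_pos lt[OF that]] by blast
  show "a x y = 0" if "i < j" "j < N" "x \<in> Ioo_block \<tau> N (N - 1 - i)" "y \<in> Ioo_block \<tau> N (N - 1 - j)" for N i j x y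
    using that(3,4) by (intro z Ioo_block_less[OF tau_pos lt[OF that(1,2)] that(4,3)]) (auto simp: Ioo_block_def)
  show "(\<Union>j<N. Ioo_block \<tau> N (N - 1 - j)) = space (lborel_Ioo \<tau>)" if "1 \<le> N" for N
  proof -
    have "(\<lambda>j. N - 1 - j) ` {..<N} = {..<N}"
    proof (intro equalityI subsetI)
      fix j assume "j \<in> {..<N}"
      then have "j = N - 1 - (N - 1 - j)" "N - 1 - j \<in> {..<N}" by auto
      then show "j \<in> (\<lambda>j. N - 1 - j) ` {..<N}" by blast
    qed auto
    then have "(\<Union>j<N. Ioo_block \<tau> N (N - 1 - j)) = (\<Union>j<N. Ioo_block \<tau> N j)"
      by (metis (no_types, lifting) SUP_cong image_image)
    then show ?thesis using Ioo_block_cover[OF tau_pos that] by simp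
  qed
qed (use tau_pos in \<open>auto simp: Ioo_block_sets measure_Ioo_block\<close>)

lemma measure_Ioo: "measure (lborel_Ioo \<tau>) {0<..<\<tau>} = \<tau>"
  using tau_pos by (subst measure_lborel_Ioo) auto

lemma exp_L2: "(\<lambda>x. exp (c * of_real x)) \<in> L2 (lborel_Ioo \<tau>)"
proof (rule L2_bounded)
  have "continuous_on UNIV (\<lambda>x::real. exp (c * of_real x))" by (intro continuous_intros)
  then show "(\<lambda>x. exp (c * of_real x)) \<in> borel_measurable (lborel_Ioo \<tau>)"
    by (intro measurable_lborel_Ioo borel_measurable_continuous_onI)
  show "cmod (exp (c * of_real x)) \<le> exp (cmod c * \<tau>)" if "x \<in> space (lborel_Ioo \<tau>)" for x
    by (rule norm_exp_mult_le) (use that in auto)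
qed

text \<open>Here \<open>V = K - R\<close> with \<open>R x y = \<Sum>\<^sub>m exp (p\<^sub>m x) w\<^sub>m y\<close>, and \<open>u\<^sub>m = (I - V)\<^sup>-\<^sup>1 exp (p\<^sub>m x)\<close>, whose
  coefficients \<open>c\<close> come from the partial fraction expansion of \<open>\<Prod>\<^sub>k\<^sub>\<noteq>\<^sub>m (s - p\<^sub>k) / \<Prod>\<^sub>n (s - z\<^sub>n)\<close>.\<close>

theorem kdet_generic:
  fixes a :: "real \<Rightarrow> real \<Rightarrow> complex" and p \<gamma> :: "nat \<Rightarrow> complex" and z :: "'i \<Rightarrow> complex"
  assumes a: "bker (lborel_Ioo \<tau>) a" and MN: "M \<le> N"
    and lower: "\<And>x y. 0 < y \<Longrightarrow> y < x \<Longrightarrow> x < \<tau> \<Longrightarrow> a x y = (\<Sum>j\<in>{M..<N}. \<gamma> j * exp (p j * of_real (x - y)))"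
    and upper: "\<And>x y. 0 < x \<Longrightarrow> x < y \<Longrightarrow> y < \<tau> \<Longrightarrow> a x y = - (\<Sum>m<M. \<gamma> m * exp (p m * of_real (x - y)))"
    and p: "inj_on p {..<N}" and \<gamma>: "\<And>j. j < N \<Longrightarrow> \<gamma> j \<noteq> 0"
    and I: "finite I" "card I = N" and z: "inj_on z I"
    and char: "\<And>s. (\<Prod>n\<in>I. s - z n) = (\<Prod>j<N. s - p j) - (\<Sum>j<N. \<gamma> j * (\<Prod>k\<in>{..<N}-{j}. s - p k))"
  shows "kdet (\<lambda>x y. - a x y) = exp (- of_real \<tau> * (\<Sum>m<M. \<gamma> m)) * (exp (- of_real \<tau> * (\<Sum>m<M. p m)) *
      (\<Sum>T | T \<subseteq> I \<and> card T = M. subset_coeff M N p z I T * exp (of_real \<tau> * (\<Sum>n\<in>T. z n))))"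
proof -
  let ?L = "lborel_Ioo \<tau>"
  define Qm where "Qm j s = (\<Prod>k\<in>{..<N}-{j}. s - p k)" for j s
  define P' where "P' n = (\<Prod>l\<in>I-{n}. z n - z l)" for n
  define c where "c m n = Qm m (z n) / P' n" for m n
  define u where "u m x = (\<Sum>n\<in>I. c m n * exp (z n * of_real x))" for m and x :: real
  define w where "w m y = - \<gamma> m * exp (- p m * of_real y)" for m and y :: real
  define R where "R x y = (\<Sum>m<M. exp (p m * of_real x) * w m y)" for x y
  define V where "V x y = a x y - R x y" for x y
  define F where "F x y = (\<Sum>m<M. u m x * w m y)" for x y
  have Qm0: "Qm k (p j) = 0" if "j < N" "k \<noteq> j" for j k
    unfolding Qm_def using that by (intro prod_zero) auto
  have Qmj: "Qm j (p j) \<noteq> 0" if "j < N" for j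
    unfolding Qm_def using that p by (auto dest: inj_onD)
  \<comment> \<open>At \<open>s = p j\<close> only the summand without the factor
    \<open>s - p j\<close> survives in \<open>char\<close>.\<close>
  have Pp: "(\<Prod>n\<in>I. p j - z n) = - \<gamma> j * Qm j (p j)" if j: "j < N" for j
  proof -
    have "(\<Prod>k<N. p j - p k) = 0" using j by (intro prod_zero) auto
    moreover have "(\<Sum>k<N. \<gamma> k * Qm k (p j)) = (\<Sum>k\<in>{j}. \<gamma> k * Qm k (p j))"
      by (rule sum.mono_neutral_right) (use j Qm0 in auto)
    ultimately show ?thesis using char[of "p j"] unfolding Qm_def by simp
  qed
  \<comment> \<open>Since no \<open>\<gamma> j\<close> vanishes, the identity at the poles keeps
    zeros and poles apart.\<close>
  have zp: "z n \<noteq> p j" if "n \<in> I" "j < N" for n j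
  proof
    assume "z n = p j"
    then have "(\<Prod>n\<in>I. p j - z n) = 0" using that I by (intro prod_zero bexI[of _ n]) auto
    then show False using Pp[OF that(2)] \<gamma>[OF that(2)] Qmj[OF that(2)] by simp
  qed
  have Qfac: "(\<Prod>j<N. s - p j) = (s - p k) * Qm k s" if "k < N" for k s
    unfolding Qm_def using that by (intro prod.remove) auto
  \<comment> \<open>\<open>char\<close> at \<open>z n\<close>, divided by the product of the
    \<open>z n - p j\<close>: the Laplace transform of the convolution kernel \<open>V\<close>
    equals 1 at \<open>z n\<close>.\<close>
  have vhat: "(\<Sum>j<N. \<gamma> j / (z n - p j)) = 1" if n: "n \<in> I" for n
  proof -
    define q where "q = (\<Prod>j<N. z n - p j)"
    have q0: "q \<noteq> 0" unfolding q_def using zp[OF n] by auto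
    have "(\<Prod>l\<in>I. z n - z l) = 0" using n I by (intro prod_zero) auto
    then have "q = (\<Sum>j<N. \<gamma> j * Qm j (z n))" using char[of "z n"] unfolding q_def Qm_def by simp
    also have "\<dots> = (\<Sum>j<N. q * (\<gamma> j / (z n - p j)))"
    proof (rule sum.cong[OF refl])
      fix j assume "j \<in> {..<N}"
      then have j: "j < N" by simp
      show "\<gamma> j * Qm j (z n) = q * (\<gamma> j / (z n - p j))"
      proof -
        have "q = (z n - p j) * Qm j (z n)" unfolding q_def by (rule Qfac[OF j])
        then show ?thesis using zp[OF n j] by simp
      qed
    qed
    also have "\<dots> = q * (\<Sum>j<N. \<gamma> j / (z n - p j))" by (simp only: sum_distrib_left)
    finally show ?thesis using q0 by simp
  qed
  \<comment> \<open>Partial fractions of \<open>Qm m\<close> over the product of the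
    \<open>s - z n\<close>, evaluated at \<open>p j\<close>; the denominator there is known from
    \<open>Pp\<close>.\<close>
  have lag: "(\<Sum>n\<in>I. c m n / (z n - p j)) = (if m = j then 1 / \<gamma> m else 0)" if m: "m < N" and j: "j < N" for m j
  proof -
    define h where "h = (\<Prod>k\<in>{..<N}-{m}. [:- p k, 1:])"
    have ph: "poly h s = Qm m s" for s unfolding h_def Qm_def by (simp add: poly_prod algebra_simps)
    have dh: "degree h < card I"
    proof -
      have "degree h \<le> sum (degree \<circ> (\<lambda>k. [:- p k, 1:])) ({..<N}-{m})"
        unfolding h_def by (rule degree_prod_sum_le) auto
      then show ?thesis using I m by simp
    qed
    have pj: "p j \<notin> z ` I" using zp j by fastforce
    have "(\<Sum>n\<in>I. c m n / (z n - p j)) = - (\<Sum>n\<in>I. poly h (z n) / (\<Prod>l\<in>I-{n}. z n - z l) / (p j - z n))"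
      unfolding sum_negf[symmetric] c_def P'_def ph
      by (intro sum.cong refl) (metis minus_diff_eq minus_divide_right)
    also have "\<dots> = - (Qm m (p j) / (\<Prod>n\<in>I. p j - z n))"
      by (subst lagrange_partial_fractions[OF I(1) z dh pj]) (simp only: ph)
    also have "\<dots> = (if m = j then 1 / \<gamma> m else 0)"
      using Pp[OF j] Qm0[OF j] Qmj[OF j] \<gamma>[OF j] by auto
    finally show ?thesis .
  qed
  have uL: "u m \<in> L2 ?L" for m
    unfolding u_def by (intro L2_sum L2_cmult exp_L2)
  have wL: "w m \<in> L2 ?L" for m
    unfolding w_def by (intro L2_cmult exp_L2)
  have exp_bound: "cmod (exp (c * of_real x)) \<le> exp (cmod c * \<tau>)" if "x \<in> space ?L" for c x
    by (rule norm_exp_mult_le) (use that in auto)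
  have um: "u m \<in> borel_measurable ?L" and wm: "w m \<in> borel_measurable ?L" for m
    by (rule L2_measurable[OF uL], rule L2_measurable[OF wL])
  have ub: "cmod (u m x) \<le> (\<Sum>n\<in>I. cmod (c m n) * exp (cmod (z n) * \<tau>))" if "x \<in> space ?L" for m x
    unfolding u_def by (rule sum_norm_le, unfold norm_mult, intro mult_left_mono exp_bound that) simp
  have wb: "cmod (w m y) \<le> cmod (\<gamma> m) * exp (cmod (- p m) * \<tau>)" if "y \<in> space ?L" for m y
    unfolding w_def norm_mult norm_minus_cancel[of "\<gamma> m"] by (intro mult_left_mono exp_bound that) simp
  have bR: "bker ?L R"
    unfolding R_def by (intro bker_sum bker_rank1[OF L2_measurable[OF exp_L2] exp_bound wm wb])
  have bV: "bker ?L V" unfolding V_def by (intro bker_diff a bR)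
  have bF: "bker ?L F" unfolding F_def by (intro bker_sum bker_rank1[OF um ub wm wb])
  have Re: "R x y = - (\<Sum>m<M. \<gamma> m * exp (p m * of_real (x - y)))" for x y
    unfolding R_def w_def sum_negf[symmetric]
    by (intro sum.cong refl) (simp add: exp_add[symmetric] algebra_simps)
  have V0: "V x y = 0" if "0 < x" "x < y" "y < \<tau>" for x y
    unfolding V_def using upper[OF that] Re by simp
  have V1: "V x y = (\<Sum>j<N. \<gamma> j * exp (p j * of_real (x - y)))" if "0 < y" "y < x" "x < \<tau>" for x y
  proof -
    have "{..<N} = {..<M} \<union> {M..<N}" using MN by auto
    moreover have "(\<Sum>j\<in>{..<M} \<union> {M..<N}. \<gamma> j * exp (p j * of_real (x - y)))
       = (\<Sum>j<M. \<gamma> j * exp (p j * of_real (x - y))) + (\<Sum>j\<in>{M..<N}. \<gamma> j * exp (p j * of_real (x - y)))"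
      by (rule sum.union_disjoint) (simp_all add: disjoint_iff)
    ultimately show ?thesis unfolding V_def lower[OF that] Re by simp
  qed
  \<comment> \<open>Convolving \<open>V\<close> with \<open>exp (z n * y)\<close> returns this
    exponential with factor 1 by \<open>vhat\<close>, minus terms in \<open>exp (p j * x)\<close>;
    after summation over \<open>n\<close>, \<open>lag\<close> leaves only the one with
    \<open>j = m\<close>.\<close>
  have Vu: "kop ?L V (u m) x = u m x - exp (p m * of_real x)" if m: "m < M" and x: "0 < x" "x < \<tau>" for m x
  proof -
    have xs: "x \<in> space ?L" using x by simp
    let ?g = "\<lambda>j n y. if y < x then exp (p j * of_real (x - y)) * exp (z n * of_real y) else 0"
    have gi: "integrable ?L (?g j n)" if "j < N" "n \<in> I" for j n
      by (rule integral_exp_convolution(1)[OF zp[OF that(2,1)] x])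
    have "kop ?L V (u m) x = (LINT y|?L. (\<Sum>n\<in>I. c m n * (\<Sum>j<N. \<gamma> j * ?g j n y)))"
      unfolding kop_def
    proof (rule integral_cong_AE)
      show "(\<lambda>y. V x y * u m y) \<in> borel_measurable ?L"
        by (intro borel_measurable_times bker_row_measurable(1)[OF bV xs] um)
      show "(\<lambda>y. \<Sum>n\<in>I. c m n * (\<Sum>j<N. \<gamma> j * ?g j n y)) \<in> borel_measurable ?L"
        by (intro borel_measurable_sum borel_measurable_times borel_measurable_const borel_measurable_integrable gi) auto
      \<comment> \<open>Nothing is assumed about \<open>a\<close> on the diagonal, so the point
        \<open>y = x\<close> is excluded.\<close>
      have "AE y in lborel. y \<noteq> x" by (rule AE_lborel_singleton)
      then have "AE y in ?L. y \<noteq> x" by (subst AE_restrict_space_iff) (auto elim: eventually_mono)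
      then show "AE y in ?L. V x y * u m y = (\<Sum>n\<in>I. c m n * (\<Sum>j<N. \<gamma> j * ?g j n y))"
        using AE_space
      proof eventually_elim
        case (elim y)
        then have y: "0 < y" "y < \<tau>" by auto
        show ?case
        proof (cases "y < x")
          case True
          have "V x y * u m y = (\<Sum>n\<in>I. (\<Sum>j<N. \<gamma> j * exp (p j * of_real (x - y))) * (c m n * exp (z n * of_real y)))"
            unfolding V1[OF y(1) True x(2)] u_def sum_distrib_left ..
          also have "\<dots> = (\<Sum>n\<in>I. c m n * (\<Sum>j<N. \<gamma> j * ?g j n y))"
            using True by (intro sum.cong refl) (simp add: sum_distrib_left sum_distrib_right mult_ac)
          finally show ?thesis .
        next
          case False
          then show ?thesis using V0[of x y] elim x y by simp
        qed
      qed
    qed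
    also have "\<dots> = (\<Sum>n\<in>I. c m n * (\<Sum>j<N. \<gamma> j * (LINT y|?L. ?g j n y)))"
    proof -
      have "(LINT y|?L. (\<Sum>n\<in>I. c m n * (\<Sum>j<N. \<gamma> j * ?g j n y))) = (\<Sum>n\<in>I. LINT y|?L. c m n * (\<Sum>j<N. \<gamma> j * ?g j n y))"
        by (intro Bochner_Integration.integral_sum integrable_mult_right Bochner_Integration.integrable_sum gi) auto
      also have "\<dots> = (\<Sum>n\<in>I. c m n * (LINT y|?L. (\<Sum>j<N. \<gamma> j * ?g j n y)))" by simp
      also have "\<dots> = (\<Sum>n\<in>I. c m n * (\<Sum>j<N. LINT y|?L. \<gamma> j * ?g j n y))"
        by (intro sum.cong refl arg_cong2[where f="(*)"] Bochner_Integration.integral_sum integrable_mult_right gi) auto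
      finally show ?thesis by simp
    qed
    also have "\<dots> = (\<Sum>n\<in>I. c m n * (exp (z n * of_real x) - (\<Sum>j<N. \<gamma> j * exp (p j * of_real x) / (z n - p j))))"
    proof (intro sum.cong refl arg_cong2[where f="(*)"])
      fix n assume n: "n \<in> I"
      have "(\<Sum>j<N. \<gamma> j * (LINT y|?L. ?g j n y)) = (\<Sum>j<N. \<gamma> j * ((exp (z n * of_real x) - exp (p j * of_real x)) / (z n - p j)))"
        by (intro sum.cong refl arg_cong2[where f="(*)"] integral_exp_convolution(2)[OF zp[OF n] x]) auto
      also have "\<dots> = (\<Sum>j<N. exp (z n * of_real x) * (\<gamma> j / (z n - p j)) - \<gamma> j * exp (p j * of_real x) / (z n - p j))"
        by (intro sum.cong refl) (simp add: diff_divide_distrib right_diff_distrib mult_ac)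
      also have "\<dots> = exp (z n * of_real x) * (\<Sum>j<N. \<gamma> j / (z n - p j)) - (\<Sum>j<N. \<gamma> j * exp (p j * of_real x) / (z n - p j))"
        by (simp only: sum_subtractf sum_distrib_left)
      finally show "(\<Sum>j<N. \<gamma> j * (LINT y|?L. ?g j n y)) = exp (z n * of_real x) - (\<Sum>j<N. \<gamma> j * exp (p j * of_real x) / (z n - p j))"
        unfolding vhat[OF n] by simp
    qed
    also have "\<dots> = u m x - (\<Sum>n\<in>I. \<Sum>j<N. \<gamma> j * exp (p j * of_real x) * (c m n / (z n - p j)))"
      unfolding u_def right_diff_distrib sum_subtractf sum_distrib_left by (simp add: mult_ac)
    also have "(\<Sum>n\<in>I. \<Sum>j<N. \<gamma> j * exp (p j * of_real x) * (c m n / (z n - p j)))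
        = (\<Sum>j<N. \<gamma> j * exp (p j * of_real x) * (\<Sum>n\<in>I. c m n / (z n - p j)))"
      by (subst sum.swap) (simp only: sum_distrib_left)
    also have "\<dots> = (\<Sum>j<N. if j = m then exp (p m * of_real x) else 0)"
      using lag[of m] \<gamma> m MN by (intro sum.cong refl) auto
    also have "\<dots> = exp (p m * of_real x)" using m MN by simp
    finally show ?thesis .
  qed
  \<comment> \<open>This says (I - V) F = R, hence I - K = (I - V) (I - F).\<close>
  have VF: "kcomp ?L V F x y = F x y - R x y" if x: "x \<in> space ?L" and y: "y \<in> space ?L" for x y
  proof -
    have "kcomp ?L V F x y = (LINT t|?L. (\<Sum>m<M. w m y * (V x t * u m t)))"
      unfolding kcomp_def F_def by (simp add: sum_distrib_left mult_ac)
    also have "\<dots> = (\<Sum>m<M. LINT t|?L. w m y * (V x t * u m t))"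
      by (intro Bochner_Integration.integral_sum integrable_mult_right kop_integrable bV uL x)
    also have "\<dots> = (\<Sum>m<M. w m y * kop ?L V (u m) x)" unfolding kop_def by simp
    also have "\<dots> = (\<Sum>m<M. u m x * w m y - exp (p m * of_real x) * w m y)"
      using x by (intro sum.cong refl) (simp add: Vu right_diff_distrib mult.commute)
    finally show ?thesis unfolding F_def R_def sum_subtractf .
  qed
  have split: "kdet (\<lambda>x y. - a x y) = kdet (\<lambda>x y. - V x y) * kdet (\<lambda>x y. - F x y) * exp (- ktr ?L V F)"
  proof -
    have "kdet (\<lambda>x y. - a x y) = kdet (\<lambda>x y. - V x y + - F x y + kcomp ?L (\<lambda>x y. - V x y) (\<lambda>x y. - F x y) x y)"
    proof (rule kdet_cong)
      fix x y assume xy: "x \<in> space ?L" "y \<in> space ?L"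
      have "kcomp ?L (\<lambda>x y. - V x y) (\<lambda>x y. - F x y) x y = kcomp ?L V F x y" unfolding kcomp_def by simp
      then show "- a x y = - V x y + - F x y + kcomp ?L (\<lambda>x y. - V x y) (\<lambda>x y. - F x y) x y"
        unfolding VF[OF xy] V_def by simp
    qed
    also have "\<dots> = kdet (\<lambda>x y. - V x y) * kdet (\<lambda>x y. - F x y) * exp (- ktr ?L (\<lambda>x y. - V x y) (\<lambda>x y. - F x y))"
      by (rule kdet_mult[OF bker_minus[OF bV] bker_minus[OF bF]])
    finally show ?thesis unfolding ktr_def by simp
  qed
  have dV: "kdet (\<lambda>x y. - V x y) = 1"
    by (rule kdet_lower_triangular[OF bker_minus[OF bV]]) (simp add: V0)
  define G where "G m m' = (LINT x|?L. w m x * u m' x)" for m m'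
  have dF: "kdet (\<lambda>x y. - F x y) = Determinant.det (Matrix.mat M M (\<lambda>(m,m'). of_bool (m = m') - G m m')) * exp (\<Sum>m<M. G m m)"
    unfolding G_def by (rule kdet_finite_rank[OF uL wL bker_minus[OF bF]]) (simp add: F_def)
  \<comment> \<open>On the diagonal the composed kernel is F - R, and \<open>R x x\<close> is the
    constant minus the sum of the first \<open>M\<close> coefficients \<open>\<gamma> m\<close>;
    this constant produces the first exponential factor of the result.\<close>
  have tr: "ktr ?L V F = (\<Sum>m<M. G m m) + of_real \<tau> * (\<Sum>m<M. \<gamma> m)"
  proof -
    have "ktr ?L V F = (LINT x|?L. kcomp ?L V F x x)" by (rule ktr_eq_integral_diagonal[OF bV bF])
    also have "\<dots> = (LINT x|?L. (\<Sum>m<M. w m x * u m x) + (\<Sum>m<M. \<gamma> m))"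
      by (intro Bochner_Integration.integral_cong refl) (simp add: VF Re F_def mult.commute)
    also have "\<dots> = (LINT x|?L. (\<Sum>m<M. w m x * u m x)) + (LINT x|?L. (\<Sum>m<M. \<gamma> m))"
      by (intro Bochner_Integration.integral_add Bochner_Integration.integrable_sum L2_integrable_mult uL wL) simp
    also have "(LINT x|?L. (\<Sum>m<M. w m x * u m x)) = (\<Sum>m<M. G m m)"
      unfolding G_def by (intro Bochner_Integration.integral_sum L2_integrable_mult uL wL)
    also have "(LINT x|?L. (\<Sum>m<M. \<gamma> m)) = of_real \<tau> * (\<Sum>m<M. \<gamma> m)"
      by (simp add: measure_Ioo scaleR_conv_of_real)
    finally show ?thesis .
  qed
  \<comment> \<open>Integrating an exponential contributes an end point at 0 and one at
    \<open>\<tau>\<close>; by \<open>lag\<close> the former cancels the identity matrix.\<close>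
  have Gval: "of_bool (m = m') - G m m' = \<gamma> m * exp (- of_real \<tau> * p m) *
      (\<Sum>n\<in>I. exp (of_real \<tau> * z n) * (\<Prod>j<N. z n - p j) / (\<Prod>l\<in>I-{n}. z n - z l) * (1 / (z n - p m)) * (1 / (z n - p m')))"
    if m: "m < M" "m' < M" for m m'
  proof -
    have mN: "m < N" "m' < N" using m MN by auto
    have e: "w m x * u m' x = (\<Sum>n\<in>I. - \<gamma> m * c m' n * exp ((z n - p m) * of_real x))" for x
      unfolding w_def u_def sum_distrib_left by (intro sum.cong refl) (simp add: exp_add[symmetric] algebra_simps)
    have "G m m' = (\<Sum>n\<in>I. LINT x|?L. - \<gamma> m * c m' n * exp ((z n - p m) * of_real x))"
      unfolding G_def e by (intro Bochner_Integration.integral_sum integrable_mult_right L2_integrable exp_L2)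
    also have "\<dots> = (\<Sum>n\<in>I. - \<gamma> m * c m' n * ((exp ((z n - p m) * of_real \<tau>) - 1) / (z n - p m)))"
      using zp mN tau_pos by (intro sum.cong refl) (simp add: integral_exp)
    also have "\<dots> = (\<Sum>n\<in>I. \<gamma> m * (c m' n / (z n - p m)) - \<gamma> m * (c m' n * exp ((z n - p m) * of_real \<tau>) / (z n - p m)))"
      by (intro sum.cong refl) (simp add: diff_divide_distrib algebra_simps)
    also have "\<dots> = \<gamma> m * (\<Sum>n\<in>I. c m' n / (z n - p m)) - \<gamma> m * (\<Sum>n\<in>I. c m' n * exp ((z n - p m) * of_real \<tau>) / (z n - p m))"
      by (simp only: sum_subtractf sum_distrib_left)
    also have "\<gamma> m * (\<Sum>n\<in>I. c m' n / (z n - p m)) = of_bool (m = m')"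
      using lag[OF mN(2,1)] \<gamma>[OF mN(1)] by auto
    finally have "of_bool (m = m') - G m m' = \<gamma> m * (\<Sum>n\<in>I. c m' n * exp ((z n - p m) * of_real \<tau>) / (z n - p m))" by simp
    also have "(\<Sum>n\<in>I. c m' n * exp ((z n - p m) * of_real \<tau>) / (z n - p m)) = exp (- of_real \<tau> * p m) *
      (\<Sum>n\<in>I. exp (of_real \<tau> * z n) * (\<Prod>j<N. z n - p j) / (\<Prod>l\<in>I-{n}. z n - z l) * (1 / (z n - p m)) * (1 / (z n - p m')))"
      unfolding sum_distrib_left
    proof (rule sum.cong[OF refl])
      fix n assume n: "n \<in> I"
      have c1: "c m' n = (\<Prod>j<N. z n - p j) / P' n * (1 / (z n - p m'))"
        unfolding c_def Qfac[OF mN(2), of "z n"] using zp[OF n mN(2)] by simp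
      have e1: "exp ((z n - p m) * of_real \<tau>) = exp (- of_real \<tau> * p m) * exp (of_real \<tau> * z n)"
        by (simp add: exp_add[symmetric] algebra_simps)
      show "c m' n * exp ((z n - p m) * of_real \<tau>) / (z n - p m) = exp (- of_real \<tau> * p m) *
        (exp (of_real \<tau> * z n) * (\<Prod>j<N. z n - p j) / (\<Prod>l\<in>I-{n}. z n - z l) * (1 / (z n - p m)) * (1 / (z n - p m')))"
        unfolding c1 e1 P'_def by (simp add: mult_ac)
    qed
    finally show ?thesis by (simp only: mult.assoc)
  qed
  have "Matrix.mat M M (\<lambda>(m,m'). of_bool (m = m') - G m m') = Matrix.mat M M (\<lambda>(m,m'). \<gamma> m * exp (- of_real \<tau> * p m) *
      (\<Sum>n\<in>I. exp (of_real \<tau> * z n) * (\<Prod>j<N. z n - p j) / (\<Prod>l\<in>I-{n}. z n - z l) * (1 / (z n - p m)) * (1 / (z n - p m'))))"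
    by (rule cong_mat) (simp_all only: Gval prod.case)
  then have dG: "Determinant.det (Matrix.mat M M (\<lambda>(m,m'). of_bool (m = m') - G m m')) = exp (- of_real \<tau> * (\<Sum>m<M. p m)) *
      (\<Sum>T | T \<subseteq> I \<and> card T = M. subset_coeff M N p z I T * exp (of_real \<tau> * (\<Sum>n\<in>T. z n)))"
    using det_subset_expansion[OF I(1) MN z p zp, of \<gamma> \<tau>] Pp MN unfolding Qm_def by simp
  have "kdet (\<lambda>x y. - a x y) = Determinant.det (Matrix.mat M M (\<lambda>(m,m'). of_bool (m = m') - G m m')) * exp (- of_real \<tau> * (\<Sum>m<M. \<gamma> m))"
  proof -
    have "exp (\<Sum>m<M. G m m) * exp (- ((\<Sum>m<M. G m m) + of_real \<tau> * (\<Sum>m<M. \<gamma> m))) = exp (- of_real \<tau> * (\<Sum>m<M. \<gamma> m))"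
      by (simp add: exp_add[symmetric])
    then show ?thesis unfolding split dV dF tr by (simp only: mult_1_left mult.assoc)
  qed
  then show ?thesis unfolding dG by (simp only: mult.commute)
qed

end

section \<open>Perturbation to the generic case\<close>

lemma monic_poly_factorization:
  fixes P :: "complex poly"
  assumes "finite I" "degree P = card I" "lead_coeff P = 1"
  shows "\<exists>z. P = (\<Prod>n\<in>I. [:- z n, 1:])"
  using assms
proof (induction I arbitrary: P rule: finite_induct)
  case empty
  then obtain c where "P = [:c:]" by (auto elim: degree_eq_zeroE)
  then show ?case using empty by (auto simp: one_pCons)
next
  case (insert i I)
  then have "degree P > 0" by simp
  then have "\<not> constant (poly P)" by (simp add: constant_degree)
  then obtain r where "poly P r = 0" using fundamental_theorem_of_algebra by blast
  then obtain Q where Q: "P = [:- r, 1:] * Q" by (auto simp: poly_eq_0_iff_dvd elim: dvdE)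
  have Q0: "Q \<noteq> 0" using insert.prems Q by auto
  have "degree P = 1 + degree Q" unfolding Q using Q0 by (subst degree_mult_eq) auto
  then have dQ: "degree Q = card I" using insert by simp
  have lQ: "lead_coeff Q = 1" using insert.prems(2) unfolding Q lead_coeff_mult by simp
  from insert.IH[OF dQ lQ] obtain z where z: "Q = (\<Prod>n\<in>I. [:- z n, 1:])" by blast
  have "(\<Prod>n\<in>I. [:- (z(i := r)) n, 1:]) = (\<Prod>n\<in>I. [:- z n, 1:])"
    by (intro prod.cong refl) (use insert.hyps in auto)
  then have "P = (\<Prod>n\<in>insert i I. [:- (z(i := r)) n, 1:])"
    using insert.hyps unfolding Q z by simp
  then show ?case by blast
qed

lemma monic_linear_prod:
  fixes z :: "'a \<Rightarrow> complex"
  assumes "finite I"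
  shows "degree (\<Prod>n\<in>I. [:- z n, 1:]) = card I" "lead_coeff (\<Prod>n\<in>I. [:- z n, 1:]) = 1"
proof -
  show "lead_coeff (\<Prod>n\<in>I. [:- z n, 1:]) = 1" by (subst lead_coeff_prod) simp
  show "degree (\<Prod>n\<in>I. [:- z n, 1:]) = card I"
    by (subst degree_prod_sum_eq) auto
qed

text \<open>The numerator of 1 minus the sum of the \<open>\<gamma> j / (s - p j)\<close>, brought
  over the product of all \<open>s - p j\<close>.\<close>

definition char_poly_kern :: "nat \<Rightarrow> (nat \<Rightarrow> complex) \<Rightarrow> (nat \<Rightarrow> complex) \<Rightarrow> complex poly" where
  "char_poly_kern N \<gamma> p = (\<Prod>j<N. [:- p j, 1:]) - (\<Sum>j<N. Polynomial.smult (\<gamma> j) (\<Prod>k\<in>{..<N}-{j}. [:- p k, 1:]))"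

lemma poly_char_poly_kern:
  "poly (char_poly_kern N \<gamma> p) s = (\<Prod>j<N. s - p j) - (\<Sum>j<N. \<gamma> j * (\<Prod>k\<in>{..<N}-{j}. s - p k))"
  unfolding char_poly_kern_def by (simp add: poly_prod poly_sum algebra_simps)

lemma degree_char_poly_kern_rest:
  fixes p \<gamma> :: "nat \<Rightarrow> complex"
  assumes "N \<ge> 1"
  shows "degree (\<Sum>j<N. Polynomial.smult (\<gamma> j) (\<Prod>k\<in>{..<N}-{j}. [:- p k, 1:])) < N"
proof -
  have "degree (Polynomial.smult (\<gamma> j) (\<Prod>k\<in>{..<N}-{j}. [:- p k, 1:])) \<le> N - 1" if "j < N" for j
  proof -
    have "card ({..<N}-{j}) = N - 1" using that by simp
    then have "degree (\<Prod>k\<in>{..<N}-{j}. [:- p k, 1:]) = N - 1" using monic_linear_prod(1)[of "{..<N}-{j}" p] by simp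
    then show ?thesis using degree_smult_le[of "\<gamma> j" "\<Prod>k\<in>{..<N}-{j}. [:- p k, 1:]"] by simp
  qed
  then have "degree (\<Sum>j<N. Polynomial.smult (\<gamma> j) (\<Prod>k\<in>{..<N}-{j}. [:- p k, 1:])) \<le> N - 1"
    by (intro degree_sum_le) auto
  then show ?thesis using assms by simp
qed

lemma char_poly_kern_monic: "degree (char_poly_kern N \<gamma> p) = N" "lead_coeff (char_poly_kern N \<gamma> p) = 1"
proof -
  define A where "A = (\<Prod>j<N. [:- p j, 1:])"
  define B where "B = (\<Sum>j<N. Polynomial.smult (\<gamma> j) (\<Prod>k\<in>{..<N}-{j}. [:- p k, 1:]))"
  have A: "degree A = N" "lead_coeff A = 1" unfolding A_def using monic_linear_prod[of "{..<N}" p] by auto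
  have c: "char_poly_kern N \<gamma> p = A + (- B)" unfolding char_poly_kern_def A_def B_def by simp
  have "degree (char_poly_kern N \<gamma> p) = N \<and> lead_coeff (char_poly_kern N \<gamma> p) = 1"
  proof (cases "N = 0")
    case True
    then show ?thesis using A c by (simp add: B_def)
  next
    case False
    then have "degree (- B) < degree A" unfolding degree_minus A B_def by (intro degree_char_poly_kern_rest) simp
    then show ?thesis using A degree_add_eq_left[of "- B" A] lead_coeff_add_le[of "- B" A] unfolding c by (simp add: add.commute)
  qed
  then show "degree (char_poly_kern N \<gamma> p) = N" "lead_coeff (char_poly_kern N \<gamma> p) = 1" by auto
qed

lemma char_poly_kern_factorization:
  fixes p \<gamma> :: "nat \<Rightarrow> complex"
  assumes "finite I" "card I = N"
  shows "\<exists>z. \<forall>s. (\<Prod>n\<in>I. s - z n) = (\<Prod>j<N. s - p j) - (\<Sum>j<N. \<gamma> j * (\<Prod>k\<in>{..<N}-{j}. s - p k))"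
proof -
  obtain z where z: "char_poly_kern N \<gamma> p = (\<Prod>n\<in>I. [:- z n, 1:])"
    using monic_poly_factorization[OF assms(1), of "char_poly_kern N \<gamma> p"] char_poly_kern_monic[of N \<gamma> p] assms(2) by auto
  have "(\<Prod>n\<in>I. s - z n) = poly (char_poly_kern N \<gamma> p) s" for s
    unfolding z by (simp add: poly_prod)
  then show ?thesis unfolding poly_char_poly_kern by blast
qed

text \<open>Continuity of simple roots: \<open>\<bar>P\<^sub>k (z n)\<bar> = \<Prod>\<^sub>m \<bar>z n - y k m\<bar>\<close> bounds the distance from \<open>z n\<close> to the
  nearest root of \<open>P\<^sub>k\<close>.\<close>

lemma roots_continuous:
  fixes z :: "'a \<Rightarrow> complex" and y :: "nat \<Rightarrow> 'a \<Rightarrow> complex"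
  assumes I: "finite I" and z: "inj_on z I"
    and lim: "\<And>n. n \<in> I \<Longrightarrow> (\<lambda>k. \<Prod>m\<in>I. z n - y k m) \<longlonglongrightarrow> 0"
  obtains x where "\<And>n. n \<in> I \<Longrightarrow> (\<lambda>k. x k n) \<longlonglongrightarrow> z n" "\<forall>\<^sub>F k in sequentially. inj_on (x k) I"
    "\<forall>\<^sub>F k in sequentially. \<forall>s. (\<Prod>n\<in>I. s - x k n) = (\<Prod>n\<in>I. s - y k n)"
proof -
  define \<sigma> where "\<sigma> k n = arg_min_on (\<lambda>m. cmod (z n - y k m)) I" for k n
  define x where "x k n = y k (\<sigma> k n)" for k n
  have \<sigma>: "\<sigma> k n \<in> I" "\<And>m. m \<in> I \<Longrightarrow> cmod (z n - x k n) \<le> cmod (z n - y k m)" if "n \<in> I" for k n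
  proof -
    have ne: "I \<noteq> {}" using that by auto
    show "\<sigma> k n \<in> I" unfolding \<sigma>_def by (rule arg_min_if_finite(1)[OF I ne])
    show "cmod (z n - x k n) \<le> cmod (z n - y k m)" if "m \<in> I" for m
      unfolding \<sigma>_def x_def by (rule arg_min_least[OF I ne that])
  qed
  have xl: "(\<lambda>k. x k n) \<longlonglongrightarrow> z n" if n: "n \<in> I" for n
  proof (rule LIMSEQ_I)
    fix \<epsilon> :: real assume e: "\<epsilon> > 0"
    then have "\<epsilon> ^ card I > 0" by simp
    from LIMSEQ_D[OF lim[OF n] this] obtain K where K: "\<And>k. k \<ge> K \<Longrightarrow> norm (\<Prod>m\<in>I. z n - y k m) < \<epsilon> ^ card I" by auto
    show "\<exists>K. \<forall>k\<ge>K. norm (x k n - z n) < \<epsilon>"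
    proof (intro exI[of _ K] allI impI)
      fix k assume k: "K \<le> k"
      have "cmod (z n - x k n) ^ card I = (\<Prod>m\<in>I. cmod (z n - x k n))" by simp
      also have "\<dots> \<le> (\<Prod>m\<in>I. cmod (z n - y k m))" by (intro prod_mono) (use \<sigma>(2)[OF n] in auto)
      also have "\<dots> < \<epsilon> ^ card I" using K[OF k] by (simp add: prod_norm)
      finally have "cmod (z n - x k n) < \<epsilon>" by (rule power_less_imp_less_base) (use e in simp)
      then show "norm (x k n - z n) < \<epsilon>" by (simp add: norm_minus_commute)
    qed
  qed
  have "\<forall>\<^sub>F k in sequentially. \<forall>q\<in>{(n,m) \<in> I \<times> I. n \<noteq> m}. x k (fst q) \<noteq> x k (snd q)"
  proof (rule eventually_ball_finite)
    show "finite {(n,m) \<in> I \<times> I. n \<noteq> m}" by (rule finite_subset[of _ "I \<times> I"]) (use I in auto)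
    show "\<forall>q\<in>{(n,m) \<in> I \<times> I. n \<noteq> m}. \<forall>\<^sub>F k in sequentially. x k (fst q) \<noteq> x k (snd q)"
    proof
      fix q assume "q \<in> {(n,m) \<in> I \<times> I. n \<noteq> m}"
      then obtain n m where q: "q = (n, m)" "n \<in> I" "m \<in> I" "n \<noteq> m" by auto
      have "(\<lambda>k. x k n - x k m) \<longlonglongrightarrow> z n - z m" by (intro tendsto_diff xl q)
      moreover have "z n - z m \<noteq> 0" using q z by (auto dest: inj_onD)
      ultimately have "\<forall>\<^sub>F k in sequentially. x k n - x k m \<noteq> 0" by (rule tendsto_imp_eventually_ne)
      then show "\<forall>\<^sub>F k in sequentially. x k (fst q) \<noteq> x k (snd q)" unfolding q by simp
    qed
  qed
  then have inj: "\<forall>\<^sub>F k in sequentially. inj_on (x k) I"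
    by eventually_elim (auto simp: inj_on_def)
  moreover have "\<forall>\<^sub>F k in sequentially. \<forall>s. (\<Prod>n\<in>I. s - x k n) = (\<Prod>n\<in>I. s - y k n)"
    using inj
  proof eventually_elim
    case (elim k)
    \<comment> \<open>Once the selected roots are distinct, \<open>\<sigma> k\<close> permutes the
      finite set \<open>I\<close>, so every index has been selected exactly once.\<close>
    have "inj_on (\<sigma> k) I" using elim unfolding x_def inj_on_def by metis
    then have "bij_betw (\<sigma> k) I I"
      using endo_inj_surj[OF I] \<sigma>(1) by (auto simp: bij_betw_def)
    then show ?case unfolding x_def using prod.reindex_bij_betw[of "\<sigma> k" I I "\<lambda>m. _ - y k m"] by simp
  qed
  ultimately show ?thesis using xl by (intro that)
qed

text \<open>For poles on the proper sides of the imaginary axis, the sign on the negative half-line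
  makes the Fourier transform at \<open>x\<close> the sum of all
  \<open>\<gamma> j / (s - p j)\<close> with s = -ix. The value \<open>c\<close> at 0 is
  arbitrary.\<close>

definition kern :: "nat \<Rightarrow> nat \<Rightarrow> (nat \<Rightarrow> complex) \<Rightarrow> (nat \<Rightarrow> complex) \<Rightarrow> complex \<Rightarrow> real \<Rightarrow> complex" where
  "kern M N \<gamma> p c t = (if t > 0 then \<Sum>j\<in>{M..<N}. \<gamma> j * exp (p j * of_real t)
     else if t < 0 then - (\<Sum>m<M. \<gamma> m * exp (p m * of_real t)) else c)"

lemma kern_measurable: "kern M N \<gamma> p c \<in> borel_measurable borel"
proof -
  have "continuous_on UNIV (\<lambda>t::real. \<Sum>j\<in>{M..<N}. \<gamma> j * exp (p j * of_real t))" by (intro continuous_intros)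
  then have 1: "(\<lambda>t::real. \<Sum>j\<in>{M..<N}. \<gamma> j * exp (p j * of_real t)) \<in> borel_measurable borel"
    by (rule borel_measurable_continuous_onI)
  have "continuous_on UNIV (\<lambda>t::real. - (\<Sum>m<M. \<gamma> m * exp (p m * of_real t)))" by (intro continuous_intros)
  then have 2: "(\<lambda>t::real. - (\<Sum>m<M. \<gamma> m * exp (p m * of_real t))) \<in> borel_measurable borel"
    by (rule borel_measurable_continuous_onI)
  show ?thesis unfolding kern_def
    by (intro measurable_If 1 2 borel_measurable_const) auto
qed

lemma bker_convolution:
  fixes k :: "real \<Rightarrow> complex"
  assumes k: "k \<in> borel_measurable borel" and C: "\<And>t. \<bar>t\<bar> < \<tau> \<Longrightarrow> cmod (k t) \<le> C"
  shows "bker (lborel_Ioo \<tau>) (\<lambda>x y. k (x - y))"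
proof (rule bkerI)
  have m: "(\<lambda>x. x) \<in> borel_measurable (lborel_Ioo \<tau>)" by (rule measurable_lborel_Ioo) simp
  have "(\<lambda>q. fst q - snd q) \<in> borel_measurable (lborel_Ioo \<tau> \<Otimes>\<^sub>M lborel_Ioo \<tau>)"
    using measurable_compose[OF measurable_fst m] measurable_compose[OF measurable_snd m] by (intro borel_measurable_diff)
  from measurable_compose[OF this k] show "(\<lambda>(x,y). k (x - y)) \<in> borel_measurable (lborel_Ioo \<tau> \<Otimes>\<^sub>M lborel_Ioo \<tau>)"
    by (simp add: case_prod_beta')
  show "cmod (k (x - y)) \<le> C" if "x \<in> space (lborel_Ioo \<tau>)" "y \<in> space (lborel_Ioo \<tau>)" for x y
    by (rule C) (use that in auto)
qed

lemma norm_kern_le: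
  assumes t: "\<bar>t\<bar> < \<tau>" and MN: "M \<le> N"
  shows "cmod (kern M N \<gamma> p c t) \<le> (\<Sum>j<N. cmod (\<gamma> j) * exp (cmod (p j) * \<tau>)) + cmod c"
proof -
  define b where "b j = cmod (\<gamma> j) * exp (cmod (p j) * \<tau>)" for j
  have b: "cmod (\<gamma> j * exp (p j * of_real t)) \<le> b j" "0 \<le> b j" for j
  proof -
    have "cmod (exp (p j * of_real t)) \<le> exp (cmod (p j) * \<tau>)" using t by (intro norm_exp_mult_le) simp
    then show "cmod (\<gamma> j * exp (p j * of_real t)) \<le> b j" unfolding b_def norm_mult by (rule mult_left_mono) simp
    show "0 \<le> b j" unfolding b_def by simp
  qed
  have s: "cmod (\<Sum>j\<in>J. \<gamma> j * exp (p j * of_real t)) \<le> (\<Sum>j<N. b j)" if "J \<subseteq> {..<N}" for J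
    by (rule order_trans[OF sum_norm_le[OF b(1)] sum_mono2]) (use that b in auto)
  have s0: "0 \<le> (\<Sum>j<N. b j)" using b by (intro sum_nonneg)
  show ?thesis unfolding kern_def b_def[symmetric]
  proof -
    have "cmod (\<Sum>j\<in>{M..<N}. \<gamma> j * exp (p j * of_real t)) \<le> (\<Sum>j<N. b j)" by (rule s) auto
    moreover have "cmod (- (\<Sum>m<M. \<gamma> m * exp (p m * of_real t))) \<le> (\<Sum>j<N. b j)"
      unfolding norm_minus_cancel by (rule s) (use MN in auto)
    ultimately show "cmod (if 0 < t then \<Sum>j = M..<N. \<gamma> j * exp (p j * complex_of_real t)
          else if t < 0 then - (\<Sum>m<M. \<gamma> m * exp (p m * complex_of_real t)) else c) \<le> (\<Sum>j<N. b j) + cmod c"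
      using s0 norm_ge_zero[of c] by (simp only: split: if_split) linarith
  qed
qed

lemma bker_kern: "M \<le> N \<Longrightarrow> bker (lborel_Ioo \<tau>) (\<lambda>x y. kern M N \<gamma> p c (x - y))"
  by (rule bker_convolution[OF kern_measurable norm_kern_le])

text \<open>The bound does not depend on \<open>t\<close>, so convergence of the parameters gives
  uniform convergence of the kernels.\<close>

lemma norm_kern_diff_le:
  assumes t: "\<bar>t\<bar> < \<tau>" and MN: "M \<le> N"
  shows "cmod (kern M N \<gamma>' p' c t - kern M N \<gamma> p c t)
     \<le> (\<Sum>j<N. cmod (\<gamma>' j - \<gamma> j) * exp (cmod (p' j) * \<tau>)
        + cmod (\<gamma> j) * (exp (cmod (p j) * \<tau>) * (cmod (p' j - p j) * \<tau> * exp (cmod (p' j - p j) * \<tau>))))"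
proof -
  define b where "b j = cmod (\<gamma>' j - \<gamma> j) * exp (cmod (p' j) * \<tau>)
        + cmod (\<gamma> j) * (exp (cmod (p j) * \<tau>) * (cmod (p' j - p j) * \<tau> * exp (cmod (p' j - p j) * \<tau>)))" for j
  have t0: "0 \<le> \<tau>" using t by linarith
  have b0: "0 \<le> b j" for j unfolding b_def using t0 by simp
  have b: "cmod (\<gamma>' j * exp (p' j * of_real t) - \<gamma> j * exp (p j * of_real t)) \<le> b j" for j
  proof -
    define d where "d = p' j - p j"
    have "exp (p' j * of_real t) = exp (p j * of_real t) * exp (d * of_real t)"
      unfolding d_def by (simp add: exp_add[symmetric] algebra_simps)
    then have "\<gamma>' j * exp (p' j * of_real t) - \<gamma> j * exp (p j * of_real t)
       = (\<gamma>' j - \<gamma> j) * exp (p' j * of_real t) + \<gamma> j * (exp (p j * of_real t) * (exp (d * of_real t) - 1))"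
      by (simp add: algebra_simps)
    also have "cmod \<dots> \<le> cmod ((\<gamma>' j - \<gamma> j) * exp (p' j * of_real t)) + cmod (\<gamma> j * (exp (p j * of_real t) * (exp (d * of_real t) - 1)))"
      by (rule norm_triangle_ineq)
    also have "\<dots> \<le> b j"
      unfolding b_def norm_mult d_def[symmetric]
    proof (intro add_mono mult_left_mono mult_mono)
      show "cmod (exp (p' j * of_real t)) \<le> exp (cmod (p' j) * \<tau>)" "cmod (exp (p j * of_real t)) \<le> exp (cmod (p j) * \<tau>)"
        by (rule norm_exp_mult_le, use t in simp)+
      have "cmod (exp (d * of_real t) - 1) \<le> cmod (d * of_real t) * exp (cmod (d * of_real t))"
        by (rule norm_exp_minus_one_le)
      also have "\<dots> \<le> (cmod d * \<tau>) * exp (cmod d * \<tau>)"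
      proof -
        have "cmod (d * of_real t) \<le> cmod d * \<tau>" unfolding norm_mult using t by (intro mult_left_mono) auto
        then show ?thesis by (intro mult_mono) (use t0 in auto)
      qed
      finally show "cmod (exp (d * of_real t) - 1) \<le> cmod d * \<tau> * exp (cmod d * \<tau>)" .
    qed auto
    finally show ?thesis .
  qed
  have s: "cmod ((\<Sum>j\<in>J. \<gamma>' j * exp (p' j * of_real t)) - (\<Sum>j\<in>J. \<gamma> j * exp (p j * of_real t))) \<le> (\<Sum>j<N. b j)" if "J \<subseteq> {..<N}" for J
    unfolding sum_subtractf[symmetric]
    by (rule order_trans[OF sum_norm_le[OF b] sum_mono2]) (use that b0 in auto)
  have s': "cmod (- (\<Sum>j\<in>J. \<gamma>' j * exp (p' j * of_real t)) - - (\<Sum>j\<in>J. \<gamma> j * exp (p j * of_real t))) \<le> (\<Sum>j<N. b j)" if "J \<subseteq> {..<N}" for J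
    using s[OF that] by (simp add: norm_minus_commute)
  have s0: "0 \<le> (\<Sum>j<N. b j)" using b0 by (intro sum_nonneg)
  have J: "{M..<N} \<subseteq> {..<N}" "{..<M} \<subseteq> {..<N}" using MN by auto
  consider "t > 0" | "t < 0" | "t = 0" by linarith
  then have "cmod (kern M N \<gamma>' p' c t - kern M N \<gamma> p c t) \<le> (\<Sum>j<N. b j)"
  proof cases
    case 1
    then show ?thesis unfolding kern_def using s[OF J(1)] by simp
  next
    case 2
    then have "kern M N \<gamma>' p' c t - kern M N \<gamma> p c t
      = - (\<Sum>j<M. \<gamma>' j * exp (p' j * of_real t)) - - (\<Sum>j<M. \<gamma> j * exp (p j * of_real t))"
      unfolding kern_def by simp
    then show ?thesis using s'[OF J(2)] by (simp only:)
  next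
    case 3
    then show ?thesis unfolding kern_def using s0 by simp
  qed
  then show ?thesis unfolding b_def .
qed

section \<open>Continuity of the determinant and passage to arbitrary poles and coefficients\<close>

context l2_basis_Ioo
begin

lemma kdet_kern_tendsto:
  assumes MN: "M \<le> N" and \<gamma>: "\<And>j. j < N \<Longrightarrow> (\<lambda>k. \<gamma>' k j) \<longlonglongrightarrow> \<gamma> j" and p: "\<And>j. j < N \<Longrightarrow> (\<lambda>k. p' k j) \<longlonglongrightarrow> p j"
  shows "(\<lambda>k. kdet (\<lambda>x y. - kern M N (\<gamma>' k) (p' k) c (x - y))) \<longlonglongrightarrow> kdet (\<lambda>x y. - kern M N \<gamma> p c (x - y))"
proof -
  define B where "B k = (\<Sum>j<N. cmod (\<gamma>' k j - \<gamma> j) * exp (cmod (p' k j) * \<tau>)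
        + cmod (\<gamma> j) * (exp (cmod (p j) * \<tau>) * (cmod (p' k j - p j) * \<tau> * exp (cmod (p' k j - p j) * \<tau>))))" for k
  define A where "A = (\<Sum>j<N. cmod (\<gamma> j) * exp (cmod (p j) * \<tau>)) + cmod c"
  have A0: "0 \<le> A" unfolding A_def by (intro add_nonneg_nonneg sum_nonneg) auto
  have B0: "0 \<le> B k" for k unfolding B_def using tau_pos by (intro sum_nonneg add_nonneg_nonneg) auto
  have "B \<longlonglongrightarrow> (\<Sum>j<N. cmod (\<gamma> j - \<gamma> j) * exp (cmod (p j) * \<tau>)
        + cmod (\<gamma> j) * (exp (cmod (p j) * \<tau>) * (cmod (p j - p j) * \<tau> * exp (cmod (p j - p j) * \<tau>))))"
    unfolding B_def
    by (intro tendsto_sum tendsto_add tendsto_mult tendsto_exp tendsto_norm tendsto_diff tendsto_const \<gamma> p) auto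
  then have B: "B \<longlonglongrightarrow> 0" by simp
  have bound: "cmod (kdet (\<lambda>x y. - kern M N (\<gamma>' k) (p' k) c (x - y)) - kdet (\<lambda>x y. - kern M N \<gamma> p c (x - y)))
      \<le> B k * \<tau> * exp ((A * \<tau> + B k * \<tau> + 1)\<^sup>2 / 2)" for k
  proof -
    have lt: "\<bar>x - y\<bar> < \<tau>" if "x \<in> space (lborel_Ioo \<tau>)" "y \<in> space (lborel_Ioo \<tau>)" for x y using that by auto
    have "cmod (kdet (\<lambda>x y. - kern M N (\<gamma>' k) (p' k) c (x - y)) - kdet (\<lambda>x y. - kern M N \<gamma> p c (x - y)))
      \<le> B k * measure (lborel_Ioo \<tau>) (space (lborel_Ioo \<tau>)) *
        exp ((A * measure (lborel_Ioo \<tau>) (space (lborel_Ioo \<tau>)) + B k * measure (lborel_Ioo \<tau>) (space (lborel_Ioo \<tau>)) + 1)\<^sup>2 / 2)"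
    proof (rule kdet_lipschitz[OF bker_minus[OF bker_kern[OF MN]] bker_minus[OF bker_kern[OF MN]] A0 _ B0])
      fix x y assume xy: "x \<in> space (lborel_Ioo \<tau>)" "y \<in> space (lborel_Ioo \<tau>)"
      show "cmod (- kern M N \<gamma> p c (x - y)) \<le> A"
        using norm_kern_le[OF lt[OF xy] MN] unfolding A_def by simp
      show "cmod (- kern M N (\<gamma>' k) (p' k) c (x - y) - - kern M N \<gamma> p c (x - y)) \<le> B k"
        using norm_kern_diff_le[OF lt[OF xy] MN, of "\<gamma>' k" "p' k" c \<gamma> p] unfolding B_def
        by (simp add: norm_minus_commute)
    qed
    then show ?thesis by (simp add: measure_Ioo)
  qed
  have "(\<lambda>k. B k * \<tau> * exp ((A * \<tau> + B k * \<tau> + 1)\<^sup>2 / 2)) \<longlonglongrightarrow> 0 * \<tau> * exp ((A * \<tau> + 0 * \<tau> + 1)\<^sup>2 / 2)"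
    by (intro tendsto_mult tendsto_exp tendsto_divide tendsto_power tendsto_add tendsto_const B) auto
  then have B': "(\<lambda>k. B k * \<tau> * exp ((A * \<tau> + B k * \<tau> + 1)\<^sup>2 / 2)) \<longlonglongrightarrow> 0" by simp
  have "(\<lambda>k. kdet (\<lambda>x y. - kern M N (\<gamma>' k) (p' k) c (x - y)) - kdet (\<lambda>x y. - kern M N \<gamma> p c (x - y))) \<longlonglongrightarrow> 0"
    by (rule Lim_null_comparison[OF always_eventually B']) (use bound in blast)
  then show ?thesis by (rule LIM_zero_cancel)
qed

text \<open>Perturbed coefficients and differences of perturbed poles are affine in a null sequence
  of nonzero numbers; with nonzero slope they vanish for only finitely many
  \<open>k\<close>.\<close>

lemma eventually_affine_ne_zero:
  fixes c d :: complex
  assumes "d \<noteq> 0"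
  shows "\<forall>\<^sub>F k in sequentially. c + d * of_real (inverse (real (Suc k))) \<noteq> 0"
proof (cases "c = 0")
  case True
  have "d * of_real (inverse (real (Suc k))) \<noteq> 0" for k
    using assms by (simp del: of_nat_Suc)
  then show ?thesis unfolding True by (intro always_eventually) simp
next
  case False
  have "(\<lambda>k. c + d * of_real (inverse (real (Suc k)))) \<longlonglongrightarrow> c + d * of_real 0"
    by (intro tendsto_add tendsto_mult tendsto_const tendsto_of_real LIMSEQ_inverse_real_of_nat)
  then show ?thesis by (rule tendsto_imp_eventually_ne) (use False in simp)
qed

text \<open>The poles are moved to \<open>p\<^sub>j + j \<epsilon>\<close> and the coefficients to \<open>\<gamma>\<^sub>j + \<epsilon>\<close>; the zeros \<open>z\<^sub>n\<close>, being simple, follow.\<close>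

theorem kdet_kern:
  fixes p \<gamma> :: "nat \<Rightarrow> complex" and z :: "'i \<Rightarrow> complex"
  assumes MN: "M \<le> N"
    and I: "finite I" "card I = N" and z: "inj_on z I"
    and pp: "\<And>m j. m < M \<Longrightarrow> M \<le> j \<Longrightarrow> j < N \<Longrightarrow> p m \<noteq> p j"
    and char: "\<And>s. (\<Prod>n\<in>I. s - z n) = (\<Prod>j<N. s - p j) - (\<Sum>j<N. \<gamma> j * (\<Prod>k\<in>{..<N}-{j}. s - p k))"
  shows "kdet (\<lambda>x y. - kern M N \<gamma> p c (x - y)) = exp (- of_real \<tau> * (\<Sum>m<M. \<gamma> m)) * (exp (- of_real \<tau> * (\<Sum>m<M. p m)) *
      (\<Sum>T | T \<subseteq> I \<and> card T = M. subset_coeff M N p z I T * exp (of_real \<tau> * (\<Sum>n\<in>T. z n))))"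
proof -
  define \<epsilon> where "\<epsilon> k = complex_of_real (inverse (real (Suc k)))" for k
  define p' where "p' k j = p j + of_nat j * \<epsilon> k" for k j
  define \<gamma>' where "\<gamma>' k j = \<gamma> j + \<epsilon> k" for k and j :: nat
  define P where "P k s = (\<Prod>j<N. s - p' k j) - (\<Sum>j<N. \<gamma>' k j * (\<Prod>i\<in>{..<N}-{j}. s - p' k i))" for k s
  have \<epsilon>0: "\<epsilon> \<longlonglongrightarrow> 0"
    unfolding \<epsilon>_def using tendsto_of_real[OF LIMSEQ_inverse_real_of_nat] by (simp only: of_real_0)
  have pl: "(\<lambda>k. p' k j) \<longlonglongrightarrow> p j" for j
  proof -
    have "(\<lambda>k. p' k j) \<longlonglongrightarrow> p j + of_nat j * 0" unfolding p'_def by (intro tendsto_add tendsto_mult tendsto_const \<epsilon>0)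
    then show ?thesis by simp
  qed
  have \<gamma>l: "(\<lambda>k. \<gamma>' k j) \<longlonglongrightarrow> \<gamma> j" for j
  proof -
    have "(\<lambda>k. \<gamma>' k j) \<longlonglongrightarrow> \<gamma> j + 0" unfolding \<gamma>'_def by (intro tendsto_add tendsto_const \<epsilon>0)
    then show ?thesis by simp
  qed
  have "\<forall>\<^sub>F k in sequentially. \<forall>q\<in>{(i,j) \<in> {..<N} \<times> {..<N}. i \<noteq> j}. p' k (fst q) \<noteq> p' k (snd q)"
  proof (rule eventually_ball_finite)
    show "finite {(i,j) \<in> {..<N} \<times> {..<N}. i \<noteq> j}" by (rule finite_subset[of _ "{..<N} \<times> {..<N}"]) auto
    show "\<forall>q\<in>{(i,j) \<in> {..<N} \<times> {..<N}. i \<noteq> j}. \<forall>\<^sub>F k in sequentially. p' k (fst q) \<noteq> p' k (snd q)"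
    proof
      fix q assume "q \<in> {(i,j) \<in> {..<N} \<times> {..<N}. i \<noteq> j}"
      then obtain i j where q: "q = (i,j)" "i \<noteq> j" by auto
      have "\<forall>\<^sub>F k in sequentially. (p i - p j) + (of_nat i - of_nat j) * \<epsilon> k \<noteq> 0"
        unfolding \<epsilon>_def by (rule eventually_affine_ne_zero) (use q in simp)
      then show "\<forall>\<^sub>F k in sequentially. p' k (fst q) \<noteq> p' k (snd q)"
        unfolding q p'_def by eventually_elim (auto simp: algebra_simps)
    qed
  qed
  then have pinj: "\<forall>\<^sub>F k in sequentially. inj_on (p' k) {..<N}"
    by eventually_elim (auto simp: inj_on_def)
  have \<gamma>ne: "\<forall>\<^sub>F k in sequentially. \<forall>j\<in>{..<N}. \<gamma>' k j \<noteq> 0"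
  proof (rule eventually_ball_finite)
    show "\<forall>j\<in>{..<N}. \<forall>\<^sub>F k in sequentially. \<gamma>' k j \<noteq> 0"
      using eventually_affine_ne_zero[of 1] unfolding \<gamma>'_def \<epsilon>_def by simp
  qed simp
  have "\<forall>k. \<exists>y. \<forall>s. (\<Prod>n\<in>I. s - y n) = P k s"
    unfolding P_def using char_poly_kern_factorization[OF I] by blast
  then obtain y where y: "\<And>k s. (\<Prod>n\<in>I. s - y k n) = P k s" by metis
  have Pl: "(\<lambda>k. P k s) \<longlonglongrightarrow> (\<Prod>n\<in>I. s - z n)" for s
    unfolding P_def char
    by (intro tendsto_diff tendsto_prod tendsto_sum tendsto_mult tendsto_const pl \<gamma>l)
  have "(\<lambda>k. \<Prod>m\<in>I. z n - y k m) \<longlonglongrightarrow> 0" if n: "n \<in> I" for n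
  proof -
    have "(\<Prod>m\<in>I. z n - z m) = 0" using n I by (intro prod_zero bexI[of _ n]) auto
    then show ?thesis using Pl[of "z n"] unfolding y by simp
  qed
  then obtain x where x: "\<And>n. n \<in> I \<Longrightarrow> (\<lambda>k. x k n) \<longlonglongrightarrow> z n" "\<forall>\<^sub>F k in sequentially. inj_on (x k) I"
    "\<forall>\<^sub>F k in sequentially. \<forall>s. (\<Prod>n\<in>I. s - x k n) = (\<Prod>n\<in>I. s - y k n)"
    using roots_continuous[OF I(1) z] by blast
  define RHS where "RHS \<gamma> p z = exp (- of_real \<tau> * (\<Sum>m<M. \<gamma> m)) * (exp (- of_real \<tau> * (\<Sum>m<M. p m)) *
      (\<Sum>T | T \<subseteq> I \<and> card T = M. subset_coeff M N p z I T * exp (of_real \<tau> * (\<Sum>n\<in>T. z n))))"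
    for \<gamma> p :: "nat \<Rightarrow> complex" and z :: "'i \<Rightarrow> complex"
  have ev: "\<forall>\<^sub>F k in sequentially. kdet (\<lambda>x y. - kern M N (\<gamma>' k) (p' k) c (x - y)) = RHS (\<gamma>' k) (p' k) (x k)"
    using pinj \<gamma>ne x(2,3)
  proof eventually_elim
    case (elim k)
    show ?case unfolding RHS_def
    proof (rule kdet_generic[OF bker_kern[OF MN] MN])
      show "(\<Prod>n\<in>I. s - x k n) = (\<Prod>j<N. s - p' k j) - (\<Sum>j<N. \<gamma>' k j * (\<Prod>i\<in>{..<N}-{j}. s - p' k i))" for s
        using elim(4) y unfolding P_def by simp
    qed (use elim I in \<open>auto simp: kern_def\<close>)
  qed
  have "(\<lambda>k. RHS (\<gamma>' k) (p' k) (x k)) \<longlonglongrightarrow> RHS \<gamma> p z"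
    unfolding RHS_def
  proof (intro tendsto_mult tendsto_exp tendsto_sum tendsto_const)
    fix T assume "T \<in> {T. T \<subseteq> I \<and> card T = M}"
    then have T: "T \<subseteq> I" "card T = M" by auto
    show "(\<lambda>k. subset_coeff M N (p' k) (x k) I T) \<longlonglongrightarrow> subset_coeff M N p z I T"
      unfolding subset_coeff_def
    proof (intro tendsto_mult tendsto_prod tendsto_diff tendsto_inverse)
      \<comment> \<open>The coefficient has denominators only between poles of different blocks and
        between different zeros, so coinciding poles within a block do no harm in the limit.\<close>
      fix m j assume "m \<in> {..<M}" "j \<in> {M..<N}"
      then show "p m - p j \<noteq> 0" using pp by auto
    next
      fix n l assume "n \<in> T" "l \<in> I - T"
      then show "z n - z l \<noteq> 0" using z T by (auto dest: inj_onD)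
    qed (use pl x(1) T in auto)
    show "(\<lambda>k. x k n) \<longlonglongrightarrow> z n" if "n \<in> T" for n using x(1) T that by auto
  qed (use pl \<gamma>l in auto)
  from Lim_transform_eventually[OF this eventually_mono[OF ev sym]]
  have "(\<lambda>k. kdet (\<lambda>x y. - kern M N (\<gamma>' k) (p' k) c (x - y))) \<longlonglongrightarrow> RHS \<gamma> p z" .
  moreover have "(\<lambda>k. kdet (\<lambda>x y. - kern M N (\<gamma>' k) (p' k) c (x - y))) \<longlonglongrightarrow> kdet (\<lambda>x y. - kern M N \<gamma> p c (x - y))"
    by (rule kdet_kern_tendsto[OF MN \<gamma>l pl])
  ultimately show ?thesis unfolding RHS_def by (intro LIMSEQ_unique)
qed

end

section \<open>Spectrum of triangular kernels\<close>

text \<open>In the weighted sup norm with weight \<open>exp (s g x)\<close> the iterated kernels decay like \<open>(C / g)\<^sup>n\<close>, with \<open>g\<close> at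
  our disposal; hence the Neumann series of the resolvent converges at every \<open>z \<noteq> 0\<close>.\<close>

lemma triangular_not_in_spectrum:
  fixes a :: "real \<Rightarrow> real \<Rightarrow> complex" and s :: real
  assumes \<tau>: "\<tau> > 0" and a: "bker (lborel_Ioo \<tau>) a" and s: "s = 1 \<or> s = -1" and z: "z \<noteq> 0"
    and tri: "\<And>x y. x \<in> {0<..<\<tau>} \<Longrightarrow> y \<in> {0<..<\<tau>} \<Longrightarrow> s * (y - x) > 0 \<Longrightarrow> a x y = 0"
  shows "z \<notin> op_spectrum (lborel_Ioo \<tau>) (kop (lborel_Ioo \<tau>) a)"
proof -
  interpret finite_measure "lborel_Ioo \<tau>" by (rule finite_measure_lborel_Ioo)
  obtain C where C0: "C \<ge> 0" and C': "\<And>x y. x \<in> space (lborel_Ioo \<tau>) \<Longrightarrow> y \<in> space (lborel_Ioo \<tau>) \<Longrightarrow> cmod (a x y) \<le> C"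
    using a by (rule bkerE) blast
  note C = C'[unfolded space_lborel_Ioo]
  \<comment> \<open>With this rate the ratio \<open>C / g / cmod z\<close> of the Neumann series is
    \<open>C / (2 * (C + 1))\<close>, which is below 1.\<close>
  define g where "g = 2 * (C + 1) / cmod z"
  have g: "g > 0" unfolding g_def using C0 z by simp
  have s2: "s * s = 1" "\<bar>s\<bar> = 1" using s by auto
  define w where "w x = exp (s * g * x)" for x
  \<comment> \<open>The row of \<open>x\<close> is supported in [0, x] for \<open>s = 1\<close> and
    to the right of \<open>x\<close> for \<open>s = -1\<close>.\<close>
  define lo where "lo x = (if s = 1 then 0 else x)" for x :: real
  define hi where "hi x = (if s = 1 then x else \<tau>)" for x :: real
  have aw: "cmod (a x y) * w y \<le> (if lo x \<le> y \<and> y \<le> hi x then C * w y else 0)" if "x \<in> {0<..<\<tau>}" "y \<in> {0<..<\<tau>}" for x y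
  proof (cases "s * (y - x) > 0")
    case True
    then show ?thesis using tri[OF that True] C0 unfolding w_def by auto
  next
    case False
    then have "lo x \<le> y \<and> y \<le> hi x" using s that unfolding lo_def hi_def by auto
    then show ?thesis using C[OF that] unfolding w_def by (simp add: mult_right_mono)
  qed
  have A: "cmod (a x y) * w y \<le> C * w x" if xy: "x \<in> {0<..<\<tau>}" "y \<in> {0<..<\<tau>}" for x y
  proof (cases "s * (y - x) > 0")
    case True
    then show ?thesis using tri[OF xy True] C0 unfolding w_def by auto
  next
    case False
    have "s * (y - x) \<le> 0" using False by simp
    then have "g * (s * (y - x)) \<le> 0" by (rule mult_nonneg_nonpos[OF less_imp_le[OF g]])
    then have "s * g * y \<le> s * g * x" by (simp add: algebra_simps)
    then have "w y \<le> w x" unfolding w_def by (simp only: exp_le_cancel_iff)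
    then show ?thesis using C[OF xy] by (intro mult_mono C0) (auto simp: w_def)
  qed
  have wm: "w \<in> borel_measurable (lborel_Ioo \<tau>)" unfolding w_def by (rule measurable_lborel_Ioo) simp
  have w_le: "w x \<le> exp (g * \<tau>)" if "x \<in> {0<..<\<tau>}" for x
  proof -
    have "s * (g * x) \<le> \<bar>s\<bar> * (g * x)" using g that by (intro mult_right_mono) auto
    also have "\<dots> \<le> g * \<tau>" using g that s2 by (simp add: mult_left_mono)
    finally show ?thesis unfolding w_def by (simp add: mult.assoc)
  qed
  have w_ratio: "w x \<le> w y * exp (g * \<tau>)" if "x \<in> {0<..<\<tau>}" "y \<in> {0<..<\<tau>}" for x y
  proof -
    have "s * (x - y) \<le> \<tau>" using s that by auto
    then have "g * (s * (x - y)) \<le> g * \<tau>" using g by (intro mult_left_mono) auto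
    then show ?thesis unfolding w_def exp_add[symmetric] by (simp add: algebra_simps)
  qed
  \<comment> \<open>Integrating the weight over the support of the row gains the factor
    \<open>1 / g\<close>; the end point at \<open>x\<close> gives the bound and the other one has
    the favourable sign.\<close>
  have q: "(LINT y|lborel_Ioo \<tau>. cmod (a x y) * w y) \<le> C / g * w x" if x: "x \<in> {0<..<\<tau>}" for x
  proof -
    have lh: "lo x \<le> hi x" using x unfolding lo_def hi_def by auto
    have sg: "s * g \<noteq> 0" using s g by auto
    have deriv: "((\<lambda>y. C / (s * g) * w y) has_vector_derivative C * w y) (at y within {lo x..hi x})" for y
    proof -
      have "((\<lambda>y. C / (s * g) * w y) has_real_derivative C * w y) (at y within {lo x..hi x})"
        unfolding w_def using sg by (auto intro!: derivative_eq_intros)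
      then show ?thesis by (simp add: has_real_derivative_iff_has_vector_derivative)
    qed
    have cont: "continuous_on {lo x..hi x} (\<lambda>y. C * w y)" unfolding w_def by (intro continuous_intros)
    have hb: "has_bochner_integral lborel (\<lambda>y. indicator {lo x..hi x} y *\<^sub>R (C * w y)) (C / (s * g) * w (hi x) - C / (s * g) * w (lo x))"
      by (rule has_bochner_integral_FTC_Icc[OF lh deriv cont])
    have "(LINT y|lborel_Ioo \<tau>. cmod (a x y) * w y) = (LINT y|lborel. indicator {0<..<\<tau>} y *\<^sub>R (cmod (a x y) * w y))"
      by (rule lborel_Ioo_integral)
    also have "\<dots> \<le> (LINT y|lborel. indicator {lo x..hi x} y *\<^sub>R (C * w y))"
    proof (rule integral_mono')
      show "integrable lborel (\<lambda>y. indicator {lo x..hi x} y *\<^sub>R (C * w y))" using hb by (rule integrable.intros)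
      show "indicator {0<..<\<tau>} y *\<^sub>R (cmod (a x y) * w y) \<le> indicator {lo x..hi x} y *\<^sub>R (C * w y)" for y
      proof (cases "y \<in> {0<..<\<tau>}")
        case True
        then show ?thesis using aw[OF x True] by (cases "lo x \<le> y \<and> y \<le> hi x") auto
      next
        case False
        then show ?thesis using C0 by (simp add: w_def)
      qed
      show "0 \<le> indicator {lo x..hi x} y *\<^sub>R (C * w y)" for y
        using C0 by (auto simp: w_def)
    qed
    also have "\<dots> = C / (s * g) * w (hi x) - C / (s * g) * w (lo x)" using hb by (rule has_bochner_integral_integral_eq)
    also have "\<dots> \<le> C / g * w x"
    proof (cases "s = 1")
      case True
      have "0 \<le> C / g * w 0" using C0 g by (simp add: w_def)
      then show ?thesis using True unfolding lo_def hi_def by simp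
    next
      case False
      then have "s = -1" using s by simp
      moreover have "0 \<le> C / g * w \<tau>" using C0 g by (simp add: w_def)
      ultimately show ?thesis unfolding lo_def hi_def by simp
    qed
    finally show ?thesis .
  qed
  \<comment> \<open>Removing the weight costs the factor \<open>exp (g * \<tau>)\<close>, which does
    not depend on \<open>n\<close>.\<close>
  define B where "B n = C * (C / g) ^ n * exp (g * \<tau>)" for n
  have kb: "cmod (kpow (lborel_Ioo \<tau>) a n x y) \<le> B n" if xy: "x \<in> {0<..<\<tau>}" "y \<in> {0<..<\<tau>}" for n x y
  proof -
    have "cmod (kpow (lborel_Ioo \<tau>) a n x y) * w y \<le> C * (C / g) ^ n * w x"
      by (rule kpow_bound_weighted[OF a, of w C "exp (g * \<tau>)" "C / g"]) (use A wm w_le q xy in \<open>auto simp: w_def\<close>)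
    also have "\<dots> \<le> C * (C / g) ^ n * (w y * exp (g * \<tau>))"
      using w_ratio[OF xy] C0 g by (intro mult_left_mono) auto
    finally have "cmod (kpow (lborel_Ioo \<tau>) a n x y) * w y \<le> B n * w y" unfolding B_def by (simp add: mult_ac)
    then show ?thesis by (rule mult_right_le_imp_le) (simp add: w_def)
  qed
  interpret kernel_powers "lborel_Ioo \<tau>" a B
    by unfold_locales (use a kb C0 g in \<open>auto simp: B_def\<close>)
  have "summable_coeff (\<lambda>n. 1 / z ^ Suc n)"
  proof -
    have r: "C / g / cmod z = C / (2 * (C + 1))" 
    proof -
      have "g * cmod z = 2 * (C + 1)" unfolding g_def using z by simp
      then show ?thesis by (metis divide_divide_eq_left)
    qed
    have "norm (C / g / cmod z) < 1" unfolding r using C0 by (simp add: field_simps)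
    then have "summable (\<lambda>n. C * exp (g * \<tau>) / cmod z * (C / g / cmod z) ^ n)"
      by (intro summable_mult summable_geometric)
    moreover have "cmod (1 / z ^ Suc n) * B n = C * exp (g * \<tau>) / cmod z * (C / g / cmod z) ^ n" for n
      unfolding B_def by (simp add: norm_divide norm_mult norm_power power_divide power_mult_distrib mult_ac)
    ultimately show ?thesis by simp
  qed
  from resolvent_not_spectrum[OF z this] show ?thesis .
qed

lemma (in l2_basis_Ioo) volterra_operator_kop:
  fixes s :: real
  assumes a: "bker (lborel_Ioo \<tau>) a" and s: "s = 1 \<or> s = -1"
    and tri: "\<And>x y. x \<in> {0<..<\<tau>} \<Longrightarrow> y \<in> {0<..<\<tau>} \<Longrightarrow> s * (y - x) > 0 \<Longrightarrow> a x y = 0"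
  shows "volterra_operator (lborel_Ioo \<tau>) (kop (lborel_Ioo \<tau>) a)"
  unfolding volterra_operator_def
  using compact_operator_kop[OF a] zero_in_spectrum[OF a] triangular_not_in_spectrum[OF tau_pos a s _ tri] by blast

section \<open>The Fourier transform of an exponential kernel\<close>

text \<open>The modulus is a real exponential, integrable by the fundamental theorem for nonnegative
  functions. It dominates the integrands cut off to (0, n), whose integrals are elementary and
  converge.\<close>

lemma has_bochner_integral_exp_halfline:
  fixes c :: complex
  assumes c: "Re c > 0"
  shows "has_bochner_integral lborel (\<lambda>t. indicator {0<..} t *\<^sub>R exp (- c * of_real t)) (1 / c)"
proof -
  have c0: "c \<noteq> 0" using c by auto
  define f where "f t = exp (- c * of_real t)" for t :: real
  have fm: "f \<in> borel_measurable borel"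
    unfolding f_def by (intro borel_measurable_continuous_onI continuous_intros)
  have nf: "cmod (f t) = exp (- Re c * t)" for t unfolding f_def by simp
  have e0: "((\<lambda>t. exp (- Re c * t)) \<longlongrightarrow> 0) at_top"
  proof (rule filterlim_compose[OF exp_at_bot])
    show "LIM t at_top. - Re c * t :> at_bot"
      using filterlim_tendsto_neg_mult_at_bot[OF tendsto_const[of "- Re c"] _ filterlim_ident] c by simp
  qed
  have "((\<lambda>t. - (exp (- Re c * t) / Re c)) \<longlongrightarrow> - (0 / Re c)) at_top"
    by (intro tendsto_minus tendsto_divide e0 tendsto_const) (use c in simp)
  then have "(\<integral>\<^sup>+t. ennreal (exp (- Re c * t)) * indicator {0..} t \<partial>lborel) = ennreal (- (0 / Re c) - - (exp (- Re c * 0) / Re c))"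
    by (intro nn_integral_FTC_atLeast) (use c in \<open>auto intro!: derivative_eq_intros\<close>)
  then have nn: "(\<integral>\<^sup>+t. ennreal (indicator {0..} t * exp (- Re c * t)) \<partial>lborel) = ennreal (1 / Re c)"
    by (simp add: ennreal_mult' mult.commute ennreal_indicator)
  have dom: "integrable lborel (\<lambda>t. indicator {0..} t * exp (- Re c * t))"
    by (rule integrableI_nn_integral_finite[OF _ _ nn]) auto
  have bound: "norm (indicator J t *\<^sub>R f t) \<le> indicator {0..} t * exp (- Re c * t)" if "J \<subseteq> {0..}" for J t
    using that by (auto simp: nf indicator_def)
  have int: "integrable lborel (\<lambda>t. indicator {0<..} t *\<^sub>R f t)"
  proof (rule Bochner_Integration.integrable_bound[OF dom])
    show "(\<lambda>t. indicator {0<..} t *\<^sub>R f t) \<in> borel_measurable lborel" using fm by (intro borel_measurable_scaleR) auto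
    show "AE t in lborel. norm (indicator {0<..} t *\<^sub>R f t) \<le> norm (indicator {0..} t * exp (- Re c * t))"
      by (intro AE_I2 order_trans[OF bound]) auto
  qed
  have lim1: "(\<lambda>n. LINT t|lborel. indicator {0<..<real n} t *\<^sub>R f t) \<longlonglongrightarrow> (LINT t|lborel. indicator {0<..} t *\<^sub>R f t)"
  proof (rule integral_dominated_convergence[where w = "\<lambda>t. indicator {0..} t * exp (- Re c * t)"])
    show "AE t in lborel. (\<lambda>n. indicator {0<..<real n} t *\<^sub>R f t) \<longlonglongrightarrow> indicator {0<..} t *\<^sub>R f t"
    proof (rule AE_I2)
      fix t :: real
      obtain K :: nat where K: "t < real K" using reals_Archimedean2 by blast
      have "indicator {0<..<real n} t *\<^sub>R f t = indicator {0<..} t *\<^sub>R f t" if "n \<ge> K" for n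
      proof -
        have "t < real n" using K that by (meson less_le_trans of_nat_le_iff)
        then show ?thesis by (simp add: indicator_def)
      qed
      then show "(\<lambda>n. indicator {0<..<real n} t *\<^sub>R f t) \<longlonglongrightarrow> indicator {0<..} t *\<^sub>R f t"
        by (intro tendsto_eventually eventually_sequentiallyI[of K])
    qed
    show "AE t in lborel. norm (indicator {0<..<real n} t *\<^sub>R f t) \<le> indicator {0..} t * exp (- Re c * t)" for n
      by (intro AE_I2 bound) auto
  qed (use fm dom in \<open>auto intro!: borel_measurable_scaleR\<close>)
  have eq: "(LINT t|lborel. indicator {0<..<real n} t *\<^sub>R f t) = (f (real n) - 1) / (- c)" for n
  proof -
    have "(LINT t|lborel. indicator {0<..<real n} t *\<^sub>R f t) = exp (- c * of_real (real n)) / (- c) - exp (- c * of_real 0) / (- c)"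
      unfolding f_def
      by (rule integral_Ioo_FTC[OF _ exp_has_vector_derivative]) (use c0 in \<open>auto intro!: continuous_intros\<close>)
    then show ?thesis unfolding f_def by (simp only: diff_divide_distrib) simp
  qed
  have "(\<lambda>n. cmod (f (real n))) \<longlonglongrightarrow> 0" unfolding nf by (rule filterlim_compose[OF e0 filterlim_real_sequentially])
  then have "(\<lambda>n. f (real n)) \<longlonglongrightarrow> 0" by (rule tendsto_norm_zero_cancel)
  then have "(\<lambda>n. (f (real n) - 1) / (- c)) \<longlonglongrightarrow> (0 - 1) / (- c)"
    by (intro tendsto_divide tendsto_diff tendsto_const) (use c0 in auto)
  then have "(\<lambda>n. LINT t|lborel. indicator {0<..<real n} t *\<^sub>R f t) \<longlonglongrightarrow> 1 / c" unfolding eq by simp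
  from LIMSEQ_unique[OF lim1 this] int show ?thesis
    unfolding f_def by (simp add: has_bochner_integral_iff)
qed

lemma has_bochner_integral_exp_halfline_neg:
  fixes c :: complex
  assumes c: "Re c > 0"
  shows "has_bochner_integral lborel (\<lambda>t. indicator {..<0} t *\<^sub>R exp (c * of_real t)) (1 / c)"
proof -
  have "has_bochner_integral lborel (\<lambda>t. indicator {..<0} (0 + (-1) * t) *\<^sub>R exp (c * of_real (0 + (-1) * t))) (1 / c)"
    using has_bochner_integral_exp_halfline[OF c] by (simp add: indicator_def)
  then have "has_bochner_integral lborel (\<lambda>t. indicator {..<0} t *\<^sub>R exp (c * of_real t)) (\<bar>-1\<bar> *\<^sub>R (1 / c))"
    by (subst lborel_has_bochner_integral_real_affine_iff[of "-1" _ _ 0]) auto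
  then show ?thesis by simp
qed

lemma fourier_exponential_sums:
  fixes k :: "real \<Rightarrow> complex"
  assumes lam: "\<And>l. l \<in> A \<Longrightarrow> Re (lam l) > 0" and \<mu>: "\<And>m. m \<in> B \<Longrightarrow> Re (\<mu> m) > 0"
    and k_pos: "\<And>t. t > 0 \<Longrightarrow> k t = (\<Sum>l\<in>A. \<alpha> l * exp (- lam l * of_real t))"
    and k_neg: "\<And>t. t < 0 \<Longrightarrow> k t = (\<Sum>m\<in>B. \<beta> m * exp (\<mu> m * of_real t))"
    and km: "k \<in> borel_measurable borel"
  shows "fourier k x = (\<Sum>l\<in>A. \<alpha> l / (lam l - \<i> * of_real x)) + (\<Sum>m\<in>B. \<beta> m / (\<mu> m + \<i> * of_real x))"
proof -
  define F where "F t = (\<Sum>l\<in>A. \<alpha> l * (indicator {0<..} t *\<^sub>R exp (- (lam l - \<i> * of_real x) * of_real t)))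
     + (\<Sum>m\<in>B. \<beta> m * (indicator {..<0} t *\<^sub>R exp ((\<mu> m + \<i> * of_real x) * of_real t)))" for t :: real
  have F: "has_bochner_integral lborel F ((\<Sum>l\<in>A. \<alpha> l * (1 / (lam l - \<i> * of_real x))) + (\<Sum>m\<in>B. \<beta> m * (1 / (\<mu> m + \<i> * of_real x))))"
    unfolding F_def
    by (intro has_bochner_integral_add has_bochner_integral_sum has_bochner_integral_mult_right
      has_bochner_integral_exp_halfline has_bochner_integral_exp_halfline_neg) (use lam \<mu> in auto)
  have Fk: "exp (\<i> * of_real x * of_real t) * k t = F t" if "t \<noteq> 0" for t
  proof (cases "t > 0")
    case True
    have "exp (\<i> * of_real x * of_real t) * exp (- lam l * of_real t) = exp (- (lam l - \<i> * of_real x) * of_real t)" for l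
      by (simp add: exp_add[symmetric] algebra_simps)
    then have "exp (\<i> * of_real x * of_real t) * k t = (\<Sum>l\<in>A. \<alpha> l * exp (- (lam l - \<i> * of_real x) * of_real t))"
      unfolding k_pos[OF True] sum_distrib_left by (intro sum.cong refl) (simp add: mult.left_commute)
    then show ?thesis using True unfolding F_def by simp
  next
    case False
    then have t: "t < 0" using that by simp
    have "exp (\<i> * of_real x * of_real t) * exp (\<mu> m * of_real t) = exp ((\<mu> m + \<i> * of_real x) * of_real t)" for m
      by (simp add: exp_add[symmetric] algebra_simps)
    then have "exp (\<i> * of_real x * of_real t) * k t = (\<Sum>m\<in>B. \<beta> m * exp ((\<mu> m + \<i> * of_real x) * of_real t))"
      unfolding k_neg[OF t] sum_distrib_left by (intro sum.cong refl) (simp add: mult.left_commute)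
    then show ?thesis using t unfolding F_def by simp
  qed
  have "continuous_on UNIV (\<lambda>t::real. exp (\<i> * of_real x * of_real t))" by (intro continuous_intros)
  then have "(\<lambda>t::real. exp (\<i> * of_real x * of_real t)) \<in> borel_measurable borel" by (rule borel_measurable_continuous_onI)
  then have m: "(\<lambda>t. exp (\<i> * of_real x * of_real t) * k t) \<in> borel_measurable lborel" using km by simp
  have "fourier k x = (LINT t|lborel. F t)"
    unfolding fourier_def
  proof (rule integral_cong_AE[OF m])
    show "F \<in> borel_measurable lborel" using F by (rule borel_measurable_has_bochner_integral)
    show "AE t in lborel. exp (\<i> * of_real x * of_real t) * k t = F t"
      using AE_lborel_singleton[of 0] by eventually_elim (rule Fk)
  qed
  also have "\<dots> = (\<Sum>l\<in>A. \<alpha> l * (1 / (lam l - \<i> * of_real x))) + (\<Sum>m\<in>B. \<beta> m * (1 / (\<mu> m + \<i> * of_real x)))"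
    using F by (rule has_bochner_integral_integral_eq)
  finally show ?thesis by simp
qed

section \<open>The determinant formula\<close>

lemma sum_two_blocks:
  fixes F f g :: "nat \<Rightarrow> 'a::comm_monoid_add"
  assumes "\<And>j. j < M \<Longrightarrow> F j = f (Suc j)" "\<And>j. M \<le> j \<Longrightarrow> F j = g (Suc (j - M))"
  shows "sum F {..<M + L} = sum f {1..M} + sum g {1..L}"
proof (induction L)
  case 0
  have "sum F {..<M} = (\<Sum>j<M. f (Suc j))" by (rule sum.cong) (use assms in auto)
  then show ?case by (simp add: sum.atLeast1_atMost_eq)
qed (simp add: assms(2) add.assoc)

lemma prod_two_blocks:
  fixes F f g :: "nat \<Rightarrow> 'a::comm_monoid_mult"
  assumes "\<And>j. j < M \<Longrightarrow> F j = f (Suc j)" "\<And>j. M \<le> j \<Longrightarrow> F j = g (Suc (j - M))"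
  shows "prod F {..<M + L} = prod f {1..M} * prod g {1..L}"
proof (induction L)
  case 0
  have "prod F {..<M} = (\<Prod>j<M. f (Suc j))" by (rule prod.cong) (use assms in auto)
  then show ?case by (simp add: prod.atLeast1_atMost_eq)
qed (simp add: assms(2) mult.assoc)

lemma sum_scaled_cong:
  fixes a b :: "'a::semiring_0"
  assumes "\<And>x. x \<in> X \<Longrightarrow> a * f x = b * g x"
  shows "a * sum f X = b * sum g X"
  unfolding sum_distrib_left by (rule sum.cong[OF refl assms])

lemma sum_first_block: "(\<Sum>m<M. g (Suc m)) = sum g {1..M}"
  by (simp add: sum.atLeast1_atMost_eq)

lemma prod_first_block: "(\<Prod>m<M. g (Suc m)) = prod g {1..M}"
  by (simp add: prod.atLeast1_atMost_eq)

lemma sum_second_block: "(\<Sum>j\<in>{M..<M + L}. g (Suc (j - M))) = sum g {1..L}"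
  by (rule sum.reindex_bij_witness[of _ "\<lambda>l. l - 1 + M" "\<lambda>j. Suc (j - M)"]) auto

lemma prod_second_block: "(\<Prod>j\<in>{M..<M + L}. g (Suc (j - M))) = prod g {1..L}"
  by (rule prod.reindex_bij_witness[of _ "\<lambda>l. l - 1 + M" "\<lambda>j. Suc (j - M)"]) auto

text \<open>The \<open>\<mu>\<^sub>m\<close> come first, followed by the \<open>-\<lambda>\<^sub>l\<close>; with \<open>s = -ix\<close> the symbol becomes
  \<open>\<Sum>\<^sub>j \<gamma>\<^sub>j / (s - p\<^sub>j)\<close>.\<close>

definition pole :: "nat \<Rightarrow> (nat \<Rightarrow> complex) \<Rightarrow> (nat \<Rightarrow> complex) \<Rightarrow> nat \<Rightarrow> complex" where
  "pole M lam \<mu> j = (if j < M then \<mu> (Suc j) else - lam (Suc (j - M)))"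

definition pole_coeff :: "nat \<Rightarrow> (nat \<Rightarrow> complex) \<Rightarrow> (nat \<Rightarrow> complex) \<Rightarrow> nat \<Rightarrow> complex" where
  "pole_coeff M \<alpha> \<beta> j = (if j < M then - \<beta> (Suc j) else \<alpha> (Suc (j - M)))"

lemma kern_pole:
  fixes k :: "real \<Rightarrow> complex"
  assumes k_pos: "\<And>t. t > 0 \<Longrightarrow> k t = (\<Sum>l\<in>{1..L}. \<alpha> l * exp (- lam l * of_real t))"
    and k_neg: "\<And>t. t < 0 \<Longrightarrow> k t = (\<Sum>m\<in>{1..M}. \<beta> m * exp (\<mu> m * of_real t))"
  shows "k = kern M (M + L) (pole_coeff M \<alpha> \<beta>) (pole M lam \<mu>) (k 0)"
proof
  fix t
  have 1: "(\<Sum>j\<in>{M..<M + L}. pole_coeff M \<alpha> \<beta> j * exp (pole M lam \<mu> j * of_real t))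
      = (\<Sum>l\<in>{1..L}. \<alpha> l * exp (- lam l * of_real t))"
    unfolding sum_second_block[symmetric, of "\<lambda>l. \<alpha> l * exp (- lam l * of_real t)" L M]
    by (rule sum.cong) (auto simp: pole_def pole_coeff_def)
  have 2: "- (\<Sum>m<M. pole_coeff M \<alpha> \<beta> m * exp (pole M lam \<mu> m * of_real t)) = (\<Sum>m\<in>{1..M}. \<beta> m * exp (\<mu> m * of_real t))"
    unfolding sum_first_block[symmetric] sum_negf[symmetric] by (rule sum.cong) (auto simp: pole_def pole_coeff_def)
  show "k t = kern M (M + L) (pole_coeff M \<alpha> \<beta>) (pole M lam \<mu>) (k 0) t"
    unfolding kern_def 1 2 using k_pos k_neg by (cases "t > 0"; cases "t < 0") auto
qed

text \<open>Both sides, divided by the product of the \<open>s - p j\<close>, equal 1 minus the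
  symbol at s = -ix, where the denominator is nonzero because the poles lie off the imaginary axis.
  So the polynomials agree at infinitely many points.\<close>

lemma char_poly_symbol:
  fixes k :: "real \<Rightarrow> complex"
  assumes lam: "\<And>l. l \<in> {1..L} \<Longrightarrow> Re (lam l) > 0" and \<mu>: "\<And>m. m \<in> {1..M} \<Longrightarrow> Re (\<mu> m) > 0"
    and k_pos: "\<And>t. t > 0 \<Longrightarrow> k t = (\<Sum>l\<in>{1..L}. \<alpha> l * exp (- lam l * of_real t))"
    and k_neg: "\<And>t. t < 0 \<Longrightarrow> k t = (\<Sum>m\<in>{1..M}. \<beta> m * exp (\<mu> m * of_real t))"
    and sym: "symbol_zeros L M lam \<mu> k \<zeta>"
  shows "(\<Prod>n\<in>{1..L+M}. [:- (- \<i> * \<zeta> n), 1:]) = char_poly_kern (M + L) (pole_coeff M \<alpha> \<beta>) (pole M lam \<mu>)"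
proof -
  let ?p = "pole M lam \<mu>" and ?\<gamma> = "pole_coeff M \<alpha> \<beta>"
  define A where "A = (\<Prod>n\<in>{1..L+M}. [:- (- \<i> * \<zeta> n), 1:])"
  define B where "B = char_poly_kern (M + L) ?\<gamma> ?p"
  have k: "k = kern M (M + L) ?\<gamma> ?p (k 0)" by (rule kern_pole[OF k_pos k_neg])
  have km: "k \<in> borel_measurable borel"
    using kern_measurable[of M "M + L" ?\<gamma> ?p "k 0"] unfolding k[symmetric] .
  have zero: "poly (A - B) (- \<i> * of_real x) = 0" for x
  proof -
    define s where "s = - \<i> * complex_of_real x"
    have "Re (?p j) \<noteq> 0" if "j < M + L" for j
    proof (cases "j < M")
      case True
      then show ?thesis using \<mu>[of "Suc j"] unfolding pole_def by auto
    next
      case False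
      then have "Suc (j - M) \<in> {1..L}" using that by auto
      from lam[OF this] show ?thesis using False unfolding pole_def by auto
    qed
    moreover have "Re s = 0" unfolding s_def by simp
    ultimately have sp: "s - ?p j \<noteq> 0" if "j < M + L" for j using that by auto
    have "fourier k x = (\<Sum>m\<in>{1..M}. \<beta> m / (\<mu> m + \<i> * of_real x)) + (\<Sum>l\<in>{1..L}. \<alpha> l / (lam l - \<i> * of_real x))"
      using fourier_exponential_sums[OF lam \<mu> k_pos k_neg km, of x] by simp
    also have "\<dots> = (\<Sum>j<M + L. ?\<gamma> j / (s - ?p j))"
    proof (rule sum_two_blocks[symmetric])
      have "- \<i> * of_real x - \<mu> (Suc j) = - (\<mu> (Suc j) + \<i> * of_real x)" for j by simp
      then show "?\<gamma> j / (s - ?p j) = \<beta> (Suc j) / (\<mu> (Suc j) + \<i> * of_real x)" if "j < M" for j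
        using that unfolding pole_def pole_coeff_def s_def by (simp only: if_True minus_divide_divide)
      show "?\<gamma> j / (s - ?p j) = \<alpha> (Suc (j - M)) / (lam (Suc (j - M)) - \<i> * of_real x)" if "M \<le> j" for j
        using that unfolding pole_def pole_coeff_def s_def by simp
    qed
    finally have F: "fourier k x = (\<Sum>j<M + L. ?\<gamma> j / (s - ?p j))" .
    have P: "(\<Prod>j<M + L. s - ?p j) = (\<Prod>m\<in>{1..M}. - \<i> * of_real x - \<mu> m) * (\<Prod>l\<in>{1..L}. - \<i> * of_real x + lam l)"
      by (rule prod_two_blocks) (auto simp: pole_def s_def)
    have P0: "(\<Prod>j<M + L. s - ?p j) \<noteq> 0" using sp by simp
    have "1 - fourier k x = (\<Prod>n\<in>{1..L+M}. - \<i> * of_real x + \<i> * \<zeta> n) *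
       (\<Prod>l\<in>{1..L}. inverse (- \<i> * of_real x + lam l)) * (\<Prod>m\<in>{1..M}. inverse (- \<i> * of_real x - \<mu> m))"
      using sym unfolding symbol_zeros_def by blast
    also have "\<dots> = poly A s * inverse (\<Prod>j<M + L. s - ?p j)"
    proof -
      have "poly A s = (\<Prod>n\<in>{1..L+M}. - \<i> * of_real x + \<i> * \<zeta> n)"
        unfolding A_def poly_prod s_def by (rule prod.cong) auto
      then show ?thesis unfolding P by (simp only: prod_inversef[symmetric] o_def inverse_mult_distrib mult_ac)
    qed
    finally have "poly A s = (1 - fourier k x) * (\<Prod>j<M + L. s - ?p j)" using P0 by (simp add: field_simps)
    also have "\<dots> = (\<Prod>j<M + L. s - ?p j) - (\<Sum>j<M + L. ?\<gamma> j / (s - ?p j) * (\<Prod>j<M + L. s - ?p j))"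
      unfolding F by (simp add: left_diff_distrib sum_distrib_right)
    also have "(\<Sum>j<M + L. ?\<gamma> j / (s - ?p j) * (\<Prod>j<M + L. s - ?p j)) = (\<Sum>j<M + L. ?\<gamma> j * (\<Prod>i\<in>{..<M+L}-{j}. s - ?p i))"
    proof (rule sum.cong[OF refl])
      fix j assume j: "j \<in> {..<M + L}"
      have "(\<Prod>j<M + L. s - ?p j) = (s - ?p j) * (\<Prod>i\<in>{..<M+L}-{j}. s - ?p i)" by (rule prod.remove[OF _ j]) simp
      then show "?\<gamma> j / (s - ?p j) * (\<Prod>j<M + L. s - ?p j) = ?\<gamma> j * (\<Prod>i\<in>{..<M+L}-{j}. s - ?p i)"
        using sp j by simp
    qed
    also have "(\<Prod>j<M + L. s - ?p j) - \<dots> = poly B s" unfolding B_def poly_char_poly_kern ..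
    finally show ?thesis unfolding s_def by simp
  qed
  have "A - B = 0"
  proof (rule ccontr)
    assume "A - B \<noteq> 0"
    then have "finite {s. poly (A - B) s = 0}" by (rule poly_roots_finite)
    moreover have "range (\<lambda>x. - \<i> * complex_of_real x) \<subseteq> {s. poly (A - B) s = 0}" using zero by auto
    ultimately have "finite (range (\<lambda>x. - \<i> * complex_of_real x))" by (rule finite_subset[rotated])
    moreover have "inj (\<lambda>x. - \<i> * complex_of_real x)" by (auto simp: inj_on_def)
    ultimately have "finite (UNIV :: real set)" by (rule finite_imageD)
    then show False using infinite_UNIV_char_0 by blast
  qed
  then show ?thesis unfolding A_def B_def by simp
qed

lemma coeff_prod_linear:
  fixes z :: "'a \<Rightarrow> complex"
  assumes "finite I"
  shows "card I = Suc m \<Longrightarrow> coeff (\<Prod>n\<in>I. [:- z n, 1:]) m = - (\<Sum>n\<in>I. z n)"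
  using assms
proof (induction I arbitrary: m rule: finite_induct)
  case (insert i I)
  define Q where "Q = (\<Prod>n\<in>I. [:- z n, 1:])"
  have m: "card I = m" using insert by simp
  have Q1: "coeff Q m = 1" using monic_linear_prod[OF insert.hyps(1), of z] m unfolding Q_def by simp
  have e: "(\<Prod>n\<in>insert i I. [:- z n, 1:]) = [:- z i, 1:] * Q" using insert.hyps unfolding Q_def by simp
  show ?case
  proof (cases m)
    case 0
    then have "I = {}" using m insert.hyps by simp
    then show ?thesis using 0 by simp
  next
    case (Suc m')
    have "coeff Q m' = - (\<Sum>n\<in>I. z n)" unfolding Q_def by (rule insert.IH) (use m Suc in simp)
    then show ?thesis using Q1 Suc insert.hyps unfolding e by simp
  qed
qed simp

lemma char_poly_kern_eval:
  fixes p \<gamma> z :: "nat \<Rightarrow> complex"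
  assumes "(\<Prod>n\<in>I. [:- z n, 1:]) = char_poly_kern N \<gamma> p"
  shows "(\<Prod>n\<in>I. s - z n) = (\<Prod>j<N. s - p j) - (\<Sum>j<N. \<gamma> j * (\<Prod>k\<in>{..<N}-{j}. s - p k))"
proof -
  have "(\<Prod>n\<in>I. s - z n) = poly (\<Prod>n\<in>I. [:- z n, 1:]) s" by (simp add: poly_prod)
  also have "\<dots> = poly (char_poly_kern N \<gamma> p) s" by (simp only: assms)
  finally show ?thesis unfolding poly_char_poly_kern .
qed

text \<open>Comparison of the coefficients of s^(N-1). It relates k(0_+) - k(0_-) to the zeros and
  poles, which turns one form of the determinant formula into the other.\<close>

lemma char_poly_kern_subleading:
  fixes p \<gamma> :: "nat \<Rightarrow> complex"
  assumes "finite I" "card I = N" "(\<Prod>n\<in>I. [:- z n, 1:]) = char_poly_kern N \<gamma> p"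
  shows "(\<Sum>j<N. \<gamma> j) = (\<Sum>n\<in>I. z n) - (\<Sum>j<N. p j)"
proof (cases N)
  case 0
  then show ?thesis using assms by simp
next
  case (Suc m)
  have 1: "coeff (\<Prod>k\<in>{..<N}-{j}. [:- p k, 1:]) m = 1" if "j < N" for j
    using monic_linear_prod[of "{..<N}-{j}" p] that Suc by simp
  have "- (\<Sum>n\<in>I. z n) = coeff (char_poly_kern N \<gamma> p) m"
    unfolding assms(3)[symmetric] by (rule coeff_prod_linear[symmetric]) (use assms Suc in auto)
  also have "\<dots> = coeff (\<Prod>j<N. [:- p j, 1:]) m - (\<Sum>j<N. \<gamma> j * coeff (\<Prod>k\<in>{..<N}-{j}. [:- p k, 1:]) m)"
    unfolding char_poly_kern_def by (simp add: coeff_sum)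
  also have "coeff (\<Prod>j<N. [:- p j, 1:]) m = - (\<Sum>j<N. p j)" by (rule coeff_prod_linear) (use Suc in auto)
  also have "(\<Sum>j<N. \<gamma> j * coeff (\<Prod>k\<in>{..<N}-{j}. [:- p k, 1:]) m) = (\<Sum>j<N. \<gamma> j)"
    by (rule sum.cong) (use 1 in auto)
  finally show ?thesis by (simp add: algebra_simps)
qed

text \<open>The signs in the second block of poles and in \<open>z n = - \<i> * \<zeta> n\<close>
  account for all differences apart from the order of the products.\<close>

lemma subset_coeff_eq_W:
  "subset_coeff M (M + L) (pole M lam \<mu>) (\<lambda>n. - \<i> * \<zeta> n) {1..L+M} T = W_coeff L M lam \<mu> \<zeta> T"
proof -
  let ?p = "pole M lam \<mu>" and ?I = "{1..L+M}"
  have 1: "(\<Prod>m<M. \<Prod>l\<in>?I-T. ?p m - (- \<i> * \<zeta> l)) = (\<Prod>l\<in>?I-T. \<Prod>m\<in>{1..M}. \<mu> m + \<i> * \<zeta> l)"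
    unfolding prod_first_block[symmetric] by (subst prod.swap) (auto simp: pole_def intro!: prod.cong)
  have 2: "(\<Prod>n\<in>T. \<Prod>j\<in>{M..<M+L}. - \<i> * \<zeta> n - ?p j) = (\<Prod>l\<in>{1..L}. \<Prod>n\<in>T. lam l - \<i> * \<zeta> n)"
    unfolding prod_second_block[symmetric, of "\<lambda>l. \<Prod>n\<in>T. lam l - \<i> * \<zeta> n" L M]
    by (subst prod.swap) (auto simp: pole_def intro!: prod.cong)
  have 3: "(\<Prod>m<M. \<Prod>j\<in>{M..<M+L}. inverse (?p m - ?p j)) = (\<Prod>l\<in>{1..L}. \<Prod>m\<in>{1..M}. inverse (\<mu> m + lam l))"
    unfolding prod_second_block[symmetric, of "\<lambda>l. \<Prod>m\<in>{1..M}. inverse (\<mu> m + lam l)" L M] unfolding prod_first_block[symmetric]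
    by (subst prod.swap) (auto simp: pole_def intro!: prod.cong)
  have 4: "(\<Prod>n\<in>T. \<Prod>l\<in>?I-T. inverse (- \<i> * \<zeta> n - - \<i> * \<zeta> l)) = (\<Prod>l\<in>?I-T. \<Prod>n\<in>T. inverse (\<i> * \<zeta> l - \<i> * \<zeta> n))"
    by (subst prod.swap) (auto intro!: prod.cong)
  show ?thesis unfolding subset_coeff_def W_coeff_def 1 2 3 4 by (simp only: mult_ac)
qed

lemma V_coeff_eq_W_compl: "S \<subseteq> {1..L+M} \<Longrightarrow> V_coeff L M lam \<mu> \<zeta> S = W_coeff L M lam \<mu> \<zeta> ({1..L+M} - S)"
  unfolding V_coeff_def W_coeff_def by (simp only: double_diff order_refl)

lemma conv_operator_eq_kop: "conv_operator \<tau> k = kop (lborel_Ioo \<tau>) (\<lambda>x y. k (x - y))"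
  unfolding conv_operator_def kop_def by (rule ext) (rule refl)

text \<open>The value must be the same \<open>d\<close> in every basis; the cosine basis witnesses
  that there is one.\<close>

lemma det2_conv_operator:
  assumes \<tau>: "\<tau> > 0" and b: "bker (lborel_Ioo \<tau>) (\<lambda>x y. k (x - y))"
    and d: "\<And>e. l2_basis_Ioo \<tau> e \<Longrightarrow> l2_basis.kdet (lborel_Ioo \<tau>) e (\<lambda>x y. - k (x - y)) = d"
  shows "det2_one_minus (lborel_Ioo \<tau>) (conv_operator \<tau> k) = d"
  unfolding conv_operator_eq_kop
proof (rule det2_one_minus_kop[OF finite_measure_lborel_Ioo b orthonormal_basis_cos_basis[OF \<tau>]])
  fix e assume e: "orthonormal_basis (lborel_Ioo \<tau>) e"
  interpret finite_measure "lborel_Ioo \<tau>" by (rule finite_measure_lborel_Ioo)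
  interpret l2_basis_Ioo \<tau> e by unfold_locales (use e \<tau> in auto)
  show "det2 (kmat (lborel_Ioo \<tau>) e (\<lambda>x y. - k (x - y))) = d"
    using d[OF l2_basis_Ioo_axioms] unfolding kdet_def .
qed

lemma Lim_at_right_exp_sum:
  fixes k :: "real \<Rightarrow> complex"
  assumes "\<And>t. t > 0 \<Longrightarrow> k t = (\<Sum>l\<in>A. \<alpha> l * exp (c l * of_real t))"
  shows "Lim (at_right 0) k = (\<Sum>l\<in>A. \<alpha> l)"
proof (rule tendsto_Lim)
  have "((\<lambda>t::real. \<Sum>l\<in>A. \<alpha> l * exp (c l * of_real t)) \<longlongrightarrow> (\<Sum>l\<in>A. \<alpha> l * exp (c l * of_real 0))) (at_right 0)"
    by (intro tendsto_intros)
  then have "((\<lambda>t::real. \<Sum>l\<in>A. \<alpha> l * exp (c l * of_real t)) \<longlongrightarrow> (\<Sum>l\<in>A. \<alpha> l)) (at_right 0)" by simp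
  moreover have "\<forall>\<^sub>F t in at_right 0. (\<Sum>l\<in>A. \<alpha> l * exp (c l * of_real t)) = k t"
    using eventually_at_right_less[of 0] by eventually_elim (simp add: assms)
  ultimately show "(k \<longlongrightarrow> (\<Sum>l\<in>A. \<alpha> l)) (at_right 0)" by (rule Lim_transform_eventually)
qed simp

theorem theorem5p3:
  fixes \<tau> :: real and L M :: nat and \<alpha> \<beta> lam \<mu> :: "nat \<Rightarrow> complex" and k :: "real \<Rightarrow> complex"
  assumes tau_pos: "\<tau> > 0"
    and lam_pos: "\<And>l. l \<in> {1..L} \<Longrightarrow> Re (lam l) > 0"
    and mu_pos: "\<And>m. m \<in> {1..M} \<Longrightarrow> Re (\<mu> m) > 0"
    and k_pos: "\<And>t. t > 0 \<Longrightarrow> k t = (\<Sum>l\<in>{1..L}. \<alpha> l * exp (- lam l * of_real t))"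
    and k_neg: "\<And>t. t < 0 \<Longrightarrow> k t = (\<Sum>m\<in>{1..M}. \<beta> m * exp (\<mu> m * of_real t))"
  shows
    "hilbert_schmidt (lborel_Ioo \<tau>) (conv_operator \<tau> k) \<and>
     (\<forall>\<zeta> :: nat \<Rightarrow> complex.
        L \<ge> 1 \<and> M \<ge> 1 \<and> symbol_zeros L M lam \<mu> k \<zeta> \<and> inj_on \<zeta> {1..L+M} \<longrightarrow>
        det2_one_minus (lborel_Ioo \<tau>) (conv_operator \<tau> k) =
          exp (of_real \<tau> * Lim (at_right 0) (\<lambda>\<epsilon>. k (- \<epsilon>)) - of_real \<tau> * (\<Sum>m\<in>{1..M}. \<mu> m)) *
          (\<Sum>S | S \<subseteq> {1..L+M} \<and> card S = L.
             V_coeff L M lam \<mu> \<zeta> S * exp (- \<i> * of_real \<tau> * (\<Sum>m\<in>{1..L+M} - S. \<zeta> m))) \<and>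
        det2_one_minus (lborel_Ioo \<tau>) (conv_operator \<tau> k) =
          exp (of_real \<tau> * Lim (at_right 0) k - of_real \<tau> * (\<Sum>l\<in>{1..L}. lam l)) *
          (\<Sum>S | S \<subseteq> {1..L+M} \<and> card S = M.
             W_coeff L M lam \<mu> \<zeta> S * exp (\<i> * of_real \<tau> * (\<Sum>l\<in>{1..L+M} - S. \<zeta> l)))) \<and>
     (L = 0 \<or> M = 0 \<longrightarrow>
        volterra_operator (lborel_Ioo \<tau>) (conv_operator \<tau> k) \<and>
        det2_one_minus (lborel_Ioo \<tau>) (conv_operator \<tau> k) = 1)"
proof -
  let ?p = "pole M lam \<mu>" and ?\<gamma> = "pole_coeff M \<alpha> \<beta>" and ?I = "{1..L+M}"
  let ?D = "det2_one_minus (lborel_Ioo \<tau>) (conv_operator \<tau> k)"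
  have k: "k = kern M (M + L) ?\<gamma> ?p (k 0)" by (rule kern_pole[OF k_pos k_neg])
  have b: "bker (lborel_Ioo \<tau>) (\<lambda>x y. k (x - y))"
    using bker_kern[of M "M + L" \<tau> ?\<gamma> ?p "k 0"] unfolding k[symmetric] by simp
  have b': "bker (lborel_Ioo \<tau>) (\<lambda>x y. - k (x - y))" by (rule bker_minus[OF b])
  interpret finite_measure "lborel_Ioo \<tau>" by (rule finite_measure_lborel_Ioo)
  interpret C: l2_basis_Ioo \<tau> "cos_basis \<tau>"
    by unfold_locales (use orthonormal_basis_cos_basis[OF tau_pos] tau_pos in auto)
  have limp: "Lim (at_right 0) k = (\<Sum>l\<in>{1..L}. \<alpha> l)" by (rule Lim_at_right_exp_sum[OF k_pos])
  have limm: "Lim (at_right 0) (\<lambda>\<epsilon>. k (- \<epsilon>)) = (\<Sum>m\<in>{1..M}. \<beta> m)"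
    by (rule Lim_at_right_exp_sum[where c = "\<lambda>m. - \<mu> m"]) (simp add: k_neg)
  have hs: "hilbert_schmidt (lborel_Ioo \<tau>) (conv_operator \<tau> k)"
    unfolding conv_operator_eq_kop by (rule C.hilbert_schmidt_kop[OF b])
  have formula: "?D = exp (of_real \<tau> * Lim (at_right 0) (\<lambda>\<epsilon>. k (- \<epsilon>)) - of_real \<tau> * (\<Sum>m\<in>{1..M}. \<mu> m)) *
          (\<Sum>S | S \<subseteq> ?I \<and> card S = L.
             V_coeff L M lam \<mu> \<zeta> S * exp (- \<i> * of_real \<tau> * (\<Sum>m\<in>?I - S. \<zeta> m)))"
    "?D = exp (of_real \<tau> * Lim (at_right 0) k - of_real \<tau> * (\<Sum>l\<in>{1..L}. lam l)) *
          (\<Sum>S | S \<subseteq> ?I \<and> card S = M.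
             W_coeff L M lam \<mu> \<zeta> S * exp (\<i> * of_real \<tau> * (\<Sum>l\<in>?I - S. \<zeta> l)))"
    if sym: "symbol_zeros L M lam \<mu> k \<zeta>" and inj: "inj_on \<zeta> ?I" for \<zeta>
  proof -
    define z where "z n = - \<i> * \<zeta> n" for n
    define W where "W T = W_coeff L M lam \<mu> \<zeta> T" for T
    define s\<beta> where "s\<beta> = (\<Sum>m\<in>{1..M}. \<beta> m)"
    define s\<mu> where "s\<mu> = (\<Sum>m\<in>{1..M}. \<mu> m)"
    define s\<alpha> where "s\<alpha> = (\<Sum>l\<in>{1..L}. \<alpha> l)"
    define slam where "slam = (\<Sum>l\<in>{1..L}. lam l)"
    have cp: "(\<Prod>n\<in>?I. [:- z n, 1:]) = char_poly_kern (M + L) ?\<gamma> ?p"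
      unfolding z_def by (rule char_poly_symbol[OF lam_pos mu_pos k_pos k_neg sym])
    have char: "(\<Prod>n\<in>?I. s - z n) = (\<Prod>j<M + L. s - ?p j) - (\<Sum>j<M + L. ?\<gamma> j * (\<Prod>i\<in>{..<M+L}-{j}. s - ?p i))" for s
      by (rule char_poly_kern_eval[OF cp])
    have zi: "inj_on z ?I"
    proof (rule inj_onI)
      fix n m assume "n \<in> ?I" "m \<in> ?I" "z n = z m"
      then show "n = m" using inj_onD[OF inj, of n m] unfolding z_def by simp
    qed
    have pp: "?p m \<noteq> ?p j" if "m < M" "M \<le> j" "j < M + L" for m j
    proof -
      have "Suc (j - M) \<in> {1..L}" "Suc m \<in> {1..M}" using that by auto
      then have "Re (lam (Suc (j - M))) > 0" "Re (\<mu> (Suc m)) > 0" using lam_pos mu_pos by blast+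
      then show ?thesis using that unfolding pole_def by (auto simp: complex_eq_iff)
    qed
    have \<gamma>M: "(\<Sum>m<M. ?\<gamma> m) = - s\<beta>"
      unfolding s\<beta>_def sum_first_block[symmetric] sum_negf[symmetric] by (rule sum.cong) (auto simp: pole_coeff_def)
    have pM: "(\<Sum>m<M. ?p m) = s\<mu>"
      unfolding s\<mu>_def sum_first_block[symmetric] by (rule sum.cong) (auto simp: pole_def)
    have \<gamma>N: "(\<Sum>j<M+L. ?\<gamma> j) = (\<Sum>m\<in>{1..M}. - \<beta> m) + s\<alpha>"
      unfolding s\<alpha>_def by (rule sum_two_blocks) (auto simp: pole_coeff_def)
    have pN: "(\<Sum>j<M+L. ?p j) = s\<mu> + (\<Sum>l\<in>{1..L}. - lam l)"
      unfolding s\<mu>_def by (rule sum_two_blocks) (auto simp: pole_def)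
    have "(\<Sum>j<M+L. ?\<gamma> j) = (\<Sum>n\<in>?I. z n) - (\<Sum>j<M+L. ?p j)"
      by (rule char_poly_kern_subleading[OF _ _ cp]) auto
    \<comment> \<open>In this form the relation exchanges the prefactor of the first formula for
      that of the second, at the price of the sum of all \<open>z n\<close>.\<close>
    then have tr: "s\<alpha> - slam = s\<beta> - s\<mu> + (\<Sum>n\<in>?I. z n)"
      unfolding \<gamma>N pN sum_negf s\<beta>_def[symmetric] slam_def[symmetric] by (simp add: algebra_simps)
    have D: "?D = exp (of_real \<tau> * s\<beta> - of_real \<tau> * s\<mu>) * (\<Sum>T | T \<subseteq> ?I \<and> card T = M. W T * exp (of_real \<tau> * (\<Sum>n\<in>T. z n)))"
    proof (rule det2_conv_operator[OF tau_pos b])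
      fix e assume "l2_basis_Ioo \<tau> e"
      then interpret E: l2_basis_Ioo \<tau> e .
      have "E.kdet (\<lambda>x y. - k (x - y)) = exp (- of_real \<tau> * (\<Sum>m<M. ?\<gamma> m)) * (exp (- of_real \<tau> * (\<Sum>m<M. ?p m)) *
         (\<Sum>T | T \<subseteq> ?I \<and> card T = M. subset_coeff M (M + L) ?p z ?I T * exp (of_real \<tau> * (\<Sum>n\<in>T. z n))))"
        using E.kdet_kern[OF le_add1 _ _ zi pp char, of "k 0"] unfolding k[symmetric] by simp
      also have "\<dots> = exp (of_real \<tau> * s\<beta> - of_real \<tau> * s\<mu>) * (\<Sum>T | T \<subseteq> ?I \<and> card T = M. W T * exp (of_real \<tau> * (\<Sum>n\<in>T. z n)))"
        unfolding \<gamma>M pM mult.assoc[symmetric] exp_add[symmetric] z_def subset_coeff_eq_W W_def by simp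
      finally show "E.kdet (\<lambda>x y. - k (x - y)) = exp (of_real \<tau> * s\<beta> - of_real \<tau> * s\<mu>) *
         (\<Sum>T | T \<subseteq> ?I \<and> card T = M. W T * exp (of_real \<tau> * (\<Sum>n\<in>T. z n)))" .
    qed
    \<comment> \<open>Passing to complements, which have cardinality \<open>L\<close>, exchanges
      \<open>W_coeff\<close> and \<open>V_coeff\<close>.\<close>
    have "(\<Sum>T | T \<subseteq> ?I \<and> card T = M. W T * exp (of_real \<tau> * (\<Sum>n\<in>T. z n)))
       = (\<Sum>S | S \<subseteq> ?I \<and> card S = L. V_coeff L M lam \<mu> \<zeta> S * exp (- \<i> * of_real \<tau> * (\<Sum>m\<in>?I - S. \<zeta> m)))"
    proof (rule sum.reindex_bij_witness[of _ "\<lambda>S. ?I - S" "\<lambda>T. ?I - T"])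
      fix T assume "T \<in> {T. T \<subseteq> ?I \<and> card T = M}"
      then have T: "T \<subseteq> ?I" "card T = M" "finite T" by (auto intro: finite_subset)
      show dd: "?I - (?I - T) = T" using T by blast
      show "?I - T \<in> {S. S \<subseteq> ?I \<and> card S = L}" using T by (simp add: card_Diff_subset)
      show "V_coeff L M lam \<mu> \<zeta> (?I - T) * exp (- \<i> * of_real \<tau> * (\<Sum>m\<in>?I - (?I - T). \<zeta> m)) = W T * exp (of_real \<tau> * (\<Sum>n\<in>T. z n))"
        unfolding V_coeff_eq_W_compl[OF Diff_subset] dd W_def z_def sum_distrib_left[symmetric] by (simp add: mult_ac)
    next
      fix S assume "S \<in> {S. S \<subseteq> ?I \<and> card S = L}"
      then have S: "S \<subseteq> ?I" "card S = L" "finite S" by (auto intro: finite_subset)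
      show "?I - (?I - S) = S" using S by blast
      show "?I - S \<in> {T. T \<subseteq> ?I \<and> card T = M}" using S by (simp add: card_Diff_subset)
    qed
    with D show "?D = exp (of_real \<tau> * Lim (at_right 0) (\<lambda>\<epsilon>. k (- \<epsilon>)) - of_real \<tau> * (\<Sum>m\<in>{1..M}. \<mu> m)) *
          (\<Sum>S | S \<subseteq> ?I \<and> card S = L.
             V_coeff L M lam \<mu> \<zeta> S * exp (- \<i> * of_real \<tau> * (\<Sum>m\<in>?I - S. \<zeta> m)))"
      unfolding limm s\<beta>_def s\<mu>_def by simp
    \<comment> \<open>The sum of the \<open>z n\<close> over \<open>T\<close> is the total minus the
      sum over the complement, and \<open>tr\<close> absorbs the total into the prefactor.\<close>
    have exponents: "exp (of_real \<tau> * s\<beta> - of_real \<tau> * s\<mu>) * (W T * exp (of_real \<tau> * (\<Sum>n\<in>T. z n)))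
       = exp (of_real \<tau> * s\<alpha> - of_real \<tau> * slam) * (W T * exp (\<i> * of_real \<tau> * (\<Sum>l\<in>?I - T. \<zeta> l)))" if T: "T \<subseteq> ?I" for T
    proof -
      have "(\<Sum>n\<in>?I. z n) = (\<Sum>n\<in>?I - T. z n) + (\<Sum>n\<in>T. z n)" by (rule sum.subset_diff[OF T]) simp
      moreover have "(\<Sum>n\<in>?I - T. z n) = - \<i> * (\<Sum>l\<in>?I - T. \<zeta> l)" unfolding z_def sum_distrib_left ..
      ultimately have "s\<beta> - s\<mu> + (\<Sum>n\<in>T. z n) = s\<alpha> - slam + \<i> * (\<Sum>l\<in>?I - T. \<zeta> l)" unfolding tr by simp
      from arg_cong[OF this, of "\<lambda>x. exp (of_real \<tau> * x)"]
      have "exp (of_real \<tau> * s\<beta> - of_real \<tau> * s\<mu>) * exp (of_real \<tau> * (\<Sum>n\<in>T. z n))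
        = exp (of_real \<tau> * s\<alpha> - of_real \<tau> * slam) * exp (\<i> * of_real \<tau> * (\<Sum>l\<in>?I - T. \<zeta> l))"
        unfolding exp_add[symmetric] by (simp add: algebra_simps)
      then show ?thesis by (simp only: mult.left_commute[of _ "W T"])
    qed
    show "?D = exp (of_real \<tau> * Lim (at_right 0) k - of_real \<tau> * (\<Sum>l\<in>{1..L}. lam l)) *
          (\<Sum>S | S \<subseteq> ?I \<and> card S = M.
             W_coeff L M lam \<mu> \<zeta> S * exp (\<i> * of_real \<tau> * (\<Sum>l\<in>?I - S. \<zeta> l)))"
      unfolding D limp s\<alpha>_def[symmetric] slam_def[symmetric] W_def[symmetric]
      by (rule sum_scaled_cong, rule exponents) simp
  qed
  have volterra: "volterra_operator (lborel_Ioo \<tau>) (conv_operator \<tau> k)" "?D = 1" if "L = 0 \<or> M = 0"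
  proof -
    show "volterra_operator (lborel_Ioo \<tau>) (conv_operator \<tau> k)"
      unfolding conv_operator_eq_kop
    \<comment> \<open>For \<open>M = 0\<close> the kernel vanishes where \<open>x < y\<close>, for
      \<open>L = 0\<close> where \<open>y < x\<close>; the sign selects the direction.\<close>
    proof (rule C.volterra_operator_kop[OF b, of "if M = 0 then 1 else -1"])
      show "k (x - y) = 0" if "0 < (if M = 0 then 1 else - 1) * (y - x)" for x y
        using that \<open>L = 0 \<or> M = 0\<close> by (cases "M = 0") (simp_all add: k_neg k_pos)
    qed simp
    show "?D = 1"
    proof (rule det2_conv_operator[OF tau_pos b])
      fix e assume "l2_basis_Ioo \<tau> e"
      then interpret E: l2_basis_Ioo \<tau> e .
      show "E.kdet (\<lambda>x y. - k (x - y)) = 1"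
      proof (cases "M = 0")
        case True
        then show ?thesis by (intro E.kdet_lower_triangular[OF b']) (simp add: k_neg)
      next
        case False
        then have "L = 0" using that by simp
        then show ?thesis by (intro E.kdet_upper_triangular[OF b']) (simp add: k_pos)
      qed
    qed
  qed
  show ?thesis using hs formula volterra by blast
qed

end
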